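(* Let $A$ and $B$ be square matrices with nonnegative integer entries which are irreducible and not permutation matrices. Then the two-sided topological Markov shifts $(\bar X_A,\bar\sigma_A)$ and $(\bar X_B,\bar\sigma_B)$ are topologically conjugate if and only if $\bar{\mathcal{T}}_A$ and $\bar{\mathcal{T}}_B$ are transpose free isomorphic.
   Context: A square matrix $A$ with nonnegative integer entries is irreducible if for all $i,j$ there is $n\ge1$ with $A^n(i,j)>0$. $A^t$ denotes the transpose. For an $N\times N$ nonnegative integer matrix $A$, $G_A=(\mathcal{V}_A,\mathcal{E}_A)$ is the directed graph with vertices $I_1^A,\dots,I_N^A$ and $A(i,j)$ edges from $I_i^A$ to $I_j^A$; $s(a),t(a)$ are the source and target of an edge $a$. $\bar X_A$ is the compact space of bi-infinite sequences $(x_n)_{n\in\mathbb{Z}}$ of edges with $t(x_n)=s(x_{n+1})$ for all $n$, with the relative product topology, and $\bar\sigma_A((x_n)_n)=(x_{n+1})_n$. Topological conjugacy means existence of a homeomorphism intertwining the shifts. The Cuntz--Krieger algebra $\mathcal{O}_A$ is the universal $C^*$-algebra generated by partial isometries $S_a$, $a\in\mathcal{E}_A$, with $\sum_{a\in\mathcal{E}_A}S_aS_a^*=1$ and $S_a^*S_a=\sum_{b\in\mathcal{E}_A,\,s(b)=t(a)}S_bS_b^*$ for all $a$. $\mathcal{D}_A$ is the $C^*$-subalgebra generated by all projections $S_{\mu_1}\cdots S_{\mu_n}S_{\mu_n}^*\cdots S_{\mu_1}^*$. $\mathbb{T}=\mathbb{R}/\mathbb{Z}$, and the gauge action $\rho^A$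 is given by $\rho^A_t(S_a)=e^{2\pi\sqrt{-1}t}S_a$. The Cuntz--Krieger triplet is $\mathcal{T}_A=(\mathcal{O}_A,\mathcal{D}_A,\rho^A)$. Triplets $\mathcal{T}_A$ and $\mathcal{T}_B$ are isomorphic if there is an isomorphism $\Phi:\mathcal{O}_A\to\mathcal{O}_B$ with $\Phi(\mathcal{D}_A)=\mathcal{D}_B$ and $\Phi\circ\rho^A_t=\rho^B_t\circ\Phi$ for all $t\in\mathbb{T}$. Put $\bar{\mathcal{T}}_A=(\mathcal{T}_{A^t},\mathcal{T}_A)$. $\bar{\mathcal{T}}_A$ and $\bar{\mathcal{T}}_B$ are transpose free isomorphic in $1$-step if $\mathcal{T}_A$ and $\mathcal{T}_B$ are isomorphic or $\mathcal{T}_{A^t}$ and $\mathcal{T}_{B^t}$ are isomorphic. $\bar{\mathcal{T}}_A$ and $\bar{\mathcal{T}}_B$ are transpose free isomorphic if there is a finite sequence $A=A_0,A_1,\dots,A_n=B$ of irreducible, non-permutation square matrices with nonnegative integer entries such that $\bar{\mathcal{T}}_{A_{i}}$ and $\bar{\mathcal{T}}_{A_{i+1}}$ are transpose free isomorphic in $1$-step for $i=0,\dots,n-1$. *)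

theory Defs
  imports
    "HOL-Analysis.Analysis"
    "HOL-Library.Poly_Mapping"
    "HOL-Algebra.QuotRing"
    "HOL-Algebra.Module"
    "Jordan_Normal_Form.Matrix"
begin

section \<open>Unital C*-algebras\<close>

record 'a cstar = "(complex, 'a) module" +
  adj :: "'a \<Rightarrow> 'a"
  cnorm :: "'a \<Rightarrow> real"

text \<open>The value outside the carrier only serves the locale \<^locale>\<open>Metric_space\<close>, which asks for
  nonnegativity and symmetry on the whole type.\<close>

definition cdist :: "'a cstar \<Rightarrow> 'a \<Rightarrow> 'a \<Rightarrow> real" where
  "cdist \<AA> x y =
     (if x \<in> carrier \<AA> \<and> y \<in> carrier \<AA> then cnorm \<AA> (x \<ominus>\<^bsub>\<AA>\<^esub> y) else 0)"

locale cstar_algebra = ring \<AA> for \<AA> :: "'a cstar" (structure) +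
  assumes smult_closed: "x \<in> carrier \<AA> \<Longrightarrow> c \<odot> x \<in> carrier \<AA>"
    and smult_one: "x \<in> carrier \<AA> \<Longrightarrow> 1 \<odot> x = x"
    and smult_smult: "x \<in> carrier \<AA> \<Longrightarrow> c \<odot> (d \<odot> x) = (c * d) \<odot> x"
    and smult_add_left: "x \<in> carrier \<AA> \<Longrightarrow> (c + d) \<odot> x = c \<odot> x \<oplus> d \<odot> x"
    and smult_add_right:
      "\<lbrakk>x \<in> carrier \<AA>; y \<in> carrier \<AA>\<rbrakk> \<Longrightarrow> c \<odot> (x \<oplus> y) = c \<odot> x \<oplus> c \<odot> y"
    and smult_mult_left:
      "\<lbrakk>x \<in> carrier \<AA>; y \<in> carrier \<AA>\<rbrakk> \<Longrightarrow> (c \<odot> x) \<otimes> y = c \<odot> (x \<otimes> y)"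
    and smult_mult_right:
      "\<lbrakk>x \<in> carrier \<AA>; y \<in> carrier \<AA>\<rbrakk> \<Longrightarrow> x \<otimes> (c \<odot> y) = c \<odot> (x \<otimes> y)"
    and adj_closed: "x \<in> carrier \<AA> \<Longrightarrow> adj \<AA> x \<in> carrier \<AA>"
    and adj_adj: "x \<in> carrier \<AA> \<Longrightarrow> adj \<AA> (adj \<AA> x) = x"
    and adj_add:
      "\<lbrakk>x \<in> carrier \<AA>; y \<in> carrier \<AA>\<rbrakk> \<Longrightarrow> adj \<AA> (x \<oplus> y) = adj \<AA> x \<oplus> adj \<AA> y"
    and adj_smult: "x \<in> carrier \<AA> \<Longrightarrow> adj \<AA> (c \<odot> x) = cnj c \<odot> adj \<AA> x"
    and adj_mult:
      "\<lbrakk>x \<in> carrier \<AA>; y \<in> carrier \<AA>\<rbrakk> \<Longrightarrow> adj \<AA> (x \<otimes> y) = adj \<AA> y \<otimes> adj \<AA> x"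
    and cnorm_nonneg: "x \<in> carrier \<AA> \<Longrightarrow> 0 \<le> cnorm \<AA> x"
    and cnorm_eq_zero: "x \<in> carrier \<AA> \<Longrightarrow> cnorm \<AA> x = 0 \<longleftrightarrow> x = \<zero>"
    and cnorm_add:
      "\<lbrakk>x \<in> carrier \<AA>; y \<in> carrier \<AA>\<rbrakk> \<Longrightarrow> cnorm \<AA> (x \<oplus> y) \<le> cnorm \<AA> x + cnorm \<AA> y"
    and cnorm_smult: "x \<in> carrier \<AA> \<Longrightarrow> cnorm \<AA> (c \<odot> x) = cmod c * cnorm \<AA> x"
    and cnorm_mult:
      "\<lbrakk>x \<in> carrier \<AA>; y \<in> carrier \<AA>\<rbrakk> \<Longrightarrow> cnorm \<AA> (x \<otimes> y) \<le> cnorm \<AA> x * cnorm \<AA> y"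
    and cstar_identity: "x \<in> carrier \<AA> \<Longrightarrow> cnorm \<AA> (adj \<AA> x \<otimes> x) = (cnorm \<AA> x)\<^sup>2"
    and complete: "Metric_space.mcomplete (carrier \<AA>) (cdist \<AA>)"

definition star_hom :: "'a cstar \<Rightarrow> 'b cstar \<Rightarrow> ('a \<Rightarrow> 'b) set" where
  "star_hom \<AA> \<BB> = {\<Phi> \<in> Ring.ring_hom \<AA> \<BB>. \<forall>x\<in>carrier \<AA>.
     (\<forall>c. \<Phi> (c \<odot>\<^bsub>\<AA>\<^esub> x) = c \<odot>\<^bsub>\<BB>\<^esub> \<Phi> x) \<and> \<Phi> (adj \<AA> x) = adj \<BB> (\<Phi> x)}"

definition star_iso :: "'a cstar \<Rightarrow> 'b cstar \<Rightarrow> ('a \<Rightarrow> 'b) set" where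
  "star_iso \<AA> \<BB> = {\<Phi> \<in> star_hom \<AA> \<BB>. bij_betw \<Phi> (carrier \<AA>) (carrier \<BB>)}"

definition cstar_subalgebra :: "'a cstar \<Rightarrow> 'a set \<Rightarrow> bool" where
  "cstar_subalgebra \<AA> C \<longleftrightarrow>
     C \<subseteq> carrier \<AA> \<and> \<zero>\<^bsub>\<AA>\<^esub> \<in> C \<and>
     (\<forall>x\<in>C. \<forall>y\<in>C. x \<oplus>\<^bsub>\<AA>\<^esub> y \<in> C \<and> x \<otimes>\<^bsub>\<AA>\<^esub> y \<in> C) \<and>
     (\<forall>x\<in>C. adj \<AA> x \<in> C \<and> (\<forall>c. c \<odot>\<^bsub>\<AA>\<^esub> x \<in> C)) \<and>
     closedin (Metric_space.mtopology (carrier \<AA>) (cdist \<AA>)) C"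

definition generated_cstar_subalgebra :: "'a cstar \<Rightarrow> 'a set \<Rightarrow> 'a set" where
  "generated_cstar_subalgebra \<AA> X = \<Inter>{C. cstar_subalgebra \<AA> C \<and> X \<subseteq> C}"


section \<open>Free unital *-algebras\<close>

datatype 'e letter = Gen 'e | Adj 'e

fun letter_adj :: "'e letter \<Rightarrow> 'e letter" where
  "letter_adj (Gen a) = Adj a"
| "letter_adj (Adj a) = Gen a"

fun letter_degree :: "'e letter \<Rightarrow> int" where
  "letter_degree (Gen a) = 1"
| "letter_degree (Adj a) = - 1"

datatype 'e word = Word (letters: "'e letter list")

instantiation word :: (type) monoid_add
begin

definition zero_word :: "'a word" where "0 = Word []"
definition plus_word :: "'a word \<Rightarrow> 'a word \<Rightarrow> 'a word" where
  "u + v = Word (letters u @ letters v)"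

instance by standard (simp_all add: zero_word_def plus_word_def)

end

definition word_adj :: "'e word \<Rightarrow> 'e word" where
  "word_adj w = Word (rev (map letter_adj (letters w)))"

definition word_degree :: "'e word \<Rightarrow> int" where
  "word_degree w = sum_list (map letter_degree (letters w))"

text \<open>Since addition of words is concatenation, the convolution product of finitely supported
  functions is the product of the free unital *-algebra on the type of generators.\<close>

type_synonym 'e free = "'e word \<Rightarrow>\<^sub>0 complex"

definition fgen :: "'e \<Rightarrow> 'e free" where
  "fgen a = Poly_Mapping.single (Word [Gen a]) 1"

definition fscale :: "complex \<Rightarrow> 'e free \<Rightarrow> 'e free" where
  "fscale c x = Poly_Mapping.single 0 c * x"

definition fstar :: "'e free \<Rightarrow> 'e free" where
  "fstar x = (\<Sum>w\<in>Poly_Mapping.keys x.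
     Poly_Mapping.single (word_adj w) (cnj (Poly_Mapping.lookup x w)))"

text \<open>The *-endomorphism replacing every generator \<open>a\<close> by \<open>e\<^bsup>2\<pi>it\<^esup> a\<close>.\<close>

definition fgauge :: "real \<Rightarrow> 'e free \<Rightarrow> 'e free" where
  "fgauge t x = (\<Sum>w\<in>Poly_Mapping.keys x. Poly_Mapping.single w
     (exp (2 * of_real pi * \<i> * of_real t * of_int (word_degree w)) * Poly_Mapping.lookup x w))"

definition free_star_algebra :: "'e set \<Rightarrow> 'e free set" where
  "free_star_algebra G = {x. \<forall>w\<in>Poly_Mapping.keys x. set_word w \<subseteq> G}"


section \<open>Universal C*-algebras given by generators and relations\<close>

text \<open>For generators \<open>G\<close> and relations \<open>R\<close> (elements of the free *-algebra that are to vanish), the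
  universal C*-algebra is the Hausdorff completion of the free *-algebra on \<open>G\<close> with respect to the
  largest C*-seminorm vanishing on \<open>R\<close>.  The completion is realised as the ring of Cauchy sequences
  modulo the ideal of null sequences.  The real supremum \<open>univ_norm\<close> is meaningful when these seminorms
  are pointwise bounded, which \<open>ck_presentation\<close> shows for the Cuntz--Krieger relations.\<close>

definition cstar_seminorm :: "'e set \<Rightarrow> ('e free \<Rightarrow> real) \<Rightarrow> bool" where
  "cstar_seminorm G p \<longleftrightarrow>
     (\<forall>x\<in>free_star_algebra G. 0 \<le> p x \<and> (\<forall>c. p (fscale c x) = cmod c * p x) \<and>
        p (fstar x * x) = (p x)\<^sup>2 \<and>
        (\<forall>y\<in>free_star_algebra G. p (x + y) \<le> p x + p y \<and> p (x * y) \<le> p x * p y))"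

definition admissible_seminorms :: "'e set \<Rightarrow> 'e free set \<Rightarrow> ('e free \<Rightarrow> real) set" where
  "admissible_seminorms G R = {p. cstar_seminorm G p \<and> (\<forall>r\<in>R. p r = 0)}"

definition univ_norm :: "'e set \<Rightarrow> 'e free set \<Rightarrow> 'e free \<Rightarrow> real" where
  "univ_norm G R x = (SUP p\<in>admissible_seminorms G R. p x)"

definition cauchy_ring :: "'e set \<Rightarrow> 'e free set \<Rightarrow> (nat \<Rightarrow> 'e free) ring" where
  "cauchy_ring G R =
     \<lparr>carrier = {x. (\<forall>n. x n \<in> free_star_algebra G) \<and>
        (\<forall>\<epsilon>>0. \<exists>M. \<forall>m\<ge>M. \<forall>n\<ge>M. univ_norm G R (x m - x n) < \<epsilon>)},
      mult = (\<lambda>x y n. x n * y n), one = (\<lambda>n. 1), zero = (\<lambda>n. 0), add = (\<lambda>x y n. x n + y n)\<rparr>"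

definition null_ideal :: "'e set \<Rightarrow> 'e free set \<Rightarrow> (nat \<Rightarrow> 'e free) set" where
  "null_ideal G R = {x \<in> carrier (cauchy_ring G R). (\<lambda>n. univ_norm G R (x n)) \<longlonglongrightarrow> 0}"

definition univ_class :: "'e set \<Rightarrow> 'e free set \<Rightarrow> (nat \<Rightarrow> 'e free) \<Rightarrow> (nat \<Rightarrow> 'e free) set" where
  "univ_class G R x = null_ideal G R +>\<^bsub>cauchy_ring G R\<^esub> x"

definition universal_cstar ::
    "'e set \<Rightarrow> 'e free set \<Rightarrow> (nat \<Rightarrow> 'e free) set cstar" where
  "universal_cstar G R = (let Q = cauchy_ring G R Quot null_ideal G R in
     \<lparr>carrier = carrier Q, mult = mult Q, one = one Q, zero = zero Q, add = add Q,
      smult = (\<lambda>c X. \<Union>x\<in>X. univ_class G R (\<lambda>n. fscale c (x n))),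
      adj = (\<lambda>X. \<Union>x\<in>X. univ_class G R (\<lambda>n. fstar (x n))),
      cnorm = (\<lambda>X. THE r. \<forall>x\<in>X. (\<lambda>n. univ_norm G R (x n)) \<longlonglongrightarrow> r)\<rparr>)"

definition univ_gen :: "'e set \<Rightarrow> 'e free set \<Rightarrow> 'e \<Rightarrow> (nat \<Rightarrow> 'e free) set" where
  "univ_gen G R a = univ_class G R (\<lambda>n. fgen a)"


section \<open>Matrices and graphs\<close>

definition irreducible_matrix :: "nat mat \<Rightarrow> bool" where
  "irreducible_matrix A \<longleftrightarrow>
     (\<forall>i<dim_row A. \<forall>j<dim_row A. \<exists>n\<ge>1. 0 < (A ^\<^sub>m n) $$ (i, j))"

text \<open>The empty matrix counts as a permutation matrix.\<close>

definition permutation_matrix :: "nat mat \<Rightarrow> bool" where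
  "permutation_matrix A \<longleftrightarrow> (\<exists>N \<pi>. \<pi> permutes {..<N} \<and>
     A = mat N N (\<lambda>(i, j). if j = \<pi> i then 1 else 0))"

text \<open>The triple \<open>(i, j, k)\<close> with \<open>k < A(i, j)\<close> is the \<open>k\<close>-th edge from vertex \<open>i\<close> to vertex \<open>j\<close>.\<close>

type_synonym edge = "nat \<times> nat \<times> nat"

definition edges :: "nat mat \<Rightarrow> edge set" where
  "edges A = {(i, j, k). i < dim_row A \<and> j < dim_col A \<and> k < A $$ (i, j)}"

fun source :: "edge \<Rightarrow> nat" where "source (i, j, k) = i"
fun target :: "edge \<Rightarrow> nat" where "target (i, j, k) = j"


section \<open>Two-sided topological Markov shifts\<close>

definition two_sided_shift_space :: "nat mat \<Rightarrow> (int \<Rightarrow> edge) set" where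
  "two_sided_shift_space A =
     {x. \<forall>n. x n \<in> edges A \<and> target (x n) = source (x (n + 1))}"

definition two_sided_topology :: "nat mat \<Rightarrow> (int \<Rightarrow> edge) topology" where
  "two_sided_topology A =
     subtopology (product_topology (\<lambda>n. discrete_topology (edges A)) UNIV) (two_sided_shift_space A)"

definition two_sided_shift :: "(int \<Rightarrow> edge) \<Rightarrow> int \<Rightarrow> edge" where
  "two_sided_shift x = (\<lambda>n. x (n + 1))"

definition topologically_conjugate :: "nat mat \<Rightarrow> nat mat \<Rightarrow> bool" where
  "topologically_conjugate A B \<longleftrightarrow>
     (\<exists>h. homeomorphic_map (two_sided_topology A) (two_sided_topology B) h \<and>
        (\<forall>x\<in>two_sided_shift_space A. h (two_sided_shift x) = two_sided_shift (h x)))"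


section \<open>Cuntz--Krieger algebras and triplets\<close>

definition cuntz_krieger_family :: "nat mat \<Rightarrow> 'a cstar \<Rightarrow> (edge \<Rightarrow> 'a) \<Rightarrow> bool" where
  "cuntz_krieger_family A \<BB> T \<longleftrightarrow>
     T ` edges A \<subseteq> carrier \<BB> \<and>
     (\<forall>a\<in>edges A. T a \<otimes>\<^bsub>\<BB>\<^esub> adj \<BB> (T a) \<otimes>\<^bsub>\<BB>\<^esub> T a = T a) \<and>
     (\<Oplus>\<^bsub>\<BB>\<^esub>a\<in>edges A. T a \<otimes>\<^bsub>\<BB>\<^esub> adj \<BB> (T a)) = \<one>\<^bsub>\<BB>\<^esub> \<and>
     (\<forall>a\<in>edges A. adj \<BB> (T a) \<otimes>\<^bsub>\<BB>\<^esub> T a =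
        (\<Oplus>\<^bsub>\<BB>\<^esub>b\<in>{b \<in> edges A. source b = target a}. T b \<otimes>\<^bsub>\<BB>\<^esub> adj \<BB> (T b)))"

definition ck_relations :: "nat mat \<Rightarrow> edge free set" where
  "ck_relations A =
     {fgen a * fstar (fgen a) * fgen a - fgen a | a. a \<in> edges A} \<union>
     {(\<Sum>a\<in>edges A. fgen a * fstar (fgen a)) - 1} \<union>
     {fstar (fgen a) * fgen a -
        (\<Sum>b\<in>{b \<in> edges A. source b = target a}. fgen b * fstar (fgen b)) | a. a \<in> edges A}"

type_synonym ck_element = "(nat \<Rightarrow> edge free) set"

definition cuntz_krieger_algebra :: "nat mat \<Rightarrow> ck_element cstar" where
  "cuntz_krieger_algebra A = universal_cstar (edges A) (ck_relations A)"

definition ck_gen :: "nat mat \<Rightarrow> edge \<Rightarrow> ck_element" where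
  "ck_gen A a = univ_gen (edges A) (ck_relations A) a"

definition ck_word :: "nat mat \<Rightarrow> edge list \<Rightarrow> ck_element" where
  "ck_word A \<mu> = (let \<O> = cuntz_krieger_algebra A
     in foldr (\<lambda>a x. ck_gen A a \<otimes>\<^bsub>\<O>\<^esub> x) \<mu> \<one>\<^bsub>\<O>\<^esub>)"

definition ck_diagonal :: "nat mat \<Rightarrow> ck_element set" where
  "ck_diagonal A = (let \<O> = cuntz_krieger_algebra A in
     generated_cstar_subalgebra \<O>
       {ck_word A \<mu> \<otimes>\<^bsub>\<O>\<^esub> adj \<O> (ck_word A \<mu>) | \<mu>. \<mu> \<noteq> [] \<and> set \<mu> \<subseteq> edges A})"

text \<open>That \<open>cuntz_krieger_algebra A\<close> is the universal C*-algebra generated by a family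
  \<open>ck_gen A\<close> satisfying the relations is shown in \<open>cuntz_krieger_algebra_is_cstar_algebra\<close>,
  \<open>cuntz_krieger_algebra_family\<close>, \<open>cuntz_krieger_algebra_generated\<close> and
  \<open>cuntz_krieger_algebra_universal\<close>; that \<open>ck_gauge A t\<close> is the automorphism with
  \<open>ck_gen A a \<mapsto> e\<^bsup>2\<pi>it\<^esup> ck_gen A a\<close> in \<open>ck_gauge_automorphism\<close> and \<open>ck_gauge_ck_gen\<close>.\<close>

text \<open>The circle is parametrised by \<open>t :: real\<close>; the automorphism depends only on \<open>t\<close> modulo 1.\<close>

definition ck_gauge :: "nat mat \<Rightarrow> real \<Rightarrow> ck_element \<Rightarrow> ck_element" where
  "ck_gauge A t X =
     (\<Union>x\<in>X. univ_class (edges A) (ck_relations A) (\<lambda>n. fgauge t (x n)))"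

type_synonym 'a triplet = "'a cstar \<times> 'a set \<times> (real \<Rightarrow> 'a \<Rightarrow> 'a)"

definition ck_triplet :: "nat mat \<Rightarrow> ck_element triplet" where
  "ck_triplet A = (cuntz_krieger_algebra A, ck_diagonal A, ck_gauge A)"

fun triplet_isomorphic :: "'a triplet \<Rightarrow> 'b triplet \<Rightarrow> bool" where
  "triplet_isomorphic (\<O>, \<D>, \<rho>) (\<O>', \<D>', \<rho>') \<longleftrightarrow>
     (\<exists>\<Phi>\<in>star_iso \<O> \<O>'. \<Phi> ` \<D> = \<D>' \<and>
        (\<forall>t. \<forall>x\<in>carrier \<O>. \<Phi> (\<rho> t x) = \<rho>' t (\<Phi> x)))"

definition ck_triplet_pair :: "nat mat \<Rightarrow> ck_element triplet \<times> ck_element triplet" where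
  "ck_triplet_pair A = (ck_triplet (transpose_mat A), ck_triplet A)"

fun tf_isomorphic_1step :: "'a triplet \<times> 'a triplet \<Rightarrow> 'b triplet \<times> 'b triplet \<Rightarrow> bool" where
  "tf_isomorphic_1step (S, T) (S', T') \<longleftrightarrow> triplet_isomorphic T T' \<or> triplet_isomorphic S S'"

text \<open>\<open>transpose_free_isomorphic A B\<close> is the relation between the pairs \<open>ck_triplet_pair A\<close> and
  \<open>ck_triplet_pair B\<close>.\<close>

definition transpose_free_isomorphic :: "nat mat \<Rightarrow> nat mat \<Rightarrow> bool" where
  "transpose_free_isomorphic A B \<longleftrightarrow>
     (\<exists>(n::nat) C. C 0 = A \<and> C n = B \<and>
        (\<forall>i\<le>n. square_mat (C i) \<and> irreducible_matrix (C i) \<and> \<not> permutation_matrix (C i)) \<and>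
        (\<forall>i<n. tf_isomorphic_1step (ck_triplet_pair (C i)) (ck_triplet_pair (C (Suc i)))))"


section \<open>The universal property and the gauge automorphisms\<close>

lemma letter_adj_adj [simp]: "letter_adj (letter_adj l) = l"
  by (cases l) auto

lemma word_adj_adj [simp]: "word_adj (word_adj w) = w"
  by (cases w) (simp add: word_adj_def rev_map o_def)

lemma word_adj_eq_iff: "word_adj u = w \<longleftrightarrow> u = word_adj w"
  by auto

lemma word_adj_plus: "word_adj (u + v) = word_adj v + word_adj u"
  by (simp add: word_adj_def plus_word_def)

lemma word_adj_zero [simp]: "word_adj 0 = 0"
  by (simp add: word_adj_def zero_word_def)

lemma set_letter_adj [simp]: "set_letter (letter_adj l) = set_letter l"
  by (cases l) auto

lemma set_word_letters: "set_word w = (\<Union>l\<in>set (letters w). set_letter l)"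
  by (cases w) auto

lemma set_word_adj [simp]: "set_word (word_adj w) = set_word w"
  by (simp add: set_word_letters word_adj_def)

lemma set_word_plus [simp]: "set_word (u + v) = set_word u \<union> set_word v"
  by (simp add: set_word_letters plus_word_def)

lemma set_word_zero [simp]: "set_word 0 = {}"
  by (simp add: set_word_letters zero_word_def)

lemma letter_degree_adj [simp]: "letter_degree (letter_adj l) = - letter_degree l"
  by (cases l) auto

lemma word_degree_zero [simp]: "word_degree 0 = 0"
  by (simp add: word_degree_def zero_word_def)

lemma word_degree_plus [simp]: "word_degree (u + v) = word_degree u + word_degree v"
  by (simp add: word_degree_def plus_word_def)

lemma word_degree_adj [simp]: "word_degree (word_adj w) = - word_degree w"
proof -
  have "sum_list (map letter_degree (rev (map letter_adj l))) = - sum_list (map letter_degree l)" for l :: "'a letter list"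
    by (induction l) auto
  then show ?thesis
    by (simp add: word_degree_def word_adj_def del: map_map)
qed

lemma free_induct [case_names zero single add]:
  fixes x :: "'a \<Rightarrow>\<^sub>0 ('b::comm_monoid_add)"
  assumes "P 0" "\<And>w c. P (Poly_Mapping.single w c)" "\<And>x y. P x \<Longrightarrow> P y \<Longrightarrow> P (x + y)"
  shows "P x"
proof (induction x rule: update_induct)
  case const
  show ?case by (rule assms(1))
next
  case (update f a b)
  have "Poly_Mapping.update a b f = Poly_Mapping.single a b + f"
    using update(1)
    by (intro poly_mapping_eqI) (auto simp: lookup_add lookup_single lookup_update in_keys_iff when_def)
  then show ?case using assms update by metis
qed

lemma lookup_fstar: "Poly_Mapping.lookup (fstar x) w = cnj (Poly_Mapping.lookup x (word_adj w))"
proof -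
  have "Poly_Mapping.lookup (fstar x) w =
     (\<Sum>v\<in>Poly_Mapping.keys x. if v = word_adj w then cnj (Poly_Mapping.lookup x v) else 0)"
    unfolding fstar_def lookup_sum
    by (intro sum.cong refl) (auto simp: lookup_single when_def word_adj_eq_iff)
  also have "\<dots> = cnj (Poly_Mapping.lookup x (word_adj w))"
    by (auto simp: in_keys_iff)
  finally show ?thesis .
qed

lemma lookup_fgauge: "Poly_Mapping.lookup (fgauge t x) w =
   exp (2 * of_real pi * \<i> * of_real t * of_int (word_degree w)) * Poly_Mapping.lookup x w"
proof -
  have "Poly_Mapping.lookup (fgauge t x) w =
     (\<Sum>v\<in>Poly_Mapping.keys x. if v = w then exp (2 * of_real pi * \<i> * of_real t * of_int (word_degree w)) * Poly_Mapping.lookup x v else 0)"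
    unfolding fgauge_def lookup_sum
    by (intro sum.cong refl) (auto simp: lookup_single when_def)
  also have "\<dots> = exp (2 * of_real pi * \<i> * of_real t * of_int (word_degree w)) * Poly_Mapping.lookup x w"
    by (auto simp: in_keys_iff)
  finally show ?thesis .
qed

lemma fstar_add: "fstar (x + y) = fstar x + fstar y"
  by (intro poly_mapping_eqI) (simp add: lookup_fstar lookup_add)

lemma fstar_single: "fstar (Poly_Mapping.single w c) = Poly_Mapping.single (word_adj w) (cnj c)"
  by (intro poly_mapping_eqI) (auto simp: lookup_fstar lookup_single when_def)

lemma fstar_zero [simp]: "fstar 0 = 0"
  by (intro poly_mapping_eqI) (simp add: lookup_fstar)

lemma fstar_one [simp]: "fstar 1 = 1"
  using fstar_single[of 0 1] by simp

lemma fstar_minus: "fstar (- x) = - fstar x"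
  by (intro poly_mapping_eqI) (simp add: lookup_fstar)

lemma fstar_diff: "fstar (x - y) = fstar x - fstar y"
  by (intro poly_mapping_eqI) (simp add: lookup_fstar lookup_minus)

lemma fstar_fstar [simp]: "fstar (fstar x) = x"
  by (intro poly_mapping_eqI) (simp add: lookup_fstar)

lemma fstar_sum: "fstar (sum f I) = (\<Sum>i\<in>I. fstar (f i))"
  by (induction I rule: infinite_finite_induct) (auto simp: fstar_add)

lemma fstar_mult: "fstar (x * y) = fstar y * fstar x"
proof (induction x rule: free_induct)
  case (single w c)
  show ?case
    by (induction y rule: free_induct)
       (auto simp: mult_single fstar_single word_adj_plus mult.commute distrib_left distrib_right fstar_add)
qed (auto simp: distrib_left distrib_right fstar_add)

lemma fstar_fscale: "fstar (fscale c x) = fscale (cnj c) (fstar x)"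
proof (induction x rule: free_induct)
  case (single w d)
  show ?case by (simp add: fscale_def mult_single fstar_single)
qed (auto simp: fscale_def distrib_left fstar_add)

lemma fgauge_add: "fgauge t (x + y) = fgauge t x + fgauge t y"
  by (intro poly_mapping_eqI) (simp add: lookup_fgauge lookup_add distrib_left)

lemma fgauge_diff: "fgauge t (x - y) = fgauge t x - fgauge t y"
  by (intro poly_mapping_eqI) (simp add: lookup_fgauge lookup_minus algebra_simps)

lemma fgauge_zero [simp]: "fgauge t 0 = 0"
  by (intro poly_mapping_eqI) (simp add: lookup_fgauge)

lemma fgauge_sum: "fgauge t (sum f I) = (\<Sum>i\<in>I. fgauge t (f i))"
  by (induction I rule: infinite_finite_induct) (auto simp: fgauge_add)

lemma fgauge_single: "fgauge t (Poly_Mapping.single w c) =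
    Poly_Mapping.single w (exp (2 * of_real pi * \<i> * of_real t * of_int (word_degree w)) * c)"
  by (intro poly_mapping_eqI) (auto simp: lookup_fgauge lookup_single when_def)

lemma fgauge_one [simp]: "fgauge t 1 = 1"
  using fgauge_single[of t 0 1] by simp

lemma fgauge_fstar: "fgauge t (fstar x) = fstar (fgauge t x)"
  by (intro poly_mapping_eqI) (simp add: lookup_fgauge lookup_fstar exp_cnj)

lemma fgauge_mult: "fgauge t (x * y) = fgauge t x * fgauge t y"
proof (induction x rule: free_induct)
  case (single w c)
  show ?case
  proof (induction y rule: free_induct)
    case (single v d)
    show ?case by (simp add: mult_single fgauge_single distrib_left exp_add mult_ac)
  qed (auto simp: distrib_left fgauge_add)
qed (auto simp: distrib_right fgauge_add)

lemma fgauge_fscale: "fgauge t (fscale c x) = fscale c (fgauge t x)"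
proof (induction x rule: free_induct)
  case (single w d)
  show ?case by (simp add: fscale_def mult_single fgauge_single mult_ac)
qed (auto simp: fscale_def distrib_left fgauge_add)

lemma fgauge_fgauge: "fgauge s (fgauge t x) = fgauge (s + t) x"
  by (intro poly_mapping_eqI) (simp add: lookup_fgauge exp_add[symmetric] algebra_simps)

lemma fgauge_0 [simp]: "fgauge 0 x = x"
  by (intro poly_mapping_eqI) (simp add: lookup_fgauge)

lemma fgauge_fgen: "fgauge t (fgen a) = fscale (exp (2 * of_real pi * \<i> * of_real t)) (fgen a)"
  by (simp add: fgen_def fgauge_single fscale_def mult_single word_degree_def)

lemma fscale_one [simp]: "fscale 1 x = x" and fscale_zero [simp]: "fscale 0 x = 0"
  by (simp_all add: fscale_def)

lemma fscale_fscale: "fscale c (fscale d x) = fscale (c * d) x"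
  by (simp add: fscale_def mult_single flip: mult.assoc)

lemma fscale_add: "fscale c (x + y) = fscale c x + fscale c y"
  by (simp add: fscale_def distrib_left)

lemma fscale_diff: "fscale c (x - y) = fscale c x - fscale c y"
  by (simp add: fscale_def right_diff_distrib)

lemma fscale_add_left: "fscale (c + d) x = fscale c x + fscale d x"
  by (simp add: fscale_def single_add distrib_right)

lemma fscale_minus_one: "fscale (- 1) x = - x"
  by (simp add: fscale_def single_uminus)

lemma fscale_mult_left: "fscale c x * y = fscale c (x * y)"
  by (simp add: fscale_def mult.assoc)

lemma fscale_mult_right: "x * fscale c y = fscale c (x * y)"
proof (induction x rule: free_induct)
  case (single w d)
  have "Poly_Mapping.single w d * Poly_Mapping.single 0 c = Poly_Mapping.single 0 c * Poly_Mapping.single w d"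
    by (simp add: mult_single mult.commute)
  then show ?case by (simp add: fscale_def flip: mult.assoc)
qed (auto simp: distrib_right fscale_add fscale_def distrib_left)

context
  fixes G :: "'e set"
begin

lemma free_zero [simp]: "0 \<in> free_star_algebra G"
  and free_one [simp]: "1 \<in> free_star_algebra G"
  and free_single_iff: "Poly_Mapping.single w c \<in> free_star_algebra G \<longleftrightarrow> c = 0 \<or> set_word w \<subseteq> G"
  by (auto simp: free_star_algebra_def simp flip: single_one)

lemma free_fgen: "a \<in> G \<Longrightarrow> fgen a \<in> free_star_algebra G"
  by (simp add: fgen_def free_single_iff)

lemma free_add: "x \<in> free_star_algebra G \<Longrightarrow> y \<in> free_star_algebra G \<Longrightarrow> x + y \<in> free_star_algebra G"
  using keys_add[of x y] by (auto simp: free_star_algebra_def)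

lemma free_mult: "x \<in> free_star_algebra G \<Longrightarrow> y \<in> free_star_algebra G \<Longrightarrow> x * y \<in> free_star_algebra G"
proof -
  assume x: "x \<in> free_star_algebra G" and y: "y \<in> free_star_algebra G"
  have "set_word w \<subseteq> G" if w: "w \<in> Poly_Mapping.keys (x * y)" for w
  proof -
    obtain u v where "w = u + v" "u \<in> Poly_Mapping.keys x" "v \<in> Poly_Mapping.keys y"
      using keys_mult[of x y] w by blast
    then show ?thesis using x y by (simp add: free_star_algebra_def)
  qed
  then show ?thesis by (simp add: free_star_algebra_def)
qed

lemma free_fscale: "x \<in> free_star_algebra G \<Longrightarrow> fscale c x \<in> free_star_algebra G"
  unfolding fscale_def by (intro free_mult) (auto simp: free_single_iff)

lemma free_minus: "x \<in> free_star_algebra G \<Longrightarrow> - x \<in> free_star_algebra G"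
  using free_fscale[of x "-1"] by (simp add: fscale_minus_one)

lemma free_diff: "x \<in> free_star_algebra G \<Longrightarrow> y \<in> free_star_algebra G \<Longrightarrow> x - y \<in> free_star_algebra G"
  using free_add[of x "- y"] free_minus[of y] by simp

lemma free_sum: "(\<And>i. i \<in> I \<Longrightarrow> f i \<in> free_star_algebra G) \<Longrightarrow> sum f I \<in> free_star_algebra G"
  by (induction I rule: infinite_finite_induct) (auto intro: free_add)

lemma free_fstar: "x \<in> free_star_algebra G \<Longrightarrow> fstar x \<in> free_star_algebra G"
proof -
  assume x: "x \<in> free_star_algebra G"
  have "set_word w \<subseteq> G" if "w \<in> Poly_Mapping.keys (fstar x)" for w
  proof -
    have "word_adj w \<in> Poly_Mapping.keys x" using that by (simp add: in_keys_iff lookup_fstar)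
    then have "set_word (word_adj w) \<subseteq> G" using x unfolding free_star_algebra_def by blast
    then show ?thesis by simp
  qed
  then show ?thesis by (simp add: free_star_algebra_def)
qed

lemma free_fgauge: "x \<in> free_star_algebra G \<Longrightarrow> fgauge t x \<in> free_star_algebra G"
  by (simp add: free_star_algebra_def in_keys_iff lookup_fgauge)

lemmas free_intros = free_zero free_one free_fgen free_add free_mult free_fscale free_minus free_diff free_sum
  free_fstar free_fgauge

lemma free_star_algebra_induct [consumes 1, case_names zero one gen star_gen add mult scale]:
  assumes "x \<in> free_star_algebra G"
    and "P 0" "P 1" "\<And>a. a \<in> G \<Longrightarrow> P (fgen a)" "\<And>a. a \<in> G \<Longrightarrow> P (fstar (fgen a))"
    and add: "\<And>x y. x \<in> free_star_algebra G \<Longrightarrow> y \<in> free_star_algebra G \<Longrightarrow> P x \<Longrightarrow> P y \<Longrightarrow> P (x + y)"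
    and mult: "\<And>x y. x \<in> free_star_algebra G \<Longrightarrow> y \<in> free_star_algebra G \<Longrightarrow> P x \<Longrightarrow> P y \<Longrightarrow> P (x * y)"
    and scale: "\<And>c x. x \<in> free_star_algebra G \<Longrightarrow> P x \<Longrightarrow> P (fscale c x)"
  shows "P x"
proof -
  have word: "P (Poly_Mapping.single (Word ls) 1)" if "set_word (Word ls) \<subseteq> G" for ls
    using that
  proof (induction ls)
    case Nil
    show ?case using assms(3) by (simp flip: zero_word_def)
  next
    case (Cons l ls)
    have eq: "Poly_Mapping.single (Word (l # ls)) 1 = Poly_Mapping.single (Word [l]) 1 * Poly_Mapping.single (Word ls) (1::complex)"
      by (simp add: mult_single plus_word_def)
    have "P (Poly_Mapping.single (Word [l]) 1)"
      using Cons.prems assms(4,5) by (cases l) (auto simp: fgen_def fstar_single word_adj_def)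
    then show ?case unfolding eq
      using Cons by (intro mult) (auto simp: free_single_iff)
  qed
  have "x = (\<Sum>w\<in>Poly_Mapping.keys x. fscale (Poly_Mapping.lookup x w) (Poly_Mapping.single w 1))"
    by (intro poly_mapping_eqI)
       (auto simp: fscale_def mult_single lookup_sum lookup_single when_def in_keys_iff)
  moreover have "P (\<Sum>w\<in>K. fscale (Poly_Mapping.lookup x w) (Poly_Mapping.single w 1))"
    if "finite K" "K \<subseteq> Poly_Mapping.keys x" for K
    using that
  proof (induction K rule: finite_induct)
    case (insert w K)
    have w: "set_word w \<subseteq> G" using insert.prems assms(1) by (auto simp: free_star_algebra_def)
    have "P (Poly_Mapping.single w 1)"
      using word[of "letters w"] w by simp
    then show ?case
      using insert w assms(1)
      by (auto intro!: add scale free_sum free_fscale simp: free_single_iff free_star_algebra_def)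
  qed (use assms in auto)
  ultimately show ?thesis by (metis finite_keys subset_refl)
qed

end

lemma cstar_seminormD:
  assumes "cstar_seminorm G p" "x \<in> free_star_algebra G"
  shows "0 \<le> p x" "p (fscale c x) = cmod c * p x" "p (fstar x * x) = (p x)\<^sup>2"
    "y \<in> free_star_algebra G \<Longrightarrow> p (x + y) \<le> p x + p y"
    "y \<in> free_star_algebra G \<Longrightarrow> p (x * y) \<le> p x * p y"
  using assms unfolding cstar_seminorm_def by blast+

lemma cstar_seminorm_fstar:
  assumes p: "cstar_seminorm G p" and x: "x \<in> free_star_algebra G"
  shows "p (fstar x) = p x"
proof -
  have le: "p x \<le> p (fstar x)" if x: "x \<in> free_star_algebra G" for x
  proof (cases "p x = 0")
    case False
    have "(p x)\<^sup>2 \<le> p (fstar x) * p x"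
      using cstar_seminormD[OF p] x free_fstar[OF x] by metis
    then show ?thesis
      using False cstar_seminormD(1)[OF p x] by (simp add: power2_eq_square)
  qed (use cstar_seminormD(1)[OF p] free_fstar[OF x] in simp)
  show ?thesis using le[OF x] le[OF free_fstar[OF x]] by simp
qed

lemma cstar_seminorm_zero:
  assumes p: "cstar_seminorm G p"
  shows "p 0 = 0"
  using cstar_seminormD(2)[OF p free_zero, of 0] by simp

lemma cstar_seminorm_one:
  assumes p: "cstar_seminorm G p"
  shows "p 1 \<le> 1"
proof -
  have "p 1 = (p 1)\<^sup>2" using cstar_seminormD(3)[OF p free_one] by simp
  then have "p 1 * (p 1 - 1) = 0" by (simp add: power2_eq_square algebra_simps)
  then show ?thesis by auto
qed

lemma cstar_seminorm_diff_commute: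
  assumes p: "cstar_seminorm G p" and "x \<in> free_star_algebra G" "y \<in> free_star_algebra G"
  shows "p (x - y) = p (y - x)"
  using cstar_seminormD(2)[OF p, of "x - y" "-1"] assms by (simp add: fscale_minus_one free_diff)

lemma cstar_seminorm_diff_triangle:
  assumes p: "cstar_seminorm G p" and "x \<in> free_star_algebra G" "y \<in> free_star_algebra G"
   "z \<in> free_star_algebra G"
  shows "p (x - z) \<le> p (x - y) + p (y - z)"
  using cstar_seminormD(4)[OF p, of "x - y" "y - z"] assms by (simp add: free_diff)

lemma cstar_seminorm_abs_diff:
  assumes p: "cstar_seminorm G p" and "x \<in> free_star_algebra G" "y \<in> free_star_algebra G"
  shows "\<bar>p x - p y\<bar> \<le> p (x - y)"
  using cstar_seminorm_diff_triangle[OF p, of x y 0] cstar_seminorm_diff_triangle[OF p, of y x 0]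
    cstar_seminorm_diff_commute[OF p, of x y] assms by simp

locale universal_cstar_presentation =
  fixes G :: "'e set" and R :: "'e free set"
  assumes rel_sub: "R \<subseteq> free_star_algebra G"
    and bdd: "x \<in> free_star_algebra G \<Longrightarrow> bdd_above ((\<lambda>p. p x) ` admissible_seminorms G R)"
begin

abbreviation "F \<equiv> free_star_algebra G"
abbreviation "N \<equiv> univ_norm G R"
abbreviation "C \<equiv> cauchy_ring G R"
abbreviation "I \<equiv> null_ideal G R"
abbreviation "cl \<equiv> univ_class G R"
abbreviation "U \<equiv> universal_cstar G R"

lemma adm_ne: "admissible_seminorms G R \<noteq> {}"
proof -
  have "(\<lambda>x. 0) \<in> admissible_seminorms G R"
    by (simp add: admissible_seminorms_def cstar_seminorm_def)
  then show ?thesis by blast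
qed

lemma N_upper: "x \<in> F \<Longrightarrow> p \<in> admissible_seminorms G R \<Longrightarrow> p x \<le> N x"
  unfolding univ_norm_def by (rule cSUP_upper[OF _ bdd])

lemma N_least: "(\<And>p. p \<in> admissible_seminorms G R \<Longrightarrow> p x \<le> c) \<Longrightarrow> N x \<le> c"
  unfolding univ_norm_def by (rule cSUP_least[OF adm_ne])

lemma admD: "p \<in> admissible_seminorms G R \<Longrightarrow> cstar_seminorm G p"
  by (simp add: admissible_seminorms_def)

lemma N_nonneg': "x \<in> F \<Longrightarrow> 0 \<le> N x"
  using adm_ne N_upper cstar_seminormD(1)[OF admD] by (meson all_not_in_conv order_trans)

lemma N_seminorm: "cstar_seminorm G N"
proof -
  have scale_le: "N (fscale c x) \<le> cmod c * N x" if x: "x \<in> F" for c x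
  proof (rule N_least)
    fix p assume p: "p \<in> admissible_seminorms G R"
    show "p (fscale c x) \<le> cmod c * N x"
      using cstar_seminormD(2)[OF admD[OF p] x, of c] N_upper[OF x p] by (simp add: mult_left_mono)
  qed
  have scale: "N (fscale c x) = cmod c * N x" if x: "x \<in> F" for c x
  proof (cases "c = 0")
    case True
    then show ?thesis using scale_le[OF x, of c] N_nonneg'[of 0] by simp
  next
    case False
    have "cmod c * N x = cmod c * N (fscale (1 / c) (fscale c x))"
      using False by (simp add: fscale_fscale)
    also have "\<dots> \<le> cmod c * (cmod (1 / c) * N (fscale c x))"
      using scale_le[OF free_fscale[OF x]] by (intro mult_left_mono) auto
    also have "\<dots> = N (fscale c x)" using False by (simp add: norm_divide)
    finally show ?thesis using scale_le[OF x, of c] by simp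
  qed
  have add: "N (x + y) \<le> N x + N y" if x: "x \<in> F" and y: "y \<in> F" for x y
  proof (rule N_least)
    fix p assume p: "p \<in> admissible_seminorms G R"
    show "p (x + y) \<le> N x + N y"
      using cstar_seminormD(4)[OF admD[OF p] x y] N_upper[OF x p] N_upper[OF y p] by simp
  qed
  have mult: "N (x * y) \<le> N x * N y" if x: "x \<in> F" and y: "y \<in> F" for x y
  proof (rule N_least)
    fix p assume p: "p \<in> admissible_seminorms G R"
    have "p (x * y) \<le> p x * p y" by (rule cstar_seminormD(5)[OF admD[OF p] x y])
    also have "\<dots> \<le> N x * N y"
      using N_upper[OF x p] N_upper[OF y p] N_nonneg'[OF x] cstar_seminormD(1)[OF admD[OF p] y]
      by (intro mult_mono) auto
    finally show "p (x * y) \<le> N x * N y" .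
  qed
  have star: "N (fstar x * x) = (N x)\<^sup>2" if x: "x \<in> F" for x
  proof (rule antisym)
    show "N (fstar x * x) \<le> (N x)\<^sup>2"
    proof (rule N_least)
      fix p assume p: "p \<in> admissible_seminorms G R"
      show "p (fstar x * x) \<le> (N x)\<^sup>2"
        using cstar_seminormD(1,3)[OF admD[OF p] x] N_upper[OF x p] by (simp add: power_mono)
    qed
    have sx: "fstar x * x \<in> F" by (intro free_mult free_fstar x)
    have "N x \<le> sqrt (N (fstar x * x))"
    proof (rule N_least)
      fix p assume p: "p \<in> admissible_seminorms G R"
      have "(p x)\<^sup>2 \<le> N (fstar x * x)"
        using cstar_seminormD(3)[OF admD[OF p] x] N_upper[OF sx p] by simp
      then show "p x \<le> sqrt (N (fstar x * x))" by (rule real_le_rsqrt)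
    qed
    then show "(N x)\<^sup>2 \<le> N (fstar x * x)"
      using N_nonneg'[OF x] N_nonneg'[OF sx] by (metis power_mono real_sqrt_pow2)
  qed
  show ?thesis
    unfolding cstar_seminorm_def using N_nonneg' scale add mult star by blast
qed

lemma N_rel: "r \<in> R \<Longrightarrow> N r = 0"
  using N_nonneg'[of r] rel_sub by (intro antisym N_least) (auto simp: admissible_seminorms_def)

lemmas N_simps = cstar_seminormD[OF N_seminorm]
lemmas N_zero [simp] = cstar_seminorm_zero[OF N_seminorm]
lemmas N_fstar = cstar_seminorm_fstar[OF N_seminorm]
lemmas N_one = cstar_seminorm_one[OF N_seminorm]
lemmas N_commute = cstar_seminorm_diff_commute[OF N_seminorm]
lemmas N_triangle = cstar_seminorm_diff_triangle[OF N_seminorm]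
lemmas N_abs_diff = cstar_seminorm_abs_diff[OF N_seminorm]

lemma C_sel [simp]: "mult C = (\<lambda>x y n. x n * y n)" "one C = (\<lambda>n. 1)" "zero C = (\<lambda>n. 0)"
  "add C = (\<lambda>x y n. x n + y n)"
  by (simp_all add: cauchy_ring_def)

lemma C_iff: "x \<in> carrier C \<longleftrightarrow> (\<forall>n. x n \<in> F) \<and> (\<forall>\<epsilon>>0. \<exists>M. \<forall>m\<ge>M. \<forall>n\<ge>M. N (x m - x n) < \<epsilon>)"
  by (simp add: cauchy_ring_def)

lemma C_F: "x \<in> carrier C \<Longrightarrow> x n \<in> F"
  by (simp add: C_iff)

lemma C_I:
  assumes "\<And>n. x n \<in> F" "\<And>m n. N (x m - x n) \<le> B * (N (y m - y n) + N (z m - z n))"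
    and y: "y \<in> carrier C" and z: "z \<in> carrier C" and B: "B > 0"
  shows "x \<in> carrier C"
  unfolding C_iff
proof (intro conjI allI impI)
  fix e :: real assume e: "e > 0"
  then have e2: "e / (2 * B) > 0" using B by simp
  obtain M1 where M1: "\<And>m n. m \<ge> M1 \<Longrightarrow> n \<ge> M1 \<Longrightarrow> N (y m - y n) < e / (2 * B)"
    using y e2 unfolding C_iff by blast
  obtain M2 where M2: "\<And>m n. m \<ge> M2 \<Longrightarrow> n \<ge> M2 \<Longrightarrow> N (z m - z n) < e / (2 * B)"
    using z e2 unfolding C_iff by blast
  have "N (x m - x n) < e" if "m \<ge> max M1 M2" "n \<ge> max M1 M2" for m n
  proof -
    have "N (y m - y n) + N (z m - z n) < e / B"
      using M1[of m n] M2[of m n] that by (simp add: field_simps)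
    then have "B * (N (y m - y n) + N (z m - z n)) < e"
      using B by (simp add: field_simps)
    then show ?thesis using assms(2)[of m n] by simp
  qed
  then show "\<exists>M. \<forall>m\<ge>M. \<forall>n\<ge>M. N (x m - x n) < e" by blast
qed (use assms in auto)

lemma C_const: "a \<in> F \<Longrightarrow> (\<lambda>n. a) \<in> carrier C"
  by (simp add: C_iff)

lemma C_fscale: assumes x: "x \<in> carrier C" shows "(\<lambda>n. fscale c (x n)) \<in> carrier C"
proof (rule C_I[OF _ _ x x])
  show "N (fscale c (x m) - fscale c (x n)) \<le> (cmod c + 1) * (N (x m - x n) + N (x m - x n))" for m n
  proof -
    have "N (x m - x n) \<ge> 0" using x by (intro N_simps) (auto intro: free_diff C_F)
    then have "(cmod c) * N (x m - x n) \<le> (cmod c + 1) * (N (x m - x n) + N (x m - x n))"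
      by (intro mult_mono) auto
    then show ?thesis
      by (subst fscale_diff[symmetric], subst N_simps) (auto intro: free_diff C_F x)
  qed
qed (auto intro: free_fscale C_F x add_nonneg_pos)

lemma C_add: assumes x: "x \<in> carrier C" and y: "y \<in> carrier C" shows "(\<lambda>n. x n + y n) \<in> carrier C"
proof (rule C_I[OF _ _ x y])
  show "N (x m + y m - (x n + y n)) \<le> 1 * (N (x m - x n) + N (y m - y n))" for m n
    using N_simps(4)[of "x m - x n" "y m - y n"] x y
    by (simp add: algebra_simps free_diff C_F)
qed (auto intro: free_add C_F x y)

lemma C_fstar: assumes x: "x \<in> carrier C" shows "(\<lambda>n. fstar (x n)) \<in> carrier C"
proof (rule C_I[OF _ _ x x])
  show "N (fstar (x m) - fstar (x n)) \<le> 1 * (N (x m - x n) + N (x m - x n))" for m n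
    using N_fstar[of "x m - x n"] N_simps(1)[of "x m - x n"] x
    by (simp add: fstar_diff free_diff C_F)
qed (auto intro: free_fstar C_F x)

lemma C_minus: assumes x: "x \<in> carrier C" shows "(\<lambda>n. - x n) \<in> carrier C"
  using C_fscale[OF x, of "-1"] by (simp add: fscale_minus_one)

lemma C_diff: assumes x: "x \<in> carrier C" and y: "y \<in> carrier C" shows "(\<lambda>n. x n - y n) \<in> carrier C"
  using C_add[OF x C_minus[OF y]] by simp

lemma C_norm_convergent: assumes x: "x \<in> carrier C" shows "convergent (\<lambda>n. N (x n))"
proof -
  have "Cauchy (\<lambda>n. N (x n))"
    unfolding Cauchy_def
  proof (intro allI impI)
    fix e :: real assume "e > 0"
    then obtain M where M: "\<And>m n. m \<ge> M \<Longrightarrow> n \<ge> M \<Longrightarrow> N (x m - x n) < e"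
      using x unfolding C_iff by blast
    have "dist (N (x m)) (N (x n)) < e" if "m \<ge> M" "n \<ge> M" for m n
      using M[OF that] N_abs_diff[of "x m" "x n"] C_F[OF x] by (simp add: dist_real_def)
    then show "\<exists>M. \<forall>m\<ge>M. \<forall>n\<ge>M. dist (N (x m)) (N (x n)) < e" by blast
  qed
  then show ?thesis by (rule Cauchy_convergent)
qed

lemma C_bounded: assumes x: "x \<in> carrier C" shows "\<exists>B>0. \<forall>n. N (x n) \<le> B"
proof -
  have "Bseq (\<lambda>n. N (x n))" using C_norm_convergent[OF x] by (rule convergent_imp_Bseq)
  then obtain K where "K > 0" "\<And>n. norm (N (x n)) \<le> K" unfolding Bseq_def by blast
  then show ?thesis by (intro exI[of _ K]) (auto intro: order_trans[OF abs_ge_self])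
qed

lemma C_mult: assumes x: "x \<in> carrier C" and y: "y \<in> carrier C" shows "(\<lambda>n. x n * y n) \<in> carrier C"
proof -
  obtain B1 where B1: "B1 > 0" "\<And>n. N (x n) \<le> B1" using C_bounded[OF x] by blast
  obtain B2 where B2: "B2 > 0" "\<And>n. N (y n) \<le> B2" using C_bounded[OF y] by blast
  show ?thesis
  proof (rule C_I[OF _ _ x y])
    show "N (x m * y m - x n * y n) \<le> max B1 B2 * (N (x m - x n) + N (y m - y n))" for m n
    proof -
      have F: "x m \<in> F" "x n \<in> F" "y m \<in> F" "y n \<in> F" using x y by (auto intro: C_F)
      have "N (x m * y m - x n * y n) = N ((x m - x n) * y m + x n * (y m - y n))"
        by (simp add: algebra_simps)
      also have "\<dots> \<le> N (x m - x n) * N (y m) + N (x n) * N (y m - y n)"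
        by (rule order_trans[OF N_simps(4)] add_mono N_simps(5) free_intros F)+
      also have "\<dots> \<le> N (x m - x n) * max B1 B2 + max B1 B2 * N (y m - y n)"
        using B1(2)[of n] B2(2)[of m]
        by (intro add_mono mult_mono order_refl N_simps(1) free_intros F) (auto simp: B1(1) less_imp_le less_max_iff_disj le_max_iff_disj)
      finally show ?thesis by (simp add: algebra_simps)
    qed
  qed (use B1 in \<open>auto intro: free_mult C_F x y\<close>)
qed

lemma C_ring: "ring C"
proof (rule ringI)
  show "abelian_group C"
  proof (rule abelian_groupI)
    fix x assume "x \<in> carrier C"
    then show "\<exists>y\<in>carrier C. y \<oplus>\<^bsub>C\<^esub> x = \<zero>\<^bsub>C\<^esub>"
      by (intro bexI[of _ "\<lambda>n. - x n"]) (auto intro: C_minus)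
  qed (auto intro: C_add C_const simp: add_ac)
  show "Group.monoid C"
    by (rule monoidI) (auto intro: C_mult C_const simp: mult.assoc)
qed (auto simp: distrib_left distrib_right)

sublocale C: ring C by (rule C_ring)

lemma C_a_inv [simp]: assumes x: "x \<in> carrier C" shows "\<ominus>\<^bsub>C\<^esub> x = (\<lambda>n. - x n)"
  by (rule C.minus_equality) (use x in \<open>auto intro: C_minus\<close>)

lemma I_iff: "x \<in> I \<longleftrightarrow> x \<in> carrier C \<and> (\<lambda>n. N (x n)) \<longlonglongrightarrow> 0"
  by (simp add: null_ideal_def)

lemma tendsto_0_le:
  assumes "f \<longlonglongrightarrow> (0::real)" "\<And>n. 0 \<le> g n" "\<And>n. g n \<le> B * f n"
  shows "g \<longlonglongrightarrow> 0"
proof (rule tendsto_sandwich[OF _ _ tendsto_const])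
  show "(\<lambda>n. B * f n) \<longlonglongrightarrow> 0" using tendsto_mult_left[OF assms(1), of B] by simp
qed (use assms in auto)

lemma I_ideal: "ideal I C"
proof (rule idealI[OF C_ring])
  show "subgroup I (add_monoid C)"
  proof (rule group.subgroupI[OF C.a_group])
    show "I \<noteq> {}" using I_iff[of "\<lambda>n. 0"] C_const[of 0] by auto
    fix x assume x: "x \<in> I"
    have inv: "inv\<^bsub>add_monoid C\<^esub> x = (\<lambda>n. - x n)"
      using C_a_inv[of x] x by (auto simp: a_inv_def I_iff simp del: C_sel)
    show "inv\<^bsub>add_monoid C\<^esub> x \<in> I"
      unfolding inv using N_simps(2)[of _ "-1"] x
      by (simp add: I_iff C_minus C_F fscale_minus_one)
    fix y assume y: "y \<in> I"
    have "(\<lambda>n. N (x n + y n)) \<longlonglongrightarrow> 0"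
    proof (rule tendsto_0_le[where B = 1])
      show "(\<lambda>n. N (x n) + N (y n)) \<longlonglongrightarrow> 0"
        using tendsto_add[of "\<lambda>n. N (x n)" 0 _ "\<lambda>n. N (y n)" 0] x y by (simp add: I_iff)
    qed (use x y in \<open>auto intro!: N_simps free_add C_F C_add simp: I_iff\<close>)
    then show "x \<otimes>\<^bsub>add_monoid C\<^esub> y \<in> I" using x y by (simp add: I_iff C_add)
  qed (auto simp: I_iff)
  fix a x assume a: "a \<in> I" and x: "x \<in> carrier C"
  then have aC: "a \<in> carrier C" and a0: "(\<lambda>n. N (a n)) \<longlonglongrightarrow> 0" by (auto simp: I_iff)
  obtain B where B: "B > 0" "\<And>n. N (x n) \<le> B" using C_bounded[OF x] by blast
  have 1: "N (x n * a n) \<le> B * N (a n)" for n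
    by (rule order_trans[OF N_simps(5)]) (use B(2)[of n] in \<open>auto intro!: mult_right_mono N_simps C_F x aC\<close>)
  have 2: "N (a n * x n) \<le> B * N (a n)" for n
    by (rule order_trans[OF N_simps(5)])
      (use B(2)[of n] in \<open>auto intro!: mult_left_mono N_simps C_F x aC simp: mult.commute[of B]\<close>)
  show "x \<otimes>\<^bsub>C\<^esub> a \<in> I"
    using x aC by (auto simp: I_iff intro!: C_mult tendsto_0_le[OF a0 _ 1] N_simps free_mult C_F)
  show "a \<otimes>\<^bsub>C\<^esub> x \<in> I"
    using x aC by (auto simp: I_iff intro!: C_mult tendsto_0_le[OF a0 _ 2] N_simps free_mult C_F)
qed

sublocale I: ideal I C by (rule I_ideal)

end

context universal_cstar_presentation
begin

lemma cl_def: "cl x = I +>\<^bsub>C\<^esub> x"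
  by (simp add: univ_class_def)

lemma U_carrier: "carrier U = cl ` carrier C"
  by (auto simp: universal_cstar_def Let_def FactRing_def A_RCOSETS_def' cl_def)

lemma U_E: assumes "X \<in> carrier U" obtains x where "x \<in> carrier C" "X = cl x"
  using assms by (auto simp: U_carrier)

lemma cl_closed: "x \<in> carrier C \<Longrightarrow> cl x \<in> carrier U"
  by (simp add: U_carrier)

lemma cl_eq_iff:
  assumes "x \<in> carrier C" "y \<in> carrier C"
  shows "cl x = cl y \<longleftrightarrow> (\<lambda>n. N (x n - y n)) \<longlonglongrightarrow> 0"
  using C.quotient_eq_iff_same_a_r_cos[OF I_ideal assms] assms
  by (simp add: cl_def a_minus_def I_iff C_diff)

lemma cl_self: "x \<in> carrier C \<Longrightarrow> x \<in> cl x"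
  by (simp add: cl_def I.a_rcos_self)

lemma cl_memD:
  assumes "z \<in> cl x" "x \<in> carrier C"
  shows "z \<in> carrier C" "cl z = cl x"
  using assms I.a_elemrcos_carrier I.a_repr_independence' unfolding cl_def by blast+

lemma cl_mult: "x \<in> carrier C \<Longrightarrow> y \<in> carrier C \<Longrightarrow> cl x \<otimes>\<^bsub>U\<^esub> cl y = cl (\<lambda>n. x n * y n)"
  using I.rcoset_mult_add by (simp add: universal_cstar_def Let_def FactRing_def cl_def)

lemma cl_add: "x \<in> carrier C \<Longrightarrow> y \<in> carrier C \<Longrightarrow> cl x \<oplus>\<^bsub>U\<^esub> cl y = cl (\<lambda>n. x n + y n)"
  using I.a_rcos_sum by (simp add: universal_cstar_def Let_def FactRing_def cl_def)

lemma cl_one: "\<one>\<^bsub>U\<^esub> = cl (\<lambda>n. 1)"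
  by (simp add: universal_cstar_def Let_def FactRing_def cl_def)

lemma cl_zero: "\<zero>\<^bsub>U\<^esub> = cl (\<lambda>n. 0)"
  using C.a_coset_join2[of "\<lambda>n. 0" I] I.a_subgroup I_iff[of "\<lambda>n. 0"] C_const[of 0]
  by (simp add: universal_cstar_def Let_def FactRing_def cl_def)

lemma cl_lift:
  assumes x: "x \<in> carrier C"
    and f: "\<And>z. z \<in> carrier C \<Longrightarrow> (\<lambda>n. f (z n)) \<in> carrier C"
    and b: "\<And>u v. u \<in> F \<Longrightarrow> v \<in> F \<Longrightarrow> N (f u - f v) \<le> B * N (u - v)"
    and fF: "\<And>u. u \<in> F \<Longrightarrow> f u \<in> F"
  shows "(\<Union>z\<in>cl x. cl (\<lambda>n. f (z n))) = cl (\<lambda>n. f (x n))"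
proof -
  have "cl (\<lambda>n. f (z n)) = cl (\<lambda>n. f (x n))" if z: "z \<in> cl x" for z
  proof -
    have zC: "z \<in> carrier C" and "cl z = cl x" using cl_memD[OF z x] by auto
    then have *: "(\<lambda>n. N (z n - x n)) \<longlonglongrightarrow> 0" using cl_eq_iff x by blast
    have "(\<lambda>n. N (f (z n) - f (x n))) \<longlonglongrightarrow> 0"
      by (rule tendsto_0_le[OF *, where B = B]) (auto intro!: b N_simps(1) free_diff fF C_F[OF zC] C_F[OF x])
    then show ?thesis using cl_eq_iff f x zC by simp
  qed
  then show ?thesis using cl_self[OF x] by blast
qed

lemma cl_smult: assumes x: "x \<in> carrier C" shows "c \<odot>\<^bsub>U\<^esub> cl x = cl (\<lambda>n. fscale c (x n))"
proof -
  have "c \<odot>\<^bsub>U\<^esub> cl x = (\<Union>z\<in>cl x. cl (\<lambda>n. fscale c (z n)))"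
    by (simp add: universal_cstar_def Let_def)
  also have "\<dots> = cl (\<lambda>n. fscale c (x n))"
    by (rule cl_lift[OF x C_fscale, where B = "cmod c"])
       (auto simp: N_simps free_diff free_fscale simp flip: fscale_diff)
  finally show ?thesis .
qed

lemma cl_adj: assumes x: "x \<in> carrier C" shows "adj U (cl x) = cl (\<lambda>n. fstar (x n))"
proof -
  have "adj U (cl x) = (\<Union>z\<in>cl x. cl (\<lambda>n. fstar (z n)))"
    by (simp add: universal_cstar_def Let_def)
  also have "\<dots> = cl (\<lambda>n. fstar (x n))"
    by (rule cl_lift[OF x C_fstar, where B = 1])
       (auto simp: N_fstar free_diff free_fstar simp flip: fstar_diff)
  finally show ?thesis .
qed

lemma cl_norm:
  assumes x: "x \<in> carrier C" and r: "(\<lambda>n. N (x n)) \<longlonglongrightarrow> r"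
  shows "cnorm U (cl x) = r"
proof -
  have lim: "(\<lambda>n. N (z n)) \<longlonglongrightarrow> r" if z: "z \<in> cl x" for z
  proof -
    have zC: "z \<in> carrier C" and "cl z = cl x" using cl_memD[OF z x] by auto
    then have *: "(\<lambda>n. N (z n - x n)) \<longlonglongrightarrow> 0" using cl_eq_iff x by blast
    have "(\<lambda>n. N (z n) - N (x n)) \<longlonglongrightarrow> 0"
      by (rule Lim_null_comparison[OF _ *]) (auto intro!: always_eventually N_abs_diff C_F zC x)
    from tendsto_add[OF this r] show ?thesis by simp
  qed
  have "cnorm U (cl x) = (THE r. \<forall>z\<in>cl x. (\<lambda>n. N (z n)) \<longlonglongrightarrow> r)"
    by (simp add: universal_cstar_def Let_def)
  also have "\<dots> = r"
    by (rule the_equality) (use lim cl_self[OF x] in \<open>auto intro: LIMSEQ_unique\<close>)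
  finally show ?thesis .
qed

lemma cl_norm_lim: "x \<in> carrier C \<Longrightarrow> (\<lambda>n. N (x n)) \<longlonglongrightarrow> cnorm U (cl x)"
  using C_norm_convergent[of x] cl_norm[of x] by (auto simp: convergent_def)

lemma U_ring: "ring U"
proof -
  have "ring (C Quot I)" by (rule I.quotient_is_ring)
  then interpret Q: ring "C Quot I" .
  have sel: "carrier U = carrier (C Quot I)" "mult U = mult (C Quot I)" "one U = one (C Quot I)"
    "zero U = zero (C Quot I)" "add U = add (C Quot I)"
    by (simp_all add: universal_cstar_def Let_def)
  show ?thesis
    by (intro ringI abelian_groupI monoidI; unfold sel)
       (auto simp: Q.a_ac Q.m_assoc Q.l_distr Q.r_distr intro: Q.a_inv_closed Q.l_neg)
qed

sublocale U: ring U by (rule U_ring)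

lemma cl_minus: 
  assumes x: "x \<in> carrier C" and y: "y \<in> carrier C"
  shows "cl x \<ominus>\<^bsub>U\<^esub> cl y = cl (\<lambda>n. x n - y n)"
proof -
  have "\<ominus>\<^bsub>U\<^esub> cl y = cl (\<lambda>n. - y n)"
    by (rule U.minus_equality) (use y in \<open>simp_all add: cl_add C_minus cl_zero cl_closed\<close>)
  then show ?thesis using x y by (simp add: a_minus_def cl_add C_minus)
qed

lemma cl_dist: 
  assumes x: "x \<in> carrier C" and y: "y \<in> carrier C"
  shows "(\<lambda>n. N (x n - y n)) \<longlonglongrightarrow> cdist U (cl x) (cl y)"
  using cl_norm_lim[OF C_diff[OF x y]] x y by (simp add: cdist_def cl_closed cl_minus)

lemma U_Metric_space: "Metric_space (carrier U) (cdist U)"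
proof
  fix X Y
  have *: "0 \<le> cdist U X Y \<and> cdist U X Y = cdist U Y X \<and> (cdist U X Y = 0 \<longleftrightarrow> X = Y)"
    if "X \<in> carrier U" "Y \<in> carrier U"
  proof -
    obtain x y where x: "x \<in> carrier C" "X = cl x" and y: "y \<in> carrier C" "Y = cl y"
      using \<open>X \<in> carrier U\<close> \<open>Y \<in> carrier U\<close> unfolding U_carrier by blast
    have lim: "(\<lambda>n. N (x n - y n)) \<longlonglongrightarrow> cdist U X Y"
      using cl_dist[OF x(1) y(1)] unfolding x(2) y(2) .
    have "(\<lambda>n. N (y n - x n)) \<longlonglongrightarrow> cdist U Y X"
      using cl_dist[OF y(1) x(1)] unfolding x(2) y(2) .
    moreover have "N (x n - y n) = N (y n - x n)" for n
      by (intro N_commute C_F x y)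
    ultimately have "(\<lambda>n. N (x n - y n)) \<longlonglongrightarrow> cdist U Y X"
      by simp
    then have 1: "cdist U X Y = cdist U Y X" using lim by (rule LIMSEQ_unique[symmetric])
    have 2: "0 \<le> cdist U X Y"
      by (rule LIMSEQ_le_const[OF lim])
        (auto intro!: exI[of _ 0] N_simps(1) free_diff C_F[OF x(1)] C_F[OF y(1)])
    have 3: "cdist U X Y = 0 \<longleftrightarrow> X = Y"
      using cl_eq_iff[OF x(1) y(1)] lim LIMSEQ_unique unfolding x(2) y(2) by metis
    show ?thesis using 1 2 3 by blast
  qed
  show "0 \<le> cdist U X Y" using * by (cases "X \<in> carrier U \<and> Y \<in> carrier U") (auto simp: cdist_def)
  show "cdist U X Y = cdist U Y X" using * by (cases "X \<in> carrier U \<and> Y \<in> carrier U") (auto simp: cdist_def)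
  show "X \<in> carrier U \<Longrightarrow> Y \<in> carrier U \<Longrightarrow> cdist U X Y = 0 \<longleftrightarrow> X = Y" using * by blast
  fix Z assume "X \<in> carrier U" "Y \<in> carrier U" "Z \<in> carrier U"
  then obtain x y z where x: "x \<in> carrier C" "X = cl x" and y: "y \<in> carrier C" "Y = cl y"
    and z: "z \<in> carrier C" "Z = cl z" unfolding U_carrier by blast
  show "cdist U X Z \<le> cdist U X Y + cdist U Y Z"
    unfolding x(2) y(2) z(2)
    by (rule LIMSEQ_le[OF cl_dist[OF x(1) z(1)] tendsto_add[OF cl_dist[OF x(1) y(1)] cl_dist[OF y(1) z(1)]]])
       (auto intro!: exI[of _ 0] N_triangle C_F x(1) y(1) z(1))
qed

sublocale U: Metric_space "carrier U" "cdist U" by (rule U_Metric_space)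

lemma cl_const_lim:
  assumes x: "x \<in> carrier C"
  shows "limitin U.mtopology (\<lambda>k. cl (\<lambda>n. x k)) (cl x) sequentially"
  unfolding U.limit_metric_sequentially
proof (intro conjI allI impI cl_closed x)
  fix e :: real assume e: "e > 0"
  then have "e / 2 > 0" by simp
  then obtain M where M: "\<And>m n. m \<ge> M \<Longrightarrow> n \<ge> M \<Longrightarrow> N (x m - x n) < e / 2"
    using x unfolding C_iff by blast
  have "cl (\<lambda>n. x k) \<in> carrier U \<and> cdist U (cl (\<lambda>n. x k)) (cl x) < e" if k: "k \<ge> M" for k
  proof
    show "cl (\<lambda>n. x k) \<in> carrier U" by (intro cl_closed C_const C_F x)
    have "cdist U (cl (\<lambda>n. x k)) (cl x) \<le> e / 2"
      by (rule LIMSEQ_le_const2[OF cl_dist[OF C_const[OF C_F[OF x]] x]])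
         (use k M in \<open>auto intro!: exI[of _ M] less_imp_le\<close>)
    then show "cdist U (cl (\<lambda>n. x k)) (cl x) < e" using e by simp
  qed
  then show "\<exists>M. \<forall>k\<ge>M. cl (\<lambda>n. x k) \<in> carrier U \<and> cdist U (cl (\<lambda>n. x k)) (cl x) < e" by blast
qed

lemma U_complete: "U.mcomplete"
  unfolding U.mcomplete_def
proof (intro allI impI)
  fix X assume X: "U.MCauchy X"
  have "\<exists>e\<in>F. cdist U (X k) (cl (\<lambda>n. e)) < 1 / real (Suc k)" for k
  proof -
    have "X k \<in> carrier U" using X by (auto simp: U.MCauchy_def)
    then obtain x where x: "x \<in> carrier C" "X k = cl x" unfolding U_carrier by blast
    obtain m where "cdist U (cl (\<lambda>n. x m)) (cl x) < 1 / real (Suc k)"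
      using cl_const_lim[OF x(1)] unfolding U.limit_metric_sequentially
      by (metis le_refl of_nat_0_less_iff zero_less_Suc zero_less_divide_1_iff)
    then show ?thesis using x C_F U.commute by metis
  qed
  then obtain e where eF: "\<And>k. e k \<in> F"
    and e: "\<And>k. cdist U (X k) (cl (\<lambda>n. e k)) < 1 / real (Suc k)" by metis
  have XU: "X k \<in> carrier U" for k using X by (auto simp: U.MCauchy_def)
  have eU: "cl (\<lambda>n. e k) \<in> carrier U" for k by (intro cl_closed C_const eF)
  have dist_e: "cdist U (cl (\<lambda>n. e j)) (cl (\<lambda>n. e k)) = N (e j - e k)" for j k
    using LIMSEQ_unique[OF cl_dist[OF C_const C_const] tendsto_const, OF eF eF] by simp
  have small: "\<exists>M. \<forall>k\<ge>M. 1 / real (Suc k) < d" if "d > 0" for d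
    using LIMSEQ_inverse_real_of_nat[unfolded LIMSEQ_iff, rule_format, OF that]
    by (auto simp: inverse_eq_divide)
  have eC: "e \<in> carrier C"
    unfolding C_iff
  proof (intro conjI allI impI eF)
    fix d :: real assume "d > 0"
    then have d: "d / 3 > 0" by simp
    obtain M1 where M1: "\<And>j k. j \<ge> M1 \<Longrightarrow> k \<ge> M1 \<Longrightarrow> cdist U (X j) (X k) < d / 3"
      using X d unfolding U.MCauchy_def by blast
    obtain M2 where M2: "\<And>k. k \<ge> M2 \<Longrightarrow> 1 / real (Suc k) < d / 3" using small[OF d] by blast
    have "N (e j - e k) < d" if "j \<ge> max M1 M2" "k \<ge> max M1 M2" for j k
    proof -
      have "cdist U (cl (\<lambda>n. e j)) (cl (\<lambda>n. e k)) \<le>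
          cdist U (X j) (cl (\<lambda>n. e j)) + (cdist U (X j) (X k) + cdist U (X k) (cl (\<lambda>n. e k)))"
        using U.triangle[OF eU[of j] XU[of j] eU[of k]] U.triangle[OF XU[of j] XU[of k] eU[of k]]
          U.commute[of "X j" "cl (\<lambda>n. e j)"] by linarith
      also have "\<dots> < d / 3 + (d / 3 + d / 3)"
        using e[of j] e[of k] M1[of j k] M2[of j] M2[of k] that by (intro add_strict_mono) auto
      finally show ?thesis by (simp add: dist_e)
    qed
    then show "\<exists>M. \<forall>j\<ge>M. \<forall>k\<ge>M. N (e j - e k) < d" by blast
  qed
  have "limitin U.mtopology X (cl e) sequentially"
    unfolding U.limit_metric_sequentially
  proof (intro conjI allI impI cl_closed eC)
    fix d :: real assume "d > 0"
    then have d: "d / 2 > 0" by simp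
    obtain M1 where M1: "\<And>k. k \<ge> M1 \<Longrightarrow> cdist U (cl (\<lambda>n. e k)) (cl e) < d / 2"
      using cl_const_lim[OF eC] d unfolding U.limit_metric_sequentially by blast
    obtain M2 where M2: "\<And>k. k \<ge> M2 \<Longrightarrow> 1 / real (Suc k) < d / 2" using small[OF d] by blast
    have "X k \<in> carrier U \<and> cdist U (X k) (cl e) < d" if "k \<ge> max M1 M2" for k
      using U.triangle[OF XU[of k] eU[of k] cl_closed[OF eC]] M1[of k] M2[of k] e[of k] that XU[of k]
      by auto
    then show "\<exists>M. \<forall>k\<ge>M. X k \<in> carrier U \<and> cdist U (X k) (cl e) < d" by blast
  qed
  then show "\<exists>x. limitin U.mtopology X x sequentially" by blast
qed

theorem universal_cstar_is_cstar_algebra: "cstar_algebra U"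
proof
  fix X Y c d assume X: "X \<in> carrier U"
  then obtain x where x: "x \<in> carrier C" "X = cl x" unfolding U_carrier by blast
  note xs = C_add C_mult C_fscale C_fstar x(1) cl_closed cl_smult cl_add cl_mult cl_adj
  show "c \<odot>\<^bsub>U\<^esub> X \<in> carrier U" "1 \<odot>\<^bsub>U\<^esub> X = X" "c \<odot>\<^bsub>U\<^esub> (d \<odot>\<^bsub>U\<^esub> X) = (c * d) \<odot>\<^bsub>U\<^esub> X"
    "(c + d) \<odot>\<^bsub>U\<^esub> X = c \<odot>\<^bsub>U\<^esub> X \<oplus>\<^bsub>U\<^esub> d \<odot>\<^bsub>U\<^esub> X"
    "adj U X \<in> carrier U" "adj U (adj U X) = X" "adj U (c \<odot>\<^bsub>U\<^esub> X) = cnj c \<odot>\<^bsub>U\<^esub> adj U X"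
    by (simp_all add: xs x(2) fscale_fscale fscale_add_left fstar_fscale)
  note lim = cl_norm_lim[OF x(1)]
  show "0 \<le> cnorm U X"
    unfolding x(2) by (rule LIMSEQ_le_const[OF lim]) (auto intro!: exI[of _ 0] N_simps(1) C_F[OF x(1)])
  show "cnorm U X = 0 \<longleftrightarrow> X = \<zero>\<^bsub>U\<^esub>"
    using cl_eq_iff[OF x(1) C_const[of 0]] lim LIMSEQ_unique unfolding x(2) cl_zero by (auto dest: LIMSEQ_unique)
  show "cnorm U (c \<odot>\<^bsub>U\<^esub> X) = cmod c * cnorm U X"
    unfolding x(2) cl_smult[OF x(1)]
    by (rule cl_norm) (use tendsto_mult_left[OF lim, of "cmod c"] N_simps(2)[OF C_F[OF x(1)]] in \<open>auto intro: C_fscale x(1)\<close>)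
  show "cnorm U (adj U X \<otimes>\<^bsub>U\<^esub> X) = (cnorm U X)\<^sup>2"
    unfolding x(2) cl_adj[OF x(1)] cl_mult[OF C_fstar[OF x(1)] x(1)]
    by (rule cl_norm) (use tendsto_power[OF lim, of 2] N_simps(3)[OF C_F[OF x(1)]] in \<open>auto intro: C_mult[OF C_fstar[OF x(1)] x(1)]\<close>)
  assume Y: "Y \<in> carrier U"
  then obtain y where y: "y \<in> carrier C" "Y = cl y" unfolding U_carrier by blast
  note lim2 = cl_norm_lim[OF y(1)]
  show "c \<odot>\<^bsub>U\<^esub> (X \<oplus>\<^bsub>U\<^esub> Y) = c \<odot>\<^bsub>U\<^esub> X \<oplus>\<^bsub>U\<^esub> c \<odot>\<^bsub>U\<^esub> Y"
    "(c \<odot>\<^bsub>U\<^esub> X) \<otimes>\<^bsub>U\<^esub> Y = c \<odot>\<^bsub>U\<^esub> (X \<otimes>\<^bsub>U\<^esub> Y)"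
    "X \<otimes>\<^bsub>U\<^esub> (c \<odot>\<^bsub>U\<^esub> Y) = c \<odot>\<^bsub>U\<^esub> (X \<otimes>\<^bsub>U\<^esub> Y)"
    "adj U (X \<oplus>\<^bsub>U\<^esub> Y) = adj U X \<oplus>\<^bsub>U\<^esub> adj U Y"
    "adj U (X \<otimes>\<^bsub>U\<^esub> Y) = adj U Y \<otimes>\<^bsub>U\<^esub> adj U X"
    by (simp_all add: xs x(2) y fscale_add fstar_add fstar_mult fscale_mult_left fscale_mult_right)
  show "cnorm U (X \<oplus>\<^bsub>U\<^esub> Y) \<le> cnorm U X + cnorm U Y"
    unfolding x(2) y(2) cl_add[OF x(1) y(1)]
    by (rule LIMSEQ_le[OF cl_norm_lim tendsto_add[OF lim lim2]])
       (auto intro!: C_add x y exI[of _ 0] N_simps C_F)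
  show "cnorm U (X \<otimes>\<^bsub>U\<^esub> Y) \<le> cnorm U X * cnorm U Y"
    unfolding x(2) y(2) cl_mult[OF x(1) y(1)]
    by (rule LIMSEQ_le[OF cl_norm_lim tendsto_mult[OF lim lim2]])
       (auto intro!: C_mult x y exI[of _ 0] N_simps C_F)
next
  show "U.mcomplete" by (rule U_complete)
qed

abbreviation "\<iota> x \<equiv> cl (\<lambda>n. x)"

theorem universal_cstar_generated:
  "generated_cstar_subalgebra U (insert \<one>\<^bsub>U\<^esub> (univ_gen G R ` G)) = carrier U"
proof (rule antisym)
  interpret A: cstar_algebra U by (rule universal_cstar_is_cstar_algebra)
  have "cstar_subalgebra U (carrier U)"
    unfolding cstar_subalgebra_def
    by (auto intro: A.smult_closed A.adj_closed)
  moreover have "univ_gen G R ` G \<subseteq> carrier U"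
    by (auto simp: univ_gen_def intro!: cl_closed C_const free_fgen)
  ultimately show "generated_cstar_subalgebra U (insert \<one>\<^bsub>U\<^esub> (univ_gen G R ` G)) \<subseteq> carrier U"
    unfolding generated_cstar_subalgebra_def by blast
  show "carrier U \<subseteq> generated_cstar_subalgebra U (insert \<one>\<^bsub>U\<^esub> (univ_gen G R ` G))"
    unfolding generated_cstar_subalgebra_def
  proof (intro subsetI InterI)
    fix X D assume X: "X \<in> carrier U"
      and "D \<in> {D. cstar_subalgebra U D \<and> insert \<one>\<^bsub>U\<^esub> (univ_gen G R ` G) \<subseteq> D}"
    then have D: "cstar_subalgebra U D" and GD: "univ_gen G R ` G \<subseteq> D" and one: "\<one>\<^bsub>U\<^esub> \<in> D"
      by auto
    have Dmult: "a \<otimes>\<^bsub>U\<^esub> b \<in> D" and Dadd: "a \<oplus>\<^bsub>U\<^esub> b \<in> D" if "a \<in> D" "b \<in> D" for a b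
      using D that by (auto simp: cstar_subalgebra_def)
    have Dadj: "adj U a \<in> D" and Dscale: "c \<odot>\<^bsub>U\<^esub> a \<in> D" if "a \<in> D" for a c
      using D that by (auto simp: cstar_subalgebra_def)
    have zero: "\<zero>\<^bsub>U\<^esub> \<in> D" and cls: "closedin U.mtopology D" using D by (auto simp: cstar_subalgebra_def)
    have dense: "\<iota> x \<in> D" if "x \<in> F" for x
      using that
    proof (induction x rule: free_star_algebra_induct)
      case zero
      show ?case using \<open>\<zero>\<^bsub>U\<^esub> \<in> D\<close> by (simp add: cl_zero)
    next
      case one
      show ?case using \<open>\<one>\<^bsub>U\<^esub> \<in> D\<close> by (simp add: cl_one)
    next
      case (gen a)
      then show ?case using GD by (auto simp: univ_gen_def)
    next
      case (star_gen a)
      then have "\<iota> (fgen a) \<in> D" using GD by (auto simp: univ_gen_def)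
      then show ?case using Dadj[of "\<iota> (fgen a)"] by (simp add: cl_adj C_const free_fgen star_gen)
    next
      case (add x y)
      then show ?case using Dadd[of "\<iota> x" "\<iota> y"] by (simp add: cl_add C_const)
    next
      case (mult x y)
      then show ?case using Dmult[of "\<iota> x" "\<iota> y"] by (simp add: cl_mult C_const)
    next
      case (scale c x)
      then show ?case using Dscale[of "\<iota> x" c] by (simp add: cl_smult C_const)
    qed
    obtain x where x: "x \<in> carrier C" "X = cl x" using X unfolding U_carrier by blast
    show "X \<in> D"
      using cls cl_const_lim[OF x(1)] dense[OF C_F[OF x(1)]] unfolding x(2)
      U.metric_closedin_iff_sequentially_closed by (meson image_subset_iff)
  qed
qed

end

context cstar_algebra
begin

lemma smult_zero_left: "x \<in> carrier \<AA> \<Longrightarrow> 0 \<odot> x = \<zero>"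
  using cnorm_smult[of x 0] cnorm_eq_zero[of "0 \<odot> x"] smult_closed[of x 0] by simp

lemma smult_zero_right: "c \<odot> \<zero> = \<zero>"
  using cnorm_smult[of \<zero> c] cnorm_eq_zero[of "c \<odot> \<zero>"] cnorm_eq_zero[of \<zero>] smult_closed[of \<zero> c] by simp

lemma smult_minus_one: assumes x: "x \<in> carrier \<AA>" shows "(- 1) \<odot> x = \<ominus> x"
proof -
  have "(- 1) \<odot> x \<oplus> x = (- 1 + 1) \<odot> x"
    using x by (simp only: smult_add_left smult_one)
  also have "\<dots> = \<zero>" using x by (simp add: smult_zero_left)
  finally show ?thesis using minus_equality[of "(- 1) \<odot> x" x] x smult_closed by simp
qed

lemma cnorm_zero: "cnorm \<AA> \<zero> = 0"
  using cnorm_eq_zero[of \<zero>] by simp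

lemma cnorm_minus: "x \<in> carrier \<AA> \<Longrightarrow> cnorm \<AA> (\<ominus> x) = cnorm \<AA> x"
  using cnorm_smult[of x "-1"] by (simp add: smult_minus_one)

lemma adj_one: "adj \<AA> \<one> = \<one>"
proof -
  have "adj \<AA> \<one> = adj \<AA> \<one> \<otimes> adj \<AA> (adj \<AA> \<one>)" by (simp add: adj_adj adj_closed)
  also have "\<dots> = adj \<AA> (adj \<AA> \<one> \<otimes> \<one>)"
    using adj_mult[of "adj \<AA> \<one>" \<one>] adj_closed[of \<one>] by simp
  also have "\<dots> = \<one>" by (simp add: adj_adj adj_closed)
  finally show ?thesis .
qed

lemma adj_zero: "adj \<AA> \<zero> = \<zero>"
  using adj_smult[of \<zero> 0] by (simp add: smult_zero_left adj_closed)

lemma adj_minus: "x \<in> carrier \<AA> \<Longrightarrow> adj \<AA> (\<ominus> x) = \<ominus> adj \<AA> x"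
  using adj_smult[of x "-1"] by (simp add: smult_minus_one adj_closed)

lemma adj_diff: "x \<in> carrier \<AA> \<Longrightarrow> y \<in> carrier \<AA> \<Longrightarrow> adj \<AA> (x \<ominus> y) = adj \<AA> x \<ominus> adj \<AA> y"
  by (simp add: a_minus_def adj_add adj_minus)

lemma smult_diff: "x \<in> carrier \<AA> \<Longrightarrow> y \<in> carrier \<AA> \<Longrightarrow> c \<odot> (x \<ominus> y) = c \<odot> x \<ominus> c \<odot> y"
  by (simp add: a_minus_def smult_add_right smult_closed smult_smult flip: smult_minus_one)

lemma cnorm_adj: assumes x: "x \<in> carrier \<AA>" shows "cnorm \<AA> (adj \<AA> x) = cnorm \<AA> x"
proof -
  have le: "cnorm \<AA> x \<le> cnorm \<AA> (adj \<AA> x)" if x: "x \<in> carrier \<AA>" for x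
  proof (cases "cnorm \<AA> x = 0")
    case False
    have "(cnorm \<AA> x)\<^sup>2 \<le> cnorm \<AA> (adj \<AA> x) * cnorm \<AA> x"
      using cstar_identity[OF x] cnorm_mult[OF adj_closed[OF x] x] by simp
    then show ?thesis
      using False cnorm_nonneg[OF x] by (simp add: power2_eq_square)
  qed (use cnorm_nonneg adj_closed x in simp)
  show ?thesis using le[OF x] le[OF adj_closed[OF x]] x by (simp add: adj_adj)
qed

lemma cnorm_diff_commute:
  "x \<in> carrier \<AA> \<Longrightarrow> y \<in> carrier \<AA> \<Longrightarrow> cnorm \<AA> (x \<ominus> y) = cnorm \<AA> (y \<ominus> x)"
  using cnorm_minus[of "x \<ominus> y"] by (simp add: a_minus_def minus_add a_comm)

lemma cnorm_diff_eq_zero: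
  assumes "x \<in> carrier \<AA>" "y \<in> carrier \<AA>" shows "cnorm \<AA> (x \<ominus> y) = 0 \<longleftrightarrow> x = y"
proof
  assume "cnorm \<AA> (x \<ominus> y) = 0"
  then have "x \<ominus> y = \<zero>" using assms by (simp add: cnorm_eq_zero)
  moreover have "x = (x \<ominus> y) \<oplus> y" using assms by algebra
  ultimately show "x = y" using assms by simp
next
  assume "x = y"
  then show "cnorm \<AA> (x \<ominus> y) = 0" using assms by (simp add: cnorm_zero a_minus_def r_neg)
qed

lemma cnorm_diff_triangle:
  assumes "x \<in> carrier \<AA>" "y \<in> carrier \<AA>" "z \<in> carrier \<AA>"
  shows "cnorm \<AA> (x \<ominus> z) \<le> cnorm \<AA> (x \<ominus> y) + cnorm \<AA> (y \<ominus> z)"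
proof -
  have "x \<ominus> z = (x \<ominus> y) \<oplus> (y \<ominus> z)" using assms by algebra
  then show ?thesis using cnorm_add[of "x \<ominus> y" "y \<ominus> z"] assms by simp
qed

lemma Metric_space_cdist: "Metric_space (carrier \<AA>) (cdist \<AA>)"
  by standard
     (auto simp: cdist_def cnorm_nonneg cnorm_diff_commute cnorm_diff_eq_zero cnorm_diff_triangle)

sublocale met: Metric_space "carrier \<AA>" "cdist \<AA>" by (rule Metric_space_cdist)

definition conv :: "(nat \<Rightarrow> 'a) \<Rightarrow> 'a \<Rightarrow> bool" where
  "conv f y \<longleftrightarrow> (\<forall>n. f n \<in> carrier \<AA>) \<and> y \<in> carrier \<AA> \<and> (\<lambda>n. cnorm \<AA> (f n \<ominus> y)) \<longlonglongrightarrow> 0"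

lemma conv_unique: assumes "conv f y" "conv f z" shows "y = z"
proof -
  have "(\<lambda>n. cnorm \<AA> (f n \<ominus> y) + cnorm \<AA> (f n \<ominus> z)) \<longlonglongrightarrow> 0 + 0"
    using assms by (intro tendsto_add) (auto simp: conv_def)
  then have "cnorm \<AA> (y \<ominus> z) \<le> 0 + 0"
    by (rule LIMSEQ_le_const)
       (use assms cnorm_diff_triangle[of y _ z] cnorm_diff_commute[of y] in \<open>auto simp: conv_def\<close>)
  then show ?thesis
    using assms cnorm_nonneg[of "y \<ominus> z"] cnorm_diff_eq_zero[of y z] by (simp add: conv_def)
qed

lemma conv_cauchy:
  assumes f: "\<And>n. f n \<in> carrier \<AA>"
    and c: "\<And>e. e > 0 \<Longrightarrow> \<exists>M. \<forall>m\<ge>M. \<forall>n\<ge>M. cnorm \<AA> (f m \<ominus> f n) < e"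
  shows "\<exists>y. conv f y"
proof -
  have "met.MCauchy f"
    unfolding met.MCauchy_def using f c by (simp add: cdist_def image_subset_iff)
  then obtain y where "limitin met.mtopology f y sequentially"
    using complete unfolding met.mcomplete_def by blast
  then have "conv f y"
    using f by (auto simp: met.limitin_metric_dist_null conv_def cdist_def)
  then show ?thesis by blast
qed

lemma conv_const: "x \<in> carrier \<AA> \<Longrightarrow> conv (\<lambda>n. x) x"
  by (simp add: conv_def cnorm_diff_eq_zero[THEN iffD2])

lemma conv_le: 
  assumes "\<And>n. f n \<in> carrier \<AA>" "y \<in> carrier \<AA>" "g \<longlonglongrightarrow> 0" "\<And>n. cnorm \<AA> (f n \<ominus> y) \<le> g n"
  shows "conv f y"
  unfolding conv_def
  using assms cnorm_nonneg
  by (auto intro!: tendsto_sandwich[OF _ _ tendsto_const assms(3)] always_eventually)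

lemma conv_add: assumes f: "conv f y" and g: "conv g z" shows "conv (\<lambda>n. f n \<oplus> g n) (y \<oplus> z)"
proof (rule conv_le)
  show "(\<lambda>n. cnorm \<AA> (f n \<ominus> y) + cnorm \<AA> (g n \<ominus> z)) \<longlonglongrightarrow> 0"
    using f g tendsto_add[of "\<lambda>n. cnorm \<AA> (f n \<ominus> y)" 0 _ "\<lambda>n. cnorm \<AA> (g n \<ominus> z)" 0] by (simp add: conv_def)
  fix n
  have c: "f n \<in> carrier \<AA>" "g n \<in> carrier \<AA>" "y \<in> carrier \<AA>" "z \<in> carrier \<AA>" using f g by (auto simp: conv_def)
  have "f n \<oplus> g n \<ominus> (y \<oplus> z) = (f n \<ominus> y) \<oplus> (g n \<ominus> z)" using c by algebra
  then show "cnorm \<AA> (f n \<oplus> g n \<ominus> (y \<oplus> z)) \<le> cnorm \<AA> (f n \<ominus> y) + cnorm \<AA> (g n \<ominus> z)"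
    using c cnorm_add[of "f n \<ominus> y" "g n \<ominus> z"] by simp
qed (use f g in \<open>auto simp: conv_def\<close>)

lemma conv_mult: assumes f: "conv f y" and g: "conv g z" shows "conv (\<lambda>n. f n \<otimes> g n) (y \<otimes> z)"
proof (rule conv_le)
  show "(\<lambda>n. cnorm \<AA> (f n \<ominus> y) * (cnorm \<AA> (g n \<ominus> z) + cnorm \<AA> z) + cnorm \<AA> y * cnorm \<AA> (g n \<ominus> z)) \<longlonglongrightarrow> 0"
    using f g by (auto simp: conv_def intro!: tendsto_eq_intros)
  fix n
  have c: "f n \<in> carrier \<AA>" "g n \<in> carrier \<AA>" "y \<in> carrier \<AA>" "z \<in> carrier \<AA>" using f g by (auto simp: conv_def)
  have eq: "f n \<otimes> g n \<ominus> y \<otimes> z = (f n \<ominus> y) \<otimes> g n \<oplus> y \<otimes> (g n \<ominus> z)" using c by algebra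
  have "g n = (g n \<ominus> z) \<oplus> z" using c by algebra
  then have gn: "cnorm \<AA> (g n) \<le> cnorm \<AA> (g n \<ominus> z) + cnorm \<AA> z"
    using c cnorm_add[of "g n \<ominus> z" z] by simp
  have "cnorm \<AA> (f n \<otimes> g n \<ominus> y \<otimes> z) \<le> cnorm \<AA> ((f n \<ominus> y) \<otimes> g n) + cnorm \<AA> (y \<otimes> (g n \<ominus> z))"
    unfolding eq using c by (intro cnorm_add) auto
  also have "\<dots> \<le> cnorm \<AA> (f n \<ominus> y) * cnorm \<AA> (g n) + cnorm \<AA> y * cnorm \<AA> (g n \<ominus> z)"
    using c by (intro add_mono cnorm_mult) auto
  also have "\<dots> \<le> cnorm \<AA> (f n \<ominus> y) * (cnorm \<AA> (g n \<ominus> z) + cnorm \<AA> z) + cnorm \<AA> y * cnorm \<AA> (g n \<ominus> z)"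
    using c gn by (intro add_mono mult_left_mono cnorm_nonneg) auto
  finally show "cnorm \<AA> (f n \<otimes> g n \<ominus> y \<otimes> z) \<le> \<dots>" .
qed (use f g in \<open>auto simp: conv_def\<close>)

lemma conv_adj: assumes f: "conv f y" shows "conv (\<lambda>n. adj \<AA> (f n)) (adj \<AA> y)"
  using f by (simp add: conv_def adj_closed cnorm_adj flip: adj_diff)

lemma conv_smult: assumes f: "conv f y" shows "conv (\<lambda>n. c \<odot> f n) (c \<odot> y)"
  using f tendsto_mult_left[of "\<lambda>n. cnorm \<AA> (f n \<ominus> y)" 0 _ "cmod c"]
  by (simp add: conv_def smult_closed cnorm_smult flip: smult_diff)

end

locale free_evaluation = cstar_algebra \<AA> for \<AA> :: "'a cstar" (structure) +
  fixes T :: "'e \<Rightarrow> 'a"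
  assumes T_closed: "T a \<in> carrier \<AA>"
begin

definition letter_ev :: "'e letter \<Rightarrow> 'a" where
  "letter_ev l = (case l of Gen a \<Rightarrow> T a | Adj a \<Rightarrow> adj \<AA> (T a))"

definition word_ev :: "'e word \<Rightarrow> 'a" where
  "word_ev w = foldr (\<lambda>l x. letter_ev l \<otimes> x) (letters w) \<one>"

definition ev :: "'e free \<Rightarrow> 'a" where
  "ev x = (\<Oplus>w\<in>Poly_Mapping.keys x. Poly_Mapping.lookup x w \<odot> word_ev w)"

lemma letter_ev_closed: "letter_ev l \<in> carrier \<AA>"
  by (cases l) (auto simp: letter_ev_def T_closed adj_closed)

lemma foldr_closed: "foldr (\<lambda>l x. letter_ev l \<otimes> x) ls \<one> \<in> carrier \<AA>"
  by (induction ls) (auto simp: letter_ev_closed)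

lemma word_ev_closed: "word_ev w \<in> carrier \<AA>"
  by (simp add: word_ev_def foldr_closed)

lemma foldr_append': "foldr (\<lambda>l x. letter_ev l \<otimes> x) (ks @ ls) \<one> =
   foldr (\<lambda>l x. letter_ev l \<otimes> x) ks \<one> \<otimes> foldr (\<lambda>l x. letter_ev l \<otimes> x) ls \<one>"
proof (induction ks)
  case (Cons k ks)
  then show ?case by (simp del: foldr_append add: foldr_closed letter_ev_closed m_assoc)
qed (simp add: foldr_closed)

lemma word_ev_plus: "word_ev (u + v) = word_ev u \<otimes> word_ev v"
  by (simp del: foldr_append add: word_ev_def plus_word_def foldr_append')

lemma letter_ev_adj: "letter_ev (letter_adj l) = adj \<AA> (letter_ev l)"
  by (cases l) (auto simp: letter_ev_def T_closed adj_adj)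

lemma word_ev_adj: "word_ev (word_adj w) = adj \<AA> (word_ev w)"
proof -
  have "foldr (\<lambda>l x. letter_ev l \<otimes> x) (rev (map letter_adj ls)) \<one> =
      adj \<AA> (foldr (\<lambda>l x. letter_ev l \<otimes> x) ls \<one>)" for ls
  proof (induction ls)
    case (Cons l ls)
    have "foldr (\<lambda>l x. letter_ev l \<otimes> x) (rev (map letter_adj (l # ls))) \<one> = 
      foldr (\<lambda>l x. letter_ev l \<otimes> x) (rev (map letter_adj ls) @ [letter_adj l]) \<one>" by simp
    also have "\<dots> = adj \<AA> (foldr (\<lambda>l x. letter_ev l \<otimes> x) ls \<one>) \<otimes> adj \<AA> (letter_ev l)"
      unfolding foldr_append' Cons by (simp add: letter_ev_adj adj_closed letter_ev_closed)
    finally show ?case by (simp add: adj_mult letter_ev_closed foldr_closed)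
  qed (simp add: adj_one)
  then show ?thesis by (simp add: word_ev_def word_adj_def)
qed

lemma ev_superset:
  assumes "finite K" "Poly_Mapping.keys x \<subseteq> K"
  shows "ev x = (\<Oplus>w\<in>K. Poly_Mapping.lookup x w \<odot> word_ev w)"
  unfolding ev_def
  by (rule add.finprod_mono_neutral_cong_left[OF assms])
     (auto simp: in_keys_iff smult_zero_left word_ev_closed smult_closed)

lemma ev_closed: "ev x \<in> carrier \<AA>"
  unfolding ev_def by (rule finsum_closed) (auto simp: word_ev_closed smult_closed)

lemma ev_zero: "ev 0 = \<zero>"
  by (simp add: ev_def)

lemma ev_single: "ev (Poly_Mapping.single w c) = c \<odot> word_ev w"
  by (cases "c = 0") (simp_all add: ev_def smult_zero_left word_ev_closed smult_closed)

lemma ev_one: "ev 1 = \<one>"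
proof -
  have "word_ev 0 = \<one>" by (simp add: word_ev_def zero_word_def)
  then show ?thesis using ev_single[of 0 1] by (simp add: smult_one)
qed

lemma ev_fgen: "ev (fgen a) = T a"
  by (simp add: fgen_def ev_single word_ev_def letter_ev_def T_closed smult_one)

lemma ev_add: "ev (x + y) = ev x \<oplus> ev y"
proof -
  let ?K = "Poly_Mapping.keys x \<union> Poly_Mapping.keys y"
  have "ev (x + y) = (\<Oplus>w\<in>?K. Poly_Mapping.lookup x w \<odot> word_ev w \<oplus> Poly_Mapping.lookup y w \<odot> word_ev w)"
    using keys_add[of x y]
    by (subst ev_superset[of ?K]) (auto simp: lookup_add smult_add_left word_ev_closed)
  also have "\<dots> = (\<Oplus>w\<in>?K. Poly_Mapping.lookup x w \<odot> word_ev w) \<oplus> (\<Oplus>w\<in>?K. Poly_Mapping.lookup y w \<odot> word_ev w)"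
    by (rule finsum_addf) (auto simp: smult_closed word_ev_closed)
  also have "\<dots> = ev x \<oplus> ev y"
    by (simp add: ev_superset[of ?K])
  finally show ?thesis .
qed

lemma ev_fscale: "ev (fscale c x) = c \<odot> ev x"
proof (induction x rule: free_induct)
  case (single w d)
  show ?case by (simp add: fscale_def mult_single ev_single smult_smult word_ev_closed)
qed (auto simp: ev_add smult_add_right ev_closed ev_zero smult_zero_right fscale_def distrib_left)

lemma ev_mult: "ev (x * y) = ev x \<otimes> ev y"
proof (induction x rule: free_induct)
  case (single w c)
  show ?case
  proof (induction y rule: free_induct)
    case (single v d)
    show ?case
      by (simp add: mult_single ev_single word_ev_plus word_ev_closed smult_closed
          smult_mult_left smult_mult_right smult_smult mult.commute)
  qed (auto simp: distrib_left ev_add r_distr ev_closed ev_zero)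
qed (auto simp: distrib_right ev_add l_distr ev_closed ev_zero)

lemma ev_fstar: "ev (fstar x) = adj \<AA> (ev x)"
proof (induction x rule: free_induct)
  case (single w d)
  show ?case by (simp add: fstar_single ev_single word_ev_adj adj_smult word_ev_closed)
qed (auto simp: fstar_add ev_add adj_add ev_closed ev_zero adj_zero)

lemma ev_minus: "ev (- x) = \<ominus> ev x"
  using ev_fscale[of "-1" x] by (simp add: fscale_minus_one smult_minus_one ev_closed)

lemma ev_diff: "ev (x - y) = ev x \<ominus> ev y"
  using ev_add[of x "- y"] by (simp add: ev_minus a_minus_def)

lemma ev_sum: "finite K \<Longrightarrow> ev (sum f K) = (\<Oplus>i\<in>K. ev (f i))"
  by (induction K rule: finite_induct) (auto simp: ev_zero ev_add ev_closed)

lemma ev_seminorm: "cstar_seminorm H (\<lambda>x. cnorm \<AA> (ev x))"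
  unfolding cstar_seminorm_def
  by (auto simp: ev_fscale ev_mult ev_fstar ev_add ev_closed cnorm_nonneg cnorm_smult cstar_identity
      cnorm_add cnorm_mult)

end

locale universal_evaluation = universal_cstar_presentation G R + free_evaluation \<AA> T
  for G :: "'e set" and R and \<AA> :: "'a cstar" (structure) and T :: "'e \<Rightarrow> 'a" +
  assumes ev_rel: "r \<in> R \<Longrightarrow> ev r = \<zero>"
begin

lemma ev_le: "x \<in> F \<Longrightarrow> cnorm \<AA> (ev x) \<le> N x"
  by (rule N_upper[where p = "\<lambda>x. cnorm \<AA> (ev x)"])
     (auto simp: admissible_seminorms_def ev_seminorm ev_rel cnorm_zero)

definition Ev :: "(nat \<Rightarrow> 'e free) set \<Rightarrow> 'a" where
  "Ev X = (THE y. \<exists>x\<in>X. conv (\<lambda>n. ev (x n)) y)"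

lemma Ev_conv: assumes x: "x \<in> carrier C" shows "conv (\<lambda>n. ev (x n)) (Ev (cl x))"
proof -
  have "\<exists>y. conv (\<lambda>n. ev (x n)) y"
  proof (rule conv_cauchy)
    fix e :: real assume "e > 0"
    then obtain M where M: "\<And>m n. m \<ge> M \<Longrightarrow> n \<ge> M \<Longrightarrow> N (x m - x n) < e"
      using x unfolding C_iff by blast
    have "cnorm \<AA> (ev (x m) \<ominus> ev (x n)) < e" if "m \<ge> M" "n \<ge> M" for m n
      using M[OF that] ev_le[of "x m - x n"] C_F[OF x] by (simp add: ev_diff free_diff)
    then show "\<exists>M. \<forall>m\<ge>M. \<forall>n\<ge>M. cnorm \<AA> (ev (x m) \<ominus> ev (x n)) < e" by blast
  qed (rule ev_closed)
  then obtain y where y: "conv (\<lambda>n. ev (x n)) y" by blast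
  have "conv (\<lambda>n. ev (z n)) y" if z: "z \<in> cl x" for z
  proof -
    have zC: "z \<in> carrier C" and "cl z = cl x" using cl_memD[OF z x] by auto
    then have *: "(\<lambda>n. N (z n - x n)) \<longlonglongrightarrow> 0" using cl_eq_iff x by blast
    show ?thesis
    proof (rule conv_le[OF ev_closed])
      show "y \<in> carrier \<AA>" using y by (simp add: conv_def)
      show "(\<lambda>n. N (z n - x n) + cnorm \<AA> (ev (x n) \<ominus> y)) \<longlonglongrightarrow> 0"
        using tendsto_add[OF *, of "\<lambda>n. cnorm \<AA> (ev (x n) \<ominus> y)" 0] y by (simp add: conv_def)
      fix n
      have "cnorm \<AA> (ev (z n) \<ominus> y) \<le> cnorm \<AA> (ev (z n) \<ominus> ev (x n)) + cnorm \<AA> (ev (x n) \<ominus> y)"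
        by (rule cnorm_diff_triangle) (use y in \<open>auto simp: conv_def ev_closed\<close>)
      then show "cnorm \<AA> (ev (z n) \<ominus> y) \<le> N (z n - x n) + cnorm \<AA> (ev (x n) \<ominus> y)"
        using ev_le[of "z n - x n"] C_F[OF x] C_F[OF zC] by (simp add: ev_diff free_diff)
    qed
  qed
  then have "Ev (cl x) = y"
    unfolding Ev_def using y conv_unique cl_self[OF x] by (intro the_equality) blast+
  then show ?thesis using y by simp
qed

lemma Ev_eq: "x \<in> carrier C \<Longrightarrow> conv (\<lambda>n. ev (x n)) y \<Longrightarrow> Ev (cl x) = y"
  using Ev_conv conv_unique by blast

lemma Ev_gen: "a \<in> G \<Longrightarrow> Ev (univ_gen G R a) = T a"
  unfolding univ_gen_def
  by (rule Ev_eq) (simp_all add: C_const free_fgen ev_fgen conv_const T_closed)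

lemma Ev_hom: "Ev \<in> star_hom U \<AA>"
  unfolding star_hom_def
proof (intro CollectI conjI ballI allI)
  show "Ev \<in> Ring.ring_hom U \<AA>"
  proof (rule ring_hom_memI)
    show "Ev \<one>\<^bsub>U\<^esub> = \<one>"
      unfolding cl_one by (rule Ev_eq) (simp_all add: C_const ev_one conv_const)
    fix X assume "X \<in> carrier U"
    then obtain x where x: "x \<in> carrier C" "X = cl x" unfolding U_carrier by blast
    show "Ev X \<in> carrier \<AA>" using Ev_conv[OF x(1)] unfolding x(2) by (simp add: conv_def)
    fix Y assume "Y \<in> carrier U"
    then obtain y where y: "y \<in> carrier C" "Y = cl y" unfolding U_carrier by blast
    show "Ev (X \<oplus>\<^bsub>U\<^esub> Y) = Ev X \<oplus> Ev Y"
      unfolding x(2) y(2) cl_add[OF x(1) y(1)]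
      by (rule Ev_eq[OF C_add[OF x(1) y(1)]]) (simp add: ev_add conv_add Ev_conv x(1) y(1))
    show "Ev (X \<otimes>\<^bsub>U\<^esub> Y) = Ev X \<otimes> Ev Y"
      unfolding x(2) y(2) cl_mult[OF x(1) y(1)]
      by (rule Ev_eq[OF C_mult[OF x(1) y(1)]]) (simp add: ev_mult conv_mult Ev_conv x(1) y(1))
  qed
  fix X c assume "X \<in> carrier U"
  then obtain x where x: "x \<in> carrier C" "X = cl x" unfolding U_carrier by blast
  show "Ev (c \<odot>\<^bsub>U\<^esub> X) = c \<odot> Ev X"
    unfolding x(2) cl_smult[OF x(1)]
    by (rule Ev_eq[OF C_fscale[OF x(1)]]) (simp add: ev_fscale conv_smult Ev_conv x(1))
  show "Ev (adj U X) = adj \<AA> (Ev X)"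
    unfolding x(2) cl_adj[OF x(1)]
    by (rule Ev_eq[OF C_fstar[OF x(1)]]) (simp add: ev_fstar conv_adj Ev_conv x(1))
qed

end

lemma finite_edges: "finite (edges A)"
proof (rule finite_subset)
  define K where "K = Max (insert 0 ((\<lambda>(i, j). A $$ (i, j)) ` ({..<dim_row A} \<times> {..<dim_col A})))"
  have "A $$ (i, j) \<le> K" if "i < dim_row A" "j < dim_col A" for i j
    unfolding K_def by (rule Max_ge) (use that in \<open>auto intro!: image_eqI[of _ _ "(i, j)"]\<close>)
  then show "edges A \<subseteq> {..<dim_row A} \<times> {..<dim_col A} \<times> {..<K}"
    by (fastforce simp: edges_def)
qed auto

abbreviation ck_phase :: "real \<Rightarrow> complex" where
  "ck_phase t \<equiv> exp (2 * of_real pi * \<i> * of_real t)"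

lemma phase_cnj: "ck_phase t * cnj (ck_phase t) = 1" "cnj (ck_phase t) * ck_phase t = 1"
  by (simp_all add: exp_cnj flip: exp_add)

lemma ck_relationsI:
  "a \<in> edges A \<Longrightarrow> fgen a * fstar (fgen a) * fgen a - fgen a \<in> ck_relations A"
  "(\<Sum>a\<in>edges A. fgen a * fstar (fgen a)) - 1 \<in> ck_relations A"
  "a \<in> edges A \<Longrightarrow> fstar (fgen a) * fgen a -
     (\<Sum>b\<in>{b \<in> edges A. source b = target a}. fgen b * fstar (fgen b)) \<in> ck_relations A"
  unfolding ck_relations_def by blast+

lemma admissible_fgen_le_one:
  assumes a: "a \<in> edges A" and "p \<in> admissible_seminorms (edges A) (ck_relations A)"
  shows "p (fgen a) \<le> 1"
proof -
  have p: "cstar_seminorm (edges A) p"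
    and "p (fgen a * fstar (fgen a) * fgen a - fgen a) = 0"
    using assms ck_relationsI(1)[OF a] by (auto simp: admissible_seminorms_def)
  define s where "s = fgen a"
  have s: "s \<in> free_star_algebra (edges A)" using a by (simp add: s_def free_fgen)
  have rel: "p (s * fstar s * s - s) = 0" unfolding s_def by fact
  have hF: "fstar s * s \<in> free_star_algebra (edges A)" and rF: "s * fstar s * s - s \<in> free_star_algebra (edges A)"
    by (intro free_mult free_fstar free_diff s)+
  have "fstar (fstar s * s) * (fstar s * s) - fstar s * s = fstar s * (s * fstar s * s - s)"
    by (simp add: fstar_mult algebra_simps)
  also have "p \<dots> \<le> p (fstar s) * p (s * fstar s * s - s)"
    by (rule cstar_seminormD(5)[OF p free_fstar[OF s] rF])
  finally have "p (fstar (fstar s * s) * (fstar s * s) - fstar s * s) \<le> 0" using rel by simp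
  then have "p (fstar (fstar s * s) * (fstar s * s)) = p (fstar s * s)"
    using cstar_seminorm_abs_diff[OF p free_mult[OF free_fstar[OF hF] hF] hF] by simp
  then have "(p (fstar s * s))\<^sup>2 = p (fstar s * s)"
    using cstar_seminormD(3)[OF p hF] by simp
  then have "p (fstar s * s) * (p (fstar s * s) - 1) = 0"
    by (simp add: power2_eq_square algebra_simps)
  then have "(p s)\<^sup>2 \<le> 1\<^sup>2" using cstar_seminormD(3)[OF p s] by auto
  then show "p (fgen a) \<le> 1" unfolding s_def by (rule power2_le_imp_le) simp
qed

lemma ck_presentation: "universal_cstar_presentation (edges A) (ck_relations A)"
proof
  show "ck_relations A \<subseteq> free_star_algebra (edges A)"
    by (auto simp: ck_relations_def intro!: free_diff free_mult free_sum free_fstar free_fgen)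
  fix x assume "x \<in> free_star_algebra (edges A)"
  then have "\<exists>B. \<forall>p\<in>admissible_seminorms (edges A) (ck_relations A). p x \<le> B"
  proof (induction x rule: free_star_algebra_induct)
    case zero
    show ?case by (rule exI[of _ 0]) (auto simp: admissible_seminorms_def cstar_seminorm_zero)
  next
    case one
    show ?case by (rule exI[of _ 1]) (auto simp: admissible_seminorms_def cstar_seminorm_one)
  next
    case (gen a)
    then show ?case using admissible_fgen_le_one by blast
  next
    case (star_gen a)
    have "p (fstar (fgen a)) \<le> 1" if "p \<in> admissible_seminorms (edges A) (ck_relations A)" for p
    proof -
      have "cstar_seminorm (edges A) p" using that by (simp add: admissible_seminorms_def)
      then have "p (fstar (fgen a)) = p (fgen a)"
        by (rule cstar_seminorm_fstar[OF _ free_fgen[OF star_gen]])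
      then show ?thesis using admissible_fgen_le_one[OF star_gen that] by simp
    qed
    then show ?case by blast
  next
    case (add x y)
    then obtain B1 B2 where "\<forall>p\<in>admissible_seminorms (edges A) (ck_relations A). p x \<le> B1"
      "\<forall>p\<in>admissible_seminorms (edges A) (ck_relations A). p y \<le> B2" by blast
    then show ?case
      using add.hyps cstar_seminormD(4)
      by (intro exI[of _ "B1 + B2"]) (force simp: admissible_seminorms_def)
  next
    case (mult x y)
    then obtain B1 B2 where B1: "\<And>p. p\<in>admissible_seminorms (edges A) (ck_relations A) \<Longrightarrow> p x \<le> B1"
      and B2: "\<And>p. p\<in>admissible_seminorms (edges A) (ck_relations A) \<Longrightarrow> p y \<le> B2" by blast
    show ?case
    proof (intro exI[of _ "\<bar>B1\<bar> * \<bar>B2\<bar>"] ballI)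
      fix p assume p: "p \<in> admissible_seminorms (edges A) (ck_relations A)"
      then have "cstar_seminorm (edges A) p" by (simp add: admissible_seminorms_def)
      note D = cstar_seminormD[OF this]
      have "p (x * y) \<le> p x * p y" by (rule D) fact+
      also have "\<dots> \<le> \<bar>B1\<bar> * \<bar>B2\<bar>"
        using B1[OF p] B2[OF p] D(1)[of x] D(1)[of y] mult.hyps by (intro mult_mono) auto
      finally show "p (x * y) \<le> \<bar>B1\<bar> * \<bar>B2\<bar>" .
    qed
  next
    case (scale c x)
    then obtain B1 where "\<forall>p\<in>admissible_seminorms (edges A) (ck_relations A). p x \<le> B1" by blast
    then have "p (fscale c x) \<le> cmod c * B1" if "p \<in> admissible_seminorms (edges A) (ck_relations A)" for p
    proof -
      have "cstar_seminorm (edges A) p" using that by (simp add: admissible_seminorms_def)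
      then have "p (fscale c x) = cmod c * p x" by (rule cstar_seminormD(2)) fact
      then show ?thesis using \<open>\<forall>p\<in>_. p x \<le> B1\<close> that by (simp add: mult_left_mono)
    qed
    then show ?case by blast
  qed
  then show "bdd_above ((\<lambda>p. p x) ` admissible_seminorms (edges A) (ck_relations A))"
    by (auto simp: bdd_above_def)
qed

context universal_cstar_presentation
begin

lemma iota_closed: "x \<in> F \<Longrightarrow> \<iota> x \<in> carrier U"
  by (simp add: cl_closed C_const)

lemma iota_mult: "x \<in> F \<Longrightarrow> y \<in> F \<Longrightarrow> \<iota> (x * y) = \<iota> x \<otimes>\<^bsub>U\<^esub> \<iota> y"
  by (simp add: cl_mult C_const)

lemma iota_add: "x \<in> F \<Longrightarrow> y \<in> F \<Longrightarrow> \<iota> (x + y) = \<iota> x \<oplus>\<^bsub>U\<^esub> \<iota> y"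
  by (simp add: cl_add C_const)

lemma iota_adj: "x \<in> F \<Longrightarrow> \<iota> (fstar x) = adj U (\<iota> x)"
  by (simp add: cl_adj C_const)

lemma iota_fscale: "x \<in> F \<Longrightarrow> \<iota> (fscale c x) = c \<odot>\<^bsub>U\<^esub> \<iota> x"
  by (simp add: cl_smult C_const)

lemma iota_sum: "finite K \<Longrightarrow> (\<And>i. i \<in> K \<Longrightarrow> f i \<in> F) \<Longrightarrow> \<iota> (sum f K) = (\<Oplus>\<^bsub>U\<^esub>i\<in>K. \<iota> (f i))"
proof (induction K rule: finite_induct)
  case (insert a K)
  then show ?case
    by (simp add: iota_add free_sum) (subst U.finsum_insert, auto simp: iota_closed)
qed (simp add: cl_zero)

lemma iota_eq: "x \<in> F \<Longrightarrow> y \<in> F \<Longrightarrow> x - y \<in> R \<Longrightarrow> \<iota> x = \<iota> y"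
  by (simp add: cl_eq_iff C_const N_rel)

end

theorem cuntz_krieger_algebra_is_cstar_algebra: "cstar_algebra (cuntz_krieger_algebra A)"
proof -
  interpret universal_cstar_presentation "edges A" "ck_relations A" by (rule ck_presentation)
  show ?thesis unfolding cuntz_krieger_algebra_def by (rule universal_cstar_is_cstar_algebra)
qed

theorem cuntz_krieger_algebra_family:
  "cuntz_krieger_family A (cuntz_krieger_algebra A) (ck_gen A)"
proof -
  interpret universal_cstar_presentation "edges A" "ck_relations A" by (rule ck_presentation)
  have S: "ck_gen A a = \<iota> (fgen a)" for a by (simp add: ck_gen_def univ_gen_def)
  have P: "\<iota> (fgen b) \<otimes>\<^bsub>U\<^esub> adj U (\<iota> (fgen b)) = \<iota> (fgen b * fstar (fgen b))" if "b \<in> edges A" for b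
    using that by (simp add: iota_mult iota_adj free_fgen free_fstar)
  have sumP: "(\<Oplus>\<^bsub>U\<^esub>b\<in>K. \<iota> (fgen b) \<otimes>\<^bsub>U\<^esub> adj U (\<iota> (fgen b))) = \<iota> (\<Sum>b\<in>K. fgen b * fstar (fgen b))"
    if K: "K \<subseteq> edges A" for K
  proof -
    have "(\<Oplus>\<^bsub>U\<^esub>b\<in>K. \<iota> (fgen b) \<otimes>\<^bsub>U\<^esub> adj U (\<iota> (fgen b))) = (\<Oplus>\<^bsub>U\<^esub>b\<in>K. \<iota> (fgen b * fstar (fgen b)))"
      using K by (intro U.finsum_cong') (auto simp: P intro!: iota_closed free_mult free_fstar free_fgen)
    also have "\<dots> = \<iota> (\<Sum>b\<in>K. fgen b * fstar (fgen b))"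
      using K finite_subset[OF K finite_edges] by (subst iota_sum) (auto intro!: free_mult free_fstar free_fgen)
    finally show ?thesis .
  qed
  show ?thesis
    unfolding cuntz_krieger_family_def cuntz_krieger_algebra_def S
  proof (intro conjI ballI)
    show "(\<lambda>a. \<iota> (fgen a)) ` edges A \<subseteq> carrier U"
      by (auto intro!: iota_closed free_fgen)
    show "(\<Oplus>\<^bsub>U\<^esub>b\<in>edges A. \<iota> (fgen b) \<otimes>\<^bsub>U\<^esub> adj U (\<iota> (fgen b))) = \<one>\<^bsub>U\<^esub>"
      unfolding sumP[OF subset_refl] cl_one
      by (rule iota_eq) (auto intro!: ck_relationsI free_sum free_mult free_fstar free_fgen)
    fix a assume a: "a \<in> edges A"
    have F: "fgen a \<in> F" "fstar (fgen a) \<in> F" "fgen a * fstar (fgen a) \<in> F"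
      using a by (auto intro!: free_mult free_fstar free_fgen)
    show "\<iota> (fgen a) \<otimes>\<^bsub>U\<^esub> adj U (\<iota> (fgen a)) \<otimes>\<^bsub>U\<^esub> \<iota> (fgen a) = \<iota> (fgen a)"
      unfolding P[OF a] iota_mult[OF F(3,1), symmetric]
      by (rule iota_eq) (use a F in \<open>auto intro!: ck_relationsI free_mult\<close>)
    show "adj U (\<iota> (fgen a)) \<otimes>\<^bsub>U\<^esub> \<iota> (fgen a) =
       (\<Oplus>\<^bsub>U\<^esub>b\<in>{b \<in> edges A. source b = target a}. \<iota> (fgen b) \<otimes>\<^bsub>U\<^esub> adj U (\<iota> (fgen b)))"
      unfolding sumP[OF Collect_restrict] iota_adj[OF F(1), symmetric] iota_mult[OF F(2,1), symmetric]
      by (rule iota_eq)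
        (use a F in \<open>auto intro!: ck_relationsI free_sum free_mult free_fstar free_fgen\<close>)
  qed
qed

theorem cuntz_krieger_algebra_generated:
  "generated_cstar_subalgebra (cuntz_krieger_algebra A) (ck_gen A ` edges A) =
     carrier (cuntz_krieger_algebra A)"
proof -
  interpret universal_cstar_presentation "edges A" "ck_relations A" by (rule ck_presentation)
  have "\<one>\<^bsub>U\<^esub> \<in> D" if D: "cstar_subalgebra U D" and gen: "ck_gen A ` edges A \<subseteq> D" for D
  proof -
    have cl: "\<zero>\<^bsub>U\<^esub> \<in> D" "D \<subseteq> carrier U" "\<And>x y. x \<in> D \<Longrightarrow> y \<in> D \<Longrightarrow> x \<oplus>\<^bsub>U\<^esub> y \<in> D"
      "\<And>x y. x \<in> D \<Longrightarrow> y \<in> D \<Longrightarrow> x \<otimes>\<^bsub>U\<^esub> y \<in> D" "\<And>x. x \<in> D \<Longrightarrow> adj U x \<in> D"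
      using D unfolding cstar_subalgebra_def by blast+
    have mem: "ck_gen A a \<otimes>\<^bsub>U\<^esub> adj U (ck_gen A a) \<in> D" if "a \<in> edges A" for a
      using gen that by (intro cl) blast+
    have "(\<Oplus>\<^bsub>U\<^esub>a\<in>K. ck_gen A a \<otimes>\<^bsub>U\<^esub> adj U (ck_gen A a)) \<in> D" if "finite K" "K \<subseteq> edges A" for K
      using that
    proof (induction K rule: finite_induct)
      case (insert a K)
      then have "(\<Oplus>\<^bsub>U\<^esub>b\<in>insert a K. ck_gen A b \<otimes>\<^bsub>U\<^esub> adj U (ck_gen A b)) =
         ck_gen A a \<otimes>\<^bsub>U\<^esub> adj U (ck_gen A a) \<oplus>\<^bsub>U\<^esub> (\<Oplus>\<^bsub>U\<^esub>b\<in>K. ck_gen A b \<otimes>\<^bsub>U\<^esub> adj U (ck_gen A b))"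
        using insert.hyps insert.prems by (intro U.finsum_insert) (auto intro!: mem cl(2)[THEN subsetD])
      then show ?case using insert mem cl(3) by auto
    qed (simp add: cl)
    from this[OF finite_edges subset_refl] show ?thesis
      using cuntz_krieger_algebra_family[of A] by (simp add: cuntz_krieger_family_def cuntz_krieger_algebra_def)
  qed
  then have "{D. cstar_subalgebra U D \<and> ck_gen A ` edges A \<subseteq> D} =
     {D. cstar_subalgebra U D \<and> insert \<one>\<^bsub>U\<^esub> (ck_gen A ` edges A) \<subseteq> D}" by blast
  then show ?thesis
    using universal_cstar_generated
    by (simp add: generated_cstar_subalgebra_def cuntz_krieger_algebra_def ck_gen_def[abs_def])
qed

theorem cuntz_krieger_algebra_universal:
  fixes \<BB> :: "'b cstar"
  assumes "cstar_algebra \<BB>" and T: "cuntz_krieger_family A \<BB> T"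
  shows "\<exists>\<Phi>\<in>star_hom (cuntz_krieger_algebra A) \<BB>. \<forall>a\<in>edges A. \<Phi> (ck_gen A a) = T a"
proof -
  interpret B: cstar_algebra \<BB> by fact
  define T' where "T' a = (if a \<in> edges A then T a else \<zero>\<^bsub>\<BB>\<^esub>)" for a
  interpret universal_cstar_presentation "edges A" "ck_relations A" by (rule ck_presentation)
  interpret free_evaluation \<BB> T'
    by standard (use T in \<open>auto simp: T'_def cuntz_krieger_family_def\<close>)
  have P: "ev (fgen b * fstar (fgen b)) = T b \<otimes>\<^bsub>\<BB>\<^esub> adj \<BB> (T b)" if "b \<in> edges A" for b
    using that by (simp add: ev_mult ev_fstar ev_fgen T'_def)
  have TB: "T b \<in> carrier \<BB>" if "b \<in> edges A" for b using T that by (auto simp: cuntz_krieger_family_def)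
  have sumP: "ev (\<Sum>b\<in>K. fgen b * fstar (fgen b)) = (\<Oplus>\<^bsub>\<BB>\<^esub>b\<in>K. T b \<otimes>\<^bsub>\<BB>\<^esub> adj \<BB> (T b))"
    if K: "K \<subseteq> edges A" for K
  proof -
    have "ev (\<Sum>b\<in>K. fgen b * fstar (fgen b)) = (\<Oplus>\<^bsub>\<BB>\<^esub>b\<in>K. ev (fgen b * fstar (fgen b)))"
      by (rule ev_sum[OF finite_subset[OF K finite_edges]])
    also have "\<dots> = (\<Oplus>\<^bsub>\<BB>\<^esub>b\<in>K. T b \<otimes>\<^bsub>\<BB>\<^esub> adj \<BB> (T b))"
      using K by (intro B.finsum_cong') (auto simp: P TB B.adj_closed)
    finally show ?thesis .
  qed
  have zero: "x \<ominus>\<^bsub>\<BB>\<^esub> x = \<zero>\<^bsub>\<BB>\<^esub>" if "x \<in> carrier \<BB>" for x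
    using that by (simp add: a_minus_def B.r_neg)
  interpret universal_evaluation "edges A" "ck_relations A" \<BB> T'
  proof
    fix r assume "r \<in> ck_relations A"
    then consider (a) a where "a \<in> edges A" "r = fgen a * fstar (fgen a) * fgen a - fgen a"
      | (b) "r = (\<Sum>a\<in>edges A. fgen a * fstar (fgen a)) - 1"
      | (c) a where "a \<in> edges A" "r = fstar (fgen a) * fgen a -
        (\<Sum>b\<in>{b \<in> edges A. source b = target a}. fgen b * fstar (fgen b))"
      unfolding ck_relations_def by blast
    then show "ev r = \<zero>\<^bsub>\<BB>\<^esub>"
    proof cases
      case a
      have "ev r = T a \<otimes>\<^bsub>\<BB>\<^esub> adj \<BB> (T a) \<otimes>\<^bsub>\<BB>\<^esub> T a \<ominus>\<^bsub>\<BB>\<^esub> T a"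
        unfolding a(2) using a(1) by (simp add: ev_diff ev_mult ev_fstar ev_fgen T'_def)
      then show ?thesis using T a(1) TB zero by (simp add: cuntz_krieger_family_def)
    next
      case b
      then show ?thesis
        using T by (simp add: ev_diff sumP ev_one cuntz_krieger_family_def zero)
    next
      case c
      have "ev r = adj \<BB> (T a) \<otimes>\<^bsub>\<BB>\<^esub> T a \<ominus>\<^bsub>\<BB>\<^esub>
         (\<Oplus>\<^bsub>\<BB>\<^esub>b\<in>{b \<in> edges A. source b = target a}. T b \<otimes>\<^bsub>\<BB>\<^esub> adj \<BB> (T b))"
        unfolding c(2) ev_diff sumP[OF Collect_restrict]
        using c(1) by (simp add: ev_mult ev_fstar ev_fgen T'_def)
      also have "\<dots> = adj \<BB> (T a) \<otimes>\<^bsub>\<BB>\<^esub> T a \<ominus>\<^bsub>\<BB>\<^esub> adj \<BB> (T a) \<otimes>\<^bsub>\<BB>\<^esub> T a"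
        using T c(1) by (simp add: cuntz_krieger_family_def)
      also have "\<dots> = \<zero>\<^bsub>\<BB>\<^esub>" using TB[OF c(1)] by (intro zero) (auto simp: B.adj_closed)
      finally show ?thesis .
    qed
  qed
  show ?thesis
    unfolding cuntz_krieger_algebra_def ck_gen_def
    by (rule bexI[OF _ Ev_hom]) (simp add: Ev_gen T'_def)
qed

theorem ck_gauge_automorphism:
  "ck_gauge A t \<in> star_iso (cuntz_krieger_algebra A) (cuntz_krieger_algebra A)"
  and ck_gauge_ck_gen: "a \<in> edges A \<Longrightarrow> ck_gauge A t (ck_gen A a) =
     exp (2 * of_real pi * \<i> * of_real t) \<odot>\<^bsub>cuntz_krieger_algebra A\<^esub> ck_gen A a"
proof -
  interpret universal_cstar_presentation "edges A" "ck_relations A" by (rule ck_presentation)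
  have proj: "fgauge t (fgen b * fstar (fgen b)) = fgen b * fstar (fgen b)"
      "fgauge t (fstar (fgen b) * fgen b) = fstar (fgen b) * fgen b" for t and b :: edge
    by (simp_all add: fgauge_mult fgauge_fstar fgauge_fgen fstar_fscale fscale_mult_left fscale_mult_right
        fscale_fscale phase_cnj)
  have rel: "p (fgauge t r) = 0" if p: "p \<in> admissible_seminorms (edges A) (ck_relations A)"
    and r: "r \<in> ck_relations A" for p r t
  proof -
    have p0: "p r = 0" using p r by (simp add: admissible_seminorms_def)
    have rF: "r \<in> F" using r rel_sub by blast
    from r consider (a) a where "a \<in> edges A" "r = fgen a * fstar (fgen a) * fgen a - fgen a"
      | (b) "r = (\<Sum>a\<in>edges A. fgen a * fstar (fgen a)) - 1"
      | (c) a where "a \<in> edges A" "r = fstar (fgen a) * fgen a -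
        (\<Sum>b\<in>{b \<in> edges A. source b = target a}. fgen b * fstar (fgen b))"
      unfolding ck_relations_def by blast
    then show ?thesis
    proof cases
      case a
      have "fgauge t r = fscale (ck_phase t) r"
        unfolding a(2) fgauge_diff fgauge_mult[of t "fgen a * fstar (fgen a)"] proj
        by (simp add: fgauge_fgen fscale_mult_right fscale_diff)
      then show ?thesis using p0 cstar_seminormD(2)[OF admD[OF p] rF] by simp
    next
      case b
      then show ?thesis using p0 by (simp add: fgauge_diff fgauge_sum proj)
    next
      case c
      then show ?thesis using p0 by (simp add: fgauge_diff fgauge_sum proj)
    qed
  qed
  have le: "N (fgauge t x) \<le> N x" if x: "x \<in> F" for t x
  proof (rule N_least)
    fix p assume p: "p \<in> admissible_seminorms (edges A) (ck_relations A)"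
    have "cstar_seminorm (edges A) (\<lambda>x. p (fgauge t x))"
      using cstar_seminormD[OF admD[OF p] free_fgauge]
      unfolding cstar_seminorm_def
      by (simp add: fgauge_fscale fgauge_add fgauge_mult fgauge_fstar free_fgauge)
    then have "(\<lambda>x. p (fgauge t x)) \<in> admissible_seminorms (edges A) (ck_relations A)"
      using rel[OF p] by (simp add: admissible_seminorms_def)
    from N_upper[OF x this] show "p (fgauge t x) \<le> N x" .
  qed
  have eq: "N (fgauge t x) = N x" if x: "x \<in> F" for t x
    using le[OF x, of t] le[OF free_fgauge[OF x], of "- t" t] by (simp add: fgauge_fgauge)
  have CI: "(\<lambda>n. fgauge t (x n)) \<in> carrier C" if x: "x \<in> carrier C" for t x
    by (rule C_I[OF _ _ x x, where B = 1])
       (use eq C_F[OF x] in \<open>auto simp: free_fgauge free_diff N_simps(1) simp flip: fgauge_diff\<close>)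
  have gauge: "ck_gauge A t (cl x) = cl (\<lambda>n. fgauge t (x n))" if x: "x \<in> carrier C" for t x
    unfolding ck_gauge_def
    by (rule cl_lift[OF x CI, where B = 1])
       (auto simp: eq free_diff free_fgauge simp flip: fgauge_diff)
  have inv: "ck_gauge A (- t) (ck_gauge A t X) = X \<and> ck_gauge A t (ck_gauge A (- t) X) = X"
    if "X \<in> carrier U" for X
    using that unfolding U_carrier by (auto simp: gauge CI fgauge_fgauge)
  have closed: "ck_gauge A t X \<in> carrier U" if "X \<in> carrier U" for X t
    using that unfolding U_carrier by (auto simp: gauge CI)
  have "bij_betw (ck_gauge A t) (carrier U) (carrier U)"
    by (rule bij_betw_byWitness[where f' = "ck_gauge A (- t)"]) (use inv closed in auto)
  moreover have "ck_gauge A t \<in> star_hom U U"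
    unfolding star_hom_def
  proof (intro CollectI conjI ballI allI)
    show "ck_gauge A t \<in> Ring.ring_hom U U"
    proof (rule ring_hom_memI)
      show "ck_gauge A t \<one>\<^bsub>U\<^esub> = \<one>\<^bsub>U\<^esub>" by (simp add: cl_one gauge C_const)
      fix X Y assume "X \<in> carrier U" "Y \<in> carrier U"
      then obtain x y where x: "x \<in> carrier C" "X = cl x" and y: "y \<in> carrier C" "Y = cl y"
        unfolding U_carrier by blast
      show "ck_gauge A t (X \<oplus>\<^bsub>U\<^esub> Y) = ck_gauge A t X \<oplus>\<^bsub>U\<^esub> ck_gauge A t Y"
        unfolding x(2) y(2) using x(1) y(1) by (simp add: cl_add gauge CI C_add fgauge_add)
      show "ck_gauge A t (X \<otimes>\<^bsub>U\<^esub> Y) = ck_gauge A t X \<otimes>\<^bsub>U\<^esub> ck_gauge A t Y"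
        unfolding x(2) y(2) using x(1) y(1) by (simp add: cl_mult gauge CI C_mult fgauge_mult)
    qed (rule closed)
    fix X c assume "X \<in> carrier U"
    then obtain x where x: "x \<in> carrier C" "X = cl x" unfolding U_carrier by blast
    show "ck_gauge A t (c \<odot>\<^bsub>U\<^esub> X) = c \<odot>\<^bsub>U\<^esub> ck_gauge A t X"
      unfolding x(2) using x(1) by (simp add: cl_smult gauge CI C_fscale fgauge_fscale)
    show "ck_gauge A t (adj U X) = adj U (ck_gauge A t X)"
      unfolding x(2) using x(1) by (simp add: cl_adj gauge CI C_fstar fgauge_fstar)
  qed
  ultimately show "ck_gauge A t \<in> star_iso (cuntz_krieger_algebra A) (cuntz_krieger_algebra A)"
    by (simp add: star_iso_def cuntz_krieger_algebra_def)
  show "ck_gauge A t (ck_gen A a) =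
     exp (2 * of_real pi * \<i> * of_real t) \<odot>\<^bsub>cuntz_krieger_algebra A\<^esub> ck_gen A a" if "a \<in> edges A"
    using that
    by (simp add: ck_gen_def univ_gen_def cuntz_krieger_algebra_def gauge C_const free_fgen fgauge_fgen cl_smult)
qed

end

theory Submission
  imports Defs
begin

text \<open>
  Composed with a power of the shift, a conjugacy \<open>y = H x\<close> has \<open>y\<^sub>0\<close> depending only on \<open>x\<^sub>0, \<dots>, x\<^sub>N\<close> and
  \<open>x\<^sub>0\<close> depending only on \<open>y\<^sub>-\<^sub>N, \<dots>, y\<^sub>0\<close>.  Let \<open>C\<close> be the graph of the words \<open>(x\<^sub>i, y\<^sub>i)\<close>, \<open>0 \<le> i < N\<close>, of the
  joint sequence.  The state of the joint sequence is a function of the future of \<open>x\<close>, so that the triplet of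
  \<open>C\<close> is that of \<open>A\<close>: a generator \<open>S\<^sub>a\<close> is the sum of the \<open>S\<^sub>e\<close> with label \<open>a\<close>, and \<open>S\<^sub>e\<close> is \<open>S\<^sub>a\<close> times a
  projection of the diagonal.  Reversing time, the triplets of the transposes of \<open>B\<close> and \<open>C\<close> are isomorphic, and
  \<open>A, C, B\<close> is a chain as required.

  Conversely, an isomorphism \<open>\<Phi>\<close> of triplets maps the projections of one diagonal, that is, the clopen sets of
  one-sided paths, to those of the other and thus has a dual bijection \<open>h\<close> of one-sided paths.  By gauge averaging
  \<open>\<Phi> S\<^sub>a\<close> is close to a polynomial whose words all have degree 1.  In the representation on one-sided paths this
  forces \<open>\<sigma>\<^sup>n\<^sup>+\<^sup>1 \<circ> h = \<sigma>\<^sup>n \<circ> h \<circ> \<sigma>\<close> for some \<open>n\<close>, so \<open>\<sigma>\<^sup>n \<circ> h\<close> commutes with the shift and defines a block map of the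
  two-sided shifts, which is inverse up to a power of the shift to the one obtained from \<open>\<Phi>\<^sup>-\<^sup>1\<close>.
\<close>

section \<open>Contractions in C*-algebras\<close>

text \<open>A labelling of \<open>C\<close> by edges of \<open>A\<close> yields an isomorphism of
  triplets when it resolves against the direction of time: label and target fix an edge, and a long
  path fixes the vertex where its lifts start. After the composition with a power of the shift the
  joint sequence has this property over \<open>x\<close> in forward time and over \<open>y\<close>
  in reversed time, so one graph serves both sides. Irreducibility and branching of \<open>A\<close>
  pass to \<open>C\<close>, which makes it a legitimate member of the chain.

  For the converse, preserving the diagonal alone would give
  \<open>\<sigma>^i (h x) = \<sigma>^j (h (\<sigma> x))\<close> with arbitrary \<open>i\<close> and
  \<open>j\<close>. The gauge action forces \<open>i = j + 1\<close>, and the finitely many words of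
  the approximating polynomials bound \<open>j\<close> uniformly.

  The facts on C*-algebras rest on the C*-identity and completeness: orthogonality of projections
  with sum 1 comes from extremality of the unit, contractivity of homomorphisms from a fixed point
  equation for a square root. Lower bounds of norms come from the representation on paths, whose
  seminorm is admissible in the definition of the universal norm.\<close>

lemma cstar_seminorm_UNIV:
  assumes "cstar_seminorm UNIV p"
  shows "0 \<le> p x" "p (fscale c x) = cmod c * p x" "p (fstar x * x) = (p x)\<^sup>2"
    "p (x + y) \<le> p x + p y" "p (x * y) \<le> p x * p y" "p (fstar x) = p x" "p (x - y) \<le> p x + p y"
    "p (- x) = p x"
proof -
  have [simp]: "free_star_algebra UNIV = UNIV" by (simp add: free_star_algebra_def)
  note D = cstar_seminormD[OF assms, simplified]
  show "0 \<le> p x" "p (fscale c x) = cmod c * p x" "p (fstar x * x) = (p x)\<^sup>2"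
    "p (x + y) \<le> p x + p y" "p (x * y) \<le> p x * p y" by (rule D)+
  show "p (fstar x) = p x" using cstar_seminorm_fstar[OF assms] by simp
  show m: "p (- x) = p x" for x using D(2)[of "-1" x] by (simp add: fscale_minus_one)
  show "p (x - y) \<le> p x + p y" using D(4)[of x "- y"] m[of y] by simp
qed

lemma cstar_seminorm_sum:
  assumes "cstar_seminorm UNIV p"
  shows "p (sum f K) \<le> (\<Sum>i\<in>K. p (f i))"
proof (induction K rule: infinite_finite_induct)
  case (insert i K)
  then show ?case using cstar_seminorm_UNIV(4)[OF assms, of "f i" "sum f K"] by simp
qed (simp_all add: cstar_seminorm_zero[OF assms])

lemma fscale_double: "fscale 2 x = x + x"
  using fscale_add_left[of 1 1 x] by simp

text \<open>The unit is an extreme point of the unit ball.  From the contractions \<open>1 \<plusminus> v\<close> one builds the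
  contraction \<open>1 + 3/2 v\<close> out of products and convex combinations; iterating forces \<open>v = 0\<close>.\<close>

lemma cstar_seminorm_extreme_step:
  fixes v :: "'e free"
  assumes p: "cstar_seminorm UNIV p" and v: "fstar v = v" and 1: "p (1 + v) \<le> 1" "p (1 - v) \<le> 1"
  shows "p (1 + fscale (3/2) v) \<le> 1"
proof -
  note P = cstar_seminorm_UNIV[OF p]
  have mult: "p (x * y) \<le> 1" if "p x \<le> 1" "p y \<le> 1" for x y
    using P(5)[of x y] mult_mono[OF that] P(1) by force
  have avg: "p z \<le> 1" if "p x \<le> 1" "p y \<le> 1" "z + z = x + y" for x y z
    using P(2)[of 2 z] P(4)[of x y] that by (simp add: fscale_double)
  define u w where "u = v * v" and "w = fscale \<i> v"
  have ww: "w * w = - u"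
    by (simp add: w_def u_def fscale_mult_left fscale_mult_right fscale_fscale fscale_minus_one)
  have ws: "fstar w = - w"
    using v by (simp add: w_def fstar_fscale flip: fscale_minus_one) (simp add: fscale_fscale)
  have pu: "p (1 + u) \<le> 1"
    by (rule avg[OF mult[OF 1(1) 1(1)] mult[OF 1(2) 1(2)]]) (simp add: u_def algebra_simps)
  have mu: "p (1 - u) \<le> 1"
    using mult[OF 1] by (simp add: u_def algebra_simps)
  \<comment> \<open>Here the C*-identity enters: \<open>w\<close> is skew-adjoint, so the C*-squares
    of \<open>1 + w\<close> and \<open>1 - w\<close> are both \<open>1 - w^2 = 1 + u\<close>, which
    was just bounded.\<close>
  have "(p (1 + w))\<^sup>2 = p (1 + u)" "(p (1 - w))\<^sup>2 = p (1 + u)"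
    using P(3)[of "1 + w"] P(3)[of "1 - w"] ww
    by (simp_all add: fstar_add fstar_diff ws algebra_simps)
  then have pw: "p (1 + w) \<le> 1" "p (1 - w) \<le> 1"
    using pu P(1) by (metis power2_le_imp_le one_power2 zero_le_one)+
  have w2: "p ((1 + w) * (1 + w)) \<le> 1" "p ((1 - w) * (1 - w)) \<le> 1"
    using mult pw by blast+
  let ?six = "u + u + u + u + u + u"
  have e: "(1 + w) * (1 + w) = 1 + (w + w) - u" "(1 - w) * (1 - w) = 1 - (w + w) - u"
    using ww by (simp_all add: algebra_simps)
  have uw: "w * u = u * w" unfolding u_def w_def
    by (simp add: fscale_mult_left fscale_mult_right mult.assoc)
  \<comment> \<open>This is the average of the fourth powers of \<open>1 + w\<close> and
    \<open>1 - w\<close>, since \<open>w^2 = - u\<close>. Averaging once more with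
    \<open>1 - u^2\<close> removes the quartic term and leaves \<open>1 - 3 u\<close>.\<close>
  have "p (1 - ?six + u * u) \<le> 1"
    by (rule avg[OF mult[OF w2(1) w2(1)] mult[OF w2(2) w2(2)]])
       (use ww uw in \<open>simp add: e algebra_simps\<close>)
  moreover have "p (1 - u * u) \<le> 1"
    using mult[OF pu mu] by (simp add: algebra_simps)
  ultimately have 3: "p (1 - (u + u + u)) \<le> 1"
    by (rule avg) (simp add: algebra_simps)
  \<comment> \<open>The weights 3 and 1 cancel \<open>u\<close>:
    \<open>3 (1 + v)^2 + (1 - 3 u) = 4 + 6 v\<close>. This is the origin of the factor 3/2.\<close>
  let ?s = "(1 + v) * (1 + v)" and ?x = "1 + fscale (3/2) v"
  have "fscale 4 ?x = ?s + ?s + ?s + (1 - (u + u + u))"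
  proof -
    have "fscale 4 ?x = fscale 4 1 + fscale 6 v" by (simp add: fscale_add fscale_fscale)
    also have "\<dots> = (1 + 1 + 1 + 1) + (v + v + v + v + v + v)"
      using fscale_add_left[of 2 2 1] fscale_add_left[of 4 2 v] fscale_add_left[of 2 2 v]
      by (simp add: fscale_double add.assoc)
    also have "\<dots> = ?s + ?s + ?s + (1 - (u + u + u))" by (simp add: u_def algebra_simps)
    finally show ?thesis .
  qed
  then have "4 * p ?x \<le> p ?s + p ?s + p ?s + p (1 - (u + u + u))"
    using P(2)[of 4 ?x] P(4)[of "?s + ?s + ?s" "1 - (u + u + u)"] P(4)[of "?s + ?s" ?s] P(4)[of ?s ?s]
    by simp
  then show ?thesis using mult[OF 1(1) 1(1)] 3 by simp
qed

lemma cstar_seminorm_extreme: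
  fixes v :: "'e free"
  assumes p: "cstar_seminorm UNIV p" and v: "fstar v = v" and 1: "p (1 + v) \<le> 1" "p (1 - v) \<le> 1"
  shows "p v = 0"
proof -
  note P = cstar_seminorm_UNIV[OF p]
  let ?c = "\<lambda>n. (3/2 :: complex) ^ n"
  \<comment> \<open>Both signs are carried along, because each application of the step consumes the
    bounds for \<open>1 + v\<close> and \<open>1 - v\<close> together.\<close>
  have "p (1 + fscale (?c n) v) \<le> 1 \<and> p (1 - fscale (?c n) v) \<le> 1" for n
  proof (induction n)
    case (Suc n)
    have r: "cnj (?c n) = ?c n" by simp
    have s: "fstar (fscale (?c n) v) = fscale (?c n) v" "fstar (- fscale (?c n) v) = - fscale (?c n) v"
      by (simp_all add: fstar_fscale fstar_minus v r del: power_divide)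
    have m: "fscale (3/2) (- x) = - fscale (3/2) x" for x :: "'e free"
      by (simp add: fscale_fscale flip: fscale_minus_one)
    show ?case
      using cstar_seminorm_extreme_step[OF p s(1)] cstar_seminorm_extreme_step[OF p s(2)] Suc
      by (simp add: fscale_fscale m del: power_divide)
  qed (use 1 in simp)
  note b = this
  have le: "(3/2) ^ n * p v \<le> 1" for n
  proof -
    let ?y = "fscale (?c n) v"
    have "2 * p ?y = p (?y + ?y)" using P(2)[of 2 ?y] by (simp add: fscale_double)
    also have "?y + ?y = (1 + ?y) - (1 - ?y)" by simp
    also have "p \<dots> \<le> 2" using P(7)[of "1 + ?y" "1 - ?y"] b[of n] by linarith
    finally show ?thesis by (simp add: P(2) norm_power norm_divide)
  qed
  have "p v \<le> (2/3) ^ n" for n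
    using le[of n] by (simp add: field_simps power_divide)
  then have "p v \<le> 0"
    by (intro LIMSEQ_le_const[OF LIMSEQ_realpow_zero[of "2/3::real"]]) auto
  then show ?thesis using P(1)[of v] by simp
qed

section \<open>Projections in a C*-algebra and their orthogonality\<close>

context cstar_algebra
begin

lemma cnorm_self_adjoint_square:
  "x \<in> carrier \<AA> \<Longrightarrow> adj \<AA> x = x \<Longrightarrow> cnorm \<AA> (x \<otimes> x) = (cnorm \<AA> x)\<^sup>2"
  using cstar_identity[of x] by simp

lemma cnorm_projection:
  assumes "x \<in> carrier \<AA>" "adj \<AA> x = x" "x \<otimes> x = x"
  shows "cnorm \<AA> x = 0 \<or> cnorm \<AA> x = 1"
  using cnorm_self_adjoint_square[OF assms(1,2)] assms(3) by (simp add: power2_eq_square)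

lemma cnorm_one_le: "cnorm \<AA> \<one> \<le> 1"
  using cnorm_projection[of \<one>] adj_one by auto

lemma cnorm_partial_isometry:
  assumes x: "x \<in> carrier \<AA>" and "x \<otimes> adj \<AA> x \<otimes> x = x"
  shows "cnorm \<AA> x \<le> 1"
proof -
  have "cnorm \<AA> (adj \<AA> x \<otimes> x) = 0 \<or> cnorm \<AA> (adj \<AA> x \<otimes> x) = 1"
    using assms by (intro cnorm_projection) (auto simp: adj_closed adj_mult adj_adj m_assoc)
  then have "(cnorm \<AA> x)\<^sup>2 \<le> 1\<^sup>2" using cstar_identity[OF x] by auto
  then show ?thesis by (rule power2_le_imp_le) simp
qed

text \<open>Extremality of the unit, transported to the corner with unit \<open>P\<close>. Since
  \<open>P\<close> commutes with every polynomial in \<open>v\<close>, compressing by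
  \<open>P\<close> gives a C*-seminorm on the free *-algebra in one generator, in which the free
  unit stands for \<open>P\<close>.\<close>

lemma extreme_corner:
  assumes c: "P \<in> carrier \<AA>" "v \<in> carrier \<AA>" and P: "adj \<AA> P = P" "P \<otimes> P = P"
    and v: "adj \<AA> v = v" "P \<otimes> v = v" and le: "cnorm \<AA> (P \<oplus> v) \<le> 1" "cnorm \<AA> (P \<ominus> v) \<le> 1"
  shows "v = \<zero>"
proof -
  have vP: "v \<otimes> P = v"
    using adj_mult[OF c] c P v by simp
  interpret free_evaluation \<AA> "\<lambda>_::unit. v" by standard fact
  note [simp] = ev_closed c
  have comm: "P \<otimes> ev x = ev x \<otimes> P" for x
  proof -
    have "x \<in> free_star_algebra UNIV" by (simp add: free_star_algebra_def)
    then show ?thesis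
    proof (induction x rule: free_star_algebra_induct)
      case (mult x y)
      have "P \<otimes> (ev x \<otimes> ev y) = (P \<otimes> ev x) \<otimes> ev y" by (simp add: m_assoc)
      also have "\<dots> = ev x \<otimes> (P \<otimes> ev y)" unfolding mult(3) by (simp add: m_assoc)
      also have "\<dots> = ev x \<otimes> ev y \<otimes> P" unfolding mult(4) by (simp add: m_assoc)
      finally show ?case by (simp add: ev_mult)
    qed (auto simp: ev_zero ev_one ev_fgen ev_fstar ev_add ev_fscale v vP smult_mult_left smult_mult_right
        l_distr r_distr smult_closed)
  qed
  have PP: "P \<otimes> (P \<otimes> x) = P \<otimes> x" if "x \<in> carrier \<AA>" for x
    using P that by (simp flip: m_assoc)
  have split: "P \<otimes> (ev x \<otimes> ev y) = (P \<otimes> ev x) \<otimes> (P \<otimes> ev y)" for x y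
    by (simp add: m_assoc comm[of y] comm[of x])
       (metis PP comm c(1) ev_closed m_assoc m_closed)
  have "cstar_seminorm UNIV (\<lambda>x. cnorm \<AA> (P \<otimes> ev x))"
    unfolding cstar_seminorm_def
  proof (intro ballI conjI allI)
    fix x y :: "unit free" and d
    show "cnorm \<AA> (P \<otimes> ev (fstar x * x)) = (cnorm \<AA> (P \<otimes> ev x))\<^sup>2"
      using cstar_identity[of "P \<otimes> ev x"] comm[of "fstar x"] split[of "fstar x" x]
      by (simp add: ev_mult adj_mult P ev_fstar)
    show "cnorm \<AA> (P \<otimes> ev (x + y)) \<le> cnorm \<AA> (P \<otimes> ev x) + cnorm \<AA> (P \<otimes> ev y)"
      by (simp add: ev_add r_distr cnorm_add)
    show "cnorm \<AA> (P \<otimes> ev (x * y)) \<le> cnorm \<AA> (P \<otimes> ev x) * cnorm \<AA> (P \<otimes> ev y)"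
      by (simp add: ev_mult split cnorm_mult)
  qed (simp_all add: cnorm_nonneg ev_fscale smult_mult_right cnorm_smult)
  note q = this
  \<comment> \<open>The free generator is not self-adjoint, although its value \<open>v\<close> is.
    Its real part is, and has the same value.\<close>
  define g where "g = fscale (1/2) (fgen () + fstar (fgen ()))"
  have g: "P \<otimes> ev g = v"
    using smult_add_left[of v "1/2" "1/2"] v
    by (simp add: g_def fscale_add ev_add ev_fscale ev_fstar ev_fgen r_distr smult_closed smult_mult_right
        smult_one)
  have "cnorm \<AA> (P \<otimes> ev g) = 0"
    by (rule cstar_seminorm_extreme[OF q])
       (use le g in \<open>simp_all add: ev_add ev_diff ev_one r_distr a_minus_def r_minus\<close>,
        simp add: g_def fstar_fscale fstar_add add.commute)
  then show ?thesis using cnorm_eq_zero g by simp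
qed

end

context free_evaluation
begin

lemma ev_cong_mult: "ev x = ev x' \<Longrightarrow> ev y = ev y' \<Longrightarrow> ev (x * y) = ev (x' * y')"
  by (simp add: ev_mult)

text \<open>For \<open>z\<^sub>c = T\<^sub>b T\<^sub>c T\<^sub>b\<close> the sum over \<open>c \<noteq> b\<close> vanishes, and each \<open>T\<^sub>b - 2 z\<^sub>c\<close> is a contraction;
  extremality of the unit \<open>T\<^sub>b\<close> of its corner then gives \<open>z\<^sub>a = 0\<close>.\<close>

lemma projections_orthogonal:
  assumes K: "finite K" "a \<in> K" "b \<in> K" "a \<noteq> b"
    and proj: "\<And>a. a \<in> K \<Longrightarrow> adj \<AA> (T a) = T a" "\<And>a. a \<in> K \<Longrightarrow> T a \<otimes> T a = T a"
    and sum: "ev (\<Sum>a\<in>K. fgen a) = \<one>"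
  shows "T a \<otimes> T b = \<zero>"
proof -
  note [simp] = ev_closed T_closed
  let ?q = "\<lambda>x. cnorm \<AA> (ev x)"
  have q: "cstar_seminorm UNIV ?q" by (rule ev_seminorm)
  note Q = cstar_seminorm_UNIV[OF q]
  define z where "z c = fgen b * fgen c * fgen b" for c
  have idem: "ev (fgen b * fgen b) = ev (fgen b)" using proj K by (simp add: ev_mult ev_fgen)
  have "ev (\<Sum>c\<in>K. z c) = ev (fgen b * (\<Sum>c\<in>K. fgen c) * fgen b)"
    by (simp add: z_def sum_distrib_left sum_distrib_right)
  also have "\<dots> = ev (fgen b)" using sum idem by (simp add: ev_mult ev_fgen)
  also have "\<dots> = ev (z b)" using proj K by (simp add: z_def ev_mult ev_fgen)
  finally have "ev (\<Sum>c\<in>K. z c) = ev (z b)" .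
  moreover have "(\<Sum>c\<in>K. z c) = z b + (z a + (\<Sum>c\<in>K - {b} - {a}. z c))"
    using K by (subst sum.remove[of _ b], simp, simp, subst sum.remove[of _ a]) auto
  ultimately have *: "ev (z a + (\<Sum>c\<in>K - {b} - {a}. z c)) = \<zero>"
    by (simp add: ev_add)
  define L where "L = K - {b} - {a}"
  have *: "ev (z a + (\<Sum>c\<in>L. z c)) = \<zero>" using * by (simp add: L_def)
  \<comment> \<open>The element is the compression by \<open>T b\<close> of the symmetry
    \<open>1 - 2 T c\<close>, whose square is the unit.\<close>
  have le1: "?q (fgen b - fscale 2 (z c)) \<le> 1" if c: "c \<in> K" for c
  proof -
    let ?s = "1 - fscale 2 (fgen c)"
    have n: "?q (fgen b) \<le> 1" using cnorm_projection[of "T b"] proj K by (auto simp: ev_fgen)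
    have "ev (fstar ?s * ?s) = ev 1"
    proof -
      have "ev (fstar (fgen c)) = ev (fgen c)" using proj c by (simp add: ev_fstar ev_fgen)
      then have "ev (fstar ?s * ?s) = ev (?s * ?s)"
        by (intro ev_cong_mult refl) (simp add: fstar_diff fstar_fscale ev_diff ev_fscale)
      also have "?s * ?s = 1 - fscale 4 (fgen c) + fscale 4 (fgen c * fgen c)"
      proof -
        have "fscale 4 x = fscale 2 x + fscale 2 x" for x :: "'e free"
          using fscale_add_left[of 2 2 x] by simp
        then show ?thesis
          by (simp add: algebra_simps fscale_mult_left fscale_mult_right fscale_fscale fscale_diff)
      qed
      also have "ev \<dots> = ev (1 - fscale 4 (fgen c) + fscale 4 (fgen c))"
        using proj c by (simp only: ev_add ev_fscale ev_mult ev_fgen)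
      finally show ?thesis by simp
    qed
    then have "(?q ?s)\<^sup>2 = ?q 1" using Q(3)[of ?s] by simp
    then have s: "?q ?s \<le> 1"
      using cnorm_one_le Q(1) by (simp add: ev_one) (metis power2_le_imp_le one_power2 zero_le_one)
    have "ev (fgen b - fscale 2 (z c)) = ev (fgen b * ?s * fgen b)"
      using idem by (simp add: z_def algebra_simps fscale_mult_left fscale_mult_right ev_diff)
    also have "cnorm \<AA> \<dots> \<le> ?q (fgen b) * ?q ?s * ?q (fgen b)"
      using Q(5)[of "fgen b * ?s" "fgen b"] Q(5)[of "fgen b" ?s] Q(1)
      by (meson mult_right_mono order_trans)
    also have "\<dots> \<le> 1" using n s Q(1) by (intro mult_le_one mult_nonneg_nonneg) auto
    finally show ?thesis .
  qed
  have "ev (z a) = \<zero>"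
  proof (cases "L = {}")
    case True then show ?thesis using * by simp
  next
    case False
    define k where "k = real (card L)"
    have finL: "finite L" "L \<subseteq> K" using K by (auto simp: L_def)
    have k: "k \<ge> 1" using False finL by (simp add: k_def Suc_leI card_gt_0_iff)
    \<comment> \<open>The factor \<open>2 / k\<close> makes both \<open>T b + v\<close> and
      \<open>T b - v\<close> averages of \<open>k\<close> contractions: the former of
      \<open>T b - 2 z c\<close> for \<open>c\<close> in \<open>L\<close>, because these
      \<open>z c\<close> sum to \<open>- z a\<close>; the latter of \<open>k - 1\<close> copies of
      \<open>T b\<close> and one \<open>T b - 2 z a\<close>.\<close>
    define v where "v = fscale (of_real (2 / k)) (z a)"
    have "ev (fscale (of_real k) (fgen b + v)) = ev (\<Sum>c\<in>L. fgen b - fscale 2 (z c))"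
    proof -
      have kv: "fscale (of_real k) v = fscale 2 (z a)" using k by (simp add: v_def fscale_fscale)
      have "(\<Sum>c\<in>L. fgen b) = fscale (of_real k) (fgen b)"
        using finL(1) unfolding k_def
        by (induction L rule: finite_induct) (simp_all add: fscale_add_left del: sum_constant)
      moreover have "(\<Sum>c\<in>L. fscale 2 (z c)) = fscale 2 (\<Sum>c\<in>L. z c)"
        by (simp add: fscale_def sum_distrib_left)
      ultimately have "fscale (of_real k) (fgen b + v) - (\<Sum>c\<in>L. fgen b - fscale 2 (z c))
         = fscale 2 (z a + (\<Sum>c\<in>L. z c))"
        by (simp add: fscale_add kv sum_subtractf)
      then have "ev (fscale (of_real k) (fgen b + v) - (\<Sum>c\<in>L. fgen b - fscale 2 (z c))) = \<zero>"
        using * by (simp only: ev_fscale smult_zero_right)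
      then show ?thesis
        by (metis ev_diff cnorm_zero cnorm_diff_eq_zero[OF ev_closed ev_closed])
    qed
    then have "k * ?q (fgen b + v) = ?q (\<Sum>c\<in>L. fgen b - fscale 2 (z c))"
      using Q(2)[of "of_real k" "fgen b + v"] k by simp
    also have "\<dots> \<le> (\<Sum>c\<in>L. ?q (fgen b - fscale 2 (z c)))"
      by (rule cstar_seminorm_sum[OF q])
    also have "\<dots> \<le> (\<Sum>c\<in>L. 1)" using le1 finL by (intro sum_mono) blast
    finally have plus: "?q (fgen b + v) \<le> 1" using k by (simp add: k_def)
    have "fscale (of_real k) (fgen b - v) = fscale (of_real (k - 1)) (fgen b) + (fgen b - fscale 2 (z a))"
      using k fscale_add_left[of "of_real (k - 1)" 1 "fgen b"] by (simp add: v_def fscale_diff fscale_fscale)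
    moreover have "cmod (complex_of_real k - 1) = k - 1"
      using k norm_of_real[of "k - 1", where 'a = complex] by simp
    ultimately have "k * ?q (fgen b - v) \<le> (k - 1) * ?q (fgen b) + ?q (fgen b - fscale 2 (z a))"
      using Q(2)[of "of_real k" "fgen b - v"] Q(2)[of "of_real (k - 1)" "fgen b"]
        Q(4)[of "fscale (of_real (k - 1)) (fgen b)" "fgen b - fscale 2 (z a)"] k by simp
    also have "\<dots> \<le> (k - 1) * 1 + 1"
      using le1[OF K(2)] k cnorm_projection[of "T b"] proj K
      by (intro add_mono mult_left_mono) (auto simp: ev_fgen)
    finally have minus: "?q (fgen b - v) \<le> 1" using k by simp
    have "ev v = \<zero>"
    proof (rule extreme_corner[of "T b"])
      show "adj \<AA> (ev v) = ev v"
        using proj K by (simp add: v_def ev_fscale z_def ev_mult ev_fgen adj_smult adj_mult m_assoc)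
      show "T b \<otimes> ev v = ev v"
        using proj K by (simp add: v_def ev_fscale z_def ev_mult ev_fgen smult_mult_right flip: m_assoc)
    qed (use proj K plus minus in \<open>simp_all add: ev_add ev_diff ev_fgen\<close>)
    then have "of_real (k / 2) \<odot> ev v = \<zero>" by (simp add: smult_zero_right)
    then show ?thesis using k by (simp add: v_def ev_fscale smult_smult smult_one)
  qed
  then have zero: "T b \<otimes> T a \<otimes> T b = \<zero>" by (simp add: z_def ev_mult ev_fgen)
  have "adj \<AA> (T a \<otimes> T b) \<otimes> (T a \<otimes> T b) = T b \<otimes> (T a \<otimes> T a) \<otimes> T b"
    using proj(1) K by (simp add: adj_mult m_assoc)
  then have "cnorm \<AA> (adj \<AA> (T a \<otimes> T b) \<otimes> (T a \<otimes> T b)) = 0"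
    using proj(2) K zero by (simp add: cnorm_zero)
  then show ?thesis
    using cstar_identity[of "T a \<otimes> T b"] cnorm_eq_zero[of "T a \<otimes> T b"] by simp
qed

end

section \<open>Closed subalgebras, generation and a square root\<close>

context cstar_algebra
begin

lemma conv_closedin:
  "closedin met.mtopology D \<longleftrightarrow> D \<subseteq> carrier \<AA> \<and> (\<forall>f y. range f \<subseteq> D \<longrightarrow> conv f y \<longrightarrow> y \<in> D)"
proof -
  have "limitin met.mtopology f y sequentially \<longleftrightarrow> conv f y" if "range f \<subseteq> D" "D \<subseteq> carrier \<AA>" for f y
  proof -
    have f: "f n \<in> carrier \<AA>" for n using that by blast
    show ?thesis using f by (auto simp: met.limitin_metric_dist_null conv_def cdist_def)
  qed
  then show ?thesis unfolding met.metric_closedin_iff_sequentially_closed by blast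
qed

lemma cstar_subalgebra_conv:
  "cstar_subalgebra \<AA> D \<longleftrightarrow> D \<subseteq> carrier \<AA> \<and> \<zero> \<in> D \<and>
     (\<forall>x\<in>D. \<forall>y\<in>D. x \<oplus> y \<in> D \<and> x \<otimes> y \<in> D) \<and> (\<forall>x\<in>D. adj \<AA> x \<in> D \<and> (\<forall>c. c \<odot> x \<in> D)) \<and>
     (\<forall>f y. range f \<subseteq> D \<longrightarrow> conv f y \<longrightarrow> y \<in> D)"
  unfolding cstar_subalgebra_def conv_closedin by blast

lemma cstar_subalgebra_carrier: "cstar_subalgebra \<AA> (carrier \<AA>)"
  unfolding cstar_subalgebra_conv by (auto simp: smult_closed adj_closed conv_def)

lemma generated_closed: "X \<subseteq> carrier \<AA> \<Longrightarrow> generated_cstar_subalgebra \<AA> X \<subseteq> carrier \<AA>"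
  using cstar_subalgebra_carrier by (auto simp: generated_cstar_subalgebra_def)

lemma generated_subset: "X \<subseteq> generated_cstar_subalgebra \<AA> X"
  by (auto simp: generated_cstar_subalgebra_def)

lemma generated_least: "cstar_subalgebra \<AA> D \<Longrightarrow> X \<subseteq> D \<Longrightarrow> generated_cstar_subalgebra \<AA> X \<subseteq> D"
  by (auto simp: generated_cstar_subalgebra_def)

lemma generated_subalgebra:
  assumes "X \<subseteq> carrier \<AA>"
  shows "cstar_subalgebra \<AA> (generated_cstar_subalgebra \<AA> X)"
proof -
  let ?G = "generated_cstar_subalgebra \<AA> X"
  have mem: "x \<in> ?G \<longleftrightarrow> (\<forall>D. cstar_subalgebra \<AA> D \<longrightarrow> X \<subseteq> D \<longrightarrow> x \<in> D)" for x
    by (auto simp: generated_cstar_subalgebra_def)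
  show ?thesis
    unfolding cstar_subalgebra_conv[of ?G]
  proof (intro conjI ballI allI impI generated_closed[OF assms])
    fix f y assume f: "range f \<subseteq> ?G" "conv f y"
    show "y \<in> ?G"
      unfolding mem
    proof (intro allI impI)
      fix D assume D: "cstar_subalgebra \<AA> D" "X \<subseteq> D"
      then have "range f \<subseteq> D" using f(1) generated_least[OF D] by blast
      then show "y \<in> D" using D(1) f(2) unfolding cstar_subalgebra_conv by blast
    qed
  qed (simp_all add: mem cstar_subalgebra_def)
qed

text \<open>\<open>z = (t + z\<^sup>2) / 2\<close> is the equation for \<open>z = 1 - sqrt (1 - t)\<close>; the fixed point is found among the
  self-adjoint elements commuting with \<open>x\<close>.\<close>

lemma sqrt_equation:
  assumes t: "t \<in> carrier \<AA>" "adj \<AA> t = t" "cnorm \<AA> t < 1" and x: "x \<in> carrier \<AA>" "x \<otimes> t = t \<otimes> x"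
  shows "\<exists>z\<in>carrier \<AA>. adj \<AA> z = z \<and> x \<otimes> z = z \<otimes> x \<and> z \<oplus> z = t \<oplus> z \<otimes> z"
proof -
  let ?r = "cnorm \<AA> t"
  \<comment> \<open>With \<open>r = ?r < 1\<close>, the map \<open>f\<close> sends the ball of
    radius \<open>r\<close> into itself, as \<open>(r + r^2) / 2 \<le> r\<close>, and is Lipschitz
    there with constant \<open>r\<close>. Being self-adjoint and commuting with \<open>x\<close> are
    closed conditions that \<open>f\<close> preserves.\<close>
  define M where "M = {z \<in> carrier \<AA>. adj \<AA> z = z \<and> x \<otimes> z = z \<otimes> x \<and> cnorm \<AA> z \<le> ?r}"
  define f where "f z = (1/2) \<odot> (t \<oplus> z \<otimes> z)" for z
  have Msub: "M \<subseteq> carrier \<AA>" by (auto simp: M_def)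
  have clos: "closedin met.mtopology M"
    unfolding conv_closedin
  proof (intro conjI allI impI Msub)
    fix g y assume g: "range g \<subseteq> M" and y: "conv g y"
    have gM: "g n \<in> M" for n using g by blast
    have yc: "y \<in> carrier \<AA>" using y by (simp add: conv_def)
    have "adj \<AA> y = y"
      using conv_adj[OF y] gM by (intro conv_unique[OF _ y]) (simp add: M_def)
    moreover have "x \<otimes> y = y \<otimes> x"
      using conv_mult[OF conv_const[OF x(1)] y] conv_mult[OF y conv_const[OF x(1)]] gM
      by (intro conv_unique[of "\<lambda>n. x \<otimes> g n"]) (simp_all add: M_def)
    moreover have "cnorm \<AA> y \<le> ?r"
    proof -
      have "cnorm \<AA> y \<le> ?r + cnorm \<AA> (g n \<ominus> y)" for n
      proof -
        have gc: "g n \<in> carrier \<AA>" using gM by (simp add: M_def)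
        have "y = g n \<oplus> (y \<ominus> g n)" using yc gc by algebra
        then have "cnorm \<AA> y \<le> cnorm \<AA> (g n) + cnorm \<AA> (y \<ominus> g n)"
          using cnorm_add[of "g n" "y \<ominus> g n"] yc gc by simp
        then show ?thesis using gM[of n] cnorm_diff_commute[OF gc yc] by (simp add: M_def)
      qed
      moreover have "(\<lambda>n. ?r + cnorm \<AA> (g n \<ominus> y)) \<longlonglongrightarrow> ?r + 0"
        using y by (intro tendsto_intros) (auto simp: conv_def)
      ultimately show ?thesis using LIMSEQ_le_const[of _ "?r + 0"] by fastforce
    qed
    ultimately show "y \<in> M" using yc by (simp add: M_def)
  qed
  interpret S: Submetric "carrier \<AA>" "cdist \<AA>" M by standard (rule Msub)
  have mc: "S.sub.mcomplete" using clos complete by (rule S.closedin_mcomplete_imp_mcomplete)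
  have fM: "f z \<in> M" if "z \<in> M" for z
  proof -
    have z: "z \<in> carrier \<AA>" "adj \<AA> z = z" "x \<otimes> z = z \<otimes> x" "cnorm \<AA> z \<le> ?r" using that by (auto simp: M_def)
    have "x \<otimes> (z \<otimes> z) = (z \<otimes> z) \<otimes> x" using z x by (metis m_assoc)
    then have "x \<otimes> f z = f z \<otimes> x"
      using x t z by (simp add: f_def smult_mult_left smult_mult_right l_distr r_distr)
    moreover have "cnorm \<AA> (t \<oplus> z \<otimes> z) \<le> ?r + ?r * ?r"
      using cnorm_add[of t "z \<otimes> z"] cnorm_mult[of z z] mult_mono[OF z(4) z(4)] t z cnorm_nonneg
      by (smt (verit) m_closed)
    moreover have "?r * ?r \<le> ?r * 1" using t cnorm_nonneg[of t] by (intro mult_left_mono) auto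
    ultimately show ?thesis
      using t z x by (simp add: M_def f_def smult_closed adj_smult adj_add adj_mult cnorm_smult norm_divide)
  qed
  have con: "cdist \<AA> (f z) (f w) \<le> ?r * cdist \<AA> z w" if "z \<in> M" "w \<in> M" for z w
  proof -
    have z: "z \<in> carrier \<AA>" "cnorm \<AA> z \<le> ?r" and w: "w \<in> carrier \<AA>" "cnorm \<AA> w \<le> ?r"
      using that by (auto simp: M_def)
    have "(t \<oplus> z \<otimes> z) \<ominus> (t \<oplus> w \<otimes> w) = z \<otimes> (z \<ominus> w) \<oplus> (z \<ominus> w) \<otimes> w"
      using t z w by algebra
    then have "cnorm \<AA> ((t \<oplus> z \<otimes> z) \<ominus> (t \<oplus> w \<otimes> w)) \<le> cnorm \<AA> z * cnorm \<AA> (z \<ominus> w) + cnorm \<AA> (z \<ominus> w) * cnorm \<AA> w"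
      using cnorm_add[of "z \<otimes> (z \<ominus> w)" "(z \<ominus> w) \<otimes> w"] cnorm_mult[of z "z \<ominus> w"] cnorm_mult[of "z \<ominus> w" w] z w
      by simp
    also have "\<dots> \<le> ?r * cnorm \<AA> (z \<ominus> w) + cnorm \<AA> (z \<ominus> w) * ?r"
      using z w cnorm_nonneg[of "z \<ominus> w"] by (intro add_mono mult_right_mono mult_left_mono) auto
    finally have "cnorm \<AA> ((t \<oplus> z \<otimes> z) \<ominus> (t \<oplus> w \<otimes> w)) \<le> 2 * (?r * cnorm \<AA> (z \<ominus> w))" by simp
    then show ?thesis
      using t z w by (simp add: cdist_def f_def smult_closed cnorm_smult norm_divide flip: smult_diff)
  qed
  have "\<zero> \<in> M" using x cnorm_nonneg[OF t(1)] by (simp add: M_def adj_zero cnorm_zero)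
  then obtain z where z: "z \<in> M" "f z = z"
    using S.sub.Banach_fixedpoint_thm[OF mc _ _ t(3) con] fM by blast
  have "z \<oplus> z = f z \<oplus> f z" using z by simp
  also have "\<dots> = t \<oplus> z \<otimes> z"
    using smult_add_left[of "t \<oplus> z \<otimes> z" "1/2" "1/2"] t z Msub by (auto simp: f_def smult_one)
  finally show ?thesis using z by (auto simp: M_def)
qed

end

section \<open>Contractivity of *-homomorphisms\<close>

locale star_homomorphism = A: cstar_algebra \<AA> + B: cstar_algebra \<BB>
  for \<AA> :: "'a cstar" and \<BB> :: "'b cstar" + fixes \<Phi> :: "'a \<Rightarrow> 'b"
  assumes hom: "\<Phi> \<in> star_hom \<AA> \<BB>"
begin

lemma hom_closed [simp]: "x \<in> carrier \<AA> \<Longrightarrow> \<Phi> x \<in> carrier \<BB>"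
  and hom_add: "x \<in> carrier \<AA> \<Longrightarrow> y \<in> carrier \<AA> \<Longrightarrow> \<Phi> (x \<oplus>\<^bsub>\<AA>\<^esub> y) = \<Phi> x \<oplus>\<^bsub>\<BB>\<^esub> \<Phi> y"
  and hom_mult: "x \<in> carrier \<AA> \<Longrightarrow> y \<in> carrier \<AA> \<Longrightarrow> \<Phi> (x \<otimes>\<^bsub>\<AA>\<^esub> y) = \<Phi> x \<otimes>\<^bsub>\<BB>\<^esub> \<Phi> y"
  and hom_one: "\<Phi> \<one>\<^bsub>\<AA>\<^esub> = \<one>\<^bsub>\<BB>\<^esub>"
  and hom_smult: "x \<in> carrier \<AA> \<Longrightarrow> \<Phi> (c \<odot>\<^bsub>\<AA>\<^esub> x) = c \<odot>\<^bsub>\<BB>\<^esub> \<Phi> x"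
  and hom_adj: "x \<in> carrier \<AA> \<Longrightarrow> \<Phi> (adj \<AA> x) = adj \<BB> (\<Phi> x)"
  using hom by (auto simp: star_hom_def ring_hom_closed ring_hom_add ring_hom_mult ring_hom_one)

lemma hom_zero: "\<Phi> \<zero>\<^bsub>\<AA>\<^esub> = \<zero>\<^bsub>\<BB>\<^esub>"
  using hom_smult[of "\<zero>\<^bsub>\<AA>\<^esub>" 0] A.smult_zero_left[of "\<zero>\<^bsub>\<AA>\<^esub>"] B.smult_zero_left[of "\<Phi> \<zero>\<^bsub>\<AA>\<^esub>"] by simp

lemma hom_diff: "x \<in> carrier \<AA> \<Longrightarrow> y \<in> carrier \<AA> \<Longrightarrow> \<Phi> (x \<ominus>\<^bsub>\<AA>\<^esub> y) = \<Phi> x \<ominus>\<^bsub>\<BB>\<^esub> \<Phi> y"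
  unfolding a_minus_def
  by (simp add: hom_add hom_smult A.smult_closed flip: A.smult_minus_one B.smult_minus_one)

text \<open>A self-adjoint \<open>x\<close> with \<open>\<parallel>x\<parallel> < 1\<close> has a self-adjoint \<open>y\<close> commuting with it such that
  \<open>x\<^sup>2 + y\<^sup>2 = 1\<close>; then \<open>\<Phi> x\<close> is the real part of the unitary \<open>\<Phi> (x + iy)\<close>.\<close>

lemma contractive_self_adjoint:
  assumes x: "x \<in> carrier \<AA>" "adj \<AA> x = x" "cnorm \<AA> x < 1"
  shows "cnorm \<BB> (\<Phi> x) \<le> 1"
proof -
  let ?t = "x \<otimes>\<^bsub>\<AA>\<^esub> x"
  have "(cnorm \<AA> x)\<^sup>2 < 1" using x A.cnorm_nonneg[OF x(1)] by (simp add: power_less_one_iff)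
  then have "cnorm \<AA> ?t < 1" using A.cnorm_self_adjoint_square[OF x(1,2)] by simp
  then obtain z where z: "z \<in> carrier \<AA>" "adj \<AA> z = z" "x \<otimes>\<^bsub>\<AA>\<^esub> z = z \<otimes>\<^bsub>\<AA>\<^esub> x"
    "z \<oplus>\<^bsub>\<AA>\<^esub> z = ?t \<oplus>\<^bsub>\<AA>\<^esub> z \<otimes>\<^bsub>\<AA>\<^esub> z"
    using A.sqrt_equation[of ?t x] x by (auto simp: A.adj_mult A.m_assoc)
  \<comment> \<open>From \<open>2 z = t + z^2\<close> follows \<open>(1 - z)^2 = 1 - t\<close>, so
    this is the square root of \<open>1 - x^2\<close>.\<close>
  define y where "y = \<one>\<^bsub>\<AA>\<^esub> \<ominus>\<^bsub>\<AA>\<^esub> z"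
  have y: "y \<in> carrier \<AA>" "adj \<AA> y = y" using z by (auto simp: y_def A.adj_diff A.adj_one)
  have xy: "x \<otimes>\<^bsub>\<AA>\<^esub> y = y \<otimes>\<^bsub>\<AA>\<^esub> x"
    using x z by (simp add: y_def a_minus_def A.r_distr A.l_distr A.r_minus A.l_minus)
  have "y \<otimes>\<^bsub>\<AA>\<^esub> y = \<one>\<^bsub>\<AA>\<^esub> \<ominus>\<^bsub>\<AA>\<^esub> (z \<oplus>\<^bsub>\<AA>\<^esub> z) \<oplus>\<^bsub>\<AA>\<^esub> z \<otimes>\<^bsub>\<AA>\<^esub> z"
    unfolding y_def using z(1)
    by (simp add: a_minus_def A.l_distr A.r_distr A.l_minus A.r_minus A.minus_add A.a_assoc)
  also have "\<dots> = \<one>\<^bsub>\<AA>\<^esub> \<ominus>\<^bsub>\<AA>\<^esub> ?t" unfolding z(4) using z(1) x(1) by algebra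
  finally have one: "x \<otimes>\<^bsub>\<AA>\<^esub> x \<oplus>\<^bsub>\<AA>\<^esub> y \<otimes>\<^bsub>\<AA>\<^esub> y = \<one>\<^bsub>\<AA>\<^esub>" using x by algebra
  define u where "u = x \<oplus>\<^bsub>\<AA>\<^esub> \<i> \<odot>\<^bsub>\<AA>\<^esub> y"
  have u: "u \<in> carrier \<AA>" "adj \<AA> u = x \<oplus>\<^bsub>\<AA>\<^esub> (- \<i>) \<odot>\<^bsub>\<AA>\<^esub> y"
    using x y by (auto simp: u_def A.smult_closed A.adj_add A.adj_smult)
  let ?xy = "\<i> \<odot>\<^bsub>\<AA>\<^esub> (x \<otimes>\<^bsub>\<AA>\<^esub> y)"
  have "adj \<AA> u \<otimes>\<^bsub>\<AA>\<^esub> u = (x \<otimes>\<^bsub>\<AA>\<^esub> x \<oplus>\<^bsub>\<AA>\<^esub> ?xy) \<oplus>\<^bsub>\<AA>\<^esub> ((- 1) \<odot>\<^bsub>\<AA>\<^esub> ?xy \<oplus>\<^bsub>\<AA>\<^esub> y \<otimes>\<^bsub>\<AA>\<^esub> y)"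
    unfolding u(2) unfolding u_def using x y xy
    by (simp add: A.l_distr A.r_distr A.smult_closed A.smult_mult_left A.smult_mult_right A.smult_smult
        A.smult_one A.smult_add_right A.a_ac)
  also have "\<dots> = x \<otimes>\<^bsub>\<AA>\<^esub> x \<oplus>\<^bsub>\<AA>\<^esub> y \<otimes>\<^bsub>\<AA>\<^esub> y"
  proof -
    have c: "x \<otimes>\<^bsub>\<AA>\<^esub> x \<in> carrier \<AA>" "y \<otimes>\<^bsub>\<AA>\<^esub> y \<in> carrier \<AA>" "?xy \<in> carrier \<AA>"
      using x y by (auto simp: A.smult_closed)
    show ?thesis unfolding A.smult_minus_one[OF c(3)] using c by algebra
  qed
  finally have uu: "adj \<AA> u \<otimes>\<^bsub>\<AA>\<^esub> u = \<one>\<^bsub>\<AA>\<^esub>" using one by simp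
  have "(cnorm \<BB> (\<Phi> u))\<^sup>2 \<le> 1"
  proof -
    have "adj \<BB> (\<Phi> u) \<otimes>\<^bsub>\<BB>\<^esub> \<Phi> u = \<one>\<^bsub>\<BB>\<^esub>"
      using hom_mult[of "adj \<AA> u" u] hom_adj[OF u(1)] A.adj_closed[OF u(1)] u(1) uu hom_one by metis
    then show ?thesis using B.cstar_identity[of "\<Phi> u"] u(1) B.cnorm_one_le by simp
  qed
  then have nu: "cnorm \<BB> (\<Phi> u) \<le> 1" by (simp add: power2_le_iff_abs_le abs_square_le_1)
  have "u \<oplus>\<^bsub>\<AA>\<^esub> adj \<AA> u = (x \<oplus>\<^bsub>\<AA>\<^esub> x) \<oplus>\<^bsub>\<AA>\<^esub> (\<i> \<odot>\<^bsub>\<AA>\<^esub> y \<oplus>\<^bsub>\<AA>\<^esub> (- \<i>) \<odot>\<^bsub>\<AA>\<^esub> y)"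
    unfolding u(2) unfolding u_def using x y by (simp add: A.smult_closed A.a_ac)
  also have "\<dots> = 2 \<odot>\<^bsub>\<AA>\<^esub> x"
    using x y A.smult_add_left[of y \<i> "- \<i>"] A.smult_add_left[of x 1 1]
    by (simp add: A.smult_zero_left A.smult_one A.smult_closed)
  finally have "2 * cnorm \<BB> (\<Phi> x) = cnorm \<BB> (\<Phi> u \<oplus>\<^bsub>\<BB>\<^esub> adj \<BB> (\<Phi> u))"
    using u(1) x hom_add[of u "adj \<AA> u"] hom_smult[of x 2] B.cnorm_smult[of "\<Phi> x" 2]
    by (simp add: hom_adj A.adj_closed)
  also have "\<dots> \<le> 2"
    using B.cnorm_add[of "\<Phi> u" "adj \<BB> (\<Phi> u)"] nu u B.cnorm_adj[of "\<Phi> u"] by (simp add: B.adj_closed)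
  finally show ?thesis by simp
qed

text \<open>The C*-identity reduces the claim to the self-adjoint \<open>x* x\<close>. A
  self-adjoint element is divided by a number slightly above its norm, because the square root needs
  norm strictly below 1.\<close>

theorem contractive:
  assumes x: "x \<in> carrier \<AA>"
  shows "cnorm \<BB> (\<Phi> x) \<le> cnorm \<AA> x"
proof -
  have sa: "cnorm \<BB> (\<Phi> x) \<le> cnorm \<AA> x" if x: "x \<in> carrier \<AA>" "adj \<AA> x = x" for x
  proof (rule field_le_epsilon)
    fix e :: real assume e: "e > 0"
    define r where "r = cnorm \<AA> x + e"
    have r: "r > 0" using e A.cnorm_nonneg[OF x(1)] by (simp add: r_def)
    have "cnorm \<BB> (\<Phi> (of_real (1 / r) \<odot>\<^bsub>\<AA>\<^esub> x)) \<le> 1"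
      by (rule contractive_self_adjoint)
         (use x r e in \<open>simp_all add: A.smult_closed A.adj_smult A.cnorm_smult norm_divide, simp add: r_def\<close>)
    then have "cnorm \<BB> (\<Phi> x) \<le> r"
      using x r by (simp add: hom_smult B.cnorm_smult norm_divide)
    then show "cnorm \<BB> (\<Phi> x) \<le> cnorm \<AA> x + e" by (simp add: r_def)
  qed
  have "(cnorm \<BB> (\<Phi> x))\<^sup>2 = cnorm \<BB> (\<Phi> (adj \<AA> x \<otimes>\<^bsub>\<AA>\<^esub> x))"
    using x by (simp add: hom_mult hom_adj A.adj_closed B.cstar_identity)
  also have "\<dots> \<le> cnorm \<AA> (adj \<AA> x \<otimes>\<^bsub>\<AA>\<^esub> x)"
    using x by (intro sa) (simp_all add: A.adj_closed A.adj_mult A.adj_adj)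
  also have "\<dots> = (cnorm \<AA> x)\<^sup>2" using x by (rule A.cstar_identity)
  finally show ?thesis using A.cnorm_nonneg[OF x] by (rule power2_le_imp_le)
qed

lemma hom_conv: "A.conv f y \<Longrightarrow> B.conv (\<lambda>n. \<Phi> (f n)) (\<Phi> y)"
  by (rule B.conv_le[where g = "\<lambda>n. cnorm \<AA> (f n \<ominus>\<^bsub>\<AA>\<^esub> y)"])
     (auto simp: A.conv_def contractive simp flip: hom_diff)

text \<open>Contractivity makes the preimage of \<open>D\<close> closed, hence a C*-subalgebra that
  contains the generators.\<close>

lemma hom_generated:
  assumes D: "cstar_subalgebra \<BB> D" and X: "X \<subseteq> carrier \<AA>" "\<Phi> ` X \<subseteq> D"
  shows "\<Phi> ` generated_cstar_subalgebra \<AA> X \<subseteq> D"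
proof -
  note D' = D[unfolded B.cstar_subalgebra_conv]
  have "cstar_subalgebra \<AA> {x \<in> carrier \<AA>. \<Phi> x \<in> D}"
    unfolding A.cstar_subalgebra_conv
  proof (intro conjI ballI allI impI)
    fix f y assume f: "range f \<subseteq> {x \<in> carrier \<AA>. \<Phi> x \<in> D}" "A.conv f y"
    then have "range (\<lambda>n. \<Phi> (f n)) \<subseteq> D" by blast
    then show "y \<in> {x \<in> carrier \<AA>. \<Phi> x \<in> D}"
      using D' hom_conv[OF f(2)] f(2) by (auto simp: A.conv_def)
  qed (use D' in \<open>auto simp: hom_zero hom_add hom_mult hom_adj hom_smult A.smult_closed A.adj_closed\<close>)
  then show ?thesis using A.generated_least[of "{x \<in> carrier \<AA>. \<Phi> x \<in> D}" X] X by blast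
qed

end

lemma star_hom_eqI:
  assumes "star_homomorphism \<AA> \<BB> \<Phi>" "star_homomorphism \<AA> \<BB> \<Psi>" and X: "X \<subseteq> carrier \<AA>"
    and eq: "\<And>x. x \<in> X \<Longrightarrow> \<Phi> x = \<Psi> x" and x: "x \<in> generated_cstar_subalgebra \<AA> X"
  shows "\<Phi> x = \<Psi> x"
proof -
  interpret F: star_homomorphism \<AA> \<BB> \<Phi> by fact
  interpret G: star_homomorphism \<AA> \<BB> \<Psi> by fact
  have "cstar_subalgebra \<AA> {x \<in> carrier \<AA>. \<Phi> x = \<Psi> x}"
    unfolding F.A.cstar_subalgebra_conv
  proof (intro conjI ballI allI impI)
    fix f y assume f: "range f \<subseteq> {x \<in> carrier \<AA>. \<Phi> x = \<Psi> x}" "F.A.conv f y"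
    then have "(\<lambda>n. \<Phi> (f n)) = (\<lambda>n. \<Psi> (f n))" by auto
    then have "\<Phi> y = \<Psi> y" using F.hom_conv[OF f(2)] G.hom_conv[OF f(2)] F.B.conv_unique by metis
    then show "y \<in> {x \<in> carrier \<AA>. \<Phi> x = \<Psi> x}" using f(2) by (auto simp: F.A.conv_def)
  qed (auto simp: F.hom_zero F.hom_add F.hom_mult F.hom_adj F.hom_smult F.A.smult_closed F.A.adj_closed
       G.hom_zero G.hom_add G.hom_mult G.hom_adj G.hom_smult)
  then show ?thesis using F.A.generated_least[of "{x \<in> carrier \<AA>. \<Phi> x = \<Psi> x}" X] X eq x by blast
qed

section \<open>Projections of the diagonal\<close>

definition wgen :: "'e list \<Rightarrow> 'e free" where
  "wgen \<mu> = Poly_Mapping.single (Word (map Gen \<mu>)) 1"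

text \<open>The range projection of a word, kept in the free *-algebra. Identities that hold only in
  the Cuntz--Krieger algebra are stated as equalities of values of \<open>ev\<close>.\<close>

definition pr :: "'e list \<Rightarrow> 'e free" where
  "pr \<mu> = wgen \<mu> * fstar (wgen \<mu>)"

lemma wgen_Nil [simp]: "wgen [] = 1"
  by (simp add: wgen_def flip: zero_word_def)

lemma wgen_append: "wgen (\<mu> @ \<nu>) = wgen \<mu> * wgen \<nu>"
  by (simp add: wgen_def mult_single plus_word_def)

lemma wgen_single: "wgen [a] = fgen a"
  by (simp add: wgen_def fgen_def)

lemma wgen_Cons: "wgen (a # \<mu>) = fgen a * wgen \<mu>"
  using wgen_append[of "[a]" \<mu>] by (simp add: wgen_single)

lemma pr_Nil [simp]: "pr [] = 1"
  by (simp add: pr_def)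

lemma pr_Cons: "pr (a # \<mu>) = fgen a * pr \<mu> * fstar (fgen a)"
  by (simp add: pr_def wgen_Cons fstar_mult mult.assoc)

lemma fstar_pr [simp]: "fstar (pr \<mu>) = pr \<mu>"
  by (simp add: pr_def fstar_mult)

definition words :: "nat mat \<Rightarrow> nat \<Rightarrow> edge list set" where
  "words A m = {\<mu>. set \<mu> \<subseteq> edges A \<and> length \<mu> = m}"

definition is_path :: "edge list \<Rightarrow> bool" where
  "is_path \<mu> \<longleftrightarrow> successively (\<lambda>a b. target a = source b) \<mu>"

lemma finite_words [simp]: "finite (words A m)"
  unfolding words_def by (rule finite_lists_length_eq[OF finite_edges])

lemma words_0 [simp]: "words A 0 = {[]}"
  by (auto simp: words_def)

lemma words_Suc: "words A (Suc m) = (\<lambda>(a, \<mu>). a # \<mu>) ` (edges A \<times> words A m)"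
  by (auto simp: words_def length_Suc_conv image_iff)

lemma words_Suc_snoc: "words A (Suc m) = (\<lambda>(\<mu>, b). \<mu> @ [b]) ` (words A m \<times> edges A)"
  by (auto simp: words_def length_Suc_conv_rev image_iff)

lemma sum_words_Suc: "sum f (words A (Suc m)) = (\<Sum>a\<in>edges A. \<Sum>\<mu>\<in>words A m. f (a # \<mu>))"
  unfolding words_Suc by (subst sum.reindex) (auto simp: inj_on_def sum.cartesian_product case_prod_unfold)

lemma sum_words_Suc_snoc: "sum f (words A (Suc m)) = (\<Sum>\<mu>\<in>words A m. \<Sum>b\<in>edges A. f (\<mu> @ [b]))"
  unfolding words_Suc_snoc by (subst sum.reindex) (auto simp: inj_on_def sum.cartesian_product case_prod_unfold)

text \<open>The locale \<open>free_evaluation\<close> asks for a value at every element of the type;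
  edges outside the graph are sent to 0.\<close>

definition ck_gen0 :: "nat mat \<Rightarrow> edge \<Rightarrow> ck_element" where
  "ck_gen0 A a = (if a \<in> edges A then ck_gen A a else \<zero>\<^bsub>cuntz_krieger_algebra A\<^esub>)"

lemma ck_gen_closed: "a \<in> edges A \<Longrightarrow> ck_gen A a \<in> carrier (cuntz_krieger_algebra A)"
  using cuntz_krieger_algebra_family[of A] by (auto simp: cuntz_krieger_family_def)

section \<open>The Cuntz--Krieger relations and their consequences\<close>

locale cuntz_krieger =
  fixes A :: "nat mat"
begin

sublocale pres: universal_cstar_presentation "edges A" "ck_relations A"
  by (rule ck_presentation)

sublocale cstar_algebra "cuntz_krieger_algebra A"
  by (rule cuntz_krieger_algebra_is_cstar_algebra)

sublocale free_evaluation "cuntz_krieger_algebra A" "ck_gen0 A"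
  by standard (simp add: ck_gen0_def ck_gen_closed)

abbreviation (input) \<O> where "\<O> \<equiv> cuntz_krieger_algebra A"

declare ev_closed [simp]

text \<open>Having equal values under \<open>ev\<close> is a congruence on the free *-algebra. The
  calculations below rewrite free polynomials as ring elements and apply the relations to subterms
  with these rules.\<close>

lemma cong_sum: "(\<And>i. i \<in> K \<Longrightarrow> ev (f i) = ev (g i)) \<Longrightarrow> ev (sum f K) = ev (sum g K)"
  by (induction K rule: infinite_finite_induct) (auto simp: ev_add)

lemma cong_fstar: "ev x = ev y \<Longrightarrow> ev (fstar x) = ev (fstar y)"
  by (simp add: ev_fstar)

lemma cong_fscale: "ev x = ev y \<Longrightarrow> ev (fscale c x) = ev (fscale c y)"
  by (simp add: ev_fscale)

lemmas cong_mult = ev_cong_mult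

lemma cong_mult_left: "ev x = ev y \<Longrightarrow> ev (z * x) = ev (z * y)"
  and cong_mult_right: "ev x = ev y \<Longrightarrow> ev (x * z) = ev (y * z)"
  by (simp_all add: ev_mult)

lemma ev_outside: "a \<notin> edges A \<Longrightarrow> ev (fgen a) = ev 0"
  by (simp add: ev_fgen ck_gen0_def ev_zero)

lemma ev_gen: "a \<in> edges A \<Longrightarrow> ev (fgen a) = ck_gen A a"
  by (simp add: ev_fgen ck_gen0_def)

lemmas folded_pres =
  pres.cl_zero[folded cuntz_krieger_algebra_def] pres.cl_one[folded cuntz_krieger_algebra_def]
  pres.iota_adj[folded cuntz_krieger_algebra_def] pres.iota_add[folded cuntz_krieger_algebra_def]
  pres.iota_mult[folded cuntz_krieger_algebra_def] pres.iota_fscale[folded cuntz_krieger_algebra_def]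

lemma ev_iota: "x \<in> pres.F \<Longrightarrow> ev x = pres.\<iota> x"
proof (induction x rule: free_star_algebra_induct)
  case (gen a)
  then show ?case by (simp add: ev_gen ck_gen_def univ_gen_def)
next
  case (star_gen a)
  then show ?case by (simp add: ev_fstar ev_gen ck_gen_def univ_gen_def free_fgen folded_pres)
qed (simp_all add: ev_zero ev_one ev_add ev_mult ev_fscale folded_pres)

lemma norm_ev: "x \<in> pres.F \<Longrightarrow> cnorm \<O> (ev x) = pres.N x"
  using pres.cl_norm[folded cuntz_krieger_algebra_def, of "\<lambda>n. x" "pres.N x"]
  by (simp add: ev_iota pres.C_const)

lemma dense:
  assumes X: "X \<in> carrier \<O>" and e: "e > 0"
  shows "\<exists>x\<in>pres.F. cnorm \<O> (X \<ominus>\<^bsub>\<O>\<^esub> ev x) < e"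
proof -
  obtain x where x: "x \<in> carrier pres.C" "X = pres.cl x"
    using X by (auto simp: cuntz_krieger_algebra_def pres.U_carrier)
  obtain k where "cdist \<O> (pres.\<iota> (x k)) X < e"
    using pres.cl_const_lim[OF x(1)] e
    unfolding pres.U.limit_metric_sequentially x(2) cuntz_krieger_algebra_def by blast
  moreover have "x k \<in> pres.F" using pres.C_F[OF x(1)] .
  moreover have "cnorm \<O> (X \<ominus>\<^bsub>\<O>\<^esub> ev (x k)) = cdist \<O> (ev (x k)) X"
    using X by (simp add: cdist_def cnorm_diff_commute)
  ultimately show ?thesis by (intro bexI[of _ "x k"]) (simp_all add: ev_iota)
qed

lemma rel1: "ev (fgen a * fstar (fgen a) * fgen a) = ev (fgen a)"
proof (cases "a \<in> edges A")
  case True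
  then show ?thesis
    using cuntz_krieger_algebra_family[of A] by (simp add: ev_mult ev_fstar ev_gen cuntz_krieger_family_def)
qed (simp add: ev_mult ev_outside ev_zero)

lemma rel2: "ev (\<Sum>a\<in>edges A. fgen a * fstar (fgen a)) = ev 1"
proof -
  have "ev (\<Sum>a\<in>edges A. fgen a * fstar (fgen a)) =
     (\<Oplus>\<^bsub>\<O>\<^esub>a\<in>edges A. ck_gen A a \<otimes>\<^bsub>\<O>\<^esub> adj \<O> (ck_gen A a))"
    unfolding ev_sum[OF finite_edges]
    by (intro finsum_cong') (auto simp: ev_mult ev_fstar ev_gen adj_closed ck_gen_closed)
  then show ?thesis
    using cuntz_krieger_algebra_family[of A] by (simp add: ev_one cuntz_krieger_family_def)
qed

text \<open>The projection of the vertex \<open>i\<close>; by \<open>rel3\<close> it is the initial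
  projection of every edge that ends there.\<close>

definition V :: "nat \<Rightarrow> edge free" where
  "V i = (\<Sum>b\<in>{b \<in> edges A. source b = i}. fgen b * fstar (fgen b))"

lemma rel3:
  assumes "a \<in> edges A"
  shows "ev (fstar (fgen a) * fgen a) = ev (V (target a))"
proof -
  have "ev (V (target a)) = (\<Oplus>\<^bsub>\<O>\<^esub>b\<in>{b \<in> edges A. source b = target a}. ck_gen A b \<otimes>\<^bsub>\<O>\<^esub> adj \<O> (ck_gen A b))"
    unfolding V_def ev_sum[OF finite_subset[OF Collect_restrict finite_edges]]
    by (intro finsum_cong') (auto simp: ev_mult ev_fstar ev_gen adj_closed ck_gen_closed)
  then show ?thesis
    using cuntz_krieger_algebra_family[of A] assms
    by (simp add: ev_mult ev_fstar ev_gen cuntz_krieger_family_def)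
qed

text \<open>The relations only say that the range projections have sum 1; their orthogonality is a
  theorem about projections. Inserting both range projections between the two factors then
  annihilates the product.\<close>

lemma orth: assumes "a \<noteq> b" shows "ev (fstar (fgen a) * fgen b) = ev 0"
proof (cases "a \<in> edges A \<and> b \<in> edges A")
  case True
  define T where "T a = ev (fgen a * fstar (fgen a))" for a
  interpret t: free_evaluation "cuntz_krieger_algebra A" T
    by standard (simp add: T_def)
  have idem: "ev (fgen a * fstar (fgen a) * (fgen a * fstar (fgen a))) = ev (fgen a * fstar (fgen a))" for a
    using cong_mult_right[OF rel1, of a "fstar (fgen a)"] by (simp add: mult.assoc)
  have tg: "t.ev (fgen a) = ev (fgen a * fstar (fgen a))" for a
    unfolding t.ev_fgen by (rule T_def)
  have "T a \<otimes>\<^bsub>\<O>\<^esub> T b = \<zero>\<^bsub>\<O>\<^esub>"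
  proof (rule t.projections_orthogonal[OF finite_edges[of A]])
    have "t.ev (sum fgen K) = ev (\<Sum>a\<in>K. fgen a * fstar (fgen a))" if "finite K" for K
      using that by (induction K rule: finite_induct)
        (simp_all add: t.ev_zero ev_zero t.ev_add ev_add tg)
    then show "t.ev (sum fgen (edges A)) = \<one>\<^bsub>\<O>\<^esub>" using rel2 by (simp add: finite_edges ev_one)
    show "adj \<O> (T a) = T a" for a by (simp add: T_def fstar_mult flip: ev_fstar)
    show "T a \<otimes>\<^bsub>\<O>\<^esub> T a = T a" for a unfolding T_def ev_mult[symmetric] by (rule idem)
  qed (use True assms in auto)
  then have 0: "ev (fgen a * fstar (fgen a) * (fgen b * fstar (fgen b))) = ev 0"
    unfolding T_def ev_mult[symmetric] by (simp add: ev_zero)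
  have star: "ev (fstar (fgen a) * fgen a * fstar (fgen a)) = ev (fstar (fgen a))"
    using cong_fstar[OF rel1, of a] by (simp add: fstar_mult mult.assoc)
  have "ev (fstar (fgen a) * fgen b) = ev ((fstar (fgen a) * fgen a * fstar (fgen a)) * (fgen b * fstar (fgen b) * fgen b))"
    by (intro cong_mult star[symmetric] rel1[symmetric])
  also have "\<dots> = ev (fstar (fgen a) * (fgen a * fstar (fgen a) * (fgen b * fstar (fgen b))) * fgen b)"
    by (simp add: mult.assoc)
  also have "\<dots> = ev (fstar (fgen a) * 0 * fgen b)"
    by (intro cong_mult 0 refl)
  finally show ?thesis by simp
next
  case False
  then consider "a \<notin> edges A" | "b \<notin> edges A" by blast
  then show ?thesis by cases (simp_all add: ev_mult ev_fstar ev_outside ev_zero adj_zero adj_closed)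
qed

lemma fstar_V [simp]: "fstar (V i) = V i"
  by (simp add: V_def fstar_sum fstar_mult)

lemma V_gen:
  assumes b: "b \<in> edges A"
  shows "ev (V i * fgen b) = ev (if source b = i then fgen b else 0)"
proof -
  have "V i * fgen b = (\<Sum>c\<in>{c \<in> edges A. source c = i}. fgen c * (fstar (fgen c) * fgen b))"
    by (simp add: V_def sum_distrib_right mult.assoc)
  also have "ev \<dots> = ev (\<Sum>c\<in>{c \<in> edges A. source c = i}. if c = b then fgen b else 0)"
  proof (rule cong_sum)
    fix c
    show "ev (fgen c * (fstar (fgen c) * fgen b)) = ev (if c = b then fgen b else 0)"
      using rel1[of b] cong_mult_left[OF orth[of c b], of "fgen c"] by (simp add: mult.assoc)
  qed
  also have "(\<Sum>c\<in>{c \<in> edges A. source c = i}. if c = b then fgen b else 0) = (if source b = i then fgen b else 0)"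
    using b by (simp add: sum.delta' finite_edges)
  finally show ?thesis .
qed

lemma gen_V:
  assumes b: "b \<in> edges A"
  shows "ev (fgen b * V i) = ev (if target b = i then fgen b else 0)"
proof -
  have *: "ev (V i * V j) = ev (if i = j then V i else 0)" for i j
  proof -
    have "V i * V j = (\<Sum>c\<in>{c \<in> edges A. source c = j}. (V i * fgen c) * fstar (fgen c))"
      by (simp add: V_def[of j] sum_distrib_left mult.assoc)
    also have "ev \<dots> = ev (\<Sum>c\<in>{c \<in> edges A. source c = j}. (if source c = i then fgen c else 0) * fstar (fgen c))"
      by (intro cong_sum cong_mult V_gen refl) auto
    also have "\<dots> = ev (\<Sum>c\<in>{c \<in> edges A. source c = j}. if i = j then fgen c * fstar (fgen c) else 0)"
      by (intro arg_cong[where f = ev] sum.cong) auto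
    also have "\<dots> = ev (if i = j then V i else 0)" by (auto simp: V_def)
    finally show ?thesis .
  qed
  have "ev (fgen b * V i) = ev (fgen b * fstar (fgen b) * fgen b * V i)"
    by (intro cong_mult rel1[symmetric] refl)
  also have "\<dots> = ev (fgen b * (fstar (fgen b) * fgen b) * V i)" by (simp add: mult.assoc)
  also have "\<dots> = ev (fgen b * V (target b) * V i)"
    by (intro cong_mult rel3 refl b)
  also have "\<dots> = ev (fgen b * (if target b = i then V (target b) else 0))"
    using cong_mult_left[OF *[of "target b" i], of "fgen b"] by (simp add: mult.assoc)
  also have "\<dots> = ev (if target b = i then fgen b * (fstar (fgen b) * fgen b) else 0)"
    using cong_mult_left[OF rel3[OF b], of "fgen b"] by auto
  also have "\<dots> = ev (if target b = i then fgen b else 0)"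
    using rel1[of b] by (auto simp: mult.assoc)
  finally show ?thesis .
qed

lemma gen_gen:
  assumes "a \<in> edges A" "b \<in> edges A" "target a \<noteq> source b"
  shows "ev (fgen a * fgen b) = ev 0"
proof -
  have "ev (fgen a * fgen b) = ev (fgen a * (V (source b) * fgen b))"
    using V_gen[OF assms(2), of "source b"] by (intro cong_mult_left) simp
  also have "\<dots> = ev (fgen a * V (source b) * fgen b)" by (simp add: mult.assoc)
  also have "\<dots> = ev (0 * fgen b)" using gen_V[OF assms(1), of "source b"] assms(3) by (intro cong_mult_right) simp
  finally show ?thesis by simp
qed

lemma V_pr:
  assumes "set \<mu> \<subseteq> edges A" "\<mu> \<noteq> []"
  shows "ev (V i * pr \<mu>) = ev (if source (hd \<mu>) = i then pr \<mu> else 0)"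
proof (cases \<mu>)
  case (Cons a \<nu>)
  then have "ev (V i * pr \<mu>) = ev (V i * fgen a * (pr \<nu> * fstar (fgen a)))"
    by (simp add: pr_Cons mult.assoc)
  also have "\<dots> = ev ((if source a = i then fgen a else 0) * (pr \<nu> * fstar (fgen a)))"
    using assms Cons by (intro cong_mult_right V_gen) simp
  finally show ?thesis using Cons by (simp add: pr_Cons mult.assoc)
qed (use assms in simp)

lemma pr_V:
  assumes "set \<mu> \<subseteq> edges A" "\<mu> \<noteq> []"
  shows "ev (pr \<mu> * V i) = ev (if source (hd \<mu>) = i then pr \<mu> else 0)"
proof -
  have "pr \<mu> * V i = fstar (V i * pr \<mu>)" by (simp add: fstar_mult)
  also have "ev \<dots> = ev (fstar (if source (hd \<mu>) = i then pr \<mu> else 0))"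
    by (rule cong_fstar[OF V_pr[OF assms]])
  finally show ?thesis by (simp split: if_splits)
qed

lemma gen_V_target: "ev (fgen a * V (target a)) = ev (fgen a)"
  using gen_V[of a "target a"] ev_outside[of a] by (cases "a \<in> edges A") (auto simp: ev_mult ev_zero)

lemma pr_mult:
  assumes "length \<mu> = length \<nu>" "set \<mu> \<subseteq> edges A" "set \<nu> \<subseteq> edges A"
  shows "ev (pr \<mu> * pr \<nu>) = ev (if \<mu> = \<nu> then pr \<mu> else 0)"
  using assms
proof (induction \<mu> \<nu> rule: list_induct2)
  case (Cons a \<mu> b \<nu>)
  let ?p = "\<lambda>x. fgen a * x * fstar (fgen b)"
  have eq: "pr (a # \<mu>) * pr (b # \<nu>) = ?p (pr \<mu> * (fstar (fgen a) * fgen b) * pr \<nu>)"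
    by (simp add: pr_Cons mult.assoc)
  show ?case
  proof (cases "a = b")
    case False
    then show ?thesis unfolding eq using orth[OF False] by (simp add: ev_mult ev_zero)
  next
    case True
    have a: "a \<in> edges A" using Cons.prems by simp
    have IH: "ev (pr \<mu> * pr \<nu>) = ev (if \<mu> = \<nu> then pr \<mu> else 0)"
      by (rule Cons.IH) (use Cons.prems in auto)
    have "ev (pr \<mu> * (fstar (fgen a) * fgen b) * pr \<nu>) = ev (pr \<mu> * V (target a) * pr \<nu>)"
      using rel3[OF a] True by (intro cong_mult refl) simp
    \<comment> \<open>The vertex projection is moved to the left end, where \<open>fgen a\<close>
      absorbs it.\<close>
    also have "\<dots> = ev (V (target a) * (pr \<mu> * pr \<nu>))"
    proof (cases "\<mu> = []")
      case False
      then have "ev (pr \<mu> * V (target a)) = ev (V (target a) * pr \<mu>)"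
        using V_pr[of \<mu> "target a"] pr_V[of \<mu> "target a"] Cons.prems by simp
      from cong_mult_right[OF this, of "pr \<nu>"] show ?thesis by (simp add: mult.assoc)
    qed simp
    also note cong_mult_left[OF IH]
    finally have "ev (?p (pr \<mu> * (fstar (fgen a) * fgen b) * pr \<nu>)) =
       ev (?p (V (target a) * (if \<mu> = \<nu> then pr \<mu> else 0)))"
      by (rule cong_mult_right[OF cong_mult_left])
    also have "\<dots> = ev ((fgen a * V (target a)) * ((if \<mu> = \<nu> then pr \<mu> else 0) * fstar (fgen b)))"
      by (simp add: mult.assoc)
    also have "\<dots> = ev (fgen a * ((if \<mu> = \<nu> then pr \<mu> else 0) * fstar (fgen b)))"
      by (rule cong_mult_right[OF gen_V_target])
    finally show ?thesis unfolding eq using True by (simp add: pr_Cons mult.assoc)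
  qed
qed simp

lemma pr_snoc: "ev (pr \<mu>) = ev (\<Sum>b\<in>edges A. pr (\<mu> @ [b]))"
proof -
  have "(\<Sum>b\<in>edges A. pr (\<mu> @ [b])) = wgen \<mu> * (\<Sum>b\<in>edges A. fgen b * fstar (fgen b)) * fstar (wgen \<mu>)"
    by (simp add: pr_def wgen_append wgen_single fstar_mult sum_distrib_left sum_distrib_right mult.assoc)
  moreover have "ev (wgen \<mu> * 1 * fstar (wgen \<mu>)) = ev (wgen \<mu> * (\<Sum>b\<in>edges A. fgen b * fstar (fgen b)) * fstar (wgen \<mu>))"
    by (intro cong_mult rel2[symmetric] refl)
  ultimately show ?thesis by (simp add: pr_def)
qed

lemma sum_pr: "ev (\<Sum>\<mu>\<in>words A m. pr \<mu>) = ev 1"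
proof (induction m)
  case (Suc m)
  have "ev (\<Sum>\<mu>\<in>words A (Suc m). pr \<mu>) = ev (\<Sum>\<mu>\<in>words A m. pr \<mu>)"
    unfolding sum_words_Suc_snoc by (intro cong_sum pr_snoc[symmetric])
  then show ?case using Suc by simp
qed simp

lemma wgen_nonpath:
  assumes "set \<mu> \<subseteq> edges A" "\<not> is_path \<mu>"
  shows "ev (wgen \<mu>) = ev 0"
  using assms
proof (induction \<mu> rule: induct_list012)
  case (3 a b \<mu>)
  show ?case
  proof (cases "target a = source b")
    case True
    then have "ev (wgen (b # \<mu>)) = ev 0" using 3 by (auto simp: is_path_def)
    then show ?thesis by (simp add: wgen_Cons[of a] ev_mult ev_zero)
  next
    case False
    have "wgen (a # b # \<mu>) = fgen a * fgen b * wgen \<mu>" by (simp add: wgen_Cons mult.assoc)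
    then show ?thesis using gen_gen[of a b] False 3 by (simp add: ev_mult ev_zero)
  qed
qed (auto simp: is_path_def)

lemma pr_nonpath: "set \<mu> \<subseteq> edges A \<Longrightarrow> \<not> is_path \<mu> \<Longrightarrow> ev (pr \<mu>) = ev 0"
  using wgen_nonpath[of \<mu>] by (simp add: pr_def ev_mult ev_zero)

lemma ev_wgen: "set \<mu> \<subseteq> edges A \<Longrightarrow> ev (wgen \<mu>) = ck_word A \<mu>"
  by (induction \<mu>) (simp_all add: ck_word_def Let_def ev_one wgen_Cons ev_mult ev_gen)

lemma wgen_F: "set \<mu> \<subseteq> edges A \<Longrightarrow> wgen \<mu> \<in> pres.F"
  by (auto simp: wgen_def free_single_iff set_word_letters)

lemma pr_F: "set \<mu> \<subseteq> edges A \<Longrightarrow> pr \<mu> \<in> pres.F"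
  by (simp add: pr_def wgen_F free_mult free_fstar)

end

section \<open>Locally constant elements and the projections they approximate\<close>

context cstar_algebra
begin

lemma closure_subalgebra:
  assumes L: "L \<subseteq> carrier \<AA>" "\<zero> \<in> L"
    and cl: "\<And>x y. x \<in> L \<Longrightarrow> y \<in> L \<Longrightarrow> x \<oplus> y \<in> L" "\<And>x y. x \<in> L \<Longrightarrow> y \<in> L \<Longrightarrow> x \<otimes> y \<in> L"
      "\<And>x. x \<in> L \<Longrightarrow> adj \<AA> x \<in> L" "\<And>x c. x \<in> L \<Longrightarrow> c \<odot> x \<in> L"
  shows "cstar_subalgebra \<AA> {y. \<exists>f. range f \<subseteq> L \<and> conv f y}"
  unfolding cstar_subalgebra_conv
proof (intro conjI ballI allI impI)
  let ?C = "{y. \<exists>f. range f \<subseteq> L \<and> conv f y}"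
  show "?C \<subseteq> carrier \<AA>" by (auto simp: conv_def)
  show "\<zero> \<in> ?C" using L conv_const[of \<zero>] by (intro CollectI exI[of _ "\<lambda>_. \<zero>"]) auto
  fix x y assume "x \<in> ?C" "y \<in> ?C"
  then obtain f g where fg: "range f \<subseteq> L" "range g \<subseteq> L" "conv f x" "conv g y" by blast
  show "x \<oplus> y \<in> ?C" using fg conv_add cl(1) by (intro CollectI exI[of _ "\<lambda>n. f n \<oplus> g n"]) blast
  show "x \<otimes> y \<in> ?C" using fg conv_mult cl(2) by (intro CollectI exI[of _ "\<lambda>n. f n \<otimes> g n"]) blast
next
  let ?C = "{y. \<exists>f. range f \<subseteq> L \<and> conv f y}"
  fix x c assume "x \<in> ?C"
  then obtain f where f: "range f \<subseteq> L" "conv f x" by blast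
  show "adj \<AA> x \<in> ?C" using f conv_adj cl(3) by (intro CollectI exI[of _ "\<lambda>n. adj \<AA> (f n)"]) blast
  show "c \<odot> x \<in> ?C" using f conv_smult cl(4) by (intro CollectI exI[of _ "\<lambda>n. c \<odot> f n"]) blast
next
  let ?C = "{y. \<exists>f. range f \<subseteq> L \<and> conv f y}"
  fix f y assume f: "range f \<subseteq> ?C" "conv f y"
  \<comment> \<open>A limit of limits: every \<open>f n\<close> is replaced by an element of
    \<open>L\<close> at distance below \<open>1 / (n + 1)\<close>, which does not change the
    limit.\<close>
  have "\<exists>s\<in>L. cnorm \<AA> (s \<ominus> f n) < 1 / Suc n" for n
  proof -
    obtain g where g: "range g \<subseteq> L" "conv g (f n)" using f by blast
    then have "(\<lambda>k. cnorm \<AA> (g k \<ominus> f n)) \<longlonglongrightarrow> 0" by (simp add: conv_def)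
    from order_tendstoD(2)[OF this, of "1 / Suc n"] obtain k where "cnorm \<AA> (g k \<ominus> f n) < 1 / Suc n"
      by (auto simp: eventually_sequentially)
    then show ?thesis using g by blast
  qed
  then obtain s where s: "\<And>n. s n \<in> L" "\<And>n. cnorm \<AA> (s n \<ominus> f n) < 1 / Suc n" by metis
  have fc: "f n \<in> carrier \<AA>" "y \<in> carrier \<AA>" "s n \<in> carrier \<AA>" for n using f s L by (auto simp: conv_def)
  have "conv s y"
  proof (rule conv_le)
    show "(\<lambda>n. 1 / Suc n + cnorm \<AA> (f n \<ominus> y)) \<longlonglongrightarrow> 0"
      using tendsto_add[OF LIMSEQ_inverse_real_of_nat, of "\<lambda>n. cnorm \<AA> (f n \<ominus> y)" 0] f(2)
      by (simp add: conv_def inverse_eq_divide)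
    show "cnorm \<AA> (s n \<ominus> y) \<le> 1 / Suc n + cnorm \<AA> (f n \<ominus> y)" for n
      using cnorm_diff_triangle[OF fc(3) fc(1) fc(2), of n n] s(2)[of n] by simp
  qed (use fc in auto)
  then show "y \<in> ?C" using s(1) by blast
qed

lemma commutant_subalgebra:
  assumes p: "p \<in> carrier \<AA>" "adj \<AA> p = p"
  shows "cstar_subalgebra \<AA> {x \<in> carrier \<AA>. x \<otimes> p = p \<otimes> x}"
  unfolding cstar_subalgebra_conv
proof (intro conjI ballI allI impI; (elim CollectE conjE)?)
  fix x y assume x: "x \<in> carrier \<AA>" "x \<otimes> p = p \<otimes> x" and y: "y \<in> carrier \<AA>" "y \<otimes> p = p \<otimes> y"
  have "x \<otimes> y \<otimes> p = x \<otimes> (p \<otimes> y)" using x y p by (simp add: m_assoc)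
  also have "\<dots> = p \<otimes> (x \<otimes> y)" using x y p by (simp flip: m_assoc)
  finally show "x \<otimes> y \<in> {x \<in> carrier \<AA>. x \<otimes> p = p \<otimes> x}" using x y by simp
next
  fix x assume x: "x \<in> carrier \<AA>" "x \<otimes> p = p \<otimes> x"
  have "adj \<AA> x \<otimes> p = adj \<AA> (p \<otimes> x)" using x(1) p by (simp add: adj_mult)
  also have "\<dots> = adj \<AA> (x \<otimes> p)" using x(2) by simp
  also have "\<dots> = p \<otimes> adj \<AA> x" using x(1) p by (simp add: adj_mult)
  finally show "adj \<AA> x \<in> {x \<in> carrier \<AA>. x \<otimes> p = p \<otimes> x}" using x(1) by (simp add: adj_closed)
next
  fix f y assume f: "range f \<subseteq> {x \<in> carrier \<AA>. x \<otimes> p = p \<otimes> x}" "conv f y"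
  then have "(\<lambda>n. f n \<otimes> p) = (\<lambda>n. p \<otimes> f n)" by auto
  then have "y \<otimes> p = p \<otimes> y"
    using conv_mult[OF f(2) conv_const[OF p(1)]] conv_mult[OF conv_const[OF p(1)] f(2)] conv_unique by metis
  then show "y \<in> {x \<in> carrier \<AA>. x \<otimes> p = p \<otimes> x}" using f(2) by (simp add: conv_def)
qed (use p in \<open>auto simp: l_distr r_distr smult_mult_left smult_mult_right smult_closed\<close>)

text \<open>If \<open>f\<close> and \<open>g = p - f\<close> were both nonzero, they would have norm
  1, and multiplying \<open>f - c p\<close> by them would give \<open>|1 - c| < 1/2\<close> and
  \<open>|c| < 1/2\<close>.\<close>

lemma subprojection_dichotomy:
  assumes p: "p \<in> carrier \<AA>" "adj \<AA> p = p" "p \<otimes> p = p"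
    and f: "f \<in> carrier \<AA>" "adj \<AA> f = f" "f \<otimes> f = f" "f \<otimes> p = f"
    and le: "cnorm \<AA> (f \<ominus> c \<odot> p) < 1/2"
  shows "f = \<zero> \<or> f = p"
proof (rule ccontr)
  assume "\<not> (f = \<zero> \<or> f = p)"
  then have ne: "f \<noteq> \<zero>" "p \<ominus> f \<noteq> \<zero>"
    using p(1) f(1) cnorm_diff_eq_zero[of p f] cnorm_zero by auto
  have pf: "p \<otimes> f = f" using arg_cong[OF f(4), of "adj \<AA>"] f p adj_mult[of f p] by simp
  define g where "g = p \<ominus> f"
  have g: "g \<in> carrier \<AA>" "adj \<AA> g = g" "g \<otimes> g = g" "g \<otimes> f = \<zero>" "g \<otimes> p = g"
    using p f pf by (auto simp: g_def adj_add adj_minus a_minus_def l_distr r_distr l_minus r_minus r_neg)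
  have nf: "cnorm \<AA> f = 1" using cnorm_projection[OF f(1-3)] cnorm_eq_zero[OF f(1)] ne by auto
  have ng: "cnorm \<AA> g = 1" using cnorm_projection[OF g(1-3)] cnorm_eq_zero[OF g(1)] ne by (auto simp: g_def)
  note [simp] = smult_closed
  have "f \<otimes> (f \<ominus> c \<odot> p) = (1 - c) \<odot> f"
    using p f smult_add_left[of f 1 "- c"] smult_smult[of f "-1" c]
    by (simp add: a_minus_def r_distr r_minus smult_mult_right smult_one flip: smult_minus_one)
  then have "cmod (1 - c) < 1/2"
    using cnorm_mult[of f "f \<ominus> c \<odot> p"] p f le nf cnorm_smult[of f "1 - c"] by simp
  moreover have "g \<otimes> (f \<ominus> c \<odot> p) = (- c) \<odot> g"
    using p f g smult_smult[of g "-1" c]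
    by (simp add: a_minus_def r_distr r_minus smult_mult_right flip: smult_minus_one)
  then have "cmod c < 1/2"
    using cnorm_mult[of g "f \<ominus> c \<odot> p"] p f g le ng cnorm_smult[of g "- c"] by simp
  ultimately show False using norm_triangle_ineq[of "1 - c" c] by simp
qed

end

context cuntz_krieger
begin

lemma fscale_0: "fscale c 0 = 0"
  by (simp add: fscale_def)

text \<open>The diagonal element that corresponds to the function \<open>c\<close> of the first
  \<open>m\<close> letters of a sequence.\<close>

definition level_sum :: "nat \<Rightarrow> (edge list \<Rightarrow> complex) \<Rightarrow> edge free" where
  "level_sum m c = (\<Sum>\<mu>\<in>words A m. fscale (c \<mu>) (pr \<mu>))"

lemma level_sum_cong: "(\<And>\<mu>. \<mu> \<in> words A m \<Longrightarrow> c \<mu> = d \<mu>) \<Longrightarrow> level_sum m c = level_sum m d"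
  by (simp add: level_sum_def)

lemma wordsD: "\<mu> \<in> words A m \<Longrightarrow> set \<mu> \<subseteq> edges A" "\<mu> \<in> words A m \<Longrightarrow> length \<mu> = m"
  by (auto simp: words_def)

lemma level_sum_Suc: "ev (level_sum m c) = ev (level_sum (Suc m) (\<lambda>\<mu>. c (take m \<mu>)))"
proof -
  have "level_sum (Suc m) (\<lambda>\<mu>. c (take m \<mu>)) = (\<Sum>\<mu>\<in>words A m. fscale (c \<mu>) (\<Sum>b\<in>edges A. pr (\<mu> @ [b])))"
    unfolding level_sum_def sum_words_Suc_snoc
    by (intro sum.cong refl) (simp add: fscale_def sum_distrib_left wordsD)
  then show ?thesis unfolding level_sum_def by (auto intro!: cong_sum cong_fscale pr_snoc)
qed

lemma level_sum_raise: "m \<le> n \<Longrightarrow> ev (level_sum m c) = ev (level_sum n (\<lambda>\<mu>. c (take m \<mu>)))"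
proof (induction n rule: dec_induct)
  case base
  then show ?case by (intro arg_cong[where f = ev] level_sum_cong) (simp add: wordsD)
next
  case (step n)
  then show ?case using level_sum_Suc[of n "\<lambda>\<mu>. c (take m \<mu>)"] by (simp add: min_def)
qed

lemma level_sum_add: "level_sum m c + level_sum m d = level_sum m (\<lambda>\<mu>. c \<mu> + d \<mu>)"
  by (simp add: level_sum_def fscale_add_left sum.distrib)

lemma level_sum_scale: "fscale k (level_sum m c) = level_sum m (\<lambda>\<mu>. k * c \<mu>)"
  by (simp add: level_sum_def fscale_def[of k] sum_distrib_left flip: fscale_fscale)

lemma level_sum_star: "fstar (level_sum m c) = level_sum m (\<lambda>\<mu>. cnj (c \<mu>))"
  by (simp add: level_sum_def fstar_sum fstar_fscale)

lemma level_sum_pr: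
  assumes "\<mu> \<in> words A m"
  shows "ev (level_sum m c * pr \<mu>) = ev (fscale (c \<mu>) (pr \<mu>))"
proof -
  have "level_sum m c * pr \<mu> = (\<Sum>\<nu>\<in>words A m. fscale (c \<nu>) (pr \<nu> * pr \<mu>))"
    by (simp add: level_sum_def sum_distrib_right fscale_mult_left)
  also have "ev \<dots> = ev (\<Sum>\<nu>\<in>words A m. if \<nu> = \<mu> then fscale (c \<mu>) (pr \<mu>) else 0)"
  proof (rule cong_sum)
    fix \<nu> assume "\<nu> \<in> words A m"
    then have "ev (pr \<nu> * pr \<mu>) = ev (if \<nu> = \<mu> then pr \<nu> else 0)"
      using assms by (intro pr_mult) (auto simp: words_def)
    from cong_fscale[OF this, of "c \<nu>"]
    show "ev (fscale (c \<nu>) (pr \<nu> * pr \<mu>)) = ev (if \<nu> = \<mu> then fscale (c \<mu>) (pr \<mu>) else 0)"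
      by (cases "\<nu> = \<mu>") (simp_all add: fscale_0)
  qed
  also have "(\<Sum>\<nu>\<in>words A m. if \<nu> = \<mu> then fscale (c \<mu>) (pr \<mu>) else 0) = fscale (c \<mu>) (pr \<mu>)"
    using assms by simp
  finally show ?thesis .
qed

lemma level_sum_mult: "ev (level_sum m c * level_sum m d) = ev (level_sum m (\<lambda>\<mu>. c \<mu> * d \<mu>))"
proof -
  have "level_sum m c * level_sum m d = (\<Sum>\<mu>\<in>words A m. fscale (d \<mu>) (level_sum m c * pr \<mu>))"
    by (simp add: level_sum_def[of m d] sum_distrib_left fscale_mult_right)
  also have "ev \<dots> = ev (\<Sum>\<mu>\<in>words A m. fscale (d \<mu>) (fscale (c \<mu>) (pr \<mu>)))"
    by (intro cong_sum cong_fscale level_sum_pr)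
  also have "(\<Sum>\<mu>\<in>words A m. fscale (d \<mu>) (fscale (c \<mu>) (pr \<mu>))) = level_sum m (\<lambda>\<mu>. c \<mu> * d \<mu>)"
    by (simp add: level_sum_def fscale_fscale mult.commute)
  finally show ?thesis .
qed

lemma sum_pr_level_sum: "K \<subseteq> words A m \<Longrightarrow> sum pr K = level_sum m (\<lambda>\<mu>. if \<mu> \<in> K then 1 else 0)"
proof -
  assume K: "K \<subseteq> words A m"
  have "level_sum m (\<lambda>\<mu>. if \<mu> \<in> K then 1 else 0) = (\<Sum>\<mu>\<in>words A m. if \<mu> \<in> K then pr \<mu> else 0)"
    unfolding level_sum_def by (intro sum.cong) auto
  also have "\<dots> = sum pr K" using K by (simp add: sum.inter_restrict[symmetric] Int_absorb1)
  finally show ?thesis by simp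
qed

lemma gen_level_sum:
  assumes "a \<in> edges A"
  shows "fgen a * level_sum m c * fstar (fgen a) = level_sum (Suc m) (\<lambda>\<nu>. if hd \<nu> = a then c (tl \<nu>) else 0)"
proof -
  have "level_sum (Suc m) (\<lambda>\<nu>. if hd \<nu> = a then c (tl \<nu>) else 0) =
     (\<Sum>b\<in>edges A. if b = a then (\<Sum>\<mu>\<in>words A m. fscale (c \<mu>) (pr (a # \<mu>))) else 0)"
    unfolding level_sum_def sum_words_Suc by (intro sum.cong refl) (auto simp: fscale_def)
  also have "\<dots> = (\<Sum>\<mu>\<in>words A m. fscale (c \<mu>) (pr (a # \<mu>)))"
    using assms by (simp add: finite_edges)
  also have "\<dots> = fgen a * level_sum m c * fstar (fgen a)"
    by (simp add: level_sum_def pr_Cons sum_distrib_left sum_distrib_right fscale_mult_left fscale_mult_right)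
  finally show ?thesis by simp
qed

text \<open>The locally constant functions. By passing to a common level they form a commutative
  *-subalgebra, which is dense in the diagonal.\<close>

definition level_elements :: "ck_element set" where
  "level_elements = {ev (level_sum m c) | m c. True}"

lemma level_common:
  assumes "x \<in> level_elements" "y \<in> level_elements"
  obtains m c d where "x = ev (level_sum m c)" "y = ev (level_sum m d)"
proof -
  obtain m c n d where "x = ev (level_sum m c)" "y = ev (level_sum n d)" using assms by (auto simp: level_elements_def)
  then show ?thesis using level_sum_raise[of m "max m n" c] level_sum_raise[of n "max m n" d] that by simp
qed

lemma level_closed:
  assumes "x \<in> level_elements" "y \<in> level_elements"
  shows "x \<oplus>\<^bsub>\<O>\<^esub> y \<in> level_elements" "x \<otimes>\<^bsub>\<O>\<^esub> y \<in> level_elements" "x \<otimes>\<^bsub>\<O>\<^esub> y = y \<otimes>\<^bsub>\<O>\<^esub> x"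
    "adj \<O> x \<in> level_elements" "k \<odot>\<^bsub>\<O>\<^esub> x \<in> level_elements"
    "a \<in> edges A \<Longrightarrow> ev (fgen a) \<otimes>\<^bsub>\<O>\<^esub> x \<otimes>\<^bsub>\<O>\<^esub> adj \<O> (ev (fgen a)) \<in> level_elements"
proof -
  obtain m c d where x: "x = ev (level_sum m c)" and y: "y = ev (level_sum m d)" using level_common assms by metis
  show "x \<oplus>\<^bsub>\<O>\<^esub> y \<in> level_elements" "adj \<O> x \<in> level_elements" "k \<odot>\<^bsub>\<O>\<^esub> x \<in> level_elements"
    unfolding x y by (auto simp: level_elements_def level_sum_add level_sum_scale level_sum_star simp flip: ev_add ev_fstar ev_fscale)
  show "x \<otimes>\<^bsub>\<O>\<^esub> y \<in> level_elements" "x \<otimes>\<^bsub>\<O>\<^esub> y = y \<otimes>\<^bsub>\<O>\<^esub> x"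
    unfolding x y by (auto simp: level_elements_def level_sum_mult mult.commute simp flip: ev_mult)
  show "ev (fgen a) \<otimes>\<^bsub>\<O>\<^esub> x \<otimes>\<^bsub>\<O>\<^esub> adj \<O> (ev (fgen a)) \<in> level_elements" if "a \<in> edges A"
    unfolding x using gen_level_sum[OF that, of m c] by (auto simp: level_elements_def simp flip: ev_mult ev_fstar)
qed

lemma level_zero: "\<zero>\<^bsub>\<O>\<^esub> \<in> level_elements"
proof -
  have "level_sum 0 (\<lambda>_. 0) = 0" by (simp add: level_sum_def)
  then have "\<zero>\<^bsub>\<O>\<^esub> = ev (level_sum 0 (\<lambda>_. 0))" by (simp add: ev_zero)
  then show ?thesis unfolding level_elements_def by blast
qed

lemma sum_pr_level: "K \<subseteq> words A m \<Longrightarrow> ev (sum pr K) \<in> level_elements"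
  unfolding level_elements_def using sum_pr_level_sum[of K m] by auto

lemma pr_level: "set \<mu> \<subseteq> edges A \<Longrightarrow> ev (pr \<mu>) \<in> level_elements"
  using sum_pr_level[of "{\<mu>}" "length \<mu>"] by (simp add: words_def)

abbreviation (input) \<D> where "\<D> \<equiv> ck_diagonal A"

lemma diagonal_eq: "\<D> = generated_cstar_subalgebra \<O> {ev (pr \<mu>) | \<mu>. \<mu> \<noteq> [] \<and> set \<mu> \<subseteq> edges A}"
proof -
  have *: "ck_word A \<mu> \<otimes>\<^bsub>\<O>\<^esub> adj \<O> (ck_word A \<mu>) = ev (pr \<mu>)" if "set \<mu> \<subseteq> edges A" for \<mu>
    using that by (simp add: pr_def ev_mult ev_fstar ev_wgen)
  have "{ck_word A \<mu> \<otimes>\<^bsub>\<O>\<^esub> adj \<O> (ck_word A \<mu>) | \<mu>. \<mu> \<noteq> [] \<and> set \<mu> \<subseteq> edges A} =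
    {ev (pr \<mu>) | \<mu>. \<mu> \<noteq> [] \<and> set \<mu> \<subseteq> edges A}"
    by (intro Collect_cong ex_cong1) (metis *)
  then show ?thesis by (simp add: ck_diagonal_def Let_def)
qed

lemma gens_closed: "{ev (pr \<mu>) | \<mu>. \<mu> \<noteq> [] \<and> set \<mu> \<subseteq> edges A} \<subseteq> carrier \<O>"
  by auto

lemma diagonal_subalgebra: "cstar_subalgebra \<O> \<D>"
  unfolding diagonal_eq by (rule generated_subalgebra) (rule gens_closed)

lemma diagonal_closed: "x \<in> \<D> \<Longrightarrow> x \<in> carrier \<O>"
  using diagonal_subalgebra by (auto simp: cstar_subalgebra_def)

lemma level_diagonal: "level_elements \<subseteq> \<D>"
proof -
  note D = iffD1[OF cstar_subalgebra_conv diagonal_subalgebra]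
  have pr: "ev (pr \<mu>) \<in> \<D>" if "\<mu> \<noteq> []" "set \<mu> \<subseteq> edges A" for \<mu>
    unfolding diagonal_eq by (rule subsetD[OF generated_subset]) (use that in blast)
  \<comment> \<open>The diagonal is generated by nonempty words only, so the claim is proved at
    level \<open>Suc m\<close> and carried down to level \<open>m\<close> by
    \<open>level_sum_Suc\<close>.\<close>
  have "ev (\<Sum>\<mu>\<in>K. fscale (c \<mu>) (pr \<mu>)) \<in> \<D>" if "finite K" "K \<subseteq> words A (Suc m)" for K m c
    using that
  proof (induction K rule: finite_induct)
    case (insert \<mu> K)
    then have "ev (pr \<mu>) \<in> \<D>" by (intro pr) (auto simp: words_def)
    then show ?case using insert D by (simp add: ev_add ev_fscale)
  qed (use D in \<open>simp add: ev_zero\<close>)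
  from this[OF finite_words subset_refl] have "ev (level_sum (Suc m) c) \<in> \<D>" for m c unfolding level_sum_def .
  then have "ev (level_sum m c) \<in> \<D>" for m c by (subst level_sum_Suc)
  then show ?thesis by (auto simp: level_elements_def)
qed

lemma diagonal_approx:
  assumes "d \<in> \<D>" "e > 0"
  shows "\<exists>s\<in>level_elements. cnorm \<O> (s \<ominus>\<^bsub>\<O>\<^esub> d) < e"
proof -
  have "\<D> \<subseteq> {y. \<exists>f. range f \<subseteq> level_elements \<and> conv f y}"
    unfolding diagonal_eq
  proof (rule generated_least[OF closure_subalgebra])
    show "level_elements \<subseteq> carrier \<O>" by (auto simp: level_elements_def)
    show "{ev (pr \<mu>) | \<mu>. \<mu> \<noteq> [] \<and> set \<mu> \<subseteq> edges A} \<subseteq> {y. \<exists>f. range f \<subseteq> level_elements \<and> conv f y}"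
    proof safe
      fix \<mu> assume "set \<mu> \<subseteq> edges A"
      then show "\<exists>f. range f \<subseteq> level_elements \<and> conv f (ev (pr \<mu>))"
        using pr_level conv_const by (intro exI[of _ "\<lambda>_. ev (pr \<mu>)"]) auto
    qed
  qed (fact level_zero | erule (1) level_closed | rule level_closed, assumption, assumption)+
  then obtain f where f: "range f \<subseteq> level_elements" "conv f d" using assms by blast
  then have "(\<lambda>n. cnorm \<O> (f n \<ominus>\<^bsub>\<O>\<^esub> d)) \<longlonglongrightarrow> 0" by (simp add: conv_def)
  from order_tendstoD(2)[OF this assms(2)] obtain n where "cnorm \<O> (f n \<ominus>\<^bsub>\<O>\<^esub> d) < e"
    unfolding eventually_sequentially by blast
  then show ?thesis using f by blast
qed

lemma diagonal_commute:
  assumes "d \<in> \<D>" "set \<mu> \<subseteq> edges A"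
  shows "d \<otimes>\<^bsub>\<O>\<^esub> ev (pr \<mu>) = ev (pr \<mu>) \<otimes>\<^bsub>\<O>\<^esub> d"
proof -
  have "adj \<O> (ev (pr \<mu>)) = ev (pr \<mu>)" by (simp flip: ev_fstar)
  then have "\<D> \<subseteq> {x \<in> carrier \<O>. x \<otimes>\<^bsub>\<O>\<^esub> ev (pr \<mu>) = ev (pr \<mu>) \<otimes>\<^bsub>\<O>\<^esub> x}"
    unfolding diagonal_eq
    by (intro generated_least commutant_subalgebra) (auto intro!: level_closed(3) pr_level assms)
  then show ?thesis using assms by blast
qed

definition is_proj :: "ck_element \<Rightarrow> bool" where
  "is_proj e \<longleftrightarrow> e \<in> \<D> \<and> adj \<O> e = e \<and> e \<otimes>\<^bsub>\<O>\<^esub> e = e"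

lemma is_proj_sum_pr: "K \<subseteq> words A m \<Longrightarrow> is_proj (ev (sum pr K))"
proof -
  assume K: "K \<subseteq> words A m"
  have "ev (sum pr K * sum pr K) = ev (sum pr K)"
    unfolding sum_pr_level_sum[OF K] level_sum_mult by (intro arg_cong[where f = ev] level_sum_cong) simp
  then show ?thesis
    using level_diagonal sum_pr_level[OF K] by (auto simp: is_proj_def fstar_sum simp flip: ev_fstar ev_mult)
qed

text \<open>A projection of the diagonal lies within 1/2 of some function of the first
  \<open>m\<close> letters. On each cylinder of length \<open>m\<close> it is then within 1/2 of a
  scalar, so \<open>subprojection_dichotomy\<close> makes it either zero there or the whole cylinder
  projection.\<close>

theorem is_proj_iff: "is_proj e \<longleftrightarrow> (\<exists>m K. K \<subseteq> words A m \<and> e = ev (sum pr K))"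
proof
  assume e: "is_proj e"
  then have ec: "e \<in> carrier \<O>" "adj \<O> e = e" "e \<otimes>\<^bsub>\<O>\<^esub> e = e" and eD: "e \<in> \<D>"
    using diagonal_closed by (auto simp: is_proj_def)
  obtain s where s: "s \<in> level_elements" "cnorm \<O> (s \<ominus>\<^bsub>\<O>\<^esub> e) < 1/2"
    using diagonal_approx[OF eD, of "1/2"] by auto
  then obtain m c where s: "cnorm \<O> (ev (level_sum m c) \<ominus>\<^bsub>\<O>\<^esub> e) < 1/2" by (auto simp: level_elements_def)
  define W where "W = words A m"
  have dich: "e \<otimes>\<^bsub>\<O>\<^esub> ev (pr \<mu>) = \<zero>\<^bsub>\<O>\<^esub> \<or> e \<otimes>\<^bsub>\<O>\<^esub> ev (pr \<mu>) = ev (pr \<mu>)" if \<mu>: "\<mu> \<in> W" for \<mu>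
  proof (rule subprojection_dichotomy)
    let ?p = "ev (pr \<mu>)"
    have mE: "set \<mu> \<subseteq> edges A" using \<mu> by (simp add: W_def wordsD)
    note comm = diagonal_commute[OF eD mE]
    show p: "adj \<O> ?p = ?p" "?p \<otimes>\<^bsub>\<O>\<^esub> ?p = ?p"
      using pr_mult[OF refl mE mE] by (simp_all flip: ev_fstar ev_mult)
    show "adj \<O> (e \<otimes>\<^bsub>\<O>\<^esub> ?p) = e \<otimes>\<^bsub>\<O>\<^esub> ?p" using ec p comm by (simp add: adj_mult)
    show *: "e \<otimes>\<^bsub>\<O>\<^esub> ?p \<otimes>\<^bsub>\<O>\<^esub> ?p = e \<otimes>\<^bsub>\<O>\<^esub> ?p" using ec p by (simp add: m_assoc)
    have "e \<otimes>\<^bsub>\<O>\<^esub> ?p \<otimes>\<^bsub>\<O>\<^esub> (e \<otimes>\<^bsub>\<O>\<^esub> ?p) = e \<otimes>\<^bsub>\<O>\<^esub> (?p \<otimes>\<^bsub>\<O>\<^esub> e) \<otimes>\<^bsub>\<O>\<^esub> ?p" using ec by (simp add: m_assoc)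
    also have "\<dots> = e \<otimes>\<^bsub>\<O>\<^esub> e \<otimes>\<^bsub>\<O>\<^esub> (?p \<otimes>\<^bsub>\<O>\<^esub> ?p)" unfolding comm[symmetric] using ec(1) by (simp add: m_assoc)
    finally show "e \<otimes>\<^bsub>\<O>\<^esub> ?p \<otimes>\<^bsub>\<O>\<^esub> (e \<otimes>\<^bsub>\<O>\<^esub> ?p) = e \<otimes>\<^bsub>\<O>\<^esub> ?p" using ec p by simp
    have "e \<otimes>\<^bsub>\<O>\<^esub> ?p \<ominus>\<^bsub>\<O>\<^esub> c \<mu> \<odot>\<^bsub>\<O>\<^esub> ?p = (e \<ominus>\<^bsub>\<O>\<^esub> ev (level_sum m c)) \<otimes>\<^bsub>\<O>\<^esub> ?p"
      using level_sum_pr[of \<mu> m c] \<mu> ec by (simp add: W_def ev_mult ev_fscale a_minus_def l_distr l_minus)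
    moreover have "cnorm \<O> ((e \<ominus>\<^bsub>\<O>\<^esub> ev (level_sum m c)) \<otimes>\<^bsub>\<O>\<^esub> ?p) \<le> cnorm \<O> (e \<ominus>\<^bsub>\<O>\<^esub> ev (level_sum m c)) * cnorm \<O> ?p"
      using ec by (intro cnorm_mult) auto
    moreover have "\<dots> \<le> cnorm \<O> (e \<ominus>\<^bsub>\<O>\<^esub> ev (level_sum m c)) * 1"
      using cnorm_projection[OF ev_closed p] ec by (intro mult_left_mono cnorm_nonneg) auto
    ultimately show "cnorm \<O> (e \<otimes>\<^bsub>\<O>\<^esub> ?p \<ominus>\<^bsub>\<O>\<^esub> c \<mu> \<odot>\<^bsub>\<O>\<^esub> ?p) < 1/2"
      using s cnorm_diff_commute[of e "ev (level_sum m c)"] ec by simp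
  qed (use ec in auto)
  have "e \<otimes>\<^bsub>\<O>\<^esub> ev (sum pr W') = ev (sum pr {\<mu>\<in>W'. e \<otimes>\<^bsub>\<O>\<^esub> ev (pr \<mu>) = ev (pr \<mu>)})"
    if "finite W'" "W' \<subseteq> W" for W'
    using that
  proof (induction W' rule: finite_induct)
    case empty
    then show ?case using ec by (simp add: ev_zero)
  next
    case (insert \<mu> W')
    let ?K = "{\<mu>\<in>W'. e \<otimes>\<^bsub>\<O>\<^esub> ev (pr \<mu>) = ev (pr \<mu>)}"
    have "e \<otimes>\<^bsub>\<O>\<^esub> ev (sum pr (insert \<mu> W')) = e \<otimes>\<^bsub>\<O>\<^esub> ev (pr \<mu>) \<oplus>\<^bsub>\<O>\<^esub> ev (sum pr ?K)"
      using insert ec by (simp add: ev_add r_distr)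
    also have "\<dots> = ev (sum pr {\<nu>\<in>insert \<mu> W'. e \<otimes>\<^bsub>\<O>\<^esub> ev (pr \<nu>) = ev (pr \<nu>)})"
    proof (cases "e \<otimes>\<^bsub>\<O>\<^esub> ev (pr \<mu>) = ev (pr \<mu>)")
      case True
      then have "{\<nu>\<in>insert \<mu> W'. e \<otimes>\<^bsub>\<O>\<^esub> ev (pr \<nu>) = ev (pr \<nu>)} = insert \<mu> ?K" by blast
      then show ?thesis using True insert.hyps by (simp add: ev_add)
    next
      case False
      then have "{\<nu>\<in>insert \<mu> W'. e \<otimes>\<^bsub>\<O>\<^esub> ev (pr \<nu>) = ev (pr \<nu>)} = ?K" by blast
      then show ?thesis using dich[of \<mu>] False insert.prems by simp
    qed
    finally show ?case .
  qed
  note W = this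
  define K where "K = {\<mu>\<in>W. e \<otimes>\<^bsub>\<O>\<^esub> ev (pr \<mu>) = ev (pr \<mu>)}"
  have "e = ev (sum pr K)"
    using W[of W] ec(1) sum_pr[of m] by (simp add: W_def ev_one K_def)
  moreover have "K \<subseteq> words A m" by (auto simp: K_def W_def)
  ultimately show "\<exists>m K. K \<subseteq> words A m \<and> e = ev (sum pr K)" by (intro exI conjI)
next
  assume "\<exists>m K. K \<subseteq> words A m \<and> e = ev (sum pr K)"
  then obtain m K where "K \<subseteq> words A m" "e = ev (sum pr K)" by (elim exE conjE)
  then show "is_proj e" using is_proj_sum_pr[of K m] by simp
qed

end

section \<open>Triplets of labelled graphs\<close>

context cuntz_krieger
begin

lemma familyI:
  assumes 1: "\<And>b. b \<in> edges B \<Longrightarrow> ev (t b * fstar (t b) * t b) = ev (t b)"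
    and 2: "ev (\<Sum>b\<in>edges B. t b * fstar (t b)) = ev 1"
    and 3: "\<And>b. b \<in> edges B \<Longrightarrow>
      ev (fstar (t b) * t b) = ev (\<Sum>c\<in>{c \<in> edges B. source c = target b}. t c * fstar (t c))"
  shows "cuntz_krieger_family B \<O> (\<lambda>b. ev (t b))"
proof -
  have s: "(\<Oplus>\<^bsub>\<O>\<^esub>b\<in>K. ev (t b) \<otimes>\<^bsub>\<O>\<^esub> adj \<O> (ev (t b))) = ev (\<Sum>b\<in>K. t b * fstar (t b))"
    if "K \<subseteq> edges B" for K
    unfolding ev_sum[OF finite_subset[OF that finite_edges]] by (simp add: ev_mult ev_fstar)
  show ?thesis
    unfolding cuntz_krieger_family_def s[OF subset_refl] s[OF Collect_restrict]
    using 1 2 3 by (simp add: ev_one ev_mult ev_fstar image_subset_iff)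
qed

definition paths :: "nat \<Rightarrow> edge list set" where
  "paths m = {\<mu> \<in> words A m. is_path \<mu>}"

lemma finite_paths [simp]: "finite (paths m)" by (simp add: paths_def)

lemma sum_pr_paths: "ev (\<Sum>\<mu>\<in>{\<mu> \<in> words A m. Q \<mu>}. pr \<mu>) = ev (\<Sum>\<mu>\<in>{\<mu> \<in> paths m. Q \<mu>}. pr \<mu>)"
proof -
  have "ev (\<Sum>\<mu>\<in>{\<mu> \<in> words A m. Q \<mu>}. pr \<mu>) = ev (\<Sum>\<mu>\<in>{\<mu> \<in> words A m. Q \<mu>}. if is_path \<mu> then pr \<mu> else 0)"
    by (rule cong_sum) (auto simp: wordsD pr_nonpath)
  also have "(\<Sum>\<mu>\<in>{\<mu> \<in> words A m. Q \<mu>}. if is_path \<mu> then pr \<mu> else 0) = sum pr {\<mu> \<in> {\<mu> \<in> words A m. Q \<mu>}. is_path \<mu>}"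
    by (rule sum.inter_filter[symmetric]) simp
  also have "{\<mu> \<in> {\<mu> \<in> words A m. Q \<mu>}. is_path \<mu>} = {\<mu> \<in> paths m. Q \<mu>}"
    by (auto simp: paths_def)
  finally show ?thesis .
qed

lemma V_commute_pr:
  assumes "set \<mu> \<subseteq> edges A" shows "ev (V i * pr \<mu>) = ev (pr \<mu> * V i)"
  using V_pr[OF assms, of i] pr_V[OF assms, of i] by (cases "\<mu> = []") auto

end

locale ck_hom = star_homomorphism "cuntz_krieger_algebra A" "cuntz_krieger_algebra C" \<Phi> +
  a: cuntz_krieger A + c: cuntz_krieger C
  for A C :: "nat mat" and \<Phi>
begin

text \<open>These rules make \<open>\<Phi> (a.ev x) = c.ev x'\<close> a congruence between the two
  free *-algebras, so that the image of a polynomial is computed by structural recursion.\<close>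

lemma mult_rel: "\<Phi> (a.ev x) = c.ev x' \<Longrightarrow> \<Phi> (a.ev y) = c.ev y' \<Longrightarrow> \<Phi> (a.ev (x * y)) = c.ev (x' * y')"
  by (simp add: a.ev_mult c.ev_mult hom_mult)

lemma fstar_rel: "\<Phi> (a.ev x) = c.ev x' \<Longrightarrow> \<Phi> (a.ev (fstar x)) = c.ev (fstar x')"
  by (simp add: a.ev_fstar c.ev_fstar hom_adj)

lemma one_rel: "\<Phi> (a.ev 1) = c.ev 1"
  by (simp add: a.ev_one c.ev_one hom_one)

lemma sum_rel: "(\<And>i. i \<in> K \<Longrightarrow> \<Phi> (a.ev (f i)) = c.ev (g i)) \<Longrightarrow> \<Phi> (a.ev (sum f K)) = c.ev (sum g K)"
  by (induction K rule: infinite_finite_induct)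
     (simp_all add: a.ev_zero c.ev_zero hom_zero a.ev_add c.ev_add hom_add)

end

lemma ck_hom_exists:
  assumes "cuntz_krieger_family A (cuntz_krieger_algebra C) T"
  shows "\<exists>\<Phi>. ck_hom A C \<Phi> \<and> (\<forall>a\<in>edges A. \<Phi> (ck_gen A a) = T a)"
proof -
  obtain \<Phi> where "\<Phi> \<in> star_hom (cuntz_krieger_algebra A) (cuntz_krieger_algebra C)"
    "\<forall>a\<in>edges A. \<Phi> (ck_gen A a) = T a"
    using cuntz_krieger_algebra_universal[OF cuntz_krieger_algebra_is_cstar_algebra assms] by blast
  then show ?thesis
    by (intro exI[of _ \<Phi>] conjI ck_hom.intro star_homomorphism.intro star_homomorphism_axioms.intro
        cuntz_krieger_algebra_is_cstar_algebra) auto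
qed

text \<open>The edges of \<open>C\<close> are labelled by edges of \<open>A\<close>; an edge is determined by its label and its target, and
  \<open>st \<mu>\<close> is the vertex of \<open>C\<close> at which every lift of a path \<open>\<mu>\<close> of length \<open>m\<close> starts.\<close>

locale label_graph =
  a: cuntz_krieger A + c: cuntz_krieger C for A C :: "nat mat" +
  fixes \<rho> :: "edge \<Rightarrow> edge" and st :: "edge list \<Rightarrow> nat" and m :: nat
  assumes m: "0 < m"
    and \<rho>_edge: "e \<in> edges C \<Longrightarrow> \<rho> e \<in> edges A"
    and \<rho>_adjacent: "e \<in> edges C \<Longrightarrow> f \<in> edges C \<Longrightarrow> target e = source f \<Longrightarrow> target (\<rho> e) = source (\<rho> f)"
    and \<rho>_unique: "e \<in> edges C \<Longrightarrow> f \<in> edges C \<Longrightarrow> \<rho> e = \<rho> f \<Longrightarrow> target e = target f \<Longrightarrow> e = f"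
    and \<rho>_exists: "b \<in> edges A \<Longrightarrow> f \<in> edges C \<Longrightarrow> target b = source (\<rho> f) \<Longrightarrow>
      \<exists>e\<in>edges C. \<rho> e = b \<and> target e = source f"
    and st_edge: "b # \<mu> \<in> a.paths (Suc m) \<Longrightarrow>
      \<exists>e\<in>edges C. \<rho> e = b \<and> target e = st \<mu> \<and> source e = st (butlast (b # \<mu>))"
    and st_lift: "\<kappa> \<in> c.paths m \<Longrightarrow> st (map \<rho> \<kappa>) = source (hd \<kappa>)"
    and st_target: "e \<in> edges C \<Longrightarrow> \<mu> \<in> a.paths m \<Longrightarrow> st \<mu> = target e \<Longrightarrow> source (hd \<mu>) = target (\<rho> e)"
begin

definition fibre :: "edge \<Rightarrow> edge set" where "fibre b = {e \<in> edges C. \<rho> e = b}"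

text \<open>\<open>T b\<close> will be the image of \<open>S\<^sub>b\<close> in the algebra of \<open>C\<close>, and \<open>R e\<close> the image of \<open>S\<^sub>e\<close> in the algebra
  of \<open>A\<close>.\<close>

definition T :: "edge \<Rightarrow> edge free" where "T b = (\<Sum>e\<in>fibre b. fgen e)"

lemma finite_fibre [simp]: "finite (fibre b)" by (simp add: fibre_def finite_edges)

text \<open>The cross terms vanish: distinct edges with the same label have distinct targets. The
  vertex projection absorbed by \<open>fgen e\<close> commutes past \<open>x\<close> and annihilates
  the adjoint of \<open>fgen f\<close>.\<close>

lemma T_sandwich:
  assumes x: "\<And>i. c.ev (c.V i * x) = c.ev (x * c.V i)"
  shows "c.ev (T b * x * fstar (T b)) = c.ev (\<Sum>e\<in>fibre b. fgen e * x * fstar (fgen e))"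
proof -
  have z: "c.ev (fgen e * x * fstar (fgen f)) = c.ev 0" if "e \<in> fibre b" "f \<in> fibre b" "e \<noteq> f" for e f
  proof -
    have ne: "target f \<noteq> target e" using that \<rho>_unique[of e f] by (auto simp: fibre_def)
    have fE: "f \<in> edges C" using that by (auto simp: fibre_def)
    have "c.ev (fgen e * x * fstar (fgen f)) = c.ev (fgen e * c.V (target e) * x * fstar (fgen f))"
      by (intro c.cong_mult_right c.gen_V_target[symmetric])
    also have "\<dots> = c.ev (fgen e * (c.V (target e) * x) * fstar (fgen f))" by (simp add: mult.assoc)
    also have "\<dots> = c.ev (fgen e * (x * c.V (target e)) * fstar (fgen f))"
      by (rule c.cong_mult_right[OF c.cong_mult_left[OF x]])
    also have "\<dots> = c.ev (fgen e * x * fstar (fgen f * c.V (target e)))" by (simp add: fstar_mult mult.assoc)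
    also have "\<dots> = c.ev (fgen e * x * fstar 0)"
      using c.gen_V[OF fE, of "target e"] ne by (intro c.cong_mult_left c.cong_fstar) simp
    finally show ?thesis by simp
  qed
  have "T b * x * fstar (T b) = (\<Sum>e\<in>fibre b. \<Sum>f\<in>fibre b. fgen e * x * fstar (fgen f))"
    unfolding T_def fstar_sum sum_distrib_right sum_distrib_left by (rule sum.swap)
  also have "c.ev \<dots> = c.ev (\<Sum>e\<in>fibre b. \<Sum>f\<in>fibre b. if f = e then fgen e * x * fstar (fgen e) else 0)"
    by (intro c.cong_sum) (use z in auto)
  also have "(\<Sum>e\<in>fibre b. \<Sum>f\<in>fibre b. if f = e then fgen e * x * fstar (fgen e) else 0) =
     (\<Sum>e\<in>fibre b. fgen e * x * fstar (fgen e))"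
    by (intro sum.cong refl) simp
  finally show ?thesis .
qed

lemma T_range: "c.ev (T b * fstar (T b)) = c.ev (\<Sum>e\<in>fibre b. fgen e * fstar (fgen e))"
  using T_sandwich[of 1 b] by simp

lemma sum_fibre: "(\<Sum>b\<in>{b \<in> edges A. Q b}. \<Sum>e\<in>fibre b. f e) = (\<Sum>e\<in>{e \<in> edges C. Q (\<rho> e)}. f e)"
proof -
  have "(\<Sum>e\<in>{e \<in> edges C. Q (\<rho> e)}. f e) =
      (\<Sum>b\<in>{b \<in> edges A. Q b}. \<Sum>e\<in>{x \<in> {e \<in> edges C. Q (\<rho> e)}. \<rho> x = b}. f e)"
    by (rule sum.group[symmetric]) (auto simp: finite_edges \<rho>_edge)
  also have "\<dots> = (\<Sum>b\<in>{b \<in> edges A. Q b}. \<Sum>e\<in>fibre b. f e)"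
    by (intro sum.cong refl) (auto simp: fibre_def)
  finally show ?thesis by simp
qed

lemma T_initial: "c.ev (fstar (T b) * T b) = c.ev (\<Sum>e\<in>fibre b. c.V (target e))"
proof -
  have "fstar (T b) * T b = (\<Sum>e\<in>fibre b. \<Sum>f\<in>fibre b. fstar (fgen e) * fgen f)"
    unfolding T_def fstar_sum sum_distrib_right sum_distrib_left by (rule sum.swap)
  also have "c.ev \<dots> = c.ev (\<Sum>e\<in>fibre b. \<Sum>f\<in>fibre b. if f = e then c.V (target e) else 0)"
    by (intro c.cong_sum) (auto simp: fibre_def c.orth c.rel3)
  also have "(\<Sum>e\<in>fibre b. \<Sum>f\<in>fibre b. if f = e then c.V (target e) else 0) = (\<Sum>e\<in>fibre b. c.V (target e))"
    by (intro sum.cong refl) simp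
  finally show ?thesis .
qed

lemma T_family: "cuntz_krieger_family A (cuntz_krieger_algebra C) (\<lambda>b. c.ev (T b))"
proof (rule c.familyI)
  fix b assume b: "b \<in> edges A"
  have "c.ev (T b * fstar (T b) * T b) = c.ev ((\<Sum>e\<in>fibre b. fgen e * fstar (fgen e)) * T b)"
    by (rule c.cong_mult_right[OF T_range])
  also have "\<dots> = c.ev (\<Sum>e\<in>fibre b. \<Sum>f\<in>fibre b. fgen e * (fstar (fgen e) * fgen f))"
    unfolding T_def sum_distrib_right sum_distrib_left by (subst sum.swap) (simp add: mult.assoc)
  also have "\<dots> = c.ev (\<Sum>e\<in>fibre b. \<Sum>f\<in>fibre b. if f = e then fgen e else 0)"
  proof (intro c.cong_sum)
    fix e f show "c.ev (fgen e * (fstar (fgen e) * fgen f)) = c.ev (if f = e then fgen e else 0)"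
      using c.rel1[of e] c.cong_mult_left[OF c.orth[of e f], of "fgen e"] by (auto simp: mult.assoc)
  qed
  also have "(\<Sum>e\<in>fibre b. \<Sum>f\<in>fibre b. if f = e then fgen e else 0) = T b"
    unfolding T_def by (intro sum.cong refl) simp
  finally show "c.ev (T b * fstar (T b) * T b) = c.ev (T b)" .
  have "(\<Sum>e\<in>fibre b. c.V (target e)) = (\<Sum>f\<in>(\<Union>e\<in>fibre b. {f \<in> edges C. source f = target e}). fgen f * fstar (fgen f))"
    unfolding c.V_def
  proof (rule sum.UNION_disjoint[symmetric])
    show "\<forall>i\<in>fibre b. \<forall>j\<in>fibre b. i \<noteq> j \<longrightarrow>
        {f \<in> edges C. source f = target i} \<inter> {f \<in> edges C. source f = target j} = {}"
      using \<rho>_unique by (fastforce simp: fibre_def)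
  qed (auto simp: finite_edges)
  \<comment> \<open>One inclusion is \<open>\<rho>_adjacent\<close>; the other is
    \<open>\<rho>_exists\<close>, which lets any edge whose label can follow \<open>b\<close> be
    preceded by an edge labelled \<open>b\<close>.\<close>
  also have "(\<Union>e\<in>fibre b. {f \<in> edges C. source f = target e}) = {f \<in> edges C. source (\<rho> f) = target b}"
    using \<rho>_adjacent \<rho>_exists[OF b] by (fastforce simp: fibre_def)
  also have "(\<Sum>f\<in>\<dots>. fgen f * fstar (fgen f)) = (\<Sum>d\<in>{d \<in> edges A. source d = target b}. \<Sum>f\<in>fibre d. fgen f * fstar (fgen f))"
    by (rule sum_fibre[symmetric])
  also have "c.ev \<dots> = c.ev (\<Sum>d\<in>{d \<in> edges A. source d = target b}. T d * fstar (T d))"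
    by (intro c.cong_sum T_range[symmetric])
  finally show "c.ev (fstar (T b) * T b) = \<dots>" unfolding T_initial .
next
  have "c.ev (\<Sum>b\<in>edges A. T b * fstar (T b)) = c.ev (\<Sum>b\<in>{b \<in> edges A. True}. \<Sum>e\<in>fibre b. fgen e * fstar (fgen e))"
    by (simp, intro c.cong_sum T_range)
  also have "\<dots> = c.ev 1" unfolding sum_fibre using c.rel2 by simp
  finally show "c.ev (\<Sum>b\<in>edges A. T b * fstar (T b)) = c.ev 1" .
qed

text \<open>The projection onto the sequences whose lifts to \<open>C\<close> start at
  \<open>v\<close>. Multiplied on the right of \<open>fgen b\<close> it selects one edge of the
  fibre of \<open>b\<close>, because label and target determine an edge.\<close>

definition Q :: "nat \<Rightarrow> edge free" where
  "Q v = (\<Sum>\<mu>\<in>{\<mu> \<in> a.paths m. st \<mu> = v}. pr \<mu>)"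

definition R :: "edge \<Rightarrow> edge free" where
  "R e = fgen (\<rho> e) * Q (target e)"

lemma fstar_Q [simp]: "fstar (Q v) = Q v" by (simp add: Q_def fstar_sum)

lemma pathsD: "\<mu> \<in> a.paths k \<Longrightarrow> set \<mu> \<subseteq> edges A" "\<mu> \<in> a.paths k \<Longrightarrow> length \<mu> = k" "\<mu> \<in> a.paths k \<Longrightarrow> is_path \<mu>"
  by (auto simp: a.paths_def words_def)

lemma path_mult: "\<mu> \<in> a.paths k \<Longrightarrow> \<nu> \<in> a.paths k \<Longrightarrow> a.ev (pr \<mu> * pr \<nu>) = a.ev (if \<mu> = \<nu> then pr \<mu> else 0)"
  by (rule a.pr_mult) (auto simp: a.paths_def words_def)

lemma Q_Q: "a.ev (Q v * Q v) = a.ev (Q v)"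
proof -
  let ?M = "{\<mu> \<in> a.paths m. st \<mu> = v}"
  have "Q v * Q v = (\<Sum>\<mu>\<in>?M. \<Sum>\<nu>\<in>?M. pr \<mu> * pr \<nu>)"
    unfolding Q_def sum_distrib_right sum_distrib_left by (rule sum.swap)
  also have "a.ev \<dots> = a.ev (\<Sum>\<mu>\<in>?M. \<Sum>\<nu>\<in>?M. if \<mu> = \<nu> then pr \<mu> else 0)"
    by (intro a.cong_sum path_mult) auto
  also have "(\<Sum>\<mu>\<in>?M. \<Sum>\<nu>\<in>?M. if \<mu> = \<nu> then pr \<mu> else 0) = Q v"
    unfolding Q_def by (intro sum.cong refl) simp
  finally show ?thesis .
qed

lemma V_Q: assumes "e \<in> edges C" shows "a.ev (a.V (target (\<rho> e)) * Q (target e)) = a.ev (Q (target e))"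
proof -
  have "a.V (target (\<rho> e)) * Q (target e) = (\<Sum>\<mu>\<in>{\<mu> \<in> a.paths m. st \<mu> = target e}. a.V (target (\<rho> e)) * pr \<mu>)"
    by (simp add: Q_def sum_distrib_left)
  also have "a.ev \<dots> = a.ev (Q (target e))"
    unfolding Q_def
  proof (rule a.cong_sum)
    fix \<mu> assume "\<mu> \<in> {\<mu> \<in> a.paths m. st \<mu> = target e}"
    then have \<mu>: "\<mu> \<in> a.paths m" "source (hd \<mu>) = target (\<rho> e)" using st_target[OF assms, of \<mu>] by auto
    have "\<mu> \<noteq> []" using pathsD(2)[OF \<mu>(1)] m by auto
    then show "a.ev (a.V (target (\<rho> e)) * pr \<mu>) = a.ev (pr \<mu>)"
      using a.V_pr[OF pathsD(1)[OF \<mu>(1)], of "target (\<rho> e)"] \<mu>(2) by simp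
  qed
  finally show ?thesis .
qed

lemma R_initial: assumes e: "e \<in> edges C" shows "a.ev (fstar (R e) * R e) = a.ev (Q (target e))"
proof -
  have "fstar (R e) * R e = Q (target e) * (fstar (fgen (\<rho> e)) * fgen (\<rho> e)) * Q (target e)"
    by (simp add: R_def fstar_mult mult.assoc)
  also have "a.ev \<dots> = a.ev (Q (target e) * a.V (target (\<rho> e)) * Q (target e))"
    by (intro a.cong_mult a.rel3 \<rho>_edge e refl)
  also have "\<dots> = a.ev (Q (target e) * Q (target e))"
    using a.cong_mult_left[OF V_Q[OF e]] by (simp add: mult.assoc)
  finally show ?thesis using Q_Q by simp
qed

lemma R_range: "a.ev (R e * fstar (R e)) = a.ev (fgen (\<rho> e) * Q (target e) * fstar (fgen (\<rho> e)))"
proof -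
  have "R e * fstar (R e) = fgen (\<rho> e) * (Q (target e) * Q (target e)) * fstar (fgen (\<rho> e))"
    by (simp add: R_def fstar_mult mult.assoc)
  then show ?thesis using a.cong_mult_right[OF a.cong_mult_left[OF Q_Q]] by simp
qed

text \<open>Each range projection is a sum over words \<open>\<rho> e # \<mu>\<close> with
  \<open>st \<mu> = target e\<close>. These words run bijectively through the paths of length
  \<open>m + 1\<close> whose first \<open>m\<close> letters start in \<open>X\<close>, and summing
  out the last letter leaves paths of length \<open>m\<close>. A singleton and the full set
  \<open>X\<close> give two of the relations for \<open>R\<close>.\<close>

lemma sum_R_range:
  "a.ev (\<Sum>e\<in>{e \<in> edges C. source e \<in> X}. R e * fstar (R e)) = a.ev (\<Sum>\<nu>\<in>{\<nu> \<in> a.paths m. st \<nu> \<in> X}. pr \<nu>)"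
proof -
  let ?E = "{e \<in> edges C. source e \<in> X}" and ?M = "\<lambda>e. {\<mu> \<in> a.paths m. st \<mu> = target e}"
  let ?N = "{\<nu> \<in> a.paths (Suc m). st (butlast \<nu>) \<in> X}"
  have "a.ev (\<Sum>e\<in>?E. R e * fstar (R e)) = a.ev (\<Sum>e\<in>?E. fgen (\<rho> e) * Q (target e) * fstar (fgen (\<rho> e)))"
    by (intro a.cong_sum R_range)
  also have "(\<Sum>e\<in>?E. fgen (\<rho> e) * Q (target e) * fstar (fgen (\<rho> e))) = (\<Sum>e\<in>?E. \<Sum>\<mu>\<in>?M e. pr (\<rho> e # \<mu>))"
    by (simp add: Q_def sum_distrib_left sum_distrib_right pr_Cons)
  also have "\<dots> = (\<Sum>(e, \<mu>)\<in>Sigma ?E ?M. pr (\<rho> e # \<mu>))"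
    by (rule sum.Sigma) (auto simp: finite_edges)
  also have "\<dots> = (\<Sum>\<nu>\<in>?N. pr \<nu>)"
  proof (rule sum.reindex_cong[symmetric, of "\<lambda>(e, \<mu>). \<rho> e # \<mu>"])
    show "inj_on (\<lambda>(e, \<mu>). \<rho> e # \<mu>) (Sigma ?E ?M)"
      using \<rho>_unique by (fastforce simp: inj_on_def)
    show "?N = (\<lambda>(e, \<mu>). \<rho> e # \<mu>) ` Sigma ?E ?M"
    proof (intro equalityI subsetI)
      fix \<nu> assume \<nu>: "\<nu> \<in> ?N"
      then obtain b \<mu> where b: "\<nu> = b # \<mu>" using pathsD(2)[of \<nu> "Suc m"] by (cases \<nu>) auto
      have "b # \<mu> \<in> a.paths (Suc m)" using \<nu> b by simp
      from st_edge[OF this] obtain e where e: "e \<in> edges C" "\<rho> e = b" "target e = st \<mu>" "source e = st (butlast (b # \<mu>))"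
        by blast
      have "\<mu> \<in> a.paths m" using \<nu> b by (auto simp: a.paths_def words_def is_path_def successively_Cons)
      then show "\<nu> \<in> (\<lambda>(e, \<mu>). \<rho> e # \<mu>) ` Sigma ?E ?M"
        using e \<nu> b by (intro image_eqI[of _ _ "(e, \<mu>)"]) auto
    next
      fix \<nu> assume "\<nu> \<in> (\<lambda>(e, \<mu>). \<rho> e # \<mu>) ` Sigma ?E ?M"
      then obtain e \<mu> where e: "\<nu> = \<rho> e # \<mu>" "e \<in> edges C" "source e \<in> X" "\<mu> \<in> a.paths m" "st \<mu> = target e"
        by auto
      have \<nu>: "\<nu> \<in> a.paths (Suc m)"
        using e st_target[OF e(2,4,5)] \<rho>_edge[OF e(2)]
        by (auto simp: a.paths_def words_def is_path_def successively_Cons)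
      from st_edge[OF this[unfolded e(1)]] obtain e' where
        e': "e' \<in> edges C" "\<rho> e' = \<rho> e" "target e' = st \<mu>" "source e' = st (butlast \<nu>)" using e(1) by blast
      then have "e' = e" using \<rho>_unique[of e' e] e by simp
      then show "\<nu> \<in> ?N" using e' e \<nu> by simp
    qed
  qed auto
  also have "a.ev (\<Sum>\<nu>\<in>?N. pr \<nu>) = a.ev (\<Sum>\<nu>\<in>{\<nu> \<in> words A (Suc m). st (butlast \<nu>) \<in> X}. pr \<nu>)"
    by (rule a.sum_pr_paths[symmetric])
  also have "(\<Sum>\<nu>\<in>{\<nu> \<in> words A (Suc m). st (butlast \<nu>) \<in> X}. pr \<nu>) =
     (\<Sum>\<mu>\<in>{\<mu> \<in> words A m. st \<mu> \<in> X}. \<Sum>b\<in>edges A. pr (\<mu> @ [b]))"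
  proof -
    have "(\<Sum>\<nu>\<in>{\<nu> \<in> words A (Suc m). st (butlast \<nu>) \<in> X}. pr \<nu>) =
      (\<Sum>\<nu>\<in>words A (Suc m). if st (butlast \<nu>) \<in> X then pr \<nu> else 0)"
      by (rule sum.inter_filter) simp
    also have "\<dots> = (\<Sum>\<mu>\<in>words A m. if st \<mu> \<in> X then \<Sum>b\<in>edges A. pr (\<mu> @ [b]) else 0)"
      unfolding sum_words_Suc_snoc by (intro sum.cong refl) auto
    also have "\<dots> = (\<Sum>\<mu>\<in>{\<mu> \<in> words A m. st \<mu> \<in> X}. \<Sum>b\<in>edges A. pr (\<mu> @ [b]))"
      by (rule sum.inter_filter[symmetric]) simp
    finally show ?thesis .
  qed
  also have "a.ev \<dots> = a.ev (\<Sum>\<mu>\<in>{\<mu> \<in> words A m. st \<mu> \<in> X}. pr \<mu>)"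
    by (intro a.cong_sum a.pr_snoc[symmetric])
  also have "\<dots> = a.ev (\<Sum>\<nu>\<in>{\<nu> \<in> a.paths m. st \<nu> \<in> X}. pr \<nu>)"
    by (rule a.sum_pr_paths)
  finally show ?thesis .
qed

lemma sum_paths: "a.ev (\<Sum>\<nu>\<in>a.paths m. pr \<nu>) = a.ev 1"
  using a.sum_pr_paths[of m "\<lambda>_. True"] a.sum_pr[of m] by simp

lemma R_family: "cuntz_krieger_family C (cuntz_krieger_algebra A) (\<lambda>e. a.ev (R e))"
proof (rule a.familyI)
  fix e assume e: "e \<in> edges C"
  have "a.ev (R e * fstar (R e) * R e) = a.ev (R e * (fstar (R e) * R e))" by (simp add: mult.assoc)
  also have "\<dots> = a.ev (R e * Q (target e))" by (rule a.cong_mult_left[OF R_initial[OF e]])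
  also have "\<dots> = a.ev (R e)" using a.cong_mult_left[OF Q_Q] by (simp add: R_def mult.assoc)
  finally show "a.ev (R e * fstar (R e) * R e) = a.ev (R e)" .
  show "a.ev (fstar (R e) * R e) = a.ev (\<Sum>f\<in>{f \<in> edges C. source f = target e}. R f * fstar (R f))"
    unfolding R_initial[OF e] using sum_R_range[of "{target e}"] by (simp add: Q_def)
next
  show "a.ev (\<Sum>e\<in>edges C. R e * fstar (R e)) = a.ev 1"
    using sum_R_range[of UNIV] sum_paths by simp
qed

definition lifts :: "edge list \<Rightarrow> edge list set" where
  "lifts \<mu> = {\<kappa> \<in> words C (length \<mu>). map \<rho> \<kappa> = \<mu>}"

lemma finite_lifts [simp]: "finite (lifts \<mu>)" by (simp add: lifts_def)

lemma lifts_Cons: "lifts (b # \<mu>) = (\<lambda>(e, \<kappa>). e # \<kappa>) ` (fibre b \<times> lifts \<mu>)"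
  by (auto simp: lifts_def fibre_def words_Suc image_iff)

text \<open>The inductive step in computing the image of the projection of a word as the sum over
  all its lifts.\<close>

lemma T_lifts:
  assumes "set \<mu> \<subseteq> edges A"
  shows "c.ev (T b * sum pr (lifts \<mu>) * fstar (T b)) = c.ev (sum pr (lifts (b # \<mu>)))"
proof -
  have "c.ev (c.V i * sum pr (lifts \<mu>)) = c.ev (sum pr (lifts \<mu>) * c.V i)" for i
    unfolding sum_distrib_left sum_distrib_right
    by (intro c.cong_sum c.V_commute_pr) (auto simp: lifts_def words_def)
  then have "c.ev (T b * sum pr (lifts \<mu>) * fstar (T b)) = c.ev (\<Sum>e\<in>fibre b. fgen e * sum pr (lifts \<mu>) * fstar (fgen e))"
    by (rule T_sandwich)
  also have "(\<Sum>e\<in>fibre b. fgen e * sum pr (lifts \<mu>) * fstar (fgen e)) = (\<Sum>e\<in>fibre b. \<Sum>\<kappa>\<in>lifts \<mu>. pr (e # \<kappa>))"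
    by (simp add: pr_Cons sum_distrib_left sum_distrib_right)
  also have "\<dots> = sum pr (lifts (b # \<mu>))"
    unfolding lifts_Cons by (subst sum.reindex) (auto simp: inj_on_def sum.cartesian_product case_prod_unfold)
  finally show ?thesis .
qed

lemma Q_level: "a.ev (Q v) \<in> a.level_elements"
  unfolding Q_def by (rule a.sum_pr_level[of _ m]) (auto simp: a.paths_def)

text \<open>The sets of paths starting at the targets of the fibre are disjoint and, by
  \<open>st_edge\<close>, contain every continuation of \<open>b\<close>. The remaining paths cannot
  follow \<open>b\<close>, so \<open>fgen b\<close> annihilates their projections.\<close>

lemma sum_R: assumes b: "b \<in> edges A" shows "a.ev (\<Sum>e\<in>fibre b. R e) = a.ev (fgen b)"
proof -
  define M where "M = (\<Union>e\<in>fibre b. {\<mu> \<in> a.paths m. st \<mu> = target e})"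
  have Msub: "M \<subseteq> a.paths m" by (auto simp: M_def)
  have "(\<Sum>e\<in>fibre b. R e) = (\<Sum>e\<in>fibre b. \<Sum>\<mu>\<in>{\<mu> \<in> a.paths m. st \<mu> = target e}. fgen b * pr \<mu>)"
    by (intro sum.cong refl) (simp add: R_def Q_def fibre_def sum_distrib_left)
  also have "\<dots> = (\<Sum>\<mu>\<in>M. fgen b * pr \<mu>)"
    unfolding M_def
  proof (rule sum.UNION_disjoint[symmetric])
    show "\<forall>i\<in>fibre b. \<forall>j\<in>fibre b. i \<noteq> j \<longrightarrow>
        {\<mu> \<in> a.paths m. st \<mu> = target i} \<inter> {\<mu> \<in> a.paths m. st \<mu> = target j} = {}"
      using \<rho>_unique by (fastforce simp: fibre_def)
  qed auto
  also have "\<dots> = (\<Sum>\<mu>\<in>{\<mu> \<in> a.paths m. \<mu> \<in> M}. fgen b * pr \<mu>)"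
    using Msub by (intro sum.cong refl) auto
  also have "\<dots> = (\<Sum>\<mu>\<in>a.paths m. if \<mu> \<in> M then fgen b * pr \<mu> else 0)"
    by (rule sum.inter_filter) simp
  also have "a.ev \<dots> = a.ev (\<Sum>\<mu>\<in>a.paths m. fgen b * pr \<mu>)"
  proof (rule a.cong_sum)
    fix \<mu> assume \<mu>: "\<mu> \<in> a.paths m"
    have ne: "\<mu> \<noteq> []" using pathsD(2)[OF \<mu>] m by auto
    show "a.ev (if \<mu> \<in> M then fgen b * pr \<mu> else 0) = a.ev (fgen b * pr \<mu>)"
    proof (cases "\<mu> \<in> M")
      case False
      have "source (hd \<mu>) \<noteq> target b"
      proof
        assume "source (hd \<mu>) = target b"
        then have "b # \<mu> \<in> a.paths (Suc m)"
          using \<mu> b ne by (auto simp: a.paths_def words_def is_path_def successively_Cons)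
        from st_edge[OF this] obtain e where "e \<in> edges C" "\<rho> e = b" "target e = st \<mu>" by blast
        then have "\<mu> \<in> M" unfolding M_def by (intro UN_I[of e]) (simp_all add: fibre_def \<mu>)
        then show False using False by simp
      qed
      then have "a.ev (a.V (target b) * pr \<mu>) = a.ev 0"
        using a.V_pr[OF pathsD(1)[OF \<mu>] ne, of "target b"] by simp
      from a.cong_mult_left[OF this, of "fgen b"] a.cong_mult_right[OF a.gen_V_target, of b "pr \<mu>"]
      show ?thesis using False by (simp add: mult.assoc)
    qed simp
  qed
  also have "\<dots> = a.ev (fgen b * (\<Sum>\<mu>\<in>a.paths m. pr \<mu>))" by (simp add: sum_distrib_left)
  also have "\<dots> = a.ev (fgen b * 1)" by (rule a.cong_mult_left[OF sum_paths])
  finally show ?thesis by simp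
qed

text \<open>This identifies the image of \<open>Q v\<close> with the vertex projection of
  \<open>v\<close>: by \<open>st_lift\<close> the lifts that are paths are exactly the paths of
  length \<open>m\<close> in \<open>C\<close> that start at \<open>v\<close>.\<close>

lemma sum_lifts_V:
  "c.ev (\<Sum>\<mu>\<in>{\<mu> \<in> a.paths m. st \<mu> = v}. sum pr (lifts \<mu>)) = c.ev (c.V v)"
proof -
  let ?M = "{\<mu> \<in> a.paths m. st \<mu> = v}"
  have path_map: "map \<rho> \<kappa> \<in> a.paths k" if "\<kappa> \<in> c.paths k" for \<kappa> k
  proof -
    have s: "set \<kappa> \<subseteq> edges C" "length \<kappa> = k" "successively (\<lambda>a b. target a = source b) \<kappa>"
      using that by (auto simp: c.paths_def words_def is_path_def)
    have "successively (\<lambda>a b. target (\<rho> a) = source (\<rho> b)) \<kappa>"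
      using s(3) by (rule successively_mono) (use s(1) \<rho>_adjacent in blast)
    then show ?thesis
      using s \<rho>_edge by (auto simp: a.paths_def words_def is_path_def successively_map)
  qed
  have "(\<Sum>\<mu>\<in>?M. sum pr (lifts \<mu>)) = sum pr (\<Union>\<mu>\<in>?M. lifts \<mu>)"
    by (rule sum.UNION_disjoint[symmetric]) (auto simp: lifts_def)
  also have "(\<Union>\<mu>\<in>?M. lifts \<mu>) = {\<kappa> \<in> words C m. map \<rho> \<kappa> \<in> ?M}"
    by (auto simp: lifts_def words_def dest: pathsD(2))
  also have "c.ev (sum pr \<dots>) = c.ev (\<Sum>\<kappa>\<in>{\<kappa> \<in> c.paths m. map \<rho> \<kappa> \<in> ?M}. pr \<kappa>)"
    by (rule c.sum_pr_paths)
  also have "{\<kappa> \<in> c.paths m. map \<rho> \<kappa> \<in> ?M} = {\<kappa> \<in> c.paths m. source (hd \<kappa>) = v}"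
    using st_lift path_map by auto
  also have "(\<Sum>\<kappa>\<in>{\<kappa> \<in> c.paths m. source (hd \<kappa>) = v}. pr \<kappa>) = (\<Sum>\<kappa>\<in>c.paths m. if source (hd \<kappa>) = v then pr \<kappa> else 0)"
    by (rule sum.inter_filter) simp
  also have "c.ev \<dots> = c.ev (\<Sum>\<kappa>\<in>c.paths m. c.V v * pr \<kappa>)"
  proof (rule c.cong_sum)
    fix \<kappa> assume k: "\<kappa> \<in> c.paths m"
    have "c.ev (c.V v * pr \<kappa>) = c.ev (if source (hd \<kappa>) = v then pr \<kappa> else 0)"
      by (rule c.V_pr) (use k m in \<open>auto simp: c.paths_def words_def\<close>)
    then show "c.ev (if source (hd \<kappa>) = v then pr \<kappa> else 0) = c.ev (c.V v * pr \<kappa>)" by simp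
  qed
  also have "\<dots> = c.ev (c.V v * (\<Sum>\<kappa>\<in>c.paths m. pr \<kappa>))" by (simp add: sum_distrib_left)
  also have "\<dots> = c.ev (c.V v * 1)"
    using c.sum_pr_paths[of m "\<lambda>_. True"] c.sum_pr[of m] by (intro c.cong_mult_left) simp
  finally show ?thesis by simp
qed

lemma T_V: assumes e: "e \<in> edges C" shows "c.ev (T (\<rho> e) * c.V (target e)) = c.ev (fgen e)"
proof -
  have "c.ev (T (\<rho> e) * c.V (target e)) = c.ev (\<Sum>f\<in>fibre (\<rho> e). fgen f * c.V (target e))"
    by (simp add: T_def sum_distrib_right)
  also have "\<dots> = c.ev (\<Sum>f\<in>fibre (\<rho> e). if f = e then fgen e else 0)"
  proof (rule c.cong_sum)
    fix f assume f: "f \<in> fibre (\<rho> e)"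
    have "c.ev (fgen f * c.V (target e)) = c.ev (if target f = target e then fgen f else 0)"
      by (rule c.gen_V) (use f in \<open>simp add: fibre_def\<close>)
    moreover have "target f = target e \<longleftrightarrow> f = e" using f e \<rho>_unique[of f e] by (auto simp: fibre_def)
    ultimately show "c.ev (fgen f * c.V (target e)) = c.ev (if f = e then fgen e else 0)" by auto
  qed
  also have "(\<Sum>f\<in>fibre (\<rho> e). if f = e then fgen e else 0) = fgen e"
    using e by (simp add: fibre_def finite_edges)
  finally show ?thesis .
qed

end

section \<open>The isomorphism of triplets given by a labelled graph\<close>

lemma star_homomorphism_comp:
  assumes "star_homomorphism \<AA> \<BB> \<Phi>" "star_homomorphism \<BB> \<CC> \<Psi>"
  shows "star_homomorphism \<AA> \<CC> (\<lambda>x. \<Psi> (\<Phi> x))"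
proof -
  interpret F: star_homomorphism \<AA> \<BB> \<Phi> by fact
  interpret G: star_homomorphism \<BB> \<CC> \<Psi> by fact
  show ?thesis
    by unfold_locales
       (auto simp: star_hom_def F.hom_smult G.hom_smult F.hom_adj G.hom_adj F.hom_add G.hom_add
         F.hom_mult G.hom_mult F.hom_one G.hom_one intro!: ring_hom_memI)
qed

lemma star_homomorphism_id: "cstar_algebra \<AA> \<Longrightarrow> star_homomorphism \<AA> \<AA> (\<lambda>x. x)"
  by (intro star_homomorphism.intro star_homomorphism_axioms.intro)
     (auto simp: star_hom_def intro!: ring_hom_memI)

lemma ck_homI: "star_homomorphism (cuntz_krieger_algebra A) (cuntz_krieger_algebra C) \<Phi> \<Longrightarrow> ck_hom A C \<Phi>"
  by (simp add: ck_hom_def)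

lemma ck_hom_eqI:
  assumes "ck_hom A C \<Phi>" "ck_hom A C \<Psi>" "\<And>a. a \<in> edges A \<Longrightarrow> \<Phi> (ck_gen A a) = \<Psi> (ck_gen A a)"
    "x \<in> carrier (cuntz_krieger_algebra A)"
  shows "\<Phi> x = \<Psi> x"
proof (rule star_hom_eqI[where \<AA> = "cuntz_krieger_algebra A" and \<BB> = "cuntz_krieger_algebra C"
      and \<Phi> = \<Phi> and \<Psi> = \<Psi> and X = "ck_gen A ` edges A"])
  show "star_homomorphism (cuntz_krieger_algebra A) (cuntz_krieger_algebra C) \<Phi>"
    "star_homomorphism (cuntz_krieger_algebra A) (cuntz_krieger_algebra C) \<Psi>"
    using assms(1,2) by (simp_all add: ck_hom_def)
  show "ck_gen A ` edges A \<subseteq> carrier (cuntz_krieger_algebra A)" using ck_gen_closed by blast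
  show "x \<in> generated_cstar_subalgebra (cuntz_krieger_algebra A) (ck_gen A ` edges A)"
    unfolding cuntz_krieger_algebra_generated by (rule assms(4))
  show "\<Phi> y = \<Psi> y" if "y \<in> ck_gen A ` edges A" for y using that assms(3) by blast
qed

lemma ck_gauge_hom: "ck_hom A A (ck_gauge A t)"
  using ck_gauge_automorphism[of A t]
  by (intro ck_homI star_homomorphism.intro star_homomorphism_axioms.intro
      cuntz_krieger_algebra_is_cstar_algebra) (simp add: star_iso_def)

context label_graph
begin

theorem triplet_isomorphic_A_C: "triplet_isomorphic (ck_triplet A) (ck_triplet C)"
proof -
  obtain \<Phi> where "ck_hom A C \<Phi>" and \<Phi>: "\<And>b. b \<in> edges A \<Longrightarrow> \<Phi> (ck_gen A b) = c.ev (T b)"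
    using ck_hom_exists[OF T_family] by blast
  obtain \<Psi> where "ck_hom C A \<Psi>" and \<Psi>: "\<And>e. e \<in> edges C \<Longrightarrow> \<Psi> (ck_gen C e) = a.ev (R e)"
    using ck_hom_exists[OF R_family] by blast
  interpret f: ck_hom A C \<Phi> by fact
  interpret g: ck_hom C A \<Psi> by fact
  have \<Phi>': "\<Phi> (a.ev (fgen b)) = c.ev (T b)" if "b \<in> edges A" for b
    using \<Phi>[OF that] a.ev_gen[OF that] by simp
  have \<Psi>': "\<Psi> (c.ev (fgen e)) = a.ev (R e)" if "e \<in> edges C" for e
    using \<Psi>[OF that] c.ev_gen[OF that] by simp
  have \<Phi>pr: "\<Phi> (a.ev (pr \<mu>)) = c.ev (sum pr (lifts \<mu>))" if "set \<mu> \<subseteq> edges A" for \<mu>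
    using that
  proof (induction \<mu>)
    case Nil
    have "lifts [] = {[]}" by (auto simp: lifts_def)
    then show ?case by (simp add: f.one_rel)
  next
    case (Cons b \<mu>)
    then have "\<Phi> (a.ev (pr (b # \<mu>))) = c.ev (T b * sum pr (lifts \<mu>) * fstar (T b))"
      unfolding pr_Cons by (intro f.mult_rel f.fstar_rel \<Phi>') auto
    also have "\<dots> = c.ev (sum pr (lifts (b # \<mu>)))" by (rule T_lifts) (use Cons in auto)
    finally show ?case .
  qed
  have \<Psi>pr: "\<Psi> (c.ev (pr \<kappa>)) \<in> a.level_elements" if "set \<kappa> \<subseteq> edges C" for \<kappa>
    using that
  proof (induction \<kappa>)
    case Nil
    show ?case using a.pr_level[of "[]"] by (simp add: g.one_rel)
  next
    case (Cons e \<kappa>)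
    let ?S = "a.ev (fgen (\<rho> e))" and ?Q = "a.ev (Q (target e))" and ?d = "\<Psi> (c.ev (pr \<kappa>))"
    have e: "e \<in> edges C" using Cons.prems by simp
    have d: "?d \<in> a.level_elements" using Cons by simp
    have dc: "?d \<in> carrier (cuntz_krieger_algebra A)" by simp
    have "adj (cuntz_krieger_algebra A) ?Q = ?Q" using a.ev_fstar[of "Q (target e)"] by simp
    then have "\<Psi> (c.ev (pr (e # \<kappa>))) = ?S \<otimes>\<^bsub>cuntz_krieger_algebra A\<^esub> (?Q \<otimes>\<^bsub>cuntz_krieger_algebra A\<^esub> ?d
         \<otimes>\<^bsub>cuntz_krieger_algebra A\<^esub> ?Q) \<otimes>\<^bsub>cuntz_krieger_algebra A\<^esub> adj (cuntz_krieger_algebra A) ?S"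
      using e dc by (simp add: pr_Cons c.ev_mult c.ev_fstar g.hom_mult g.hom_adj \<Psi>' R_def a.ev_mult
          a.adj_mult a.m_assoc a.adj_closed c.adj_closed)
    also have "\<dots> \<in> a.level_elements"
      by (intro a.level_closed(6)[OF _ d \<rho>_edge[OF e]] a.level_closed(2) d Q_level)
    finally show ?case .
  qed
  have \<Psi>\<Phi>: "\<Psi> (\<Phi> x) = x" if "x \<in> carrier (cuntz_krieger_algebra A)" for x
  proof (rule ck_hom_eqI[OF _ _ _ that])
    show "ck_hom A A (\<lambda>x. \<Psi> (\<Phi> x))"
      by (rule ck_homI[OF star_homomorphism_comp[OF f.star_homomorphism_axioms g.star_homomorphism_axioms]])
    show "ck_hom A A (\<lambda>x. x)" by (intro ck_homI star_homomorphism_id a.cstar_algebra_axioms)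
    fix b assume b: "b \<in> edges A"
    have "\<Psi> (c.ev (T b)) = a.ev (\<Sum>e\<in>fibre b. R e)"
      unfolding T_def by (intro g.sum_rel \<Psi>') (simp add: fibre_def)
    then show "\<Psi> (\<Phi> (ck_gen A b)) = ck_gen A b"
      using sum_R[OF b] a.ev_gen[OF b] \<Phi>[OF b] by simp
  qed
  have \<Phi>\<Psi>: "\<Phi> (\<Psi> x) = x" if "x \<in> carrier (cuntz_krieger_algebra C)" for x
  proof (rule ck_hom_eqI[OF _ _ _ that])
    show "ck_hom C C (\<lambda>x. \<Phi> (\<Psi> x))"
      by (rule ck_homI[OF star_homomorphism_comp[OF g.star_homomorphism_axioms f.star_homomorphism_axioms]])
    show "ck_hom C C (\<lambda>x. x)" by (intro ck_homI star_homomorphism_id c.cstar_algebra_axioms)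
    fix e assume e: "e \<in> edges C"
    have "\<Phi> (a.ev (R e)) = c.ev (T (\<rho> e) * (\<Sum>\<mu>\<in>{\<mu> \<in> a.paths m. st \<mu> = target e}. sum pr (lifts \<mu>)))"
      unfolding R_def Q_def
      by (intro f.mult_rel f.sum_rel \<Phi>' \<Phi>pr \<rho>_edge e) (auto dest: pathsD(1))
    also have "\<dots> = c.ev (T (\<rho> e) * c.V (target e))" by (intro c.cong_mult_left sum_lifts_V)
    also have "\<dots> = c.ev (fgen e)" by (rule T_V[OF e])
    finally show "\<Phi> (\<Psi> (ck_gen C e)) = ck_gen C e" using c.ev_gen[OF e] \<Psi>[OF e] by simp
  qed
  have bij: "bij_betw \<Phi> (carrier (cuntz_krieger_algebra A)) (carrier (cuntz_krieger_algebra C))"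
    by (rule bij_betw_byWitness[where f' = \<Psi>]) (use \<Psi>\<Phi> \<Phi>\<Psi> in auto)
  have D1: "\<Phi> ` ck_diagonal A \<subseteq> ck_diagonal C"
    unfolding a.diagonal_eq
  proof (rule f.hom_generated[OF c.diagonal_subalgebra a.gens_closed])
    have "\<Phi> (a.ev (pr \<mu>)) \<in> ck_diagonal C" if "set \<mu> \<subseteq> edges A" for \<mu>
      unfolding \<Phi>pr[OF that] using c.level_diagonal c.sum_pr_level[of "lifts \<mu>" "length \<mu>"]
      by (auto simp: lifts_def)
    then show "\<Phi> ` {a.ev (pr \<mu>) |\<mu>. \<mu> \<noteq> [] \<and> set \<mu> \<subseteq> edges A} \<subseteq> ck_diagonal C" by blast
  qed
  have D2: "\<Psi> ` ck_diagonal C \<subseteq> ck_diagonal A"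
    unfolding c.diagonal_eq
  proof (rule g.hom_generated[OF a.diagonal_subalgebra c.gens_closed])
    show "\<Psi> ` {c.ev (pr \<mu>) |\<mu>. \<mu> \<noteq> [] \<and> set \<mu> \<subseteq> edges C} \<subseteq> ck_diagonal A"
      using \<Psi>pr a.level_diagonal by blast
  qed
  have D: "\<Phi> ` ck_diagonal A = ck_diagonal C"
  proof
    show "ck_diagonal C \<subseteq> \<Phi> ` ck_diagonal A"
    proof
      fix y assume y: "y \<in> ck_diagonal C"
      then have "y = \<Phi> (\<Psi> y)" using \<Phi>\<Psi> c.diagonal_closed by simp
      then show "y \<in> \<Phi> ` ck_diagonal A" using D2 y by blast
    qed
  qed (rule D1)
  have gauge: "\<Phi> (ck_gauge A t x) = ck_gauge C t (\<Phi> x)" if "x \<in> carrier (cuntz_krieger_algebra A)" for t x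
  proof -
    interpret ga: ck_hom A A "ck_gauge A t" by (rule ck_gauge_hom)
    interpret gc: ck_hom C C "ck_gauge C t" by (rule ck_gauge_hom)
    show ?thesis
    proof (rule ck_hom_eqI[OF _ _ _ that])
      show "ck_hom A C (\<lambda>x. \<Phi> (ck_gauge A t x))"
        by (rule ck_homI[OF star_homomorphism_comp[OF ga.star_homomorphism_axioms f.star_homomorphism_axioms]])
      show "ck_hom A C (\<lambda>x. ck_gauge C t (\<Phi> x))"
        by (rule ck_homI[OF star_homomorphism_comp[OF f.star_homomorphism_axioms gc.star_homomorphism_axioms]])
      fix b assume b: "b \<in> edges A"
      have "ck_gauge C t (c.ev (T b)) = c.ev (\<Sum>e\<in>fibre b. fscale (ck_phase t) (fgen e))"
        unfolding T_def
      proof (rule gc.sum_rel)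
        fix e assume "e \<in> fibre b"
        then have "e \<in> edges C" by (simp add: fibre_def)
        then show "ck_gauge C t (c.ev (fgen e)) = c.ev (fscale (ck_phase t) (fgen e))"
          by (simp add: c.ev_gen c.ev_fscale ck_gauge_ck_gen)
      qed
      also have "(\<Sum>e\<in>fibre b. fscale (ck_phase t) (fgen e)) = fscale (ck_phase t) (T b)"
        by (simp add: T_def fscale_def sum_distrib_left)
      finally show "\<Phi> (ck_gauge A t (ck_gen A b)) = ck_gauge C t (\<Phi> (ck_gen A b))"
        using b by (simp add: \<Phi> ck_gauge_ck_gen f.hom_smult ck_gen_closed c.ev_fscale)
    qed
  qed
  have "\<Phi> \<in> star_iso (cuntz_krieger_algebra A) (cuntz_krieger_algebra C)"
    using f.hom bij by (simp add: star_iso_def)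
  then show ?thesis unfolding ck_triplet_def triplet_isomorphic.simps using D gauge by blast
qed

end

section \<open>From conjugacies to labelled graphs\<close>

definition one_sided :: "nat mat \<Rightarrow> (nat \<Rightarrow> edge) set" where
  "one_sided A = {x. \<forall>n. x n \<in> edges A \<and> target (x n) = source (x (Suc n))}"

abbreviation (input) tl_seq :: "(nat \<Rightarrow> 'a) \<Rightarrow> nat \<Rightarrow> 'a" where
  "tl_seq x \<equiv> \<lambda>n. x (Suc n)"

lemma one_sided_tl: "x \<in> one_sided A \<Longrightarrow> tl_seq x \<in> one_sided A"
  by (auto simp: one_sided_def)

lemma one_sided_Cons:
  "x \<in> one_sided A \<Longrightarrow> a \<in> edges A \<Longrightarrow> target a = source (x 0) \<Longrightarrow> case_nat a x \<in> one_sided A"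
  unfolding one_sided_def
proof (intro CollectI allI)
  fix n assume "x \<in> {x. \<forall>n. x n \<in> edges A \<and> target (x n) = source (x (Suc n))}"
    "a \<in> edges A" "target a = source (x 0)"
  then show "case_nat a x n \<in> edges A \<and> target (case_nat a x n) = source (case_nat a x (Suc n))"
    by (cases n) simp_all
qed

definition no_sinks :: "nat mat \<Rightarrow> bool" where
  "no_sinks A \<longleftrightarrow> (\<forall>a\<in>edges A. \<exists>b\<in>edges A. source b = target a)"

lemma one_sided_from:
  assumes "no_sinks A" "a \<in> edges A"
  shows "\<exists>x\<in>one_sided A. x 0 = a"
proof -
  obtain f where f: "\<And>a. a \<in> edges A \<Longrightarrow> f a \<in> edges A \<and> source (f a) = target a"
    using assms(1) unfolding no_sinks_def by metis
  have "(f ^^ n) a \<in> edges A" for n by (induction n) (auto simp: assms f)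
  then have "(\<lambda>n. (f ^^ n) a) \<in> one_sided A" by (auto simp: one_sided_def f)
  then show ?thesis by (intro bexI[of _ "\<lambda>n. (f ^^ n) a"]) auto
qed

lemma one_sided_extend:
  assumes A: "no_sinks A" and \<mu>: "set \<mu> \<subseteq> edges A" "is_path \<mu>" "\<mu> \<noteq> []"
  shows "\<exists>x\<in>one_sided A. \<forall>i<length \<mu>. x i = \<mu> ! i"
  using \<mu>
proof (induction \<mu> rule: induct_list012)
  case (2 a)
  then show ?case using one_sided_from[OF A, of a] by auto
next
  case (3 a b \<mu>)
  then obtain x where x: "x \<in> one_sided A" "\<forall>i<length (b # \<mu>). x i = (b # \<mu>) ! i"
    by (auto simp: is_path_def)
  have "x 0 = b" using x(2) by auto
  then have "case_nat a x \<in> one_sided A" using x(1) 3 by (intro one_sided_Cons) (auto simp: is_path_def)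
  moreover have "\<forall>i<length (a # b # \<mu>). case_nat a x i = (a # b # \<mu>) ! i"
    using x(2) by (auto split: nat.splits)
  ultimately show ?case by blast
qed simp

text \<open>A graph on the values of a state map \<open>U\<close> of one-sided sequences, with one edge for every pair of
  consecutive states.  The first letter of a sequence is read off its state, and the state of \<open>ax\<close> is
  determined by \<open>a\<close> and the state of \<open>x\<close>.\<close>

locale state_map =
  fixes A C :: "nat mat" and U :: "(nat \<Rightarrow> edge) \<Rightarrow> nat" and lam :: "nat \<Rightarrow> edge" and m :: nat
  assumes m: "0 < m" and sinks: "no_sinks A"
    and window: "x \<in> one_sided A \<Longrightarrow> y \<in> one_sided A \<Longrightarrow> (\<And>i. i < m \<Longrightarrow> x i = y i) \<Longrightarrow> U x = U y"
    and letter: "x \<in> one_sided A \<Longrightarrow> lam (U x) = x 0"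
    and prepend: "x \<in> one_sided A \<Longrightarrow> y \<in> one_sided A \<Longrightarrow> U (tl_seq x) = U (tl_seq y) \<Longrightarrow> x 0 = y 0 \<Longrightarrow> U x = U y"
    and edges_C: "edges C = {(U x, U (tl_seq x), 0) | x. x \<in> one_sided A}"
begin

text \<open>By \<open>window\<close> a state depends on \<open>m\<close> letters only, so for a path
  of length \<open>m\<close> the choice of the extension is immaterial.\<close>

definition st :: "edge list \<Rightarrow> nat" where
  "st \<mu> = U (SOME x. x \<in> one_sided A \<and> (\<forall>i<length \<mu>. x i = \<mu> ! i))"

lemma st_eq:
  assumes x: "x \<in> one_sided A" "\<And>i. i < m \<Longrightarrow> x i = \<mu> ! i" "length \<mu> = m"
  shows "st \<mu> = U x"
proof -
  let ?P = "\<lambda>x. x \<in> one_sided A \<and> (\<forall>i<length \<mu>. x i = \<mu> ! i)"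
  have "?P (SOME x. ?P x)" by (rule someI[of ?P x]) (use x in auto)
  then show ?thesis unfolding st_def by (intro window) (use x in auto)
qed

lemma edge_C: assumes "e \<in> edges C"
  obtains x where "x \<in> one_sided A" "e = (U x, U (tl_seq x), 0)" "lam (source e) = x 0"
    "source e = U x" "target e = U (tl_seq x)"
proof -
  obtain x where x: "x \<in> one_sided A" "e = (U x, U (tl_seq x), 0)"
    using assms unfolding edges_C by blast
  show thesis by (rule that[OF x]) (simp_all add: x(2) letter[OF x(1)])
qed

text \<open>A path of \<open>C\<close> need not come from one sequence by definition, as its edges
  are given by different ones. Gluing works from the end: the first letter of the sequence behind
  \<open>e\<close> is put in front of \<open>y\<close>, and \<open>prepend\<close> shows that the
  state of the result is the source of \<open>e\<close>.\<close>

lemma lift_path: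
  assumes "set \<kappa> \<subseteq> edges C" "is_path \<kappa>" "\<kappa> \<noteq> []"
  shows "\<exists>x\<in>one_sided A. U x = source (hd \<kappa>) \<and> (\<forall>i<length \<kappa>. x i = lam (source (\<kappa> ! i)))"
  using assms
proof (induction \<kappa> rule: induct_list012)
  case (2 e)
  then obtain x where "x \<in> one_sided A" "lam (source e) = x 0" "source e = U x" by (auto elim: edge_C)
  then show ?case by auto
next
  case (3 e f \<kappa>)
  then obtain y where y: "y \<in> one_sided A" "U y = source f" "\<forall>i<length (f # \<kappa>). y i = lam (source ((f # \<kappa>) ! i))"
    by (auto simp: is_path_def)
  have "e \<in> edges C" using 3 by simp
  then obtain x where x: "x \<in> one_sided A" "lam (source e) = x 0" "source e = U x" "target e = U (tl_seq x)"
    by (auto elim: edge_C)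
  have Uy: "U (tl_seq x) = U y" using x y 3 by (simp add: is_path_def)
  then have "x 1 = y 0" using letter[OF y(1)] letter[OF one_sided_tl[OF x(1)]] by simp
  then have z: "case_nat (x 0) y \<in> one_sided A"
    using x(1) by (intro one_sided_Cons y) (auto simp: one_sided_def)
  have "U (case_nat (x 0) y) = U x" by (rule prepend[OF z x(1)]) (simp_all add: Uy)
  moreover have "\<forall>i<length (e # f # \<kappa>). case_nat (x 0) y i = lam (source ((e # f # \<kappa>) ! i))"
    using y(3) x(2) by (auto split: nat.splits)
  ultimately show ?case using z x(3) by (intro bexI[of _ "case_nat (x 0) y"]) auto
qed simp

sublocale label_graph A C "\<lambda>e. lam (source e)" st m
proof (unfold_locales, goal_cases)
  case 1 show ?case by (rule m)
next
  case (2 e) then show ?case by (elim edge_C) (auto simp: one_sided_def)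
next
  case (3 e f)
  then obtain x y where x: "x \<in> one_sided A" "lam (source e) = x 0" "target e = U (tl_seq x)"
    and y: "y \<in> one_sided A" "lam (source f) = y 0" "source f = U y" by (metis edge_C)
  have "x 1 = y 0" using letter[OF y(1)] letter[OF one_sided_tl[OF x(1)]] x y 3 by simp
  moreover have "target (x 0) = source (x 1)" using x(1) by (auto simp: one_sided_def)
  ultimately show ?case using x y by simp
next
  case (4 e f)
  then obtain x y where x: "x \<in> one_sided A" "e = (U x, U (tl_seq x), 0)" "lam (source e) = x 0"
    and y: "y \<in> one_sided A" "f = (U y, U (tl_seq y), 0)" "lam (source f) = y 0" by (metis edge_C)
  then show ?case using 4 prepend[OF x(1) y(1)] by simp
next
  case (5 b f)
  then obtain x where x: "x \<in> one_sided A" "lam (source f) = x 0" "source f = U x" by (metis edge_C)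
  let ?y = "case_nat b x"
  have y: "?y \<in> one_sided A" using x 5 by (intro one_sided_Cons) auto
  have "(U ?y, U (tl_seq ?y), 0) \<in> edges C" unfolding edges_C using y by blast
  then show ?case using letter[OF y] x by (intro bexI[of _ "(U ?y, U (tl_seq ?y), 0)"]) auto
next
  case (6 b \<mu>)
  then have \<mu>: "set (b # \<mu>) \<subseteq> edges A" "is_path (b # \<mu>)" "length \<mu> = m"
    by (auto simp: cuntz_krieger.paths_def words_def)
  then obtain x where x: "x \<in> one_sided A" "\<And>i. i < Suc m \<Longrightarrow> x i = (b # \<mu>) ! i"
    using one_sided_extend[OF sinks \<mu>(1,2)] by auto
  have e: "(U x, U (tl_seq x), 0) \<in> edges C" unfolding edges_C using x by blast
  have "st \<mu> = U (tl_seq x)" using x(2)[of "Suc _"] \<mu> by (intro st_eq one_sided_tl x) auto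
  moreover have "st (butlast (b # \<mu>)) = U x" by (intro st_eq x) (use x(2) \<mu> in \<open>auto simp: nth_butlast simp del: butlast.simps\<close>)
  moreover have "lam (U x) = b" using letter[OF x(1)] x(2)[of 0] by simp
  ultimately show ?case using e by (intro bexI[of _ "(U x, U (tl_seq x), 0)"]) auto
next
  case (7 \<kappa>)
  then have \<kappa>: "set \<kappa> \<subseteq> edges C" "is_path \<kappa>" "length \<kappa> = m"
    by (auto simp: cuntz_krieger.paths_def words_def)
  then obtain x where x: "x \<in> one_sided A" "U x = source (hd \<kappa>)" "\<And>i. i < m \<Longrightarrow> x i = lam (source (\<kappa> ! i))"
    using lift_path[OF \<kappa>(1,2)] m by auto
  have "st (map (\<lambda>e. lam (source e)) \<kappa>) = U x" by (rule st_eq[OF x(1)]) (use x \<kappa> in auto)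
  then show ?case using x by simp
next
  case (8 e \<mu>)
  then obtain x where x: "x \<in> one_sided A" "lam (source e) = x 0" "target e = U (tl_seq x)" by (metis edge_C)
  from 8 have \<mu>: "set \<mu> \<subseteq> edges A" "is_path \<mu>" "length \<mu> = m"
    by (auto simp: cuntz_krieger.paths_def words_def)
  then have ne: "\<mu> \<noteq> []" using m by auto
  then obtain y where y: "y \<in> one_sided A" "\<And>i. i < m \<Longrightarrow> y i = \<mu> ! i"
    using one_sided_extend[OF sinks \<mu>(1,2)] \<mu> by auto
  then have "U y = U (tl_seq x)" using st_eq[OF y \<mu>(3)] 8 x by simp
  then have "y 0 = x 1" using letter[OF y(1)] letter[OF one_sided_tl[OF x(1)]] by simp
  moreover have "y 0 = hd \<mu>" using y(2)[of 0] m ne by (simp add: hd_conv_nth)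
  moreover have "target (x 0) = source (x 1)" using x(1) by (auto simp: one_sided_def)
  ultimately show ?case using x by simp
qed

end

section \<open>Bi-infinite sequences, time reversal and causal codes\<close>

abbreviation (input) shiftz :: "int \<Rightarrow> (int \<Rightarrow> 'a) \<Rightarrow> int \<Rightarrow> 'a" where
  "shiftz k x \<equiv> \<lambda>n. x (n + k)"

abbreviation X :: "nat mat \<Rightarrow> (int \<Rightarrow> edge) set" where "X \<equiv> two_sided_shift_space"

lemma X_iff: "x \<in> X A \<longleftrightarrow> (\<forall>n. x n \<in> edges A \<and> target (x n) = source (x (n + 1)))"
  by (simp add: two_sided_shift_space_def)

lemma shiftz_X [simp]: "shiftz k x \<in> X A \<longleftrightarrow> x \<in> X A"
proof
  assume x: "shiftz k x \<in> X A"
  have "x n \<in> edges A \<and> target (x n) = source (x (n + 1))" for n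
    using x[unfolded X_iff, rule_format, of "n - k"] by (simp add: algebra_simps)
  then show "x \<in> X A" by (simp add: X_iff)
next
  assume x: "x \<in> X A"
  show "shiftz k x \<in> X A"
    unfolding X_iff using x[unfolded X_iff, rule_format, of "_ + k"] by (simp add: algebra_simps)
qed

definition flip :: "edge \<Rightarrow> edge" where "flip = (\<lambda>(i, j, k). (j, i, k))"

lemma flip_flip [simp]: "flip (flip a) = a" by (cases a) (simp add: flip_def)
lemma source_flip [simp]: "source (flip a) = target a" by (cases a) (simp add: flip_def)
lemma target_flip [simp]: "target (flip a) = source a" by (cases a) (simp add: flip_def)
lemma edges_transpose: "a \<in> edges (transpose_mat A) \<longleftrightarrow> flip a \<in> edges A"
  by (cases a) (auto simp: edges_def flip_def)

definition revz :: "(int \<Rightarrow> edge) \<Rightarrow> int \<Rightarrow> edge" where "revz x = (\<lambda>n. flip (x (- n)))"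

lemma revz_revz [simp]: "revz (revz x) = x" by (simp add: revz_def)

lemma revz_X: "revz x \<in> X (transpose_mat A) \<longleftrightarrow> x \<in> X A"
proof -
  have "(\<forall>n. P (- n)) \<longleftrightarrow> (\<forall>n. P n)" for P :: "int \<Rightarrow> bool" by (metis minus_minus)
  from this[of "\<lambda>n. x n \<in> edges A \<and> source (x n) = target (x (n - 1))"]
  have "revz x \<in> X (transpose_mat A) \<longleftrightarrow> (\<forall>n. x n \<in> edges A \<and> source (x n) = target (x (n - 1)))"
    by (simp add: X_iff revz_def edges_transpose)
  also have "\<dots> \<longleftrightarrow> x \<in> X A"
    unfolding X_iff by (metis add_diff_cancel diff_add_cancel)
  finally show ?thesis .
qed

definition no_sources :: "nat mat \<Rightarrow> bool" where
  "no_sources A \<longleftrightarrow> no_sinks (transpose_mat A)"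

lemma no_sources_from:
  assumes "no_sources A" "a \<in> edges A"
  shows "\<exists>x. x 0 = a \<and> (\<forall>n. x n \<in> edges A \<and> source (x n) = target (x (Suc n)))"
proof -
  obtain x where x: "x \<in> one_sided (transpose_mat A)" "x 0 = flip a"
    using one_sided_from[of "transpose_mat A" "flip a"] assms by (auto simp: no_sources_def edges_transpose)
  have "\<forall>n. flip (x n) \<in> edges A \<and> source (flip (x n)) = target (flip (x (Suc n)))"
    using x(1) by (simp add: one_sided_def edges_transpose)
  then show ?thesis using x(2) by (intro exI[of _ "\<lambda>n. flip (x n)"]) simp
qed

lemma join_X:
  assumes past: "\<And>n. n < k \<Longrightarrow> x n \<in> edges A \<and> target (x n) = source (x (n + 1))"
    and fut: "\<And>n. n \<ge> k \<Longrightarrow> y n \<in> edges A \<and> target (y n) = source (y (n + 1))"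
    and eq: "source (x k) = source (y k)"
  shows "(\<lambda>n. if n < k then x n else y n) \<in> X A"
  unfolding X_iff
proof
  fix n :: int
  consider "n + 1 < k" | "n + 1 = k" | "n \<ge> k" by linarith
  then show "(if n < k then x n else y n) \<in> edges A \<and>
    target (if n < k then x n else y n) = source (if n + 1 < k then x (n + 1) else y (n + 1))"
    by cases (use past[of n] fut[of n] eq in auto)
qed

lemma extend_one_sided:
  assumes A: "no_sources A" and x: "x \<in> one_sided A"
  shows "\<exists>z\<in>X A. \<forall>n. z (int n) = x n"
proof -
  have "x 0 \<in> edges A" using x by (simp add: one_sided_def)
  then obtain p where p: "p 0 = x 0" "\<And>n. p n \<in> edges A \<and> source (p n) = target (p (Suc n))"
    using no_sources_from[OF A] by blast
  let ?z = "\<lambda>n. if n < 0 then p (nat (- n)) else x (nat n)"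
  have "?z \<in> X A"
  proof (rule join_X)
    fix n :: int assume "n < 0"
    then have "nat (- n) = Suc (nat (- (n + 1)))" by simp
    then show "p (nat (- n)) \<in> edges A \<and> target (p (nat (- n))) = source (p (nat (- (n + 1))))"
      using p(2) by metis
  next
    fix n :: int assume "n \<ge> 0"
    then have "nat (n + 1) = Suc (nat n)" by simp
    then show "x (nat n) \<in> edges A \<and> target (x (nat n)) = source (x (nat (n + 1)))"
      using x by (simp add: one_sided_def)
  qed (use p in simp)
  then show ?thesis by (intro bexI[of _ ?z]) auto
qed

lemma one_sided_of_X: "z \<in> X A \<Longrightarrow> (\<lambda>n. z (int n + k)) \<in> one_sided A"
  unfolding one_sided_def
proof (intro CollectI allI)
  fix n assume "z \<in> X A"
  then have "z (int n + k) \<in> edges A \<and> target (z (int n + k)) = source (z (int n + k + 1))"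
    by (simp add: X_iff)
  moreover have "int n + k + 1 = int (Suc n) + k" by simp
  ultimately show "z (int n + k) \<in> edges A \<and> target (z (int n + k)) = source (z (int (Suc n) + k))"
    by simp
qed

text \<open>\<open>K\<close> is a letter code of the two-sided shift looking \<open>N\<close> letters ahead; the vertices of \<open>C\<close> encode
  the words of length \<open>N\<close> of the joint sequence \<open>(x\<^sub>n, K(x)\<^sub>n)\<^sub>n\<close>.\<close>

definition jword :: "((int \<Rightarrow> edge) \<Rightarrow> int \<Rightarrow> 'b) \<Rightarrow> nat \<Rightarrow> (int \<Rightarrow> edge) \<Rightarrow> int \<Rightarrow> (edge \<times> 'b) list" where
  "jword K N x n = map (\<lambda>i. (x (n + int i), K x (n + int i))) [0..<N]"

lemma jword_eq_iff:
  "jword K N x n = jword K N y k \<longleftrightarrow>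
     (\<forall>i<N. x (n + int i) = y (k + int i) \<and> K x (n + int i) = K y (k + int i))"
  by (auto simp: jword_def map_eq_conv)

locale causal_code =
  fixes A :: "nat mat" and K :: "(int \<Rightarrow> edge) \<Rightarrow> int \<Rightarrow> 'b" and N :: nat
  assumes sinks: "no_sinks A" and sources: "no_sources A" and N: "0 < N"
    and K_shift: "x \<in> X A \<Longrightarrow> K (shiftz k x) n = K x (n + k)"
    and K_window: "x \<in> X A \<Longrightarrow> y \<in> X A \<Longrightarrow> (\<And>i. 0 \<le> i \<Longrightarrow> i \<le> int N \<Longrightarrow> x i = y i) \<Longrightarrow> K x 0 = K y 0"
begin

lemma K_window':
  assumes "x \<in> X A" "y \<in> X A" "\<And>i. 0 \<le> i \<Longrightarrow> i \<le> int N \<Longrightarrow> x (n + i) = y (k + i)"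
  shows "K x n = K y k"
proof -
  have "K (shiftz n x) 0 = K (shiftz k y) 0"
  proof (rule K_window)
    show "x (i + n) = y (i + k)" if "0 \<le> i" "i \<le> int N" for i
      using assms(3)[OF that] by (metis add.commute)
  qed (use assms in simp_all)
  then show ?thesis using K_shift[OF assms(1), of n 0] K_shift[OF assms(2), of k 0] by simp
qed

text \<open>The last entry of the code sits at offset \<open>N - 1\<close> and looks
  \<open>N\<close> letters further, whence the window of \<open>2 N\<close> letters.\<close>

lemma jword_window:
  assumes "x \<in> X A" "y \<in> X A" "\<And>i. 0 \<le> i \<Longrightarrow> i < 2 * int N \<Longrightarrow> x (n + i) = y (k + i)"
  shows "jword K N x n = jword K N y k"
  unfolding jword_eq_iff
proof (intro allI impI conjI)
  fix i assume i: "i < N"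
  then show "x (n + int i) = y (k + int i)" using assms(3)[of "int i"] N by simp
  show "K x (n + int i) = K y (k + int i)"
  proof (rule K_window'[OF assms(1,2)])
    fix j assume "0 \<le> j" "j \<le> int N"
    then show "x (n + int i + j) = y (k + int i + j)" using assms(3)[of "int i + j"] i by (simp add: add.assoc)
  qed
qed

lemma jword_shift:
  assumes "x \<in> X A"
  shows "jword K N (shiftz k x) n = jword K N x (n + k)"
  unfolding jword_eq_iff
proof (intro allI impI conjI)
  fix i
  have eq: "n + int i + k = n + k + int i" by simp
  show "x (n + int i + k) = x (n + k + int i)" by (simp only: eq)
  show "K (shiftz k x) (n + int i) = K x (n + k + int i)"
    using K_shift[OF assms, of k "n + int i"] by (simp only: eq)
qed

text \<open>The letter \<open>K x n\<close> depends on the letters of \<open>x\<close> from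
  \<open>n\<close> to \<open>n + N\<close>; the first is given and the others occur in the word at
  \<open>n + 1\<close>. Length \<open>N\<close> is just enough for this, and it yields the
  \<open>prepend\<close> property of the states.\<close>

lemma jword_back:
  assumes xy: "x \<in> X A" "y \<in> X A" and w: "jword K N x (n + 1) = jword K N y (k + 1)" and 0: "x n = y k"
  shows "jword K N x n = jword K N y k"
proof -
  have e: "x (n + int (Suc i)) = y (k + int (Suc i)) \<and> K x (n + int (Suc i)) = K y (k + int (Suc i))" if "i < N" for i
    using w that unfolding jword_eq_iff by (auto simp: algebra_simps)
  have "K x n = K y k"
  proof (rule K_window'[OF xy])
    fix i :: int assume i: "0 \<le> i" "i \<le> int N"
    show "x (n + i) = y (k + i)"
    proof (cases "i = 0")
      case False
      then have "i = int (Suc (nat (i - 1)))" "nat (i - 1) < N" using i by auto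
      then show ?thesis using e by metis
    qed (use 0 in simp)
  qed
  show ?thesis
    unfolding jword_eq_iff
  proof (intro allI impI)
    fix i assume "i < N"
    then show "x (n + int i) = y (k + int i) \<and> K x (n + int i) = K y (k + int i)"
      using 0 \<open>K x n = K y k\<close> e[of "i - 1"] by (cases i) auto
  qed
qed

text \<open>The numbering \<open>enc\<close> is an arbitrary injection, so that one matrix can be
  described by the words of a sequence and by those of its reversal.\<close>

theorem triplet_isomorphic_jword:
  assumes inj: "inj_on enc {jword K N x 0 | x. x \<in> X A}"
    and C: "edges C = {(enc (jword K N x 0), enc (jword K N x 1), 0) | x. x \<in> X A}"
  shows "triplet_isomorphic (ck_triplet A) (ck_triplet C)"
proof -
  \<comment> \<open>A one-sided sequence is continued to the left in some way; words at nonnegative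
    positions look only to the right and do not depend on the choice.\<close>
  define ext where "ext x = (SOME z. z \<in> X A \<and> (\<forall>n. z (int n) = x n))" for x :: "nat \<Rightarrow> edge"
  have ext: "ext x \<in> X A" "ext x (int n) = x n" if "x \<in> one_sided A" for x n
    using someI_ex[OF extend_one_sided[OF sources that, unfolded Bex_def]] by (auto simp: ext_def)
  define U where "U x = enc (jword K N (ext x) 0)" for x
  define lam where "lam v = fst (hd (inv_into {jword K N x 0 | x. x \<in> X A} enc v))" for v
  have U: "U (\<lambda>n. z (int n + k)) = enc (jword K N z k)" if z: "z \<in> X A" for z k
  proof -
    note o = one_sided_of_X[OF z, of k]
    have "jword K N (ext (\<lambda>n. z (int n + k))) 0 = jword K N z k"
    proof (rule jword_window[OF ext(1)[OF o] z])
      fix i :: int assume "0 \<le> i"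
      then show "ext (\<lambda>n. z (int n + k)) (0 + i) = z (k + i)"
        using ext(2)[OF o, of "nat i"] by (simp add: add.commute)
    qed
    then show ?thesis by (simp add: U_def)
  qed
  have Uext: "U (tl_seq x) = enc (jword K N (ext x) 1)" if x: "x \<in> one_sided A" for x
  proof -
    have "tl_seq x = (\<lambda>n. ext x (int n + 1))"
      using ext(2)[OF x, of "Suc _"] by (auto simp: add.commute)
    then show ?thesis using U[OF ext(1)[OF x], of 1] by simp
  qed
  have mem: "jword K N x n \<in> {jword K N x 0 | x. x \<in> X A}" if "x \<in> X A" for x n
    using that jword_shift[OF that, of n 0] by (intro CollectI exI[of _ "shiftz n x"]) simp
  have dec: "enc (jword K N x n) = enc (jword K N y k) \<longleftrightarrow> jword K N x n = jword K N y k"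
    if "x \<in> X A" "y \<in> X A" for x y n k
    using inj_on_eq_iff[OF inj mem mem] that by blast
  interpret state_map A C U lam "2 * N"
  proof
    show "0 < 2 * N" using N by simp
    show "no_sinks A" by (rule sinks)
    fix x assume x: "x \<in> one_sided A"
    have "inv_into {jword K N x 0 | x. x \<in> X A} enc (U x) = jword K N (ext x) 0"
      unfolding U_def by (rule inv_into_f_f[OF inj mem[OF ext(1)[OF x]]])
    then show "lam (U x) = x 0"
      using ext(2)[OF x, of 0] N by (simp add: lam_def jword_def upt_conv_Cons)
    fix y assume y: "y \<in> one_sided A"
    show "U x = U y" if "\<And>i. i < 2 * N \<Longrightarrow> x i = y i"
    proof -
      have "jword K N (ext x) 0 = jword K N (ext y) 0"
      proof (rule jword_window[OF ext(1)[OF x] ext(1)[OF y]])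
        fix i :: int assume "0 \<le> i" "i < 2 * int N"
        then show "ext x (0 + i) = ext y (0 + i)"
          using ext(2)[OF x, of "nat i"] ext(2)[OF y, of "nat i"] that[of "nat i"] by simp
      qed
      then show ?thesis by (simp add: U_def)
    qed
    show "U x = U y" if "U (tl_seq x) = U (tl_seq y)" "x 0 = y 0"
    proof -
      have "jword K N (ext x) (0 + 1) = jword K N (ext y) (0 + 1)"
        using that(1) dec[OF ext(1)[OF x] ext(1)[OF y]] by (simp add: Uext x y)
      from jword_back[OF ext(1)[OF x] ext(1)[OF y] this] show ?thesis
        using that(2) ext(2)[OF x, of 0] ext(2)[OF y, of 0] by (simp add: U_def)
    qed
  next
    show "edges C = {(U x, U (tl_seq x), 0) | x. x \<in> one_sided A}"
    proof (intro equalityI subsetI)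
      fix e :: edge assume "e \<in> edges C"
      then obtain z where z: "z \<in> X A" "e = (enc (jword K N z 0), enc (jword K N z 1), 0)" unfolding C by blast
      let ?x = "\<lambda>n. z (int n + 0)"
      have "?x \<in> one_sided A" by (rule one_sided_of_X[OF z(1)])
      moreover have "tl_seq ?x = (\<lambda>n. z (int n + 1))" by (simp add: add.commute)
      ultimately show "e \<in> {(U x, U (tl_seq x), 0) | x. x \<in> one_sided A}"
        using z(2) U[OF z(1), of 0] U[OF z(1), of 1] by (intro CollectI exI[of _ ?x]) simp
    next
      fix e :: edge assume "e \<in> {(U x, U (tl_seq x), 0) | x. x \<in> one_sided A}"
      then obtain x where x: "x \<in> one_sided A" "e = (U x, U (tl_seq x), 0)" by blast
      then show "e \<in> edges C"
        unfolding C using ext(1)[OF x(1)] Uext[OF x(1)] by (auto simp: U_def)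
    qed
  qed
  show ?thesis by (rule triplet_isomorphic_A_C)
qed

end

section \<open>Irreducible graphs: walks and branching\<close>

lemma pow_mat_pos_iff:
  fixes A :: "nat mat"
  assumes A: "A \<in> carrier_mat n n" and ij: "i < n" "j < n"
  shows "0 < (A ^\<^sub>m k) $$ (i, j) \<longleftrightarrow>
    (\<exists>v. v 0 = i \<and> v k = j \<and> (\<forall>t\<le>k. v t < n) \<and> (\<forall>t<k. 0 < A $$ (v t, v (Suc t))))"
  using ij(2)
proof (induction k arbitrary: j)
  case 0
  have "0 < (A ^\<^sub>m 0) $$ (i, j) \<longleftrightarrow> i = j" using A ij(1) 0 by auto
  also have "\<dots> \<longleftrightarrow> (\<exists>v :: nat \<Rightarrow> nat. v 0 = i \<and> v 0 = j \<and> (\<forall>t\<le>0. v t < n) \<and> (\<forall>t<0. 0 < A $$ (v t, v (Suc t))))"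
    using ij(1) by (auto intro: exI[of _ "\<lambda>_. i"])
  finally show ?case .
next
  case (Suc k)
  have Ak: "A ^\<^sub>m k \<in> carrier_mat n n" using A by (rule pow_carrier_mat)
  have "(A ^\<^sub>m Suc k) $$ (i, j) = (\<Sum>l\<in>{0..<n}. (A ^\<^sub>m k) $$ (i, l) * A $$ (l, j))"
    using A Ak ij(1) Suc.prems by (auto simp: scalar_prod_def intro!: sum.cong)
  note eq = this
  have "0 < (A ^\<^sub>m Suc k) $$ (i, j) \<longleftrightarrow> (\<exists>l<n. 0 < (A ^\<^sub>m k) $$ (i, l) \<and> 0 < A $$ (l, j))"
  proof -
    have "(\<Sum>l\<in>{0..<n}. f l) = 0 \<longleftrightarrow> (\<forall>l\<in>{0..<n}. f l = 0)" for f :: "nat \<Rightarrow> nat"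
      by (rule sum_eq_0_iff) simp
    then have "0 < (\<Sum>l\<in>{0..<n}. f l) \<longleftrightarrow> (\<exists>l<n. 0 < f l)" for f :: "nat \<Rightarrow> nat"
      by (metis atLeastLessThan_iff gr_zeroI less_numeral_extra(3) zero_le)
    from this[of "\<lambda>l. (A ^\<^sub>m k) $$ (i, l) * A $$ (l, j)"] show "?thesis"
      unfolding eq nat_0_less_mult_iff .
  qed
  also have "\<dots> \<longleftrightarrow> (\<exists>v. v 0 = i \<and> v (Suc k) = j \<and> (\<forall>t\<le>Suc k. v t < n) \<and> (\<forall>t<Suc k. 0 < A $$ (v t, v (Suc t))))"
    (is "?L \<longleftrightarrow> ?R")
  proof
    assume ?L
    then obtain l where l: "l < n" "0 < (A ^\<^sub>m k) $$ (i, l)" "0 < A $$ (l, j)" by blast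
    then obtain v where v: "v 0 = i" "v k = l" "\<forall>t\<le>k. v t < n" "\<forall>t<k. 0 < A $$ (v t, v (Suc t))"
      using Suc.IH by blast
    show ?R
      by (rule exI[of _ "v(Suc k := j)"]) (use v l Suc.prems in \<open>auto simp: less_Suc_eq le_Suc_eq\<close>)
  next
    assume ?R
    then obtain v where v: "v 0 = i" "v (Suc k) = j" "\<forall>t\<le>Suc k. v t < n" "\<forall>t<Suc k. 0 < A $$ (v t, v (Suc t))"
      by blast
    have "0 < (A ^\<^sub>m k) $$ (i, v k)" unfolding Suc.IH[OF v(3)[rule_format, of k, simplified]]
      by (rule exI[of _ v]) (use v in auto)
    then show ?L using v by (intro exI[of _ "v k"]) auto
  qed
  finally show ?case .
qed

locale irreducible_graph =
  fixes A :: "nat mat" and n :: nat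
  assumes A: "A \<in> carrier_mat n n" and irr: "irreducible_matrix A" and perm: "\<not> permutation_matrix A"
begin

lemma edge_iff: "(i, j, k) \<in> edges A \<longleftrightarrow> i < n \<and> j < n \<and> k < A $$ (i, j)"
  unfolding edges_def mem_Collect_eq prod.case carrier_matD[OF A] ..

lemma vertices: "a \<in> edges A \<Longrightarrow> source a < n \<and> target a < n"
proof -
  assume "a \<in> edges A"
  moreover obtain i j k where "a = (i, j, k)" by (cases a)
  ultimately show ?thesis using edge_iff[of i j k] by simp
qed

lemma walk:
  assumes "i < n" "j < n"
  shows "\<exists>k>0. \<exists>v. v 0 = i \<and> v k = j \<and> (\<forall>t<k. (v t, v (Suc t), 0) \<in> edges A)"
proof -
  obtain k where k: "k \<ge> 1" "0 < (A ^\<^sub>m k) $$ (i, j)"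
    using irr A assms unfolding irreducible_matrix_def by auto
  then obtain v where v: "v 0 = i" "v k = j" "\<forall>t\<le>k. v t < n" "\<forall>t<k. 0 < A $$ (v t, v (Suc t))"
    using pow_mat_pos_iff[OF A assms] by blast
  show ?thesis by (rule exI[of _ k]) (use k v in \<open>auto simp: edge_iff intro!: exI[of _ v]\<close>)
qed

lemma out_edge: assumes "i < n" shows "\<exists>b\<in>edges A. source b = i"
proof -
  obtain k v where "k > 0" "v 0 = i" "\<forall>t<k. (v t, v (Suc t), 0) \<in> edges A"
    using walk[OF assms assms] by blast
  then show ?thesis by (intro bexI[of _ "(v 0, v (Suc 0), 0)"]) auto
qed

lemma in_edge: assumes "i < n" shows "\<exists>b\<in>edges A. target b = i"
proof -
  obtain k v where k: "k > 0" "v k = i" "\<forall>t<k. (v t, v (Suc t), 0) \<in> edges A"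
    using walk[OF assms assms] by blast
  have "k - 1 < k" using k(1) by simp
  then have "(v (k - 1), v (Suc (k - 1)), 0) \<in> edges A" using k(3) by blast
  then have "(v (k - 1), v k, 0) \<in> edges A" using k(1) by simp
  then show ?thesis using k(2) by (intro bexI[of _ "(v (k - 1), v k, 0)"]) auto
qed

lemma sinks: "no_sinks A"
  unfolding no_sinks_def
proof
  fix a assume "a \<in> edges A"
  then have "target a < n" using vertices by simp
  then show "\<exists>b\<in>edges A. source b = target a" by (rule out_edge)
qed

lemma sources: "no_sources A"
  unfolding no_sources_def no_sinks_def
proof
  fix a assume "a \<in> edges (transpose_mat A)"
  then have "target a < n" using vertices[of "flip a"] edges_transpose[of a A] by simp
  from in_edge[OF this] obtain b where "b \<in> edges A" "target b = target a" by blast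
  then show "\<exists>b\<in>edges (transpose_mat A). source b = target a"
    by (intro bexI[of _ "flip b"]) (auto simp: edges_transpose)
qed

text \<open>If every vertex had a single outgoing edge, the successor map would be onto, as every
  vertex has an incoming edge. On finitely many vertices it would be a permutation, with matrix
  \<open>A\<close>.\<close>

lemma branching: "\<exists>a\<in>edges A. \<exists>b\<in>edges A. a \<noteq> b \<and> source a = source b"
proof (rule ccontr)
  assume no: "\<not> ?thesis"
  define f where "f i = (SOME a. a \<in> edges A \<and> source a = i)" for i
  have f: "f i \<in> edges A \<and> source (f i) = i" if "i < n" for i
    unfolding f_def by (rule someI_ex) (use out_edge[OF that] in \<open>simp add: Bex_def\<close>)
  have uniq: "a = f i" if "a \<in> edges A" "source a = i" for a i
  proof (rule ccontr)
    assume "a \<noteq> f i"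
    have i: "i < n" using vertices[OF that(1)] that(2) by simp
    have "source a \<noteq> source (f i)"
    proof
      assume "source a = source (f i)"
      then have "\<exists>a\<in>edges A. \<exists>b\<in>edges A. a \<noteq> b \<and> source a = source b"
        using that(1) f[OF i] \<open>a \<noteq> f i\<close> by (intro bexI[of _ a] bexI[of _ "f i"] conjI) simp_all
      then show False using no by contradiction
    qed
    then show False using that(2) f[OF i] by simp
  qed
  define \<pi> where "\<pi> i = (if i < n then target (f i) else i)" for i
  have "{..<n} \<subseteq> \<pi> ` {..<n}"
  proof
    fix j assume "j \<in> {..<n}"
    then have "j < n" by simp
    from in_edge[OF this] obtain b where b: "b \<in> edges A" "target b = j" by blast
    then show "j \<in> \<pi> ` {..<n}"
      using uniq[OF b(1) refl] vertices[OF b(1)] by (intro image_eqI[of _ _ "source b"]) (auto simp: \<pi>_def)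
  qed
  moreover have "\<pi> i < n" if "i < n" for i using vertices[of "f i"] f[OF that] that by (simp add: \<pi>_def)
  ultimately have "\<pi> ` {..<n} = {..<n}" by blast
  then have "bij_betw \<pi> {..<n} {..<n}"
    by (simp add: bij_betw_def eq_card_imp_inj_on)
  then have "\<pi> permutes {..<n}" by (rule bij_imp_permutes) (simp add: \<pi>_def)
  moreover have "A = mat n n (\<lambda>(i, j). if j = \<pi> i then 1 else 0)"
  proof (rule eq_matI)
    fix i j assume "i < dim_row (mat n n (\<lambda>(i, j). if j = \<pi> i then 1 else (0::nat)))"
      "j < dim_col (mat n n (\<lambda>(i, j). if j = \<pi> i then 1 else (0::nat)))"
    then have ij: "i < n" "j < n" by auto
    obtain j' k' where fi: "f i = (i, j', k')" using f[OF ij(1)] by (cases "f i") auto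
    have e: "(i, j, k) \<in> edges A \<longleftrightarrow> j = j' \<and> k = k'" for k
      using uniq[of "(i, j, k)" i] f[OF ij(1)] fi by auto
    have "k < A $$ (i, j) \<longleftrightarrow> j = j' \<and> k = k'" for k using e[of k] ij by (simp add: edge_iff)
    \<comment> \<open>The first and the last index below a positive entry both equal
      \<open>k'\<close>, so such an entry is 1. The index \<open>k'\<close> shows that the entry is
      positive when \<open>j = j'\<close>.\<close>
    from this[of 0] this[of 1] this[of k'] this[of "A $$ (i, j) - 1"]
    have "A $$ (i, j) = (if j = j' then 1 else 0)" by (auto split: if_splits)
    then show "A $$ (i, j) = mat n n (\<lambda>(i, j). if j = \<pi> i then 1 else 0) $$ (i, j)"
      using ij fi by (simp add: \<pi>_def)
  qed (use A in auto)
  ultimately show False using perm unfolding permutation_matrix_def by blast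
qed

lemma connect:
  assumes x: "x \<in> X A" and y: "y \<in> X A"
  shows "\<exists>k>0. \<exists>z\<in>X A. (\<forall>n<M. z n = x n) \<and> (\<forall>n\<ge>0. z (M + int k + n) = y n)"
proof -
  have "source (x M) < n" "source (y 0) < n" using x y vertices by (auto simp: X_iff)
  then obtain k v where k: "k > 0" "v 0 = source (x M)" "v k = source (y 0)"
    "\<forall>t<k. (v t, v (Suc t), 0) \<in> edges A" using walk by blast
  let ?z = "\<lambda>n. if n < M then x n else if n < M + int k then (v (nat (n - M)), v (Suc (nat (n - M))), 0)
     else y (n - M - int k)"
  have "?z n \<in> edges A \<and> target (?z n) = source (?z (n + 1))" for n
  proof -
    consider "n + 1 < M" | "n + 1 = M" | "n \<ge> M" "n + 1 < M + int k" | "n \<ge> M" "n + 1 = M + int k"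
      | "n \<ge> M + int k" using k(1) by linarith
    then show ?thesis
    proof cases
      case 1 then show ?thesis using x by (simp add: X_iff)
    next
      case 2
      then have "target (x n) = source (x M)" using x by (auto simp: X_iff)
      then show ?thesis using x k 2 by (simp add: X_iff)
    next
      case 3
      then have "nat (n + 1 - M) = Suc (nat (n - M))" "nat (n - M) < k" by linarith+
      then show ?thesis using k 3 by simp
    next
      case 4
      then have "Suc (nat (n - M)) = k" "nat (n - M) < k" by linarith+
      moreover from this have "(v (nat (n - M)), v (Suc (nat (n - M))), 0) \<in> edges A" using k(4) by blast
      ultimately show ?thesis using k 4 by simp
    next
      case 5
      have "n + 1 - M - int k = (n - M - int k) + 1" by simp
      then have "?z (n + 1) = y (n - M - int k + 1)" using 5 k(1) by (simp only:) simp
      then show ?thesis using y 5 k(1) by (simp add: X_iff)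
    qed
  qed
  then have "?z \<in> X A" by (simp add: X_iff)
  then show ?thesis using k(1) by (intro exI[of _ k] conjI bexI[of _ ?z]) auto
qed

end

lemma irreducible_graphI:
  "square_mat A \<Longrightarrow> irreducible_matrix A \<Longrightarrow> \<not> permutation_matrix A \<Longrightarrow> irreducible_graph A (dim_row A)"
  by (rule irreducible_graph.intro[OF carrier_matI]) (assumption | rule refl | simp)+

lemma no_sinks_transpose: "no_sources A \<Longrightarrow> no_sinks (transpose_mat A)"
  by (simp add: no_sources_def)

lemma no_sources_transpose: "no_sinks A \<Longrightarrow> no_sources (transpose_mat A)"
  by (simp add: no_sources_def)

text \<open>A conjugacy looking only into the future whose inverse looks only into the past.  Every
  conjugacy takes this form after composition with a power of the shift.\<close>

locale causal_conjugacy =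
  a: irreducible_graph A nA + b: irreducible_graph B nB for A B :: "nat mat" and nA nB +
  fixes H G :: "(int \<Rightarrow> edge) \<Rightarrow> int \<Rightarrow> edge" and N :: nat
  assumes N: "0 < N"
    and H: "x \<in> X A \<Longrightarrow> H x \<in> X B" and G: "y \<in> X B \<Longrightarrow> G y \<in> X A"
    and GH: "x \<in> X A \<Longrightarrow> G (H x) = x" and HG: "y \<in> X B \<Longrightarrow> H (G y) = y"
    and H_shift: "x \<in> X A \<Longrightarrow> H (shiftz k x) = shiftz k (H x)"
    and H_window: "x \<in> X A \<Longrightarrow> x' \<in> X A \<Longrightarrow> (\<And>i. 0 \<le> i \<Longrightarrow> i \<le> int N \<Longrightarrow> x i = x' i) \<Longrightarrow> H x 0 = H x' 0"
    and G_window: "y \<in> X B \<Longrightarrow> y' \<in> X B \<Longrightarrow> (\<And>i. - int N \<le> i \<Longrightarrow> i \<le> 0 \<Longrightarrow> y i = y' i) \<Longrightarrow> G y 0 = G y' 0"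
begin

lemma G_shift: assumes "y \<in> X B" shows "G (shiftz k y) = shiftz k (G y)"
proof -
  have Gy: "shiftz k (G y) \<in> X A" using G[OF assms] by simp
  have "H (shiftz k (G y)) = shiftz k y" unfolding H_shift[OF G[OF assms]] HG[OF assms] ..
  then show ?thesis using GH[OF Gy] by simp
qed

sublocale f: causal_code A H N
proof (rule causal_code.intro)
  fix x n k assume x: "x \<in> X A"
  show "H (shiftz k x) n = H x (n + k)" unfolding H_shift[OF x] ..
qed (rule a.sinks a.sources N H_window; assumption)+

text \<open>The inverse conjugacy in reversed time, where it looks into the future. Its letters
  remain edges of \<open>A\<close> instead of being flipped, since a code may take values in any
  type.\<close>

definition K :: "(int \<Rightarrow> edge) \<Rightarrow> int \<Rightarrow> edge" where "K y = (\<lambda>n. G (revz y) (- n))"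

sublocale r: causal_code "transpose_mat B" K N
proof
  show "no_sinks (transpose_mat B)" using b.sources by (rule no_sinks_transpose)
  show "no_sources (transpose_mat B)" using b.sinks by (rule no_sources_transpose)
  fix y y' assume y: "y \<in> X (transpose_mat B)" and y': "y' \<in> X (transpose_mat B)"
  have r: "revz y \<in> X B" "revz y' \<in> X B" using y y' revz_X[of "revz y"] revz_X[of "revz y'"] by simp_all
  show "K y 0 = K y' 0" if "\<And>i. 0 \<le> i \<Longrightarrow> i \<le> int N \<Longrightarrow> y i = y' i"
    unfolding K_def using G_window[OF r] that by (simp add: revz_def)
next
  fix y n k assume y: "y \<in> X (transpose_mat B)"
  then have r: "revz y \<in> X B" using revz_X[of "revz y"] by simp
  have "revz (shiftz k y) = shiftz (- k) (revz y)" by (simp add: revz_def)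
  then show "K (shiftz k y) n = K y (n + k)" unfolding K_def by (simp only: G_shift[OF r]) simp
qed (rule N)

text \<open>Turns a joint word of the reversed sequence into one of the original: the order is
  reversed, the components change places and the edges of \<open>B\<close> are flipped back.\<close>

definition conv :: "(edge \<times> edge) list \<Rightarrow> (edge \<times> edge) list" where
  "conv w = rev (map (\<lambda>(b, a). (a, flip b)) w)"

text \<open>The positions \<open>n, ..., n + N - 1\<close> of the reversed sequence are the
  positions \<open>1 - N - n, ..., - n\<close> of the original one.\<close>

lemma conv_jword: "conv (jword K N y n) = jword H N (G (revz y)) (1 - int N - n)" if y: "y \<in> X (transpose_mat B)"
proof (rule nth_equalityI)
  show "length (conv (jword K N y n)) = length (jword H N (G (revz y)) (1 - int N - n))"
    by (simp add: conv_def jword_def)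
  fix i assume "i < length (conv (jword K N y n))"
  then have i: "i < N" by (simp add: conv_def jword_def)
  have r: "revz y \<in> X B" using y revz_X[of "revz y"] by simp
  define k where "k = n + int (N - Suc i)"
  have e: "- k = 1 - int N - n + int i" using i by (simp add: k_def)
  have "conv (jword K N y n) ! i = (K y k, flip (y k))"
    using i by (simp add: conv_def jword_def rev_nth k_def)
  also have "\<dots> = (G (revz y) (- k), revz y (- k))" by (simp add: K_def revz_def)
  also have "\<dots> = jword H N (G (revz y)) (1 - int N - n) ! i"
    unfolding e using i HG[OF r] by (simp add: jword_def)
  finally show "conv (jword K N y n) ! i = \<dots>" .
qed

lemma inj_conv: "inj conv"
proof -
  have "inj (\<lambda>(b, a). (a, flip b))" by (auto simp: inj_def) (metis flip_flip prod.inject)+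
  then show ?thesis unfolding conv_def by (auto simp: inj_def inj_map_eq_map)
qed

theorem intermediate_matrix:
  "\<exists>C. square_mat C \<and> irreducible_matrix C \<and> \<not> permutation_matrix C \<and>
     triplet_isomorphic (ck_triplet A) (ck_triplet C) \<and>
     triplet_isomorphic (ck_triplet (transpose_mat B)) (ck_triplet (transpose_mat C))"
proof -
  define W where "W = {jword H N x 0 | x. x \<in> X A}"
  have memW: "jword H N x n \<in> W" if "x \<in> X A" for x n
    unfolding W_def using that f.jword_shift[OF that, of n 0] by (intro CollectI exI[of _ "shiftz n x"]) simp
  have "W \<subseteq> {w. set w \<subseteq> edges A \<times> edges B \<and> length w = N}"
    using H by (auto simp: W_def jword_def X_iff)
  then have finW: "finite W"
    by (rule finite_subset) (intro finite_lists_length_eq finite_cartesian_product finite_edges)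
  define q where "q = card W"
  obtain enc where enc: "bij_betw enc W {0..<q}" using ex_bij_betw_finite_nat[OF finW] by (auto simp: q_def)
  have inj: "inj_on enc W" using enc by (rule bij_betw_imp_inj_on)
  have encq: "enc (jword H N x n) < q" if "x \<in> X A" for x n
    using bij_betwE[OF enc] memW[OF that] by simp
  have dec: "enc (jword H N x n) = enc (jword H N y k) \<longleftrightarrow> jword H N x n = jword H N y k"
    if "x \<in> X A" "y \<in> X A" for x y n k
    using inj_on_eq_iff[OF inj memW memW] that by blast
  define C where "C = mat q q (\<lambda>(i, j). if \<exists>x\<in>X A. i = enc (jword H N x 0) \<and> j = enc (jword H N x 1) then 1 else 0 :: nat)"
  have Cc: "C \<in> carrier_mat q q" by (simp add: C_def)
  have Cij: "C $$ (i, j) = (if \<exists>x\<in>X A. i = enc (jword H N x 0) \<and> j = enc (jword H N x 1) then 1 else 0)"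
    if "i < q" "j < q" for i j using that by (simp add: C_def)
  have edges_C: "edges C = {(enc (jword H N x 0), enc (jword H N x 1), 0) | x. x \<in> X A}"
    using encq by (auto simp: edges_def C_def split: if_splits)
  have step: "C $$ (enc (jword H N x n), enc (jword H N x (n + 1))) = 1" if "x \<in> X A" for x n
    using Cij[OF encq encq, OF that that, of n "n + 1"] f.jword_shift[OF that, of n 0] f.jword_shift[OF that, of n 1] that
    by (auto simp: add.commute intro!: bexI[of _ "shiftz n x"])
  have surj: "\<exists>x\<in>X A. i = enc (jword H N x 0)" if "i < q" for i
    using enc that unfolding bij_betw_def W_def by auto
  have "irreducible_matrix C"
    unfolding irreducible_matrix_def
  proof (intro allI impI)
    fix i j assume "i < dim_row C" "j < dim_row C"
    then have ij: "i < q" "j < q" by (auto simp: C_def)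
    obtain x y where x: "x \<in> X A" "i = enc (jword H N x 0)" and y: "y \<in> X A" "j = enc (jword H N y 0)"
      using surj ij by metis
    obtain k z where k: "k > 0" and z: "z \<in> X A" "\<forall>n<2 * int N. z n = x n" "\<forall>n\<ge>0. z (2 * int N + int k + n) = y n"
      using a.connect[OF x(1) y(1)] by blast
    \<comment> \<open>A word sees only \<open>2 N\<close> letters. So the word of \<open>z\<close>
      at 0 is that of \<open>x\<close>, and at time \<open>2 N + k\<close>, where \<open>z\<close>
      has joined \<open>y\<close>, it is that of \<open>y\<close> at 0.\<close>
    let ?k = "2 * N + k"
    have zi: "enc (jword H N z 0) = i" unfolding x(2)
      by (intro arg_cong[where f = enc] f.jword_window z x) (use z in auto)
    have zj: "enc (jword H N z (int ?k)) = j" unfolding y(2)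
      by (intro arg_cong[where f = enc] f.jword_window z y) (use z in auto)
    have "0 < (C ^\<^sub>m ?k) $$ (i, j)"
      unfolding pow_mat_pos_iff[OF Cc ij]
      by (rule exI[of _ "\<lambda>t. enc (jword H N z (int t))"])
         (use zi zj encq[OF z(1)] step[OF z(1)] in \<open>auto simp: add.commute[of 1]\<close>)
    then show "\<exists>n\<ge>1. 0 < (C ^\<^sub>m n) $$ (i, j)" using k by (intro exI[of _ ?k]) auto
  qed
  moreover have "\<not> permutation_matrix C"
  proof
    assume "permutation_matrix C"
    then obtain M \<pi> where C\<pi>: "C = mat M M (\<lambda>(i, j). if j = \<pi> i then 1 else 0)"
      by (auto simp: permutation_matrix_def)
    have "M = q" using arg_cong[OF C\<pi>, of dim_row] Cc by simp
    then have succ: "j = \<pi> i" if "i < q" "j < q" "C $$ (i, j) = 1" for i j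
      using that by (simp add: C\<pi> split: if_splits)
    obtain a b where ab: "a \<in> edges A" "b \<in> edges A" "a \<noteq> b" "source a = source b" using a.branching by blast
    obtain x0 where "x0 \<in> one_sided A" "x0 0 = a" using one_sided_from[OF a.sinks ab(1)] by blast
    then obtain x where x: "x \<in> X A" "x 0 = a" using extend_one_sided[OF a.sources] by (metis of_nat_0)
    obtain y0 where "y0 \<in> one_sided A" "y0 0 = b" using one_sided_from[OF a.sinks ab(2)] by blast
    then obtain y where y: "y \<in> X A" "y 0 = b" using extend_one_sided[OF a.sources] by (metis of_nat_0)
    \<comment> \<open>Two sequences with the same past that differ at 0. Their words at
      \<open>- 2 N\<close> coincide, since these see only negative times; if states determined their
      successors, the words at 0 would coincide as well.\<close>
    let ?z = "\<lambda>n. if n < 0 then x n else y n"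
    have z: "?z \<in> X A" by (rule join_X) (use x y ab in \<open>auto simp: X_iff\<close>)
    have "jword H N x (- 2 * int N + int t) = jword H N ?z (- 2 * int N + int t)" for t
    proof (induction t)
      case 0
      show ?case by (rule f.jword_window[OF x(1) z]) auto
    next
      case (Suc t)
      have eq: "- 2 * int N + int (Suc t) = - 2 * int N + int t + 1" by simp
      have "enc (jword H N x (- 2 * int N + int t + 1)) = enc (jword H N ?z (- 2 * int N + int t + 1))"
        using succ[OF encq encq step, OF x(1) x(1) x(1)] succ[OF encq encq step, OF z z z] Suc by metis
      then show ?case unfolding eq using dec[OF x(1) z] by blast
    qed
    from this[of "2 * N"] have "jword H N x 0 = jword H N ?z 0" by simp
    then have "x 0 = y 0" using N by (auto simp: jword_eq_iff)
    then show False using x y ab by simp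
  qed
  moreover have "triplet_isomorphic (ck_triplet A) (ck_triplet C)"
    by (rule f.triplet_isomorphic_jword[OF inj[unfolded W_def] edges_C])
  moreover have "triplet_isomorphic (ck_triplet (transpose_mat B)) (ck_triplet (transpose_mat C))"
  proof (rule r.triplet_isomorphic_jword[where enc = "\<lambda>w. enc (conv w)"])
    have X': "G (revz y) \<in> X A" if "y \<in> X (transpose_mat B)" for y
      using that revz_X[of "revz y"] G by simp
    have "conv ` {jword K N y 0 | y. y \<in> X (transpose_mat B)} \<subseteq> W"
      using conv_jword memW X' by auto
    then have "inj_on enc (conv ` {jword K N y 0 | y. y \<in> X (transpose_mat B)})"
      using inj inj_on_subset by blast
    then show "inj_on (\<lambda>w. enc (conv w)) {jword K N y 0 | y. y \<in> X (transpose_mat B)}"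
      using comp_inj_on[OF inj_on_subset[OF inj_conv subset_UNIV]] by (simp add: comp_def)
    have "edges (transpose_mat C) = {(enc (jword H N x 1), enc (jword H N x 0), 0) | x. x \<in> X A}" (is "_ = ?R")
    proof (intro equalityI subsetI)
      fix e assume "e \<in> edges (transpose_mat C)"
      then obtain x where "x \<in> X A" "flip e = (enc (jword H N x 0), enc (jword H N x 1), 0)"
        unfolding edges_transpose edges_C by blast
      then show "e \<in> ?R" by (cases e) (auto simp: flip_def)
    next
      fix e assume "e \<in> ?R"
      then show "e \<in> edges (transpose_mat C)" unfolding edges_transpose edges_C by (auto simp: flip_def)
    qed
    also have "\<dots> = {(enc (conv (jword K N y 0)), enc (conv (jword K N y 1)), 0) | y. y \<in> X (transpose_mat B)}" (is "_ = ?S")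
    proof (intro equalityI subsetI)
      fix e assume "e \<in> ?R"
      then obtain x where x: "x \<in> X A" "e = (enc (jword H N x 1), enc (jword H N x 0), 0)" by blast
      \<comment> \<open>The shift by \<open>N\<close> compensates the offset
        \<open>1 - N - n\<close> of \<open>conv_jword\<close>: the words of \<open>y\<close> at 0
        and 1 become those of \<open>x\<close> at 1 and 0.\<close>
      define y where "y = revz (H (shiftz (int N) x))"
      have xN: "shiftz (int N) x \<in> X A" using x by simp
      have y: "y \<in> X (transpose_mat B)" using H[OF xN] revz_X by (simp add: y_def)
      have Gy: "G (revz y) = shiftz (int N) x" using GH[OF xN] by (simp add: y_def)
      have "conv (jword K N y 0) = jword H N x 1" "conv (jword K N y 1) = jword H N x 0"
        unfolding conv_jword[OF y] Gy f.jword_shift[OF x(1)] by simp_all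
      then show "e \<in> ?S" using y x(2) by (intro CollectI exI[of _ y]) simp
    next
      fix e assume "e \<in> ?S"
      then obtain y where y: "y \<in> X (transpose_mat B)"
        "e = (enc (conv (jword K N y 0)), enc (conv (jword K N y 1)), 0)" by blast
      let ?x = "shiftz (- int N) (G (revz y))"
      have "jword H N ?x 1 = conv (jword K N y 0)" "jword H N ?x 0 = conv (jword K N y 1)"
        unfolding conv_jword[OF y(1)] f.jword_shift[OF X'[OF y(1)]] by simp_all
      moreover have "?x \<in> X A" using X'[OF y(1)] by (simp only: shiftz_X)
      ultimately show "e \<in> ?R" using y(2) by (intro CollectI exI[of _ ?x]) simp
    qed
    finally show "edges (transpose_mat C) = ?S" .
  qed
  moreover have "square_mat C" using Cc by (auto simp: square_mat.simps)
  ultimately show ?thesis by blast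
qed

end

section \<open>Conjugacies as block maps\<close>

abbreviation agree :: "int set \<Rightarrow> (int \<Rightarrow> 'a) \<Rightarrow> (int \<Rightarrow> 'a) \<Rightarrow> bool" where
  "agree I x y \<equiv> \<forall>i\<in>I. x i = y i"

lemma agree_mono: "agree {- int L..int L} x y \<Longrightarrow> K \<le> L \<Longrightarrow> agree {- int K..int K} x y"
  by (meson atLeastAtMost_iff neg_le_iff_le of_nat_mono order_trans)

lemma topspace_two_sided [simp]: "topspace (two_sided_topology A) = X A"
  by (auto simp: two_sided_topology_def X_iff PiE_UNIV_domain)

text \<open>A basic open set of the product restricts finitely many coordinates, so cylinders over
  symmetric windows form a neighbourhood basis.\<close>

lemma openin_two_sided:
  "openin (two_sided_topology A) S \<longleftrightarrow>
     S \<subseteq> X A \<and> (\<forall>x\<in>S. \<exists>K::nat. \<forall>y\<in>X A. agree {- int K..int K} y x \<longrightarrow> y \<in> S)"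
proof
  assume "openin (two_sided_topology A) S"
  then obtain T where T: "openin (product_topology (\<lambda>n::int. discrete_topology (edges A)) UNIV) T" "S = T \<inter> X A"
    by (auto simp: two_sided_topology_def openin_subtopology)
  have "\<exists>K::nat. \<forall>y\<in>X A. agree {- int K..int K} y x \<longrightarrow> y \<in> S" if x: "x \<in> S" for x
  proof -
    obtain U where U: "finite {i. U i \<noteq> edges A}" "x \<in> PiE UNIV U" "PiE UNIV U \<subseteq> T"
      using T x unfolding openin_product_topology_alt by auto
    define K where "K = Max (insert 0 ((\<lambda>i. nat \<bar>i\<bar>) ` {i. U i \<noteq> edges A}))"
    have K: "i \<in> {- int K..int K}" if "U i \<noteq> edges A" for i
    proof -
      have "nat \<bar>i\<bar> \<le> K" unfolding K_def by (rule Max_ge) (use U that in auto)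
      then show ?thesis by auto
    qed
    have "y \<in> S" if y: "y \<in> X A" "agree {- int K..int K} y x" for y
    proof -
      have "y i \<in> U i" for i
      proof (cases "U i = edges A")
        case True then show ?thesis using y by (simp add: X_iff)
      next
        case False then show ?thesis using K[OF False] y(2) U(2) by (auto simp: PiE_UNIV_domain)
      qed
      then show ?thesis using U(3) T(2) y(1) by (auto simp: PiE_UNIV_domain)
    qed
    then show ?thesis by blast
  qed
  then show "S \<subseteq> X A \<and> (\<forall>x\<in>S. \<exists>K::nat. \<forall>y\<in>X A. agree {- int K..int K} y x \<longrightarrow> y \<in> S)"
    using T by blast
next
  assume S: "S \<subseteq> X A \<and> (\<forall>x\<in>S. \<exists>K::nat. \<forall>y\<in>X A. agree {- int K..int K} y x \<longrightarrow> y \<in> S)"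
  define T where "T = {z. (\<forall>n. z n \<in> edges A) \<and>
    (\<exists>x\<in>S. \<exists>K::nat. (\<forall>y\<in>X A. agree {- int K..int K} y x \<longrightarrow> y \<in> S) \<and> agree {- int K..int K} z x)}"
  have "openin (product_topology (\<lambda>n::int. discrete_topology (edges A)) UNIV) T"
    unfolding openin_product_topology_alt
  proof (intro ballI)
    fix z assume "z \<in> T"
    then obtain x K where z: "\<And>n. z n \<in> edges A" "x \<in> S" "\<forall>y\<in>X A. agree {- int K..int K} y x \<longrightarrow> y \<in> S"
      "agree {- int K..int K} z x" unfolding T_def by blast
    define U where "U i = (if i \<in> {- int K..int K} then {z i} else edges A)" for i :: int
    have "finite {i. U i \<noteq> edges A}"
      by (rule finite_subset[of _ "{- int K..int K}"]) (auto simp: U_def)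
    moreover have "PiE UNIV U \<subseteq> T"
    proof
      fix w assume w: "w \<in> PiE UNIV U"
      then have wU: "w i \<in> U i" for i by (auto simp: PiE_UNIV_domain)
      have "agree {- int K..int K} w x"
      proof
        fix i assume "i \<in> {- int K..int K}"
        then show "w i = x i" using wU[of i] z(4) by (simp add: U_def)
      qed
      moreover have "w i \<in> edges A" for i using wU[of i] z(1)[of i] by (auto simp: U_def split: if_splits)
      ultimately show "w \<in> T" unfolding T_def using z by blast
    qed
    ultimately show "\<exists>U. finite {i \<in> UNIV. U i \<noteq> topspace (discrete_topology (edges A))} \<and>
      (\<forall>i\<in>UNIV. openin (discrete_topology (edges A)) (U i)) \<and> z \<in> PiE UNIV U \<and> PiE UNIV U \<subseteq> T"
      using z(1) by (intro exI[of _ U]) (auto simp: U_def)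
  qed
  moreover have "S = T \<inter> X A"
  proof (intro equalityI subsetI)
    fix x assume x: "x \<in> S"
    then obtain K :: nat where K: "\<forall>y\<in>X A. agree {- int K..int K} y x \<longrightarrow> y \<in> S" using S by blast
    have "x \<in> X A" using S x by blast
    moreover from this have "\<forall>n. x n \<in> edges A" by (simp add: X_iff)
    ultimately show "x \<in> T \<inter> X A" using x K unfolding T_def by blast
  qed (auto simp: T_def)
  ultimately show "openin (two_sided_topology A) S"
    unfolding two_sided_topology_def openin_subtopology by blast
qed

lemma compact_two_sided: "compact_space (two_sided_topology A)"
proof -
  let ?P = "product_topology (\<lambda>n::int. discrete_topology (edges A)) UNIV"
  have P: "compact_space ?P"
    by (simp add: compact_space_product_topology compact_space_discrete_topology finite_edges)
  \<comment> \<open>A sequence that is not a path violates adjacency at some \<open>n\<close>, which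
    is an open condition on the two coordinates \<open>n\<close> and \<open>n + 1\<close>.\<close>
  have "openin ?P (topspace ?P - X A)"
    unfolding openin_product_topology_alt
  proof (intro ballI)
    fix z assume "z \<in> topspace ?P - X A"
    then have z: "\<And>n. z n \<in> edges A" "z \<notin> X A" by (auto simp: PiE_UNIV_domain)
    then obtain n where n: "target (z n) \<noteq> source (z (n + 1))" by (auto simp: X_iff)
    define U where "U i = (if i = n \<or> i = n + 1 then {z i} else edges A)" for i :: int
    have "finite {i. U i \<noteq> edges A}"
      by (rule finite_subset[of _ "{n, n + 1}"]) (auto simp: U_def)
    moreover have "PiE UNIV U \<subseteq> topspace ?P - X A"
    proof
      fix w assume w: "w \<in> PiE UNIV U"
      then have wU: "w i \<in> U i" for i by (auto simp: PiE_UNIV_domain)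
      have "w n = z n" "w (n + 1) = z (n + 1)" using wU[of n] wU[of "n + 1"] by (auto simp: U_def)
      have "w \<notin> X A"
      proof
        assume "w \<in> X A"
        then have "target (w n) = source (w (n + 1))" by (simp add: X_iff)
        then show False using n \<open>w n = z n\<close> \<open>w (n + 1) = z (n + 1)\<close> by simp
      qed
      moreover have "w i \<in> edges A" for i using wU[of i] z(1)[of i] by (auto simp: U_def split: if_splits)
      ultimately show "w \<in> topspace ?P - X A" by (auto simp: PiE_UNIV_domain)
    qed
    ultimately show "\<exists>U. finite {i \<in> UNIV. U i \<noteq> topspace (discrete_topology (edges A))} \<and>
      (\<forall>i\<in>UNIV. openin (discrete_topology (edges A)) (U i)) \<and> z \<in> PiE UNIV U \<and> PiE UNIV U \<subseteq> topspace ?P - X A"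
      using z(1) by (intro exI[of _ U]) (auto simp: U_def)
  qed
  moreover have "X A \<subseteq> topspace ?P" by (auto simp: PiE_UNIV_domain X_iff)
  ultimately have "closedin ?P (X A)" by (simp add: closedin_def)
  then have "compactin ?P (X A)" by (rule closedin_compact_space[OF P])
  then show ?thesis unfolding two_sided_topology_def by (rule compact_space_subtopology)
qed

text \<open>The Curtis--Hedlund--Lyndon theorem. Continuity gives a window around each point, and by
  compactness finitely many of the corresponding cylinders cover the space.\<close>

lemma continuous_window:
  assumes h: "continuous_map (two_sided_topology A) (two_sided_topology B) h"
  shows "\<exists>K::nat. \<forall>x\<in>X A. \<forall>y\<in>X A. agree {- int K..int K} x y \<longrightarrow> h x 0 = h y 0"
proof -
  have "\<exists>K::nat. \<forall>y\<in>X A. agree {- int K..int K} y x \<longrightarrow> h y 0 = h x 0" if x: "x \<in> X A" for x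
  proof -
    have "openin (two_sided_topology B) {y \<in> X B. y 0 = h x 0}"
      unfolding openin_two_sided by (auto intro!: exI[of _ 0])
    then have o: "openin (two_sided_topology A) {z \<in> X A. h z \<in> {y \<in> X B. y 0 = h x 0}}" (is "openin _ ?S")
      using openin_continuous_map_preimage[OF h, of "{y \<in> X B. y 0 = h x 0}"] by simp
    have "x \<in> ?S" using continuous_map_image_subset_topspace[OF h] x by auto
    with o obtain K :: nat where "\<forall>y\<in>X A. agree {- int K..int K} y x \<longrightarrow> y \<in> ?S"
      unfolding openin_two_sided by blast
    then show ?thesis by (intro exI[of _ K]) simp
  qed
  note local = this
  define K where "K x = (SOME K :: nat. \<forall>y\<in>X A. agree {- int K..int K} y x \<longrightarrow> h y 0 = h x 0)" for x
  have K: "h y 0 = h x 0" if "x \<in> X A" "y \<in> X A" "agree {- int (K x)..int (K x)} y x" for x y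
    using someI_ex[OF local[OF that(1)]] that(2,3) unfolding K_def by blast
  define cyl where "cyl x = {y \<in> X A. agree {- int (K x)..int (K x)} y x}" for x
  have "openin (two_sided_topology A) (cyl x)" for x
    unfolding openin_two_sided cyl_def by (auto intro!: exI[of _ "K x"])
  moreover have "topspace (two_sided_topology A) \<subseteq> \<Union> (cyl ` X A)" by (auto simp: cyl_def)
  ultimately obtain F where F: "finite F" "F \<subseteq> cyl ` X A" "topspace (two_sided_topology A) \<subseteq> \<Union> F"
    using compact_two_sided[of A, unfolded compact_space_alt, rule_format, of "cyl ` X A"] by blast
  obtain P where P: "finite P" "P \<subseteq> X A" "F = cyl ` P" using finite_subset_image[OF F(1,2)] by blast
  define M where "M = Max (insert 0 (K ` P))"
  have M: "K p \<le> M" if "p \<in> P" for p unfolding M_def by (rule Max_ge) (use P that in auto)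
  have "h x 0 = h y 0" if x: "x \<in> X A" and y: "y \<in> X A" and a: "agree {- int M..int M} x y" for x y
  proof -
    obtain p where p: "p \<in> P" "x \<in> cyl p" using F(3) P(3) x by auto
    have pX: "p \<in> X A" using p P by blast
    have "agree {- int (K p)..int (K p)} x p" using p(2) by (simp add: cyl_def)
    moreover have "agree {- int (K p)..int (K p)} y p"
      using calculation agree_mono[OF a M[OF p(1)]] by simp
    ultimately show ?thesis using K[OF pX x] K[OF pX y] by simp
  qed
  then show ?thesis by blast
qed

definition block_conjugacy ::
    "nat mat \<Rightarrow> nat mat \<Rightarrow> ((int \<Rightarrow> edge) \<Rightarrow> int \<Rightarrow> edge) \<Rightarrow> ((int \<Rightarrow> edge) \<Rightarrow> int \<Rightarrow> edge) \<Rightarrow> nat \<Rightarrow> bool" where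
  "block_conjugacy A B H G K \<longleftrightarrow>
     (\<forall>x\<in>X A. H x \<in> X B \<and> G (H x) = x \<and> H (two_sided_shift x) = two_sided_shift (H x)) \<and>
     (\<forall>y\<in>X B. G y \<in> X A \<and> H (G y) = y) \<and>
     (\<forall>x\<in>X A. \<forall>y\<in>X A. agree {- int K..int K} x y \<longrightarrow> H x 0 = H y 0) \<and>
     (\<forall>x\<in>X B. \<forall>y\<in>X B. agree {- int K..int K} x y \<longrightarrow> G x 0 = G y 0)"

lemma two_sided_shift_X [simp]: "two_sided_shift x \<in> X A \<longleftrightarrow> x \<in> X A"
  by (simp add: two_sided_shift_def)

lemma block_conjugacy_sym: "block_conjugacy A B H G K \<Longrightarrow> block_conjugacy B A G H K"
  unfolding block_conjugacy_def
proof (elim conjE, intro conjI ballI)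
  fix y assume 1: "\<forall>x\<in>X A. H x \<in> X B \<and> G (H x) = x \<and> H (two_sided_shift x) = two_sided_shift (H x)"
    and 2: "\<forall>y\<in>X B. G y \<in> X A \<and> H (G y) = y" and y: "y \<in> X B"
  have "H (two_sided_shift (G y)) = two_sided_shift y" using 1 2 y by simp
  then have "G (two_sided_shift y) = G (H (two_sided_shift (G y)))" by simp
  also have "\<dots> = two_sided_shift (G y)" using 1 2 y two_sided_shift_X[of "G y" A] by blast
  finally show "G (two_sided_shift y) = two_sided_shift (G y)" .
qed blast+

lemma shift_all:
  assumes H: "\<And>x. x \<in> X A \<Longrightarrow> H (two_sided_shift x) = two_sided_shift (H x)" and x: "x \<in> X A"
  shows "H (shiftz k x) = shiftz k (H x)"
proof -
  have pos: "H (shiftz (int k) x) = shiftz (int k) (H x)" if "x \<in> X A" for k x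
    using that
  proof (induction k arbitrary: x)
    case (Suc k)
    have sx: "two_sided_shift x \<in> X A" using Suc.prems by simp
    have e: "n + int (Suc k) = n + int k + 1" for n by simp
    have "H (shiftz (int k) (two_sided_shift x)) = shiftz (int k) (H (two_sided_shift x))" by (rule Suc.IH[OF sx])
    then have "H (shiftz (int k) (two_sided_shift x)) = shiftz (int k) (two_sided_shift (H x))"
      unfolding H[OF Suc.prems] .
    then show ?case unfolding two_sided_shift_def e .
  qed simp
  show ?thesis
  proof (cases "k \<ge> 0")
    case True
    then obtain m where "k = int m" using nonneg_int_cases by blast
    then show ?thesis using pos[OF x] by simp
  next
    case False
    then obtain m where m: "k = - int m" by (metis int_cases2 of_nat_0_le_iff)
    have x': "shiftz k x \<in> X A" using x by simp
    have "H (shiftz (int m) (shiftz k x)) = shiftz (int m) (H (shiftz k x))" by (rule pos[OF x'])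
    then have "H x = shiftz (int m) (H (shiftz k x))" by (simp add: m)
    then have "H x (n + k) = H (shiftz k x) n" for n using m by (simp add: fun_eq_iff)
    then show ?thesis by auto
  qed
qed

lemma block_window:
  assumes H: "\<And>x. x \<in> X A \<Longrightarrow> H (two_sided_shift x) = two_sided_shift (H x)"
    and w: "\<And>x y. x \<in> X A \<Longrightarrow> y \<in> X A \<Longrightarrow> agree {- int K..int K} x y \<Longrightarrow> H x 0 = H y 0"
    and xy: "x \<in> X A" "y \<in> X A" "agree {n - int K..n + int K} x y"
  shows "H x n = H y n"
proof -
  have "H (shiftz n x) 0 = H (shiftz n y) 0"
    by (rule w) (use xy in auto)
  then show ?thesis using shift_all[of A H, OF H xy(1), of n] shift_all[of A H, OF H xy(2), of n] by simp
qed

lemma block_continuous: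
  assumes H: "\<And>x. x \<in> X A \<Longrightarrow> H (two_sided_shift x) = two_sided_shift (H x)" "\<And>x. x \<in> X A \<Longrightarrow> H x \<in> X B"
    and w: "\<And>x y. x \<in> X A \<Longrightarrow> y \<in> X A \<Longrightarrow> agree {- int K..int K} x y \<Longrightarrow> H x 0 = H y 0"
  shows "continuous_map (two_sided_topology A) (two_sided_topology B) H"
proof -
  have "openin (two_sided_topology A) {x \<in> X A. H x \<in> S}" if S: "openin (two_sided_topology B) S" for S
    unfolding openin_two_sided
  proof (intro conjI ballI)
    fix x assume x: "x \<in> {x \<in> X A. H x \<in> S}"
    then obtain L :: nat where L: "\<And>y. y \<in> X B \<Longrightarrow> agree {- int L..int L} y (H x) \<Longrightarrow> y \<in> S"
      using S unfolding openin_two_sided by blast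
    have "H y \<in> S" if y: "y \<in> X A" "agree {- int (L + K)..int (L + K)} y x" for y
    proof (rule L[OF H(2)[OF y(1)]], intro ballI)
      fix i assume "i \<in> {- int L..int L}"
      then show "H y i = H x i"
        using x y by (intro block_window[of A H K, OF H(1) w]) auto
    qed
    then show "\<exists>K::nat. \<forall>y\<in>X A. agree {- int K..int K} y x \<longrightarrow> y \<in> {x \<in> X A. H x \<in> S}"
      by (intro exI[of _ "L + K"]) blast
  qed auto
  then show ?thesis using H(2) by (auto simp: continuous_map_def)
qed

theorem topologically_conjugate_iff:
  "topologically_conjugate A B \<longleftrightarrow> (\<exists>H G K. block_conjugacy A B H G K)"
proof
  assume "topologically_conjugate A B"
  then obtain h where h: "homeomorphic_map (two_sided_topology A) (two_sided_topology B) h"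
    "\<And>x. x \<in> X A \<Longrightarrow> h (two_sided_shift x) = two_sided_shift (h x)"
    unfolding topologically_conjugate_def by blast
  then obtain g where g: "homeomorphic_maps (two_sided_topology A) (two_sided_topology B) h g"
    unfolding homeomorphic_map_maps by blast
  then have c: "continuous_map (two_sided_topology A) (two_sided_topology B) h"
    "continuous_map (two_sided_topology B) (two_sided_topology A) g"
    and gh: "\<And>x. x \<in> X A \<Longrightarrow> g (h x) = x" "\<And>y. y \<in> X B \<Longrightarrow> h (g y) = y"
    by (auto simp: homeomorphic_maps_def)
  have hX: "h x \<in> X B" if "x \<in> X A" for x using continuous_map_image_subset_topspace[OF c(1)] that by auto
  have gX: "g y \<in> X A" if "y \<in> X B" for y using continuous_map_image_subset_topspace[OF c(2)] that by auto
  obtain K1 K2 :: nat where K: "\<forall>x\<in>X A. \<forall>y\<in>X A. agree {- int K1..int K1} x y \<longrightarrow> h x 0 = h y 0"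
    "\<forall>x\<in>X B. \<forall>y\<in>X B. agree {- int K2..int K2} x y \<longrightarrow> g x 0 = g y 0"
    using continuous_window[OF c(1)] continuous_window[OF c(2)] by blast
  have "block_conjugacy A B h g (max K1 K2)"
    unfolding block_conjugacy_def
  proof (intro conjI ballI impI)
    fix x y assume "x \<in> X A" "y \<in> X A" and a: "agree {- int (max K1 K2)..int (max K1 K2)} x y"
    moreover have "agree {- int K1..int K1} x y" by (rule agree_mono[OF a]) simp
    ultimately show "h x 0 = h y 0" using K by blast
  next
    fix x y assume "x \<in> X B" "y \<in> X B" and a: "agree {- int (max K1 K2)..int (max K1 K2)} x y"
    moreover have "agree {- int K2..int K2} x y" by (rule agree_mono[OF a]) simp
    ultimately show "g x 0 = g y 0" using K by blast
  qed (use h gh hX gX in auto)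
  then show "\<exists>H G K. block_conjugacy A B H G K" by blast
next
  assume "\<exists>H G K. block_conjugacy A B H G K"
  then obtain H G K where c: "block_conjugacy A B H G K" by blast
  note c' = block_conjugacy_sym[OF c]
  have "homeomorphic_maps (two_sided_topology A) (two_sided_topology B) H G"
    unfolding homeomorphic_maps_def
  proof (intro conjI)
    show "continuous_map (two_sided_topology A) (two_sided_topology B) H"
      by (rule block_continuous[of _ _ _ K]) (use c in \<open>unfold block_conjugacy_def, blast\<close>)+
    show "continuous_map (two_sided_topology B) (two_sided_topology A) G"
      by (rule block_continuous[of _ _ _ K]) (use c' in \<open>unfold block_conjugacy_def, blast\<close>)+
  qed (use c in \<open>auto simp: block_conjugacy_def\<close>)
  then have "homeomorphic_map (two_sided_topology A) (two_sided_topology B) H"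
    unfolding homeomorphic_map_maps by blast
  moreover have "\<forall>x\<in>X A. H (two_sided_shift x) = two_sided_shift (H x)"
    using c unfolding block_conjugacy_def by blast
  ultimately show "topologically_conjugate A B"
    unfolding topologically_conjugate_def by (intro exI conjI)
qed

lemma topologically_conjugate_refl: "topologically_conjugate A A"
  unfolding topologically_conjugate_def by (intro exI[of _ id]) (auto simp: homeomorphic_map_id)

lemma topologically_conjugate_trans:
  assumes "topologically_conjugate A B" "topologically_conjugate B C"
  shows "topologically_conjugate A C"
proof -
  obtain h g where h: "homeomorphic_map (two_sided_topology A) (two_sided_topology B) h"
      "\<forall>x\<in>X A. h (two_sided_shift x) = two_sided_shift (h x)"
    and g: "homeomorphic_map (two_sided_topology B) (two_sided_topology C) g"
      "\<forall>x\<in>X B. g (two_sided_shift x) = two_sided_shift (g x)"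
    using assms unfolding topologically_conjugate_def by blast
  have "h x \<in> X B" if "x \<in> X A" for x
    using homeomorphic_imp_surjective_map[OF h(1)] that by auto
  then show ?thesis
    unfolding topologically_conjugate_def
    by (intro exI[of _ "g \<circ> h"] conjI homeomorphic_map_compose[OF h(1) g(1)]) (use h(2) g(2) in auto)
qed

text \<open>Time reversal carries the shift of the transpose to the inverse shift, and a conjugacy
  commutes with negative powers of the shift too.\<close>

lemma topologically_conjugate_transpose:
  assumes "topologically_conjugate A B"
  shows "topologically_conjugate (transpose_mat A) (transpose_mat B)"
proof -
  obtain H G K where c: "block_conjugacy A B H G K" using assms unfolding topologically_conjugate_iff by blast
  have rX: "revz x \<in> X A" if "x \<in> X (transpose_mat A)" for x A using that revz_X[of "revz x" A] by simp
  have sh: "revz (H (revz (two_sided_shift x))) = two_sided_shift (revz (H (revz x)))"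
    if "x \<in> X (transpose_mat A)" "\<forall>x\<in>X A. H (two_sided_shift x) = two_sided_shift (H x)" for x and A :: "nat mat" and H
  proof -
    have "revz (two_sided_shift x) = shiftz (- 1) (revz x)" by (simp add: revz_def two_sided_shift_def)
    moreover have "H (shiftz (- 1) (revz x)) = shiftz (- 1) (H (revz x))"
      by (rule shift_all) (use that rX in auto)
    ultimately show ?thesis by (simp add: revz_def two_sided_shift_def)
  qed
  have ag: "agree {- int K..int K} (revz x) (revz y)" if "agree {- int K..int K} x y" for x y
    using that by (auto simp: revz_def)
  have cA: "H x \<in> X B" "G (H x) = x" if "x \<in> X A" for x
    using c that unfolding block_conjugacy_def by blast+
  have cB: "G x \<in> X A" "H (G x) = x" if "x \<in> X B" for x
    using c that unfolding block_conjugacy_def by blast+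
  have cH: "\<forall>x\<in>X A. H (two_sided_shift x) = two_sided_shift (H x)"
    using c unfolding block_conjugacy_def by blast
  have wH: "H x 0 = H y 0" if "x \<in> X A" "y \<in> X A" "agree {- int K..int K} x y" for x y
    using c that unfolding block_conjugacy_def by blast
  have wG: "G x 0 = G y 0" if "x \<in> X B" "y \<in> X B" "agree {- int K..int K} x y" for x y
    using c that unfolding block_conjugacy_def by blast
  have "block_conjugacy (transpose_mat A) (transpose_mat B) (\<lambda>x. revz (H (revz x))) (\<lambda>y. revz (G (revz y))) K"
    unfolding block_conjugacy_def
  proof (intro conjI ballI impI)
    fix x assume x: "x \<in> X (transpose_mat A)"
    show "revz (H (revz x)) \<in> X (transpose_mat B)" unfolding revz_X by (rule cA(1)[OF rX[OF x]])
    show "revz (G (revz (revz (H (revz x))))) = x" unfolding revz_revz cA(2)[OF rX[OF x]] ..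
    show "revz (H (revz (two_sided_shift x))) = two_sided_shift (revz (H (revz x)))"
      by (rule sh[OF x cH])
    fix y assume y: "y \<in> X (transpose_mat A)" and a: "agree {- int K..int K} x y"
    have "H (revz x) 0 = H (revz y) 0" by (rule wH[OF rX[OF x] rX[OF y] ag[OF a]])
    then show "revz (H (revz x)) 0 = revz (H (revz y)) 0" by (simp add: revz_def[of "H _"])
  next
    fix x assume x: "x \<in> X (transpose_mat B)"
    show "revz (G (revz x)) \<in> X (transpose_mat A)" unfolding revz_X by (rule cB(1)[OF rX[OF x]])
    show "revz (H (revz (revz (G (revz x))))) = x" unfolding revz_revz cB(2)[OF rX[OF x]] ..
    fix y assume y: "y \<in> X (transpose_mat B)" and a: "agree {- int K..int K} x y"
    have "G (revz x) 0 = G (revz y) 0" by (rule wG[OF rX[OF x] rX[OF y] ag[OF a]])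
    then show "revz (G (revz x)) 0 = revz (G (revz y)) 0" by (simp add: revz_def[of "G _"])
  qed
  then show ?thesis unfolding topologically_conjugate_iff by blast
qed

section \<open>Isomorphisms of triplets and the chain of length two\<close>

definition triplet_iso :: "nat mat \<Rightarrow> nat mat \<Rightarrow> (ck_element \<Rightarrow> ck_element) \<Rightarrow> bool" where
  "triplet_iso A B \<Phi> \<longleftrightarrow> \<Phi> \<in> star_iso (cuntz_krieger_algebra A) (cuntz_krieger_algebra B) \<and>
     \<Phi> ` ck_diagonal A = ck_diagonal B \<and>
     (\<forall>t. \<forall>x\<in>carrier (cuntz_krieger_algebra A). \<Phi> (ck_gauge A t x) = ck_gauge B t (\<Phi> x))"

lemma triplet_isomorphic_iff: "triplet_isomorphic (ck_triplet A) (ck_triplet B) \<longleftrightarrow> (\<exists>\<Phi>. triplet_iso A B \<Phi>)"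
  unfolding ck_triplet_def triplet_isomorphic.simps triplet_iso_def Bex_def ..

lemma triplet_iso_hom: assumes "triplet_iso A B \<Phi>" shows "ck_hom A B \<Phi>"
  by (intro ck_homI star_homomorphism.intro star_homomorphism_axioms.intro cuntz_krieger_algebra_is_cstar_algebra)
     (use assms in \<open>simp add: triplet_iso_def star_iso_def\<close>)

lemma triplet_iso_inverse:
  assumes iso\<Phi>: "triplet_iso A B \<Phi>"
  shows "\<exists>\<Psi>. triplet_iso B A \<Psi> \<and> (\<forall>x\<in>carrier (cuntz_krieger_algebra A). \<Psi> (\<Phi> x) = x) \<and>
    (\<forall>y\<in>carrier (cuntz_krieger_algebra B). \<Phi> (\<Psi> y) = y)"
proof -
  have bij: "bij_betw \<Phi> (carrier (cuntz_krieger_algebra A)) (carrier (cuntz_krieger_algebra B))"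
    and DG: "\<Phi> ` ck_diagonal A = ck_diagonal B \<and>
        (\<forall>t. \<forall>x\<in>carrier (cuntz_krieger_algebra A). \<Phi> (ck_gauge A t x) = ck_gauge B t (\<Phi> x))"
    using iso\<Phi> by (simp_all add: triplet_iso_def star_iso_def)
  interpret f: ck_hom A B \<Phi> by (rule triplet_iso_hom[OF iso\<Phi>])
  let ?A = "cuntz_krieger_algebra A" and ?B = "cuntz_krieger_algebra B"
  define \<Psi> where "\<Psi> = inv_into (carrier ?A) \<Phi>"
  have \<Psi>: "\<Psi> y \<in> carrier ?A" "\<Phi> (\<Psi> y) = y" if "y \<in> carrier ?B" for y
    using bij_betw_apply[OF bij_betw_inv_into[OF bij] that] bij_betw_inv_into_right[OF bij that]
    by (simp_all add: \<Psi>_def)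
  have inj: "x = x'" if "x \<in> carrier ?A" "x' \<in> carrier ?A" "\<Phi> x = \<Phi> x'" for x x'
    by (rule inj_onD[OF bij_betw_imp_inj_on[OF bij]]) (rule that)+
  have \<Psi>I: "\<Psi> y = x" if "x \<in> carrier ?A" "\<Phi> x = y" for x y
  proof (rule inj)
    have "y \<in> carrier ?B" using that f.hom_closed by blast
    then show "\<Psi> y \<in> carrier ?A" "\<Phi> (\<Psi> y) = \<Phi> x" using \<Psi> that(2) by simp_all
  qed (rule that(1))
  have bij\<Psi>: "bij_betw \<Psi> (carrier ?B) (carrier ?A)" unfolding \<Psi>_def by (rule bij_betw_inv_into[OF bij])
  have hom\<Psi>: "\<Psi> \<in> star_hom ?B ?A"
    unfolding star_hom_def
  proof (intro CollectI conjI ballI allI ring_hom_memI)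
    show "\<Psi> \<one>\<^bsub>?B\<^esub> = \<one>\<^bsub>?A\<^esub>" by (rule \<Psi>I) (simp_all add: f.hom_one)
    fix x assume x: "x \<in> carrier ?B"
    show "\<Psi> x \<in> carrier ?A" by (rule \<Psi>(1)[OF x])
    show "\<Psi> (c \<odot>\<^bsub>?B\<^esub> x) = c \<odot>\<^bsub>?A\<^esub> \<Psi> x" for c
      by (rule \<Psi>I) (simp_all add: f.hom_smult \<Psi>[OF x] f.A.smult_closed)
    show "\<Psi> (adj ?B x) = adj ?A (\<Psi> x)"
      by (rule \<Psi>I) (simp_all add: f.hom_adj \<Psi>[OF x] f.A.adj_closed)
    fix y assume y: "y \<in> carrier ?B"
    show "\<Psi> (x \<otimes>\<^bsub>?B\<^esub> y) = \<Psi> x \<otimes>\<^bsub>?A\<^esub> \<Psi> y" by (rule \<Psi>I) (simp_all add: f.hom_mult \<Psi>[OF x] \<Psi>[OF y])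
    show "\<Psi> (x \<oplus>\<^bsub>?B\<^esub> y) = \<Psi> x \<oplus>\<^bsub>?A\<^esub> \<Psi> y" by (rule \<Psi>I) (simp_all add: f.hom_add \<Psi>[OF x] \<Psi>[OF y])
  qed
  have iso\<Psi>: "\<Psi> \<in> star_iso ?B ?A" using hom\<Psi> bij\<Psi> by (simp add: star_iso_def)
  have D: "\<Psi> ` ck_diagonal B = ck_diagonal A"
  proof -
    have "\<Psi> (\<Phi> x) = x" if "x \<in> ck_diagonal A" for x
      using \<Psi>I[OF f.a.diagonal_closed[OF that] refl] .
    then have "\<Psi> ` \<Phi> ` ck_diagonal A = ck_diagonal A" by (simp add: image_image)
    then show ?thesis using DG by simp
  qed
  have G: "\<Psi> (ck_gauge B t x) = ck_gauge A t (\<Psi> x)" if x: "x \<in> carrier ?B" for t x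
  proof (rule \<Psi>I)
    interpret ga: ck_hom A A "ck_gauge A t" by (rule ck_gauge_hom)
    show "ck_gauge A t (\<Psi> x) \<in> carrier ?A" by (rule ga.hom_closed[OF \<Psi>(1)[OF x]])
    show "\<Phi> (ck_gauge A t (\<Psi> x)) = ck_gauge B t x" using DG \<Psi>[OF x] by simp
  qed
  have "triplet_iso B A \<Psi>" unfolding triplet_iso_def using iso\<Psi> D G by simp
  then show ?thesis by (intro exI[of _ \<Psi>] conjI ballI \<Psi>(2) \<Psi>I refl)
qed

lemma triplet_isomorphic_sym:
  "triplet_isomorphic (ck_triplet A) (ck_triplet B) \<Longrightarrow> triplet_isomorphic (ck_triplet B) (ck_triplet A)"
  unfolding triplet_isomorphic_iff using triplet_iso_inverse by blast

theorem conjugate_imp_transpose_free_isomorphic: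
  assumes A: "square_mat A" "irreducible_matrix A" "\<not> permutation_matrix A"
    and B: "square_mat B" "irreducible_matrix B" "\<not> permutation_matrix B"
    and conj: "topologically_conjugate A B"
  shows "transpose_free_isomorphic A B"
proof -
  obtain H G K where c: "block_conjugacy A B H G K" using conj unfolding topologically_conjugate_iff by blast
  note c' = block_conjugacy_sym[OF c]
  interpret a: irreducible_graph A "dim_row A" by (rule irreducible_graphI[OF A])
  interpret b: irreducible_graph B "dim_row B" by (rule irreducible_graphI[OF B])
  have H: "H x \<in> X B" "G (H x) = x" "H (two_sided_shift x) = two_sided_shift (H x)" if "x \<in> X A" for x
    using c that unfolding block_conjugacy_def by blast+
  have G: "G x \<in> X A" "H (G x) = x" "G (two_sided_shift x) = two_sided_shift (G x)" if "x \<in> X B" for x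
    using c' that unfolding block_conjugacy_def by blast+
  have w: "H x 0 = H y 0" if "x \<in> X A" "y \<in> X A" "agree {- int K..int K} x y" for x y
    using c that unfolding block_conjugacy_def by blast
  have w': "G x 0 = G y 0" if "x \<in> X B" "y \<in> X B" "agree {- int K..int K} x y" for x y
    using c' that unfolding block_conjugacy_def by blast
  have Hw: "H x n = H y n" if "x \<in> X A" "y \<in> X A" "agree {n - int K..n + int K} x y" for x y n
    by (rule block_window[of A H K, OF H(3) w that])
  have Gw: "G x n = G y n" if "x \<in> X B" "y \<in> X B" "agree {n - int K..n + int K} x y" for x y n
    by (rule block_window[of B G K, OF G(3) w' that])
  have Hs: "H (shiftz k x) = shiftz k (H x)" if "x \<in> X A" for x k by (rule shift_all[of A H, OF H(3) that])
  have Gs: "G (shiftz k x) = shiftz k (G x)" if "x \<in> X B" for x k by (rule shift_all[of B G, OF G(3) that])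
  \<comment> \<open>Composing with the \<open>K\<close>-th power of the shift moves the window
    \<open>- K, ..., K\<close> of \<open>H\<close> to \<open>0, ..., 2 K\<close> and that of the
    inverse to \<open>- 2 K, ..., 0\<close>. The added 1 only makes the bound positive.\<close>
  interpret causal_conjugacy A B "dim_row A" "dim_row B" "\<lambda>x. shiftz (int K) (H x)"
    "\<lambda>y. G (shiftz (- int K) y)" "2 * K + 1"
  proof
    show "0 < 2 * K + 1" by simp
    fix x assume x: "x \<in> X A"
    show "shiftz (int K) (H x) \<in> X B" using H(1)[OF x] by (simp only: shiftz_X)
    show "G (shiftz (- int K) (shiftz (int K) (H x))) = x" using H(2)[OF x] by simp
    show "shiftz (int K) (H (shiftz k x)) = shiftz k (shiftz (int K) (H x))" for k
      unfolding Hs[OF x] by (simp add: algebra_simps)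
    fix x' assume x': "x' \<in> X A" and "\<And>i. 0 \<le> i \<Longrightarrow> i \<le> int (2 * K + 1) \<Longrightarrow> x i = x' i"
    then show "H x (0 + int K) = H x' (0 + int K)" by (intro Hw[OF x x']) auto
  next
    fix y assume y: "y \<in> X B"
    then have y': "shiftz (- int K) y \<in> X B" by (simp only: shiftz_X)
    show "G (shiftz (- int K) y) \<in> X A" by (rule G(1)[OF y'])
    show "shiftz (int K) (H (G (shiftz (- int K) y))) = y" unfolding G(2)[OF y'] by simp
    fix z assume z: "z \<in> X B" and a: "\<And>i. - int (2 * K + 1) \<le> i \<Longrightarrow> i \<le> 0 \<Longrightarrow> y i = z i"
    have "G y (- int K) = G z (- int K)" by (rule Gw[OF y z]) (use a in auto)
    then show "G (shiftz (- int K) y) 0 = G (shiftz (- int K) z) 0"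
      unfolding Gs[OF y] Gs[OF z] by simp
  qed
  obtain C where C: "square_mat C" "irreducible_matrix C" "\<not> permutation_matrix C"
    and AC: "triplet_isomorphic (ck_triplet A) (ck_triplet C)"
    and BC: "triplet_isomorphic (ck_triplet (transpose_mat B)) (ck_triplet (transpose_mat C))"
    using intermediate_matrix by blast
  define D where "D i = (if i = 0 then A else if i = 1 then C else B)" for i :: nat
  have "tf_isomorphic_1step (ck_triplet_pair (D i)) (ck_triplet_pair (D (Suc i)))" if "i < 2" for i
    using that AC triplet_isomorphic_sym[OF BC] by (auto simp: D_def ck_triplet_pair_def less_2_cases_iff)
  moreover have "square_mat (D i) \<and> irreducible_matrix (D i) \<and> \<not> permutation_matrix (D i)" for i
    using A B C by (simp add: D_def)
  moreover have "D 0 = A" "D 2 = B" by (simp_all add: D_def)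
  ultimately show ?thesis
    unfolding transpose_free_isomorphic_def by (intro exI[of _ 2] exI[of _ D]) blast
qed

section \<open>The representation on one-sided sequences\<close>

text \<open>In the representation by functions on one-sided sequences \<open>S\<^sub>a\<close> maps \<open>\<xi>\<close> to the function \<open>y \<mapsto> \<xi> (tl y)\<close>
  on the sequences starting with \<open>a\<close>, and its adjoint maps \<open>\<xi>\<close> to \<open>y \<mapsto> \<xi> (a y)\<close>: every word pulls functions
  back along a partial injection.\<close>

fun letter_map :: "nat mat \<Rightarrow> edge letter \<Rightarrow> (nat \<Rightarrow> edge) \<Rightarrow> (nat \<Rightarrow> edge) option" where
  "letter_map A (Gen a) y = (if y \<in> one_sided A \<and> y 0 = a then Some (tl_seq y) else None)"
| "letter_map A (Adj a) y = (if y \<in> one_sided A \<and> a \<in> edges A \<and> target a = source (y 0) then Some (case_nat a y) else None)"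

fun letters_map :: "nat mat \<Rightarrow> edge letter list \<Rightarrow> (nat \<Rightarrow> edge) \<Rightarrow> (nat \<Rightarrow> edge) option" where
  "letters_map A [] y = Some y"
| "letters_map A (l # ls) y = Option.bind (letter_map A l y) (letters_map A ls)"

lemma letters_map_append: "letters_map A (ks @ ls) y = Option.bind (letters_map A ks y) (letters_map A ls)"
  by (induction ks arbitrary: y) (auto split: bind_split)

lemma case_nat_tl: "case_nat (y 0) (tl_seq y) = y"
  by (rule ext) (simp split: nat.split)

lemma letter_map_sym: "letter_map A l y = Some u \<Longrightarrow> letter_map A (letter_adj l) u = Some y"
proof (cases l)
  case (Gen a)
  assume "letter_map A l y = Some u"
  then have y: "y \<in> one_sided A" "y 0 = a" "u = tl_seq y" using Gen by (auto split: if_splits)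
  then have "u \<in> one_sided A" "a \<in> edges A" "target a = source (u 0)"
    using one_sided_tl[OF y(1)] by (auto simp: one_sided_def)
  then show ?thesis using Gen y case_nat_tl[of y] by simp
next
  case (Adj a)
  assume "letter_map A l y = Some u"
  then have y: "y \<in> one_sided A" "a \<in> edges A" "target a = source (y 0)" "u = case_nat a y"
    using Adj by (auto split: if_splits)
  then show ?thesis using Adj one_sided_Cons[OF y(1-3)] by simp
qed

lemma letters_map_sym: "letters_map A ls y = Some u \<Longrightarrow> letters_map A (rev (map letter_adj ls)) u = Some y"
proof (induction ls arbitrary: y)
  case (Cons l ls)
  then obtain v where v: "letter_map A l y = Some v" "letters_map A ls v = Some u" by (auto simp: bind_eq_Some_conv)
  then show ?case using Cons.IH[OF v(2)] letter_map_sym[OF v(1)] by (simp add: letters_map_append)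
qed simp

abbreviation word_map :: "nat mat \<Rightarrow> edge word \<Rightarrow> (nat \<Rightarrow> edge) \<Rightarrow> (nat \<Rightarrow> edge) option" where
  "word_map A w \<equiv> letters_map A (letters w)"

lemma word_map_adj: "word_map A (word_adj w) u = Some y \<longleftrightarrow> word_map A w y = Some u"
proof
  assume "word_map A (word_adj w) u = Some y"
  have "word_map A (word_adj (word_adj w)) y = Some u"
    using letters_map_sym[OF \<open>word_map A (word_adj w) u = Some y\<close>] by (simp add: word_adj_def)
  then show "word_map A w y = Some u" by simp
next
  assume "word_map A w y = Some u"
  from letters_map_sym[OF this] show "word_map A (word_adj w) u = Some y" by (simp add: word_adj_def)
qed

lemma letter_map_one_sided: "letter_map A l y = Some u \<Longrightarrow> y \<in> one_sided A \<and> u \<in> one_sided A"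
proof (cases l)
  case (Gen a)
  assume "letter_map A l y = Some u"
  then have y: "y \<in> one_sided A" "u = tl_seq y" using Gen by (simp_all split: if_splits)
  then show ?thesis using one_sided_tl[OF y(1)] by simp
next
  case (Adj a)
  assume "letter_map A l y = Some u"
  then have y: "y \<in> one_sided A" "a \<in> edges A" "target a = source (y 0)" "u = case_nat a y"
    using Adj by (simp_all split: if_splits)
  then show ?thesis using one_sided_Cons[OF y(1-3)] by simp
qed

lemma letters_map_one_sided: "letters_map A ls y = Some u \<Longrightarrow> y \<in> one_sided A \<longleftrightarrow> u \<in> one_sided A"
proof (induction ls arbitrary: y)
  case (Cons l ls)
  then obtain v where v: "letter_map A l y = Some v" "letters_map A ls v = Some u" by (auto simp: bind_eq_Some_conv)
  then show ?case using Cons.IH[OF v(2)] letter_map_one_sided[OF v(1)] by simp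
qed simp

text \<open>A generator removes the first letter of a sequence and an adjoint adds one. From some
  position on the two sequences agree, with a lag equal to the degree of the word.\<close>

lemma letters_map_tail:
  "letters_map A ls y = Some u \<Longrightarrow> \<exists>i j. i \<le> length ls \<and> j \<le> length ls \<and> int i - int j = sum_list (map letter_degree ls) \<and>
     (\<forall>k. y (k + i) = u (k + j))"
proof (induction ls arbitrary: y)
  case (Cons l ls)
  then obtain v where v: "letter_map A l y = Some v" "letters_map A ls v = Some u" by (auto simp: bind_eq_Some_conv)
  from Cons.IH[OF v(2)] obtain i j where ij: "i \<le> length ls" "j \<le> length ls"
    "int i - int j = sum_list (map letter_degree ls)" "\<And>k. v (k + i) = u (k + j)" by blast
  show ?case
  proof (cases l)
    case (Gen a)
    then have "v = tl_seq y" using v(1) by (auto split: if_splits)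
    then show ?thesis using ij Gen by (intro exI[of _ "Suc i"] exI[of _ j]) auto
  next
    case (Adj a)
    then have va: "v = case_nat a y" using v(1) by (auto split: if_splits)
    show ?thesis
    proof (cases i)
      case 0
      have "y k = u (k + Suc j)" for k using ij(4)[of "Suc k"] va 0 by simp
      then show ?thesis using ij Adj 0 by (intro exI[of _ 0] exI[of _ "Suc j"]) auto
    next
      case (Suc i')
      have "y (k + i') = u (k + j)" for k using ij(4)[of k] va Suc by simp
      then show ?thesis using ij Adj Suc by (intro exI[of _ i'] exI[of _ j]) auto
    qed
  qed
qed auto

definition word_op :: "nat mat \<Rightarrow> edge word \<Rightarrow> ((nat \<Rightarrow> edge) \<Rightarrow> complex) \<Rightarrow> (nat \<Rightarrow> edge) \<Rightarrow> complex" where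
  "word_op A w \<xi> y = (case word_map A w y of None \<Rightarrow> 0 | Some u \<Rightarrow> \<xi> u)"

definition rep :: "nat mat \<Rightarrow> edge free \<Rightarrow> ((nat \<Rightarrow> edge) \<Rightarrow> complex) \<Rightarrow> (nat \<Rightarrow> edge) \<Rightarrow> complex" where
  "rep A f \<xi> y = (\<Sum>w\<in>Poly_Mapping.keys f. Poly_Mapping.lookup f w * word_op A w \<xi> y)"

lemma rep_superset:
  assumes "finite K" "Poly_Mapping.keys f \<subseteq> K"
  shows "rep A f \<xi> y = (\<Sum>w\<in>K. Poly_Mapping.lookup f w * word_op A w \<xi> y)"
  unfolding rep_def by (rule sum.mono_neutral_left[OF assms]) (simp add: in_keys_iff)

lemma rep_add: "rep A (f + g) \<xi> y = rep A f \<xi> y + rep A g \<xi> y"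
proof -
  let ?K = "Poly_Mapping.keys f \<union> Poly_Mapping.keys g"
  have "rep A (f + g) \<xi> y = (\<Sum>w\<in>?K. Poly_Mapping.lookup (f + g) w * word_op A w \<xi> y)"
    using keys_add[of f g] by (intro rep_superset) auto
  also have "\<dots> = rep A f \<xi> y + rep A g \<xi> y"
    by (simp add: rep_superset[of ?K f] rep_superset[of ?K g] lookup_add distrib_right sum.distrib)
  finally show ?thesis .
qed

lemma rep_zero [simp]: "rep A 0 \<xi> y = 0"
  by (simp add: rep_def)

lemma rep_single: "rep A (Poly_Mapping.single w c) \<xi> y = c * word_op A w \<xi> y"
  by (cases "c = 0") (simp_all add: rep_def)

lemma rep_fscale: "rep A (fscale c f) \<xi> y = c * rep A f \<xi> y"
proof (induction f rule: free_induct)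
  case (single w d)
  show ?case by (simp add: fscale_def mult_single rep_single)
qed (simp_all add: fscale_def distrib_left rep_add)

lemma rep_diff: "rep A (f - g) \<xi> y = rep A f \<xi> y - rep A g \<xi> y"
  using rep_add[of A f "- g" \<xi> y] rep_fscale[of A "-1" g \<xi> y] by (simp add: fscale_minus_one)

lemma rep_sum: "rep A (sum f K) \<xi> y = (\<Sum>i\<in>K. rep A (f i) \<xi> y)"
  by (induction K rule: infinite_finite_induct) (simp_all add: rep_add)

lemma word_op_plus: "word_op A (u + v) \<xi> y = word_op A u (word_op A v \<xi>) y"
  by (cases "word_map A u y") (simp_all add: word_op_def plus_word_def letters_map_append)

lemma word_op_add: "word_op A w (\<lambda>x. \<xi> x + \<eta> x) y = word_op A w \<xi> y + word_op A w \<eta> y"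
  by (simp add: word_op_def split: option.split)

lemma word_op_scale: "word_op A w (\<lambda>x. c * \<xi> x) y = c * word_op A w \<xi> y"
  by (simp add: word_op_def split: option.split)

lemma word_op_zero: "word_op A w (\<lambda>x. 0) y = 0"
  by (simp add: word_op_def split: option.split)

lemma rep_mult: "rep A (f * g) \<xi> = rep A f (rep A g \<xi>)"
proof (rule ext)
  fix y
  show "rep A (f * g) \<xi> y = rep A f (rep A g \<xi>) y"
  proof (induction f rule: free_induct)
    case (single w c)
    show ?case
    proof (induction g rule: free_induct)
      case zero
      show ?case by (simp add: rep_single rep_def word_op_zero)
    next
      case (single v d)
      have "rep A (Poly_Mapping.single v d) \<xi> = (\<lambda>x. d * word_op A v \<xi> x)" by (simp add: rep_single fun_eq_iff)
      then show ?case by (simp add: mult_single rep_single word_op_plus word_op_scale)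
    next
      case (add g h)
      have "rep A (g + h) \<xi> = (\<lambda>x. rep A g \<xi> x + rep A h \<xi> x)" by (simp add: rep_add fun_eq_iff)
      then show ?case using add by (simp add: distrib_left rep_add rep_single word_op_add)
    qed
  qed (simp_all add: rep_add distrib_right)
qed

lemma letters_zero [simp]: "letters 0 = []"
  by (simp add: zero_word_def)

lemma rep_one [simp]: "rep A 1 \<xi> y = \<xi> y"
  using rep_single[of A 0 1 \<xi> y] by (simp add: word_op_def)

lemma rep_gen: "rep A (fgen a) \<xi> y = (if y \<in> one_sided A \<and> y 0 = a then \<xi> (tl_seq y) else 0)"
  by (simp add: fgen_def rep_single word_op_def)

lemma rep_gen_star:
  "rep A (fstar (fgen a)) \<xi> y = (if y \<in> one_sided A \<and> a \<in> edges A \<and> target a = source (y 0) then \<xi> (case_nat a y) else 0)"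
  by (simp add: fgen_def fstar_single rep_single word_op_def word_adj_def)

section \<open>Finitely supported vectors and the operator seminorm\<close>

definition supp :: "('x \<Rightarrow> complex) \<Rightarrow> 'x set" where "supp \<xi> = {x. \<xi> x \<noteq> 0}"

text \<open>A pre-Hilbert space: all sums are finite, and the operators enter only through their
  seminorm on these vectors.\<close>

definition finite_vectors :: "nat mat \<Rightarrow> ((nat \<Rightarrow> edge) \<Rightarrow> complex) set" where
  "finite_vectors A = {\<xi>. finite (supp \<xi>) \<and> supp \<xi> \<subseteq> one_sided A}"

definition l2_norm :: "('x \<Rightarrow> complex) \<Rightarrow> real" where
  "l2_norm \<xi> = L2_set (\<lambda>x. cmod (\<xi> x)) (supp \<xi>)"

definition l2_ip :: "('x \<Rightarrow> complex) \<Rightarrow> ('x \<Rightarrow> complex) \<Rightarrow> complex" where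
  "l2_ip \<xi> \<eta> = (\<Sum>x\<in>supp \<xi>. \<xi> x * cnj (\<eta> x))"

lemma l2_norm_superset: "finite K \<Longrightarrow> supp \<xi> \<subseteq> K \<Longrightarrow> l2_norm \<xi> = L2_set (\<lambda>x. cmod (\<xi> x)) K"
  unfolding l2_norm_def L2_set_def real_sqrt_eq_iff
  by (rule sum.mono_neutral_left) (auto simp: supp_def)

lemma l2_ip_superset: "finite K \<Longrightarrow> supp \<xi> \<inter> supp \<eta> \<subseteq> K \<Longrightarrow> finite (supp \<xi>) \<Longrightarrow> l2_ip \<xi> \<eta> = (\<Sum>x\<in>K. \<xi> x * cnj (\<eta> x))"
  unfolding l2_ip_def by (rule sum.mono_neutral_cong) (auto simp: supp_def)

lemma l2_norm_nonneg: "0 \<le> l2_norm \<xi>" by (simp add: l2_norm_def)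

lemma l2_norm_add:
  assumes "finite (supp \<xi>)" "finite (supp \<eta>)"
  shows "l2_norm (\<lambda>x. \<xi> x + \<eta> x) \<le> l2_norm \<xi> + l2_norm \<eta>"
proof -
  let ?K = "supp \<xi> \<union> supp \<eta>"
  have "l2_norm (\<lambda>x. \<xi> x + \<eta> x) = L2_set (\<lambda>x. cmod (\<xi> x + \<eta> x)) ?K"
    by (rule l2_norm_superset) (use assms in \<open>auto simp: supp_def\<close>)
  also have "\<dots> \<le> L2_set (\<lambda>x. cmod (\<xi> x) + cmod (\<eta> x)) ?K"
    by (rule L2_set_mono) (auto simp: norm_triangle_ineq)
  also have "\<dots> \<le> L2_set (\<lambda>x. cmod (\<xi> x)) ?K + L2_set (\<lambda>x. cmod (\<eta> x)) ?K"
    by (rule L2_set_triangle_ineq)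
  also have "\<dots> = l2_norm \<xi> + l2_norm \<eta>" using assms by (simp add: l2_norm_superset[of ?K])
  finally show ?thesis .
qed

lemma l2_norm_scale: "l2_norm (\<lambda>x. c * \<xi> x) = cmod c * l2_norm \<xi>"
proof (cases "c = 0")
  case True then show ?thesis by (simp add: l2_norm_def supp_def)
next
  case False
  then have "supp (\<lambda>x. c * \<xi> x) = supp \<xi>" by (simp add: supp_def)
  then show ?thesis by (simp add: l2_norm_def norm_mult L2_set_right_distrib)
qed

lemma l2_ip_self: "l2_ip \<xi> \<xi> = of_real ((l2_norm \<xi>)\<^sup>2)"
proof -
  have "\<xi> x * cnj (\<xi> x) = of_real ((cmod (\<xi> x))\<^sup>2)" for x by (simp only: complex_norm_square)
  then show ?thesis unfolding l2_ip_def l2_norm_def L2_set_def by (simp add: sum_nonneg)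
qed

lemma cauchy_schwarz:
  assumes "finite (supp \<xi>)" "finite (supp \<eta>)"
  shows "cmod (l2_ip \<xi> \<eta>) \<le> l2_norm \<xi> * l2_norm \<eta>"
proof -
  let ?K = "supp \<xi> \<union> supp \<eta>"
  have "cmod (l2_ip \<xi> \<eta>) = cmod (\<Sum>x\<in>?K. \<xi> x * cnj (\<eta> x))"
    using assms by (subst l2_ip_superset[of ?K]) auto
  also have "\<dots> \<le> (\<Sum>x\<in>?K. \<bar>cmod (\<xi> x)\<bar> * \<bar>cmod (\<eta> x)\<bar>)"
    by (rule order_trans[OF norm_sum]) (simp add: norm_mult)
  also have "\<dots> \<le> L2_set (\<lambda>x. cmod (\<xi> x)) ?K * L2_set (\<lambda>x. cmod (\<eta> x)) ?K"
    by (rule L2_set_mult_ineq)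
  finally show ?thesis using assms by (simp add: l2_norm_superset[of ?K])
qed

lemma supp_word_op: "supp (word_op A w \<xi>) \<subseteq> (\<lambda>u. the (word_map A (word_adj w) u)) ` supp \<xi>"
proof
  fix y assume "y \<in> supp (word_op A w \<xi>)"
  then obtain u where u: "word_map A w y = Some u" "\<xi> u \<noteq> 0" by (auto simp: supp_def word_op_def split: option.splits)
  then have "word_map A (word_adj w) u = Some y" by (simp add: word_map_adj)
  then show "y \<in> (\<lambda>u. the (word_map A (word_adj w) u)) ` supp \<xi>"
    using u(2) by (intro image_eqI[of _ _ u]) (auto simp: supp_def)
qed

lemma word_op_vecs: assumes "\<xi> \<in> finite_vectors A" shows "word_op A w \<xi> \<in> finite_vectors A"
proof -
  have "finite (supp (word_op A w \<xi>))"
    by (rule finite_subset[OF supp_word_op]) (use assms in \<open>simp add: finite_vectors_def\<close>)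
  moreover have "y \<in> one_sided A" if y: "y \<in> supp (word_op A w \<xi>)" for y
  proof -
    obtain u where u: "word_map A w y = Some u" "\<xi> u \<noteq> 0"
      using y by (auto simp: supp_def word_op_def split: option.splits)
    then have "u \<in> one_sided A" using assms by (auto simp: finite_vectors_def supp_def)
    then show ?thesis using letters_map_one_sided[OF u(1)] by simp
  qed
  ultimately show ?thesis by (auto simp: finite_vectors_def)
qed

lemma finite_vectors_subset:
  assumes "\<xi> \<in> finite_vectors A" "\<eta> \<in> finite_vectors A" "\<And>x. \<xi> x = 0 \<Longrightarrow> \<eta> x = 0 \<Longrightarrow> \<zeta> x = 0"
  shows "\<zeta> \<in> finite_vectors A"
proof -
  have sub: "supp \<zeta> \<subseteq> supp \<xi> \<union> supp \<eta>"
  proof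
    fix x assume "x \<in> supp \<zeta>"
    then show "x \<in> supp \<xi> \<union> supp \<eta>" using assms(3)[of x] unfolding supp_def by blast
  qed
  have "finite (supp \<zeta>)" by (rule finite_subset[OF sub]) (use assms(1,2) in \<open>simp add: finite_vectors_def\<close>)
  moreover have "supp \<zeta> \<subseteq> one_sided A" by (rule order_trans[OF sub]) (use assms(1,2) in \<open>simp add: finite_vectors_def\<close>)
  ultimately show ?thesis by (simp add: finite_vectors_def)
qed

lemma finite_vectors_zero: "(\<lambda>x. 0) \<in> finite_vectors A"
proof -
  have "supp (\<lambda>x::nat \<Rightarrow> edge. 0) = {}" unfolding supp_def by simp
  then show ?thesis by (simp add: finite_vectors_def)
qed

lemma finite_vectors_add: "\<xi> \<in> finite_vectors A \<Longrightarrow> \<eta> \<in> finite_vectors A \<Longrightarrow> (\<lambda>x. \<xi> x + \<eta> x) \<in> finite_vectors A"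
  by (rule finite_vectors_subset[of \<xi> A \<eta>]) simp_all

lemma finite_vectors_scale: "\<xi> \<in> finite_vectors A \<Longrightarrow> (\<lambda>x. c * \<xi> x) \<in> finite_vectors A"
  by (rule finite_vectors_subset[of \<xi> A \<xi>]) simp_all

lemma rep_vecs: assumes "\<xi> \<in> finite_vectors A" shows "rep A f \<xi> \<in> finite_vectors A"
proof (induction f rule: free_induct)
  case zero
  have "rep A 0 \<xi> = (\<lambda>x. 0)" by (simp add: fun_eq_iff)
  then show ?case by (simp add: finite_vectors_zero)
next
  case (single w c)
  have "rep A (Poly_Mapping.single w c) \<xi> = (\<lambda>x. c * word_op A w \<xi> x)" by (simp add: rep_single fun_eq_iff)
  then show ?case by (simp add: finite_vectors_scale word_op_vecs assms)
next
  case (add f g)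
  have "rep A (f + g) \<xi> = (\<lambda>x. rep A f \<xi> x + rep A g \<xi> x)" by (simp add: rep_add fun_eq_iff)
  then show ?case using add by (simp add: finite_vectors_add)
qed

lemma finite_vectors_finite: "\<xi> \<in> finite_vectors A \<Longrightarrow> finite (supp \<xi>)" by (simp add: finite_vectors_def)

text \<open>This is the graph of the partial injection of \<open>w\<close> over the support of
  \<open>\<xi>\<close>. Injectivity of both coordinates lets sums over the support of the image be
  rewritten as sums over that of \<open>\<xi>\<close>.\<close>

lemma word_op_pairs:
  fixes A :: "nat mat" and w :: "edge word" and \<xi> :: "(nat \<Rightarrow> edge) \<Rightarrow> complex"
  assumes "finite (supp \<xi>)"
  defines "P \<equiv> {(y, u). word_map A w y = Some u \<and> \<xi> u \<noteq> 0}"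
  shows "finite P" "inj_on fst P" "inj_on snd P" "fst ` P = supp (word_op A w \<xi>)" "snd ` P \<subseteq> supp \<xi>"
proof -
  have mem: "p \<in> P \<longleftrightarrow> word_map A w (fst p) = Some (snd p) \<and> \<xi> (snd p) \<noteq> 0" for p
    by (simp add: P_def case_prod_unfold)
  show fst: "inj_on fst P"
  proof (rule inj_onI)
    fix p q assume "p \<in> P" "q \<in> P" "fst p = fst q"
    then show "p = q" unfolding mem prod_eq_iff by (metis option.inject)
  qed
  show "inj_on snd P"
  proof (rule inj_onI)
    fix p q assume "p \<in> P" "q \<in> P" "snd p = snd q"
    then show "p = q" unfolding mem prod_eq_iff by (metis option.inject word_map_adj)
  qed
  show *: "fst ` P = supp (word_op A w \<xi>)"
  proof (intro equalityI subsetI)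
    fix y assume "y \<in> fst ` P"
    then obtain p where "p \<in> P" "y = fst p" by (rule imageE)
    then show "y \<in> supp (word_op A w \<xi>)" by (simp add: mem supp_def word_op_def)
  next
    fix y assume "y \<in> supp (word_op A w \<xi>)"
    then obtain u where "word_map A w y = Some u" "\<xi> u \<noteq> 0"
      by (cases "word_map A w y") (simp_all add: supp_def word_op_def)
    then have "(y, u) \<in> P" by (simp add: mem)
    then show "y \<in> fst ` P" by (rule image_eqI[rotated]) simp
  qed
  show "snd ` P \<subseteq> supp \<xi>"
  proof (rule image_subsetI)
    fix p assume "p \<in> P" then show "snd p \<in> supp \<xi>" by (simp add: mem supp_def)
  qed
  have "finite (supp (word_op A w \<xi>))" using finite_subset[OF supp_word_op] assms by blast
  then show "finite P" unfolding *[symmetric] using fst by (rule finite_imageD)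
qed

lemma l2_norm_wop: assumes "finite (supp \<xi>)" shows "l2_norm (word_op A w \<xi>) \<le> l2_norm \<xi>"
proof -
  let ?P = "{(y, u). word_map A w y = Some u \<and> \<xi> u \<noteq> 0}"
  note P = word_op_pairs[OF assms, of A w]
  have "(\<Sum>y\<in>supp (word_op A w \<xi>). (cmod (word_op A w \<xi> y))\<^sup>2) = (\<Sum>p\<in>?P. (cmod (word_op A w \<xi> (fst p)))\<^sup>2)"
    unfolding P(4)[symmetric] by (simp add: sum.reindex[OF P(2)])
  also have "\<dots> = (\<Sum>p\<in>?P. (cmod (\<xi> (snd p)))\<^sup>2)"
    by (rule sum.cong) (auto simp: word_op_def)
  also have "\<dots> = (\<Sum>u\<in>snd ` ?P. (cmod (\<xi> u))\<^sup>2)"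
    using sum.reindex[OF P(3), of "\<lambda>u. (cmod (\<xi> u))\<^sup>2"] by (simp add: comp_def)
  also have "\<dots> \<le> (\<Sum>u\<in>supp \<xi>. (cmod (\<xi> u))\<^sup>2)"
    by (rule sum_mono2[OF assms P(5)]) simp
  finally show ?thesis by (simp add: l2_norm_def L2_set_def)
qed

lemma l2_ip_wop:
  assumes "finite (supp \<xi>)" "finite (supp \<eta>)"
  shows "l2_ip (word_op A w \<xi>) \<eta> = l2_ip \<xi> (word_op A (word_adj w) \<eta>)"
proof -
  let ?P = "{(y, u). word_map A w y = Some u \<and> \<xi> u \<noteq> 0}"
  note P = word_op_pairs[OF assms(1), of A w]
  have "l2_ip (word_op A w \<xi>) \<eta> = (\<Sum>y\<in>fst ` ?P. word_op A w \<xi> y * cnj (\<eta> y))" by (simp add: l2_ip_def P(4))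
  also have "\<dots> = (\<Sum>p\<in>?P. word_op A w \<xi> (fst p) * cnj (\<eta> (fst p)))"
    using sum.reindex[OF P(2), of "\<lambda>y. word_op A w \<xi> y * cnj (\<eta> y)"] by (simp add: comp_def)
  also have "\<dots> = (\<Sum>p\<in>?P. \<xi> (snd p) * cnj (word_op A (word_adj w) \<eta> (snd p)))"
  proof (rule sum.cong)
    fix p assume "p \<in> ?P"
    then have p: "word_map A w (fst p) = Some (snd p)" "word_map A (word_adj w) (snd p) = Some (fst p)"
      by (auto simp: word_map_adj)
    then show "word_op A w \<xi> (fst p) * cnj (\<eta> (fst p)) = \<xi> (snd p) * cnj (word_op A (word_adj w) \<eta> (snd p))"
      by (simp add: word_op_def)
  qed simp
  also have "\<dots> = (\<Sum>u\<in>snd ` ?P. \<xi> u * cnj (word_op A (word_adj w) \<eta> u))"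
    using sum.reindex[OF P(3), of "\<lambda>u. \<xi> u * cnj (word_op A (word_adj w) \<eta> u)"] by (simp add: comp_def)
  also have "\<dots> = l2_ip \<xi> (word_op A (word_adj w) \<eta>)"
    unfolding l2_ip_def
  proof (rule sum.mono_neutral_left[OF assms(1) P(5)], intro ballI)
    fix u assume u: "u \<in> supp \<xi> - snd ` ?P"
    have "word_map A (word_adj w) u = None"
    proof (rule ccontr)
      assume "word_map A (word_adj w) u \<noteq> None"
      then obtain y where "word_map A w y = Some u" by (auto simp: word_map_adj)
      then have "(y, u) \<in> ?P" using u by (simp add: supp_def)
      then show False using u by force
    qed
    then show "\<xi> u * cnj (word_op A (word_adj w) \<eta> u) = 0" by (simp add: word_op_def)
  qed
  finally show ?thesis .
qed

lemma l2_ip_add_left: assumes "finite (supp \<xi>)" "finite (supp \<zeta>)" "finite (supp \<eta>)"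
  shows "l2_ip (\<lambda>x. \<xi> x + \<zeta> x) \<eta> = l2_ip \<xi> \<eta> + l2_ip \<zeta> \<eta>"
proof -
  let ?K = "supp \<xi> \<union> supp \<zeta>"
  have "finite (supp (\<lambda>x. \<xi> x + \<zeta> x))"
    by (rule finite_subset[of _ ?K]) (use assms in \<open>auto simp: supp_def\<close>)
  then have "l2_ip (\<lambda>x. \<xi> x + \<zeta> x) \<eta> = (\<Sum>x\<in>?K. (\<xi> x + \<zeta> x) * cnj (\<eta> x))"
    using assms by (intro l2_ip_superset) (auto simp: supp_def)
  moreover have "l2_ip \<xi> \<eta> = (\<Sum>x\<in>?K. \<xi> x * cnj (\<eta> x))" "l2_ip \<zeta> \<eta> = (\<Sum>x\<in>?K. \<zeta> x * cnj (\<eta> x))"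
    using assms by (auto intro!: l2_ip_superset)
  ultimately show ?thesis by (simp add: distrib_right sum.distrib)
qed

lemma l2_ip_commute: assumes "finite (supp \<xi>)" "finite (supp \<eta>)" shows "l2_ip \<eta> \<xi> = cnj (l2_ip \<xi> \<eta>)"
proof -
  let ?K = "supp \<xi> \<union> supp \<eta>"
  have "l2_ip \<xi> \<eta> = (\<Sum>x\<in>?K. \<xi> x * cnj (\<eta> x))" by (rule l2_ip_superset) (use assms in auto)
  moreover have "l2_ip \<eta> \<xi> = (\<Sum>x\<in>?K. \<eta> x * cnj (\<xi> x))" by (rule l2_ip_superset) (use assms in auto)
  ultimately show ?thesis by (simp add: mult.commute)
qed

lemma l2_ip_scale_left: "finite (supp \<xi>) \<Longrightarrow> l2_ip (\<lambda>x. c * \<xi> x) \<eta> = c * l2_ip \<xi> \<eta>"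
  by (subst l2_ip_superset[of "supp \<xi>"])
     (auto simp: supp_def l2_ip_def sum_distrib_left mult.assoc intro: finite_subset[of _ "supp \<xi>"])

lemma l2_ip_op:
  assumes "\<xi> \<in> finite_vectors A" "\<eta> \<in> finite_vectors A"
  shows "l2_ip (rep A f \<xi>) \<eta> = l2_ip \<xi> (rep A (fstar f) \<eta>)"
proof (induction f rule: free_induct)
  case zero
  have "rep A 0 \<zeta> = (\<lambda>x. 0)" for \<zeta> by (simp add: fun_eq_iff)
  then show ?case by (simp add: l2_ip_def supp_def)
next
  case (single w c)
  have s: "rep A (Poly_Mapping.single w c) \<zeta> = (\<lambda>x. c * word_op A w \<zeta> x)" for w c \<zeta>
    by (simp add: rep_single fun_eq_iff)
  have fin: "finite (supp (word_op A w \<xi>))" "finite (supp (word_op A (word_adj w) \<eta>))" "finite (supp \<xi>)" "finite (supp \<eta>)"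
    using word_op_vecs assms finite_vectors_finite by blast+
  have fin2: "finite (supp (\<lambda>x. cnj c * word_op A (word_adj w) \<eta> x))"
    by (rule finite_subset[OF _ fin(2)]) (auto simp: supp_def)
  have "l2_ip (\<lambda>x. c * word_op A w \<xi> x) \<eta> = c * l2_ip \<xi> (word_op A (word_adj w) \<eta>)"
    using l2_ip_scale_left[OF fin(1)] l2_ip_wop[OF fin(3,4)] by simp
  also have "\<dots> = l2_ip \<xi> (\<lambda>x. cnj c * word_op A (word_adj w) \<eta> x)"
    using l2_ip_commute[OF fin(3) fin2] l2_ip_commute[OF fin(3) fin(2)] l2_ip_scale_left[OF fin(2), of "cnj c" \<xi>]
    by (metis complex_cnj_cnj complex_cnj_mult)
  finally show ?case by (simp add: s fstar_single)
next
  case (add f g)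
  have s: "rep A (f + g) \<zeta> = (\<lambda>x. rep A f \<zeta> x + rep A g \<zeta> x)" for f g \<zeta> by (simp add: rep_add fun_eq_iff)
  have fin: "finite (supp (rep A f \<zeta>))" if "\<zeta> \<in> finite_vectors A" for f \<zeta> using rep_vecs[OF that] finite_vectors_finite by blast
  have fx: "finite (supp \<xi>)" "finite (supp \<eta>)" using assms finite_vectors_finite by blast+
  have fin2: "finite (supp (\<lambda>x. rep A (fstar f) \<eta> x + rep A (fstar g) \<eta> x))"
    using fin[OF assms(2), of "fstar f + fstar g"] by (simp add: s)
  have "l2_ip \<xi> (\<lambda>x. rep A (fstar f) \<eta> x + rep A (fstar g) \<eta> x) =
     cnj (l2_ip (rep A (fstar f) \<eta>) \<xi> + l2_ip (rep A (fstar g) \<eta>) \<xi>)"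
    using l2_ip_commute[OF fin2 fx(1)] l2_ip_add_left[OF fin[OF assms(2)] fin[OF assms(2)] fx(1)] by simp
  also have "\<dots> = l2_ip \<xi> (rep A (fstar f) \<eta>) + l2_ip \<xi> (rep A (fstar g) \<eta>)"
    using l2_ip_commute[OF fin[OF assms(2)] fx(1)] by simp
  finally show ?case
    using add l2_ip_add_left[OF fin[OF assms(1)] fin[OF assms(1)] fx(2), of f g] by (simp add: s fstar_add)
qed

definition rep_norm :: "nat mat \<Rightarrow> edge free \<Rightarrow> real" where
  "rep_norm A f = Inf {c. 0 \<le> c \<and> (\<forall>\<xi>\<in>finite_vectors A. l2_norm (rep A f \<xi>) \<le> c * l2_norm \<xi>)}"

lemma rep_bounded: "\<exists>c\<ge>0. \<forall>\<xi>\<in>finite_vectors A. l2_norm (rep A f \<xi>) \<le> c * l2_norm \<xi>"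
proof (induction f rule: free_induct)
  case zero
  have "rep A 0 \<zeta> = (\<lambda>x. 0)" for \<zeta> by (simp add: fun_eq_iff)
  then show ?case by (intro exI[of _ 0]) (simp add: l2_norm_def supp_def)
next
  case (single w c)
  have "rep A (Poly_Mapping.single w c) \<zeta> = (\<lambda>x. c * word_op A w \<zeta> x)" for \<zeta>
    by (simp add: rep_single fun_eq_iff)
  then show ?case
    by (intro exI[of _ "cmod c"]) (auto simp: l2_norm_scale intro!: mult_left_mono l2_norm_wop finite_vectors_finite)
next
  case (add f g)
  then obtain c d where c: "c \<ge> 0" "\<forall>\<xi>\<in>finite_vectors A. l2_norm (rep A f \<xi>) \<le> c * l2_norm \<xi>"
    and d: "d \<ge> 0" "\<forall>\<xi>\<in>finite_vectors A. l2_norm (rep A g \<xi>) \<le> d * l2_norm \<xi>" by blast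
  have "l2_norm (rep A (f + g) \<xi>) \<le> (c + d) * l2_norm \<xi>" if \<xi>: "\<xi> \<in> finite_vectors A" for \<xi>
  proof -
    have "rep A (f + g) \<xi> = (\<lambda>x. rep A f \<xi> x + rep A g \<xi> x)" by (simp add: rep_add fun_eq_iff)
    then have "l2_norm (rep A (f + g) \<xi>) \<le> l2_norm (rep A f \<xi>) + l2_norm (rep A g \<xi>)"
      using l2_norm_add[OF finite_vectors_finite[OF rep_vecs[OF \<xi>, of f]] finite_vectors_finite[OF rep_vecs[OF \<xi>, of g]]] by simp
    also have "\<dots> \<le> c * l2_norm \<xi> + d * l2_norm \<xi>" using c(2) d(2) \<xi> by (intro add_mono) auto
    finally show ?thesis by (simp add: distrib_right)
  qed
  then show ?case using c(1) d(1) by (intro exI[of _ "c + d"]) auto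
qed

lemma rep_norm_least: "0 \<le> c \<Longrightarrow> (\<And>\<xi>. \<xi> \<in> finite_vectors A \<Longrightarrow> l2_norm (rep A f \<xi>) \<le> c * l2_norm \<xi>) \<Longrightarrow> rep_norm A f \<le> c"
  unfolding rep_norm_def by (rule cInf_lower) (auto intro: bdd_belowI[of _ 0])

lemma rep_norm_nonneg: "0 \<le> rep_norm A f"
  unfolding rep_norm_def by (rule cInf_greatest) (use rep_bounded[of A f] in auto)

lemma rep_norm_bound: assumes "\<xi> \<in> finite_vectors A" shows "l2_norm (rep A f \<xi>) \<le> rep_norm A f * l2_norm \<xi>"
proof (cases "l2_norm \<xi> = 0")
  case True
  then show ?thesis using rep_bounded[of A f] assms by fastforce
next
  case False
  then have pos: "l2_norm \<xi> > 0" using l2_norm_nonneg[of \<xi>] by simp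
  have "l2_norm (rep A f \<xi>) / l2_norm \<xi> \<le> rep_norm A f"
    unfolding rep_norm_def
    by (rule cInf_greatest) (use rep_bounded[of A f] assms pos in \<open>auto simp: pos_divide_le_eq\<close>)
  then show ?thesis using pos by (simp add: pos_divide_le_eq)
qed

lemma rep_norm_seminorm: "cstar_seminorm G (rep_norm A)"
proof -
  have add: "rep_norm A (f + g) \<le> rep_norm A f + rep_norm A g" for f g
  proof (rule rep_norm_least)
    fix \<xi> assume \<xi>: "\<xi> \<in> finite_vectors A"
    have "rep A (f + g) \<xi> = (\<lambda>x. rep A f \<xi> x + rep A g \<xi> x)" by (simp add: rep_add fun_eq_iff)
    then have "l2_norm (rep A (f + g) \<xi>) \<le> l2_norm (rep A f \<xi>) + l2_norm (rep A g \<xi>)"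
      using l2_norm_add[OF finite_vectors_finite[OF rep_vecs[OF \<xi>, of f]] finite_vectors_finite[OF rep_vecs[OF \<xi>, of g]]] by simp
    also have "\<dots> \<le> rep_norm A f * l2_norm \<xi> + rep_norm A g * l2_norm \<xi>" by (intro add_mono rep_norm_bound \<xi>)
    finally show "l2_norm (rep A (f + g) \<xi>) \<le> (rep_norm A f + rep_norm A g) * l2_norm \<xi>" by (simp add: distrib_right)
  qed (simp add: rep_norm_nonneg)
  have mult: "rep_norm A (f * g) \<le> rep_norm A f * rep_norm A g" for f g
  proof (rule rep_norm_least)
    fix \<xi> assume \<xi>: "\<xi> \<in> finite_vectors A"
    have "l2_norm (rep A (f * g) \<xi>) \<le> rep_norm A f * l2_norm (rep A g \<xi>)"
      unfolding rep_mult by (rule rep_norm_bound[OF rep_vecs[OF \<xi>]])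
    also have "\<dots> \<le> rep_norm A f * (rep_norm A g * l2_norm \<xi>)"
      by (intro mult_left_mono rep_norm_bound \<xi> rep_norm_nonneg)
    finally show "l2_norm (rep A (f * g) \<xi>) \<le> rep_norm A f * rep_norm A g * l2_norm \<xi>" by (simp add: mult.assoc)
  qed (simp add: rep_norm_nonneg)
  have scale_le: "rep_norm A (fscale c f) \<le> cmod c * rep_norm A f" for c f
  proof (rule rep_norm_least)
    fix \<xi> assume \<xi>: "\<xi> \<in> finite_vectors A"
    have "rep A (fscale c f) \<xi> = (\<lambda>x. c * rep A f \<xi> x)" by (simp add: rep_fscale fun_eq_iff)
    then show "l2_norm (rep A (fscale c f) \<xi>) \<le> cmod c * rep_norm A f * l2_norm \<xi>"
      using rep_norm_bound[OF \<xi>, of f] by (simp add: l2_norm_scale mult.assoc mult_left_mono)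
  qed (simp add: rep_norm_nonneg)
  have scale: "rep_norm A (fscale c f) = cmod c * rep_norm A f" for c f
  proof (cases "c = 0")
    case True
    then show ?thesis using scale_le[of 0 f] rep_norm_nonneg[of A 0] by simp
  next
    case False
    have "rep_norm A f \<le> cmod (1 / c) * rep_norm A (fscale c f)"
      using scale_le[of "1 / c" "fscale c f"] False by (simp add: fscale_fscale)
    then have "cmod c * rep_norm A f \<le> rep_norm A (fscale c f)"
      using False by (simp add: norm_divide field_simps)
    then show ?thesis using scale_le[of c f] by simp
  qed
  \<comment> \<open>The squared norm of \<open>f \<xi>\<close> is the inner product of
    \<open>\<xi>\<close> with \<open>fstar f * f\<close> applied to \<open>\<xi>\<close>, which
    Cauchy--Schwarz bounds.\<close>
  have sq: "(rep_norm A f)\<^sup>2 \<le> rep_norm A (fstar f * f)" for f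
  proof -
    have "rep_norm A f \<le> sqrt (rep_norm A (fstar f * f))"
    proof (rule rep_norm_least)
      fix \<xi> assume \<xi>: "\<xi> \<in> finite_vectors A"
      note f = rep_vecs[OF \<xi>, of f] and ff = rep_vecs[OF \<xi>, of "fstar f * f"]
      have "complex_of_real ((l2_norm (rep A f \<xi>))\<^sup>2) = l2_ip \<xi> (rep A (fstar f * f) \<xi>)"
        using l2_ip_self[of "rep A f \<xi>"] l2_ip_op[OF \<xi> f, of f] by (simp add: rep_mult)
      then have "(l2_norm (rep A f \<xi>))\<^sup>2 \<le> l2_norm \<xi> * l2_norm (rep A (fstar f * f) \<xi>)"
        using cauchy_schwarz[OF finite_vectors_finite[OF \<xi>] finite_vectors_finite[OF ff]]
        by (metis norm_of_real abs_of_nonneg zero_le_power2)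
      also have "\<dots> \<le> l2_norm \<xi> * (rep_norm A (fstar f * f) * l2_norm \<xi>)"
        by (intro mult_left_mono rep_norm_bound \<xi> l2_norm_nonneg)
      finally have "(l2_norm (rep A f \<xi>))\<^sup>2 \<le> rep_norm A (fstar f * f) * (l2_norm \<xi>)\<^sup>2"
        by (simp add: power2_eq_square algebra_simps)
      then have "l2_norm (rep A f \<xi>) \<le> sqrt (rep_norm A (fstar f * f) * (l2_norm \<xi>)\<^sup>2)" by (rule real_le_rsqrt)
      then show "l2_norm (rep A f \<xi>) \<le> sqrt (rep_norm A (fstar f * f)) * l2_norm \<xi>"
        using l2_norm_nonneg[of \<xi>] by (simp add: real_sqrt_mult)
    qed (simp add: rep_norm_nonneg)
    then show ?thesis using rep_norm_nonneg[of A f] rep_norm_nonneg[of A "fstar f * f"]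
      by (metis real_sqrt_pow2 power_mono)
  qed
  have star: "rep_norm A (fstar f) = rep_norm A f" for f
  proof -
    have "rep_norm A f \<le> rep_norm A (fstar f)" for f
    proof (cases "rep_norm A f = 0")
      case False
      have "rep_norm A f * rep_norm A f \<le> rep_norm A (fstar f) * rep_norm A f"
        using sq[of f] mult[of "fstar f" f] by (simp add: power2_eq_square)
      then show ?thesis using False rep_norm_nonneg[of A f] by simp
    qed (simp add: rep_norm_nonneg)
    from this[of f] this[of "fstar f"] show ?thesis by simp
  qed
  have "rep_norm A (fstar f * f) = (rep_norm A f)\<^sup>2" for f
    using sq[of f] mult[of "fstar f" f] star[of f] by (simp add: power2_eq_square)
  then show ?thesis unfolding cstar_seminorm_def using add mult scale rep_norm_nonneg by blast
qed

lemma rep_norm_zero: assumes "\<And>\<xi> y. \<xi> \<in> finite_vectors A \<Longrightarrow> rep A f \<xi> y = 0" shows "rep_norm A f = 0"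
proof -
  have "rep_norm A f \<le> 0"
  proof (rule rep_norm_least)
    fix \<xi> assume "\<xi> \<in> finite_vectors A"
    then have "rep A f \<xi> = (\<lambda>x. 0)" using assms by (simp add: fun_eq_iff)
    then show "l2_norm (rep A f \<xi>) \<le> 0 * l2_norm \<xi>" by (simp add: l2_norm_def supp_def)
  qed simp
  then show ?thesis using rep_norm_nonneg[of A f] by simp
qed

lemma rep_gen_range: "rep A (fgen a * fstar (fgen a)) \<xi> y = (if y \<in> one_sided A \<and> y 0 = a then \<xi> y else 0)"
proof (cases "y \<in> one_sided A \<and> y 0 = a")
  case True
  then have "tl_seq y \<in> one_sided A" "a \<in> edges A" "target a = source (y (Suc 0))"
    using one_sided_tl[of y A] by (auto simp: one_sided_def)
  then show ?thesis using True case_nat_tl[of y] by (simp add: rep_mult rep_gen rep_gen_star)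
next
  case False
  then show ?thesis unfolding rep_mult rep_gen by (simp only: if_False)
qed

text \<open>Admissibility places this seminorm below the universal one, so that operators on
  sequences give lower bounds of norms in the Cuntz--Krieger algebra.\<close>

lemma rep_norm_admissible: "rep_norm A \<in> admissible_seminorms (edges A) (ck_relations A)"
proof -
  have "rep_norm A r = 0" if r: "r \<in> ck_relations A" for r
  proof (rule rep_norm_zero)
    fix \<xi> y assume \<xi>: "\<xi> \<in> finite_vectors A"
    \<comment> \<open>Outside \<open>one_sided A\<close> all range projections act as 0 while the
      unit does not; the sum relation survives there because vectors vanish.\<close>
    have out: "\<xi> y = 0" if "y \<notin> one_sided A" using \<xi> that by (auto simp: finite_vectors_def supp_def)
    from r consider (a) a where "a \<in> edges A" "r = fgen a * fstar (fgen a) * fgen a - fgen a"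
      | (b) "r = (\<Sum>a\<in>edges A. fgen a * fstar (fgen a)) - 1"
      | (c) a where "a \<in> edges A" "r = fstar (fgen a) * fgen a -
        (\<Sum>b\<in>{b \<in> edges A. source b = target a}. fgen b * fstar (fgen b))"
      unfolding ck_relations_def by blast
    then show "rep A r \<xi> y = 0"
    proof cases
      case a
      then show ?thesis by (simp add: rep_diff rep_mult[of A "fgen a * fstar (fgen a)"] rep_gen_range rep_gen)
    next
      case b
      have "(\<Sum>a\<in>edges A. rep A (fgen a * fstar (fgen a)) \<xi> y) = \<xi> y"
      proof (cases "y \<in> one_sided A")
        case True
        then have "y 0 \<in> edges A" by (simp add: one_sided_def)
        then show ?thesis using True by (simp add: rep_gen_range finite_edges)
      qed (simp add: rep_gen_range out)
      then show ?thesis by (simp add: b rep_diff rep_sum)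
    next
      case c
      have fin: "finite {b \<in> edges A. source b = target a}" by (simp add: finite_edges)
      have "rep A (fstar (fgen a) * fgen a) \<xi> y = (if y \<in> one_sided A \<and> target a = source (y 0) then \<xi> y else 0)"
        using c(1) one_sided_Cons[of y A a] by (auto simp: rep_mult rep_gen rep_gen_star)
      moreover have "(\<Sum>b\<in>{b \<in> edges A. source b = target a}. rep A (fgen b * fstar (fgen b)) \<xi> y) =
          (if y \<in> one_sided A \<and> target a = source (y 0) then \<xi> y else 0)"
      proof (cases "y \<in> one_sided A")
        case True
        then have "y 0 \<in> edges A" by (simp add: one_sided_def)
        then show ?thesis using True fin by (auto simp: rep_gen_range)
      qed (simp add: rep_gen_range)
      ultimately show ?thesis by (simp add: c rep_diff rep_sum)
    qed
  qed
  then show ?thesis using rep_norm_seminorm by (simp add: admissible_seminorms_def)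
qed

definition \<delta> :: "'x \<Rightarrow> 'x \<Rightarrow> complex" where "\<delta> z = (\<lambda>x. if x = z then 1 else 0)"

context cuntz_krieger
begin

text \<open>A diagonal matrix coefficient is at most the operator seminorm, hence at most the
  universal norm. This bound is what tells elements of the algebra apart later on.\<close>

lemma rep_delta_le:
  assumes z: "z \<in> one_sided A" and f: "f \<in> pres.F"
  shows "cmod (rep A f (\<delta> z) z) \<le> cnorm \<O> (ev f)"
proof -
  have s: "supp (\<delta> z) = {z}" by (auto simp: supp_def \<delta>_def)
  have d: "\<delta> z \<in> finite_vectors A" using z by (simp add: finite_vectors_def s)
  let ?\<xi> = "rep A f (\<delta> z)"
  have fin: "finite (supp ?\<xi>)" using rep_vecs[OF d] finite_vectors_finite by blast
  have "cmod (?\<xi> z) \<le> l2_norm ?\<xi>"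
  proof (cases "z \<in> supp ?\<xi>")
    case True
    then show ?thesis unfolding l2_norm_def using member_le_L2_set[OF fin True, of "\<lambda>x. cmod (?\<xi> x)"] by simp
  qed (simp add: supp_def l2_norm_nonneg)
  also have "\<dots> \<le> rep_norm A f * l2_norm (\<delta> z)" by (rule rep_norm_bound[OF d])
  also have "l2_norm (\<delta> z) = 1" by (simp add: l2_norm_def s) (simp add: \<delta>_def)
  finally have "cmod (?\<xi> z) \<le> rep_norm A f" by simp
  also have "\<dots> \<le> pres.N f" by (rule pres.N_upper[OF f rep_norm_admissible])
  finally show ?thesis using norm_ev[OF f] by simp
qed

lemma rep_pr:
  assumes "set \<mu> \<subseteq> edges A" "y \<in> one_sided A"
  shows "rep A (pr \<mu>) \<xi> y = (if map y [0..<length \<mu>] = \<mu> then \<xi> y else 0)"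
  using assms
proof (induction \<mu> arbitrary: \<xi> y)
  case (Cons a \<mu>)
  have eq: "map y [0..<length (a # \<mu>)] = a # \<mu> \<longleftrightarrow> y 0 = a \<and> map (tl_seq y) [0..<length \<mu>] = \<mu>"
    by (simp add: upt_conv_Cons comp_def del: upt_Suc flip: map_Suc_upt)
  have y: "tl_seq y \<in> one_sided A" "target (y 0) = source (y (Suc 0))"
    using Cons.prems one_sided_tl by (auto simp: one_sided_def)
  show ?case
  proof (cases "y 0 = a")
    case True
    have "rep A (pr (a # \<mu>)) \<xi> y = rep A (pr \<mu>) (rep A (fstar (fgen a)) \<xi>) (tl_seq y)"
      using True Cons.prems by (simp add: pr_Cons rep_mult rep_gen)
    also have "\<dots> = (if map (tl_seq y) [0..<length \<mu>] = \<mu> then rep A (fstar (fgen a)) \<xi> (tl_seq y) else 0)"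
      by (rule Cons.IH) (use Cons.prems y in auto)
    also have "rep A (fstar (fgen a)) \<xi> (tl_seq y) = \<xi> y"
      using True y Cons.prems case_nat_tl[of y] by (simp add: rep_gen_star)
    finally show ?thesis unfolding eq using True by simp
  next
    case False
    then show ?thesis unfolding eq by (simp add: pr_Cons rep_mult rep_gen)
  qed
qed simp

end

section \<open>Elements of degree 1\<close>

text \<open>A geometric sum in a \<open>k\<close>-th root of unity, which differs from 1 when
  \<open>0 < |d| < k\<close>.\<close>

lemma phase_average:
  assumes k: "\<bar>d\<bar> < int k"
  shows "(\<Sum>j<k. ck_phase (real j / real k * of_int d)) = (if d = 0 then of_nat k else 0)"
proof (cases "d = 0")
  case False
  define z where "z = ck_phase (of_int d / real k)"
  have k0: "real k \<noteq> 0" using k by simp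
  have pow: "ck_phase (real j / real k * of_int d) = z ^ j" for j
    unfolding z_def by (subst exp_of_nat_mult[symmetric]) (simp add: mult_ac)
  have "z \<noteq> 1"
  proof
    assume "z = 1"
    then obtain n :: int where "2 * pi * (of_int d / real k) = of_int (2 * n) * pi"
      unfolding z_def exp_eq_1 by auto
    then have "(2 * pi) * (of_int d / real k - of_int n) = 0" by (simp add: algebra_simps)
    then have "of_int d / real k = real_of_int n" using pi_neq_zero by (simp only: mult_eq_0_iff) simp
    then have "real_of_int d = of_int (n * int k)" using k0 by (simp add: field_simps)
    then have d: "d = n * int k" by (simp only: of_int_eq_iff)
    then have "int k \<le> \<bar>d\<bar>" using False by (cases "n = 0") (auto simp: abs_mult)
    then show False using k by simp
  qed
  moreover have "z ^ k = 1"
  proof -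
    have "z ^ k = ck_phase (of_int d)" using pow[of k] k0 by simp
    also have "\<dots> = 1" unfolding exp_eq_1 by (auto intro!: exI[of _ d])
    finally show ?thesis .
  qed
  ultimately have "(\<Sum>j<k. z ^ j) = 0" using geometric_sum[of z k] by simp
  then show ?thesis unfolding pow using False by simp
qed simp

lemma lookup_fscale: "Poly_Mapping.lookup (fscale c f) w = c * Poly_Mapping.lookup f w"
proof (induction f rule: free_induct)
  case (single v d)
  show ?case by (simp add: fscale_def mult_single lookup_single when_def)
qed (simp_all add: fscale_def distrib_left lookup_add)

context cuntz_krieger
begin

lemma gauge_ev: "f \<in> pres.F \<Longrightarrow> ck_gauge A t (ev f) = ev (fgauge t f)"
proof (induction f rule: free_star_algebra_induct)
  case (gen a)
  interpret h: ck_hom A A "ck_gauge A t" by (rule ck_gauge_hom)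
  show ?case using gen by (simp add: ev_gen ck_gauge_ck_gen fgauge_fgen ev_fscale)
next
  case (star_gen a)
  interpret h: ck_hom A A "ck_gauge A t" by (rule ck_gauge_hom)
  show ?case by (rule h.fstar_rel[of "fgen a" "fscale (ck_phase t) (fgen a)", folded fgauge_fgen fgauge_fstar])
      (simp add: star_gen ev_gen ck_gauge_ck_gen fgauge_fgen ev_fscale)
next
  case (mult f g)
  interpret h: ck_hom A A "ck_gauge A t" by (rule ck_gauge_hom)
  show ?case unfolding fgauge_mult by (rule h.mult_rel[OF mult.IH])
next
  case (add f g)
  interpret h: ck_hom A A "ck_gauge A t" by (rule ck_gauge_hom)
  show ?case by (simp add: fgauge_add ev_add h.hom_add add.IH)
next
  case (scale c f)
  interpret h: ck_hom A A "ck_gauge A t" by (rule ck_gauge_hom)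
  show ?case by (simp add: fgauge_fscale ev_fscale h.hom_smult scale.IH)
next
  case zero
  interpret h: ck_hom A A "ck_gauge A t" by (rule ck_gauge_hom)
  show ?case by (simp add: ev_zero h.hom_zero)
next
  case one
  interpret h: ck_hom A A "ck_gauge A t" by (rule ck_gauge_hom)
  show ?case by (simp add: ev_one h.hom_one)
qed

text \<open>The approximating polynomial is averaged over the gauge action of the \<open>k\<close>-th roots of unity, which
  leaves only the words of degree 1 once \<open>k\<close> exceeds the other degrees.\<close>

lemma homogeneous_approximation:
  assumes v: "v \<in> carrier \<O>" and hom: "\<And>t. ck_gauge A t v = ck_phase t \<odot>\<^bsub>\<O>\<^esub> v" and e: "e > 0"
  shows "\<exists>f\<in>pres.F. (\<forall>w\<in>Poly_Mapping.keys f. word_degree w = 1) \<and> cnorm \<O> (v \<ominus>\<^bsub>\<O>\<^esub> ev f) < e"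
proof -
  let ?q = "\<lambda>f. cnorm \<O> (ev f)"
  have q: "cstar_seminorm UNIV ?q" by (rule ev_seminorm)
  obtain g where g: "g \<in> pres.F" "cnorm \<O> (v \<ominus>\<^bsub>\<O>\<^esub> ev g) < e / 3" using dense[OF v, of "e / 3"] e by auto
  define G where "G t = fscale (cnj (ck_phase t)) (fgauge t g)" for t
  have GF: "G t \<in> pres.F" for t unfolding G_def using g(1) by (intro free_intros)
  \<comment> \<open>The gauge automorphism followed by the inverse phase fixes \<open>v\<close> and
    is contractive, so it moves \<open>ev g\<close> to an element that is as close to
    \<open>v\<close>.\<close>
  have close: "cnorm \<O> (v \<ominus>\<^bsub>\<O>\<^esub> ev (G t)) < e / 3" for t
  proof -
    interpret h: ck_hom A A "ck_gauge A t" by (rule ck_gauge_hom)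
    have "cnj (ck_phase t) \<odot>\<^bsub>\<O>\<^esub> ck_gauge A t (v \<ominus>\<^bsub>\<O>\<^esub> ev g) = v \<ominus>\<^bsub>\<O>\<^esub> ev (G t)"
      using v by (simp add: h.hom_diff hom gauge_ev[OF g(1)] smult_diff smult_closed smult_smult phase_cnj smult_one
          G_def ev_fscale)
    then have "cnorm \<O> (v \<ominus>\<^bsub>\<O>\<^esub> ev (G t)) = cmod (cnj (ck_phase t)) * cnorm \<O> (ck_gauge A t (v \<ominus>\<^bsub>\<O>\<^esub> ev g))"
      using cnorm_smult[OF h.hom_closed, of "v \<ominus>\<^bsub>\<O>\<^esub> ev g" "cnj (ck_phase t)"] v by simp
    also have "\<dots> = cnorm \<O> (ck_gauge A t (v \<ominus>\<^bsub>\<O>\<^esub> ev g))" by (simp add: norm_exp_eq_Re)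
    also have "\<dots> \<le> cnorm \<O> (v \<ominus>\<^bsub>\<O>\<^esub> ev g)" using v by (intro h.contractive) simp
    finally show ?thesis using g(2) by simp
  qed
  \<comment> \<open>The average is compared with \<open>g\<close> and not with \<open>v\<close>,
    which need not be the value of a polynomial; the errors \<open>2 e / 3\<close> and
    \<open>e / 3\<close> then add up to \<open>e\<close>.\<close>
  have diff: "?q (g - G t) \<le> 2 * e / 3" for t
    using cnorm_diff_triangle[of "ev g" v "ev (G t)"] close[of t] g(2) v cnorm_diff_commute[of v "ev g"]
    by (simp add: ev_diff)
  define k where "k = Suc (nat (Max (insert 0 ((\<lambda>w. \<bar>word_degree w - 1\<bar>) ` Poly_Mapping.keys g))))"
  have k: "\<bar>word_degree w - 1\<bar> < int k" if "w \<in> Poly_Mapping.keys g" for w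
  proof -
    have "\<bar>word_degree w - 1\<bar> \<le> Max (insert 0 ((\<lambda>w. \<bar>word_degree w - 1\<bar>) ` Poly_Mapping.keys g))"
      using that by (intro Max_ge) auto
    then show ?thesis by (simp add: k_def)
  qed
  have k0: "0 < k" by (simp add: k_def)
  define f where "f = fscale (1 / of_nat k) (\<Sum>j<k. G (real j / real k))"
  have F: "f \<in> pres.F" unfolding f_def by (intro free_intros GF)
  have "Poly_Mapping.lookup f w = 0" if w: "word_degree w \<noteq> 1" for w
  proof (cases "w \<in> Poly_Mapping.keys g")
    case True
    have "Poly_Mapping.lookup (G t) w = ck_phase (t * of_int (word_degree w - 1)) * Poly_Mapping.lookup g w" for t
    proof -
      have "cnj (ck_phase t) * exp (2 * of_real pi * \<i> * of_real t * of_int (word_degree w)) =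
          ck_phase (t * of_int (word_degree w - 1))"
        by (simp add: exp_cnj exp_add[symmetric] algebra_simps)
      then show ?thesis by (simp add: G_def lookup_fscale lookup_fgauge flip: mult.assoc)
    qed
    then have "Poly_Mapping.lookup f w = 1 / of_nat k *
        ((\<Sum>j<k. ck_phase (real j / real k * of_int (word_degree w - 1))) * Poly_Mapping.lookup g w)"
      by (simp add: f_def lookup_fscale lookup_sum sum_distrib_right)
    then show ?thesis using phase_average[OF k[OF True]] w by simp
  next
    case False
    then show ?thesis by (simp add: f_def lookup_fscale lookup_sum G_def lookup_fgauge in_keys_iff)
  qed
  then have deg: "\<forall>w\<in>Poly_Mapping.keys f. word_degree w = 1" by (auto simp: in_keys_iff)
  have "fscale (1 / of_nat k) (\<Sum>j<k. g - G (real j / real k)) = g - f"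
  proof -
    have "(\<Sum>j<k. g) = fscale (of_nat k) g"
      by (rule poly_mapping_eqI, subst lookup_sum) (simp add: lookup_fscale)
    then show ?thesis using k0 by (simp add: f_def sum_subtractf fscale_diff fscale_fscale del: sum_constant)
  qed
  then have "?q (g - f) = 1 / real k * ?q (\<Sum>j<k. g - G (real j / real k))"
    using cstar_seminorm_UNIV(2)[OF q, of "1 / of_nat k" "\<Sum>j<k. g - G (real j / real k)"]
    by (simp add: norm_divide)
  also have "\<dots> \<le> 1 / real k * (\<Sum>j<k. 2 * e / 3)"
    by (intro mult_left_mono order_trans[OF cstar_seminorm_sum[OF q]] sum_mono diff) simp
  also have "\<dots> = 2 * e / 3" using k0 by simp
  finally have "cnorm \<O> (v \<ominus>\<^bsub>\<O>\<^esub> ev f) < e"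
    using cnorm_diff_triangle[of v "ev g" "ev f"] g(2) v by (simp add: ev_diff)
  then show ?thesis using F deg by (intro bexI[of _ f]) auto
qed

end

section \<open>The map of one-sided sequences dual to an isomorphism\<close>

abbreviation (input) prefix :: "nat \<Rightarrow> (nat \<Rightarrow> 'a) \<Rightarrow> 'a list" where
  "prefix m x \<equiv> map x [0..<m]"

lemma prefix_words: "x \<in> one_sided A \<Longrightarrow> prefix m x \<in> words A m"
  by (auto simp: words_def one_sided_def)

lemma prefix_eqD: assumes "\<And>m. prefix m x = prefix m y" shows "x = y"
proof
  fix n
  have "prefix (Suc n) x ! n = prefix (Suc n) y ! n" by (simp only: assms)
  then show "x n = y n" by (simp del: upt_Suc)
qed

context cuntz_krieger
begin

text \<open>The value at \<open>x\<close> of the function on the one-sided shift space that corresponds to \<open>e\<close>, for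
  polynomials \<open>e\<close> in the generators; it is the diagonal coefficient at \<open>x\<close>.\<close>

definition val :: "ck_element \<Rightarrow> (nat \<Rightarrow> edge) \<Rightarrow> complex" where
  "val e x = rep A (SOME f. f \<in> pres.F \<and> ev f = e) (\<delta> x) x"

text \<open>Two polynomials with the same value under \<open>ev\<close> differ by one of norm 0,
  whose diagonal coefficients vanish by \<open>rep_delta_le\<close>.\<close>

lemma val_ev:
  assumes f: "f \<in> pres.F" and x: "x \<in> one_sided A"
  shows "val (ev f) x = rep A f (\<delta> x) x"
proof -
  let ?g = "SOME g. g \<in> pres.F \<and> ev g = ev f"
  have "?g \<in> pres.F \<and> ev ?g = ev f" by (rule someI[of _ f]) (simp add: f)
  then have g: "?g \<in> pres.F" "ev ?g = ev f" by (rule conjunct1, rule conjunct2)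
  have "cmod (rep A (?g - f) (\<delta> x) x) \<le> cnorm \<O> (ev (?g - f))"
    by (rule rep_delta_le[OF x free_diff[OF g(1) f]])
  also have "\<dots> = 0" by (simp only: ev_diff g(2)) (simp add: cnorm_diff_eq_zero)
  finally show ?thesis by (simp add: val_def rep_diff)
qed

lemma sum_pr_F: "K \<subseteq> words A m \<Longrightarrow> sum pr K \<in> pres.F"
  by (intro free_sum pr_F) (auto simp: words_def)

lemma val_sum_pr:
  assumes K: "K \<subseteq> words A m" and x: "x \<in> one_sided A"
  shows "val (ev (sum pr K)) x = (if prefix m x \<in> K then 1 else 0)"
proof -
  have fin: "finite K" using K finite_subset finite_words by blast
  have "val (ev (sum pr K)) x = (\<Sum>\<mu>\<in>K. rep A (pr \<mu>) (\<delta> x) x)"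
    by (simp only: val_ev[OF sum_pr_F[OF K] x] rep_sum)
  also have "\<dots> = (\<Sum>\<mu>\<in>K. if prefix m x = \<mu> then 1 else 0)"
  proof (rule sum.cong[OF refl])
    fix \<mu> assume "\<mu> \<in> K"
    then have \<mu>: "set \<mu> \<subseteq> edges A" "length \<mu> = m" using K by (auto simp: words_def)
    show "rep A (pr \<mu>) (\<delta> x) x = (if prefix m x = \<mu> then 1 else 0)"
      unfolding rep_pr[OF \<mu>(1) x] \<mu>(2) by (simp add: \<delta>_def)
  qed
  also have "\<dots> = (if prefix m x \<in> K then 1 else 0)" using fin by simp
  finally show ?thesis .
qed

lemma val_pr: "set \<mu> \<subseteq> edges A \<Longrightarrow> x \<in> one_sided A \<Longrightarrow>
    val (ev (pr \<mu>)) x = (if prefix (length \<mu>) x = \<mu> then 1 else 0)"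
  using val_sum_pr[of "{\<mu>}" "length \<mu>" x] by (simp add: words_def)

lemma val_one: "x \<in> one_sided A \<Longrightarrow> val (ev 1) x = 1"
  using val_ev[of 1 x] by (simp add: \<delta>_def)

lemma is_proj_pr: "set \<mu> \<subseteq> edges A \<Longrightarrow> is_proj (ev (pr \<mu>))"
  using is_proj_sum_pr[of "{\<mu>}" "length \<mu>"] by (simp add: words_def)

end

locale diagonal_hom = ck_hom A C \<Phi> for A C \<Phi> +
  assumes diagonal: "\<And>x. x \<in> ck_diagonal A \<Longrightarrow> \<Phi> x \<in> ck_diagonal C"
begin

lemma is_proj_image: assumes e: "a.is_proj e" shows "c.is_proj (\<Phi> e)"
proof -
  have D: "e \<in> ck_diagonal A" "adj (cuntz_krieger_algebra A) e = e" "e \<otimes>\<^bsub>cuntz_krieger_algebra A\<^esub> e = e"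
    using e unfolding a.is_proj_def by blast+
  note c = a.diagonal_closed[OF D(1)]
  show ?thesis
    unfolding c.is_proj_def using diagonal[OF D(1)] hom_adj[OF c] hom_mult[OF c c] D(2,3) by simp
qed

lemma image_pr:
  assumes "set \<nu> \<subseteq> edges A"
  shows "\<exists>m K. K \<subseteq> words C m \<and> \<Phi> (a.ev (pr \<nu>)) = c.ev (sum pr K)"
  using is_proj_image[OF a.is_proj_pr[OF assms]] unfolding c.is_proj_iff .

definition level :: "edge list \<Rightarrow> nat" where
  "level \<nu> = (SOME m. \<exists>K. K \<subseteq> words C m \<and> \<Phi> (a.ev (pr \<nu>)) = c.ev (sum pr K))"

definition img :: "edge list \<Rightarrow> edge list set" where
  "img \<nu> = (SOME K. K \<subseteq> words C (level \<nu>) \<and> \<Phi> (a.ev (pr \<nu>)) = c.ev (sum pr K))"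

lemma img: assumes "set \<nu> \<subseteq> edges A"
  shows "img \<nu> \<subseteq> words C (level \<nu>)" "\<Phi> (a.ev (pr \<nu>)) = c.ev (sum pr (img \<nu>))"
proof -
  have "\<exists>K. K \<subseteq> words C (level \<nu>) \<and> \<Phi> (a.ev (pr \<nu>)) = c.ev (sum pr K)"
    unfolding level_def by (rule someI_ex[OF image_pr[OF assms]])
  from someI_ex[OF this] show "img \<nu> \<subseteq> words C (level \<nu>)" "\<Phi> (a.ev (pr \<nu>)) = c.ev (sum pr (img \<nu>))"
    unfolding img_def[symmetric] by blast+
qed

text \<open>The prefixes of \<open>dual y\<close> will be the words \<open>\<nu>\<close> for which the image of the projection of \<open>\<nu>\<close> takes the
  value 1 at \<open>y\<close>.\<close>

definition hits :: "(nat \<Rightarrow> edge) \<Rightarrow> edge list \<Rightarrow> bool" where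
  "hits y \<nu> \<longleftrightarrow> prefix (level \<nu>) y \<in> img \<nu>"

lemma val_image_sum:
  assumes y: "y \<in> one_sided C" and K: "finite K" "\<And>\<nu>. \<nu> \<in> K \<Longrightarrow> set \<nu> \<subseteq> edges A"
  shows "c.val (\<Phi> (a.ev (sum pr K))) y = of_nat (card {\<nu> \<in> K. hits y \<nu>})"
proof -
  have "\<Phi> (a.ev (sum pr K)) = c.ev (\<Sum>\<nu>\<in>K. sum pr (img \<nu>))"
    by (rule sum_rel) (rule img(2)[OF K(2)])
  moreover have "(\<Sum>\<nu>\<in>K. sum pr (img \<nu>)) \<in> c.pres.F"
    by (intro free_sum c.sum_pr_F[OF img(1)] K(2))
  ultimately have "c.val (\<Phi> (a.ev (sum pr K))) y = (\<Sum>\<nu>\<in>K. rep C (sum pr (img \<nu>)) (\<delta> y) y)"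
    by (simp only: c.val_ev[OF _ y] rep_sum)
  also have "\<dots> = (\<Sum>\<nu>\<in>K. if hits y \<nu> then 1 else 0)"
  proof (rule sum.cong[OF refl])
    fix \<nu> assume \<nu>: "\<nu> \<in> K"
    have "rep C (sum pr (img \<nu>)) (\<delta> y) y = c.val (c.ev (sum pr (img \<nu>))) y"
      by (rule c.val_ev[OF c.sum_pr_F[OF img(1)[OF K(2)[OF \<nu>]]] y, symmetric])
    then show "rep C (sum pr (img \<nu>)) (\<delta> y) y = (if hits y \<nu> then 1 else 0)"
      by (simp only: c.val_sum_pr[OF img(1)[OF K(2)[OF \<nu>]] y] hits_def)
  qed
  also have "\<dots> = of_nat (card {\<nu> \<in> K. hits y \<nu>})" using K(1) by (simp add: sum.If_cases Int_def)
  finally show ?thesis .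
qed

text \<open>The projections of the words of length \<open>m\<close> sum to the unit, so the values
  of their images at \<open>y\<close>, each 0 or 1, sum to 1.\<close>

lemma card_hits: assumes y: "y \<in> one_sided C" shows "card {\<nu> \<in> words A m. hits y \<nu>} = 1"
proof -
  have "c.val (\<Phi> (a.ev (sum pr (words A m)))) y = of_nat (card {\<nu> \<in> words A m. hits y \<nu>})"
    by (rule val_image_sum[OF y finite_words]) (simp add: words_def)
  moreover have "\<Phi> (a.ev (sum pr (words A m))) = c.ev 1" unfolding a.sum_pr by (rule one_rel)
  ultimately have "of_nat (card {\<nu> \<in> words A m. hits y \<nu>}) = (1::complex)" using c.val_one[OF y] by simp
  then show ?thesis by (simp only: of_nat_eq_1_iff)
qed

definition word_at :: "(nat \<Rightarrow> edge) \<Rightarrow> nat \<Rightarrow> edge list" where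
  "word_at y m = the_elem {\<nu> \<in> words A m. hits y \<nu>}"

lemma word_at: assumes "y \<in> one_sided C" shows "{\<nu> \<in> words A m. hits y \<nu>} = {word_at y m}"
proof -
  obtain \<nu> where "{\<nu> \<in> words A m. hits y \<nu>} = {\<nu>}" using card_hits[OF assms, of m] card_1_singletonE by blast
  then show ?thesis by (simp add: word_at_def)
qed

lemma word_atD: assumes "y \<in> one_sided C" shows "word_at y m \<in> words A m" "hits y (word_at y m)"
  using word_at[OF assms, of m] by blast+

text \<open>The projection of a word is the sum over its extensions by one letter, so a word is hit
  as soon as one of its extensions is. This makes the words for different \<open>m\<close> prefixes
  of a single sequence.\<close>

lemma word_at_Suc: assumes y: "y \<in> one_sided C" shows "take m (word_at y (Suc m)) = word_at y m"
proof -
  let ?\<mu> = "word_at y (Suc m)"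
  have \<mu>: "set ?\<mu> \<subseteq> edges A" "length ?\<mu> = Suc m" using word_atD(1)[OF y, of "Suc m"] by (auto simp: words_def)
  let ?\<nu> = "take m ?\<mu>"
  have \<nu>: "set ?\<nu> \<subseteq> edges A" "length ?\<nu> = m" using \<mu> set_take_subset[of m ?\<mu>] by auto
  have split: "?\<mu> = ?\<nu> @ [last ?\<mu>]" "last ?\<mu> \<in> edges A"
  proof -
    have ne: "?\<mu> \<noteq> []" using \<mu>(2) by (metis list.size(3) nat.distinct(1))
    have "butlast ?\<mu> = ?\<nu>" using \<mu>(2) by (simp add: butlast_conv_take)
    then show "?\<mu> = ?\<nu> @ [last ?\<mu>]" using append_butlast_last_id[OF ne] by simp
    show "last ?\<mu> \<in> edges A" using last_in_set[OF ne] \<mu>(1) by blast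
  qed
  let ?K = "(\<lambda>b. ?\<nu> @ [b]) ` edges A"
  have "sum pr ?K = (\<Sum>b\<in>edges A. pr (?\<nu> @ [b]))" by (subst sum.reindex) (simp_all add: inj_on_def)
  then have eq: "a.ev (sum pr {?\<nu>}) = a.ev (sum pr ?K)" using a.pr_snoc[of ?\<nu>] by simp
  have "of_nat (card {\<kappa> \<in> {?\<nu>}. hits y \<kappa>}) = c.val (\<Phi> (a.ev (sum pr {?\<nu>}))) y"
    by (rule val_image_sum[OF y, symmetric]) (use \<nu> in auto)
  also have "\<dots> = of_nat (card {\<kappa> \<in> ?K. hits y \<kappa>})"
    unfolding eq by (rule val_image_sum[OF y]) (use \<nu> finite_edges in auto)
  finally have c: "card {\<kappa> \<in> {?\<nu>}. hits y \<kappa>} = card {\<kappa> \<in> ?K. hits y \<kappa>}" by (simp only: of_nat_eq_iff)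
  have "?\<mu> \<in> {\<kappa> \<in> ?K. hits y \<kappa>}" using split word_atD(2)[OF y, of "Suc m"] by blast
  then have "{\<kappa> \<in> ?K. hits y \<kappa>} \<noteq> {}" by blast
  then have "card {\<kappa> \<in> ?K. hits y \<kappa>} \<noteq> 0" by (simp add: finite_edges)
  then have "{\<kappa> \<in> {?\<nu>}. hits y \<kappa>} \<noteq> {}" using c by (metis card.empty)
  then have "?\<nu> \<in> {\<nu> \<in> words A m. hits y \<nu>}" using \<nu> by (auto simp: words_def)
  then show ?thesis unfolding word_at[OF y] by simp
qed

definition dual :: "(nat \<Rightarrow> edge) \<Rightarrow> nat \<Rightarrow> edge" where "dual y n = word_at y (Suc n) ! n"

lemma prefix_dual: assumes y: "y \<in> one_sided C" shows "prefix m (dual y) = word_at y m"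
proof (induction m)
  case 0
  show ?case using word_atD(1)[OF y, of 0] by simp
next
  case (Suc m)
  have l: "length (word_at y (Suc m)) = Suc m" using word_atD(1)[OF y, of "Suc m"] by (simp add: words_def)
  have "prefix (Suc m) (dual y) = word_at y m @ [dual y m]" by (simp add: Suc.IH)
  also have "\<dots> = take m (word_at y (Suc m)) @ [word_at y (Suc m) ! m]" by (simp add: word_at_Suc[OF y] dual_def)
  also have "\<dots> = word_at y (Suc m)" using l by (simp flip: take_Suc_conv_app_nth)
  finally show ?case .
qed

text \<open>The projection of a word that is not a path is 0, so its image takes the value 0
  everywhere and the word is never hit.\<close>

lemma dual_one_sided: assumes y: "y \<in> one_sided C" shows "dual y \<in> one_sided A"
proof -
  have "dual y n \<in> edges A \<and> target (dual y n) = source (dual y (Suc n))" for n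
  proof -
    let ?\<nu> = "prefix (n + 2) (dual y)"
    have \<nu>: "set ?\<nu> \<subseteq> edges A" "hits y ?\<nu>"
      using word_atD[OF y, of "n + 2"] by (auto simp only: prefix_dual[OF y] words_def)
    have path: "is_path ?\<nu>"
    proof (rule ccontr)
      assume "\<not> is_path ?\<nu>"
      then have 0: "a.ev (sum pr {?\<nu>}) = a.ev (sum pr {})" using a.pr_nonpath[OF \<nu>(1)] by simp
      have one: "{\<kappa> \<in> {?\<nu>}. hits y \<kappa>} = {?\<nu>}" using \<nu>(2) by blast
      have "c.val (\<Phi> (a.ev (sum pr {?\<nu>}))) y = of_nat (card {\<kappa> \<in> {?\<nu>}. hits y \<kappa>})"
        by (rule val_image_sum[OF y]) (use \<nu>(1) in auto)
      moreover have "c.val (\<Phi> (a.ev (sum pr {}))) y = of_nat (card {\<kappa> \<in> {}. hits y \<kappa>})"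
        by (rule val_image_sum[OF y]) auto
      ultimately have "(of_nat (card {?\<nu>}) :: complex) = of_nat (card {\<kappa> \<in> {}. hits y \<kappa>})"
        unfolding 0 one by (rule trans[OF sym])
      then show False by simp
    qed
    have "?\<nu> ! n = dual y n" "?\<nu> ! Suc n = dual y (Suc n)" "dual y n \<in> set ?\<nu>" by (simp_all del: upt_Suc)
    moreover have "target (?\<nu> ! n) = source (?\<nu> ! Suc n)"
      using path unfolding is_path_def successively_conv_nth by (simp del: upt_Suc nth_map)
    ultimately show ?thesis using \<nu>(1) by auto
  qed
  then show ?thesis by (simp add: one_sided_def)
qed

text \<open>With projections read as indicator functions of clopen sets, \<open>\<Phi>\<close> is
  composition with \<open>dual\<close>. Applied to cylinders, this makes the duals of inverse
  isomorphisms inverse to each other.\<close>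

theorem val_dual:
  assumes y: "y \<in> one_sided C" and e: "a.is_proj e"
  shows "c.val (\<Phi> e) y = a.val e (dual y)"
proof -
  obtain m K where K: "K \<subseteq> words A m" "e = a.ev (sum pr K)" using e unfolding a.is_proj_iff by blast
  have fin: "finite K" using K(1) finite_words finite_subset by blast
  have sub: "{\<nu> \<in> K. hits y \<nu>} = K \<inter> {word_at y m}" using word_at[OF y, of m] K(1) by blast
  have "c.val (\<Phi> e) y = of_nat (card {\<nu> \<in> K. hits y \<nu>})"
    unfolding K(2) by (rule val_image_sum[OF y fin]) (use K(1) in \<open>auto simp: words_def\<close>)
  also have "\<dots> = (if prefix m (dual y) \<in> K then 1 else 0)"
    unfolding sub prefix_dual[OF y] by (cases "word_at y m \<in> K") simp_all
  also have "\<dots> = a.val e (dual y)" unfolding K(2) by (rule a.val_sum_pr[OF K(1) dual_one_sided[OF y], symmetric])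
  finally show ?thesis .
qed

lemma dual_window:
  "\<exists>M. \<forall>y\<in>one_sided C. \<forall>z\<in>one_sided C. prefix M y = prefix M z \<longrightarrow> prefix m (dual y) = prefix m (dual z)"
proof -
  define M where "M = Max (insert 0 (level ` words A m))"
  have M: "level \<nu> \<le> M" if "\<nu> \<in> words A m" for \<nu> unfolding M_def using that by (intro Max_ge) auto
  have "prefix m (dual y) = prefix m (dual z)"
    if y: "y \<in> one_sided C" and z: "z \<in> one_sided C" and yz: "prefix M y = prefix M z" for y z
  proof -
    have "prefix l y = prefix l z" if "l \<le> M" for l
      using arg_cong[OF yz, of "take l"] that by (simp only: take_map take_upt plus_nat.add_0)
    then have "hits y \<nu> \<longleftrightarrow> hits z \<nu>" if "\<nu> \<in> words A m" for \<nu> using M[OF that] unfolding hits_def by metis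
    then have "{\<nu> \<in> words A m. hits y \<nu>} = {\<nu> \<in> words A m. hits z \<nu>}" by blast
    then show ?thesis unfolding prefix_dual[OF y] prefix_dual[OF z] by (simp add: word_at_def)
  qed
  then show ?thesis by blast
qed

end

text \<open>Changing one factor at a time costs at most \<open>1/4 + 5/4 * 1/4 = 9/16\<close>. A
  distance below 1 is what excludes that a diagonal coefficient is 1 for one element and 0 for the
  other.\<close>

lemma (in cstar_algebra) cnorm_conjugate_diff:
  assumes c: "v \<in> carrier \<AA>" "w \<in> carrier \<AA>" "q \<in> carrier \<AA>"
    and v: "cnorm \<AA> v \<le> 1" and q: "cnorm \<AA> q \<le> 1" and d: "cnorm \<AA> (v \<ominus> w) < 1 / 4"
  shows "cnorm \<AA> (v \<otimes> q \<otimes> adj \<AA> v \<ominus> w \<otimes> q \<otimes> adj \<AA> w) < 1"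
proof -
  have m3: "cnorm \<AA> (x \<otimes> q \<otimes> adj \<AA> y) \<le> cnorm \<AA> x * cnorm \<AA> y"
    if xy: "x \<in> carrier \<AA>" "y \<in> carrier \<AA>" for x y
  proof -
    have "cnorm \<AA> (x \<otimes> q \<otimes> adj \<AA> y) \<le> cnorm \<AA> (x \<otimes> q) * cnorm \<AA> (adj \<AA> y)"
      using xy c by (intro cnorm_mult) (auto simp: adj_closed)
    also have "\<dots> \<le> (cnorm \<AA> x * cnorm \<AA> q) * cnorm \<AA> y"
      using xy c by (simp add: cnorm_adj mult_right_mono cnorm_mult cnorm_nonneg)
    also have "\<dots> \<le> (cnorm \<AA> x * 1) * cnorm \<AA> y"
      using xy c q by (intro mult_right_mono mult_left_mono) (auto simp: cnorm_nonneg)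
    finally show ?thesis by simp
  qed
  have w: "cnorm \<AA> w \<le> 5 / 4"
  proof -
    have "w = v \<ominus> (v \<ominus> w)" using c by algebra
    then have "cnorm \<AA> w \<le> cnorm \<AA> (v \<ominus> \<zero>) + cnorm \<AA> (\<zero> \<ominus> (v \<ominus> w))"
      using cnorm_diff_triangle[of v "\<zero>" "v \<ominus> w"] c by simp
    also have "cnorm \<AA> (\<zero> \<ominus> (v \<ominus> w)) = cnorm \<AA> ((v \<ominus> w) \<ominus> \<zero>)" using c by (intro cnorm_diff_commute) auto
    also have "(v \<ominus> w) \<ominus> \<zero> = v \<ominus> w" using c by algebra
    also have "v \<ominus> \<zero> = v" using c by algebra
    finally show ?thesis using v d by simp
  qed
  have adj_diff: "adj \<AA> (v \<ominus> w) = adj \<AA> v \<ominus> adj \<AA> w"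
  proof -
    have "adj \<AA> v = adj \<AA> ((v \<ominus> w) \<oplus> w)" using c by (intro arg_cong[where f = "adj \<AA>"]) algebra
    then have "adj \<AA> v = adj \<AA> (v \<ominus> w) \<oplus> adj \<AA> w" using c by (simp add: adj_add)
    moreover have "adj \<AA> (v \<ominus> w) \<in> carrier \<AA>" "adj \<AA> w \<in> carrier \<AA>" using c by (simp_all add: adj_closed)
    ultimately show ?thesis by algebra
  qed
  have "v \<otimes> q \<otimes> adj \<AA> v \<ominus> w \<otimes> q \<otimes> adj \<AA> w =
      (v \<ominus> w) \<otimes> q \<otimes> adj \<AA> v \<oplus> w \<otimes> q \<otimes> adj \<AA> (v \<ominus> w)"
    using c adj_closed[OF c(1)] adj_closed[OF c(2)] unfolding adj_diff by algebra
  then have "cnorm \<AA> (v \<otimes> q \<otimes> adj \<AA> v \<ominus> w \<otimes> q \<otimes> adj \<AA> w) \<le>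
      cnorm \<AA> ((v \<ominus> w) \<otimes> q \<otimes> adj \<AA> v) + cnorm \<AA> (w \<otimes> q \<otimes> adj \<AA> (v \<ominus> w))"
    using c by (simp only:) (intro cnorm_add m_closed adj_closed minus_closed; simp)
  also have "\<dots> \<le> cnorm \<AA> (v \<ominus> w) * cnorm \<AA> v + cnorm \<AA> w * cnorm \<AA> (v \<ominus> w)"
    using c by (intro add_mono m3) auto
  also have "\<dots> \<le> 1 / 4 * 1 + 5 / 4 * (1 / 4)"
    using c v w d by (intro add_mono mult_mono) (auto simp: cnorm_nonneg)
  finally show ?thesis by simp
qed

text \<open>Duals run against the homomorphisms: the dual of \<open>\<Psi>\<close>, named
  \<open>g.dual\<close>, maps sequences of \<open>A\<close> to sequences of \<open>B\<close>, and
  \<open>f.dual\<close> maps them back.\<close>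

locale triplet_isomorphism = f: diagonal_hom A B \<Phi> + g: diagonal_hom B A \<Psi> for A B \<Phi> \<Psi> +
  assumes inverse: "x \<in> carrier (cuntz_krieger_algebra A) \<Longrightarrow> \<Psi> (\<Phi> x) = x"
    "y \<in> carrier (cuntz_krieger_algebra B) \<Longrightarrow> \<Phi> (\<Psi> y) = y"
    and gauge: "x \<in> carrier (cuntz_krieger_algebra A) \<Longrightarrow> \<Phi> (ck_gauge A t x) = ck_gauge B t (\<Phi> x)"
begin

lemma dual_dual: assumes x: "x \<in> one_sided A" shows "f.dual (g.dual x) = x"
proof (rule prefix_eqD)
  fix m
  note y = g.dual_one_sided[OF x]
  let ?e = "f.a.ev (pr (prefix m x))"
  have m: "set (prefix m x) \<subseteq> edges A" "length (prefix m x) = m"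
    using prefix_words[OF x, of m] by (simp_all only: words_def mem_Collect_eq)
  note e = f.a.is_proj_pr[OF m(1)]
  have "f.a.val ?e (f.dual (g.dual x)) = f.c.val (\<Phi> ?e) (g.dual x)" by (rule f.val_dual[OF y e, symmetric])
  also have "\<dots> = f.a.val (\<Psi> (\<Phi> ?e)) x" by (rule g.val_dual[OF x f.is_proj_image[OF e], symmetric])
  also have "\<dots> = f.a.val ?e x" by (simp only: inverse(1)[OF f.a.ev_closed])
  finally show "prefix m (f.dual (g.dual x)) = prefix m x"
    unfolding f.a.val_pr[OF m(1) f.dual_one_sided[OF y]] f.a.val_pr[OF m(1) x] m(2) by (simp split: if_splits)
qed

text \<open>Otherwise some projection \<open>q\<close> of a word takes the value 1 at the dual of \<open>tl x\<close> and 0 at all sequences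
  reached from \<open>y = dual x\<close> by words of \<open>F\<close>.  For \<open>v = \<Phi> S\<^sub>a\<close> the projection \<open>v q v\<^sup>*\<close> takes the value 1 at \<open>y\<close>,
  whereas \<open>F q F\<^sup>*\<close> takes the value 0, although they are at distance less than 1.\<close>

lemma dual_tail:
  assumes a: "a \<in> edges A" and F: "F \<in> f.c.pres.F"
    and close: "cnorm (cuntz_krieger_algebra B) (\<Phi> (f.a.ev (fgen a)) \<ominus>\<^bsub>cuntz_krieger_algebra B\<^esub> f.c.ev F) < 1 / 4"
    and x: "x \<in> one_sided A" "x 0 = a"
  shows "\<exists>w\<in>Poly_Mapping.keys F. word_map B w (g.dual x) = Some (g.dual (tl_seq x))"
proof (rule ccontr)
  assume contra: "\<not> ?thesis"
  let ?B = "cuntz_krieger_algebra B"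
  define y where "y = g.dual x"
  define z where "z = g.dual (tl_seq x)"
  have y: "y \<in> one_sided B" unfolding y_def by (rule g.dual_one_sided[OF x(1)])
  have tx: "tl_seq x \<in> one_sided A" by (rule one_sided_tl[OF x(1)])
  have z: "z \<in> one_sided B" unfolding z_def by (rule g.dual_one_sided[OF tx])
  \<comment> \<open>A word undefined at \<open>y\<close> contributes the arbitrary sequence
    \<open>the None\<close>. This is harmless, since \<open>U\<close> only has to contain the
    sequences that are to be separated from \<open>z\<close>.\<close>
  define U where "U = (\<lambda>w. the (word_map B w y)) ` Poly_Mapping.keys F"
  have "\<exists>M. \<forall>u\<in>U. u \<noteq> z \<longrightarrow> prefix M u \<noteq> prefix M z"
  proof -
    have "\<exists>i. u \<noteq> z \<longrightarrow> u i \<noteq> z i" for u by (auto simp: fun_eq_iff)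
    then obtain i where i: "\<And>u. u \<noteq> z \<Longrightarrow> u (i u) \<noteq> z (i u)" by metis
    have fin: "finite U" by (simp add: U_def)
    have "prefix (Suc (Max (i ` U))) u \<noteq> prefix (Suc (Max (i ` U))) z" if u: "u \<in> U" "u \<noteq> z" for u
    proof
      assume eq: "prefix (Suc (Max (i ` U))) u = prefix (Suc (Max (i ` U))) z"
      have "i u \<le> Max (i ` U)" using u(1) fin by (intro Max_ge) auto
      then have "u (i u) = z (i u)" using arg_cong[OF eq, of "\<lambda>l. l ! i u"] by (simp del: upt_Suc)
      then show False using i[OF u(2)] by simp
    qed
    then show ?thesis by blast
  qed
  then obtain M where M: "\<And>u. u \<in> U \<Longrightarrow> u \<noteq> z \<Longrightarrow> prefix M u \<noteq> prefix M z" by blast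
  let ?\<nu> = "prefix M z"
  have \<nu>: "set ?\<nu> \<subseteq> edges B" "length ?\<nu> = M"
    using prefix_words[OF z, of M] by (simp_all only: words_def mem_Collect_eq)
  define q where "q = f.c.ev (pr ?\<nu>)"
  have q: "f.c.is_proj q" unfolding q_def by (rule f.c.is_proj_pr[OF \<nu>(1)])
  obtain m K where K: "K \<subseteq> words A m" "\<Psi> q = f.a.ev (sum pr K)"
    using g.is_proj_image[OF q] unfolding f.a.is_proj_iff by blast
  have "f.a.val (\<Psi> q) (tl_seq x) = f.c.val q z" unfolding z_def by (rule g.val_dual[OF tx q])
  also have "\<dots> = 1" unfolding q_def f.c.val_pr[OF \<nu>(1) z] \<nu>(2) by simp
  finally have inK: "prefix m (tl_seq x) \<in> K"
    unfolding K(2) f.a.val_sum_pr[OF K(1) tx] by (simp split: if_splits)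
  let ?K = "(#) a ` K"
  have K': "?K \<subseteq> words A (Suc m)"
  proof (rule image_subsetI)
    fix \<mu> assume "\<mu> \<in> K"
    then have "\<mu> \<in> words A m" using K(1) by blast
    then show "a # \<mu> \<in> words A (Suc m)" using a by (simp add: words_def)
  qed
  have sum_K': "sum pr ?K = fgen a * sum pr K * fstar (fgen a)"
    by (simp add: sum.reindex pr_Cons sum_distrib_left sum_distrib_right)
  define v where "v = \<Phi> (f.a.ev (fgen a))"
  have v: "v \<in> carrier ?B" unfolding v_def by (rule f.hom_closed[OF f.a.ev_closed])
  have qc: "q \<in> carrier ?B" unfolding q_def by simp
  have "\<Phi> (f.a.ev (sum pr K)) = q" using inverse(2)[OF qc] K(2) by simp
  then have conj: "\<Phi> (f.a.ev (sum pr ?K)) = v \<otimes>\<^bsub>?B\<^esub> q \<otimes>\<^bsub>?B\<^esub> adj ?B v"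
    unfolding sum_K' by (simp add: f.a.ev_mult f.a.ev_fstar f.hom_mult f.hom_adj f.A.adj_closed v_def)
  have proj: "f.c.is_proj (\<Phi> (f.a.ev (sum pr ?K)))" by (rule f.is_proj_image[OF f.a.is_proj_sum_pr[OF K']])
  obtain l L where L: "L \<subseteq> words B l" "\<Phi> (f.a.ev (sum pr ?K)) = f.c.ev (sum pr L)"
    using proj unfolding f.c.is_proj_iff by blast
  have "rep B (sum pr L) (\<delta> y) y = f.c.val (\<Phi> (f.a.ev (sum pr ?K))) y"
    unfolding L(2) by (rule f.c.val_ev[OF f.c.sum_pr_F[OF L(1)] y, symmetric])
  also have "\<dots> = f.a.val (\<Psi> (\<Phi> (f.a.ev (sum pr ?K)))) x" unfolding y_def by (rule g.val_dual[OF x(1) proj, symmetric])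
  also have "\<dots> = f.a.val (f.a.ev (sum pr ?K)) x" by (simp only: inverse(1)[OF f.a.ev_closed])
  also have "\<dots> = 1"
  proof -
    have "prefix (Suc m) x = a # prefix m (tl_seq x)"
      using x(2) by (simp add: upt_conv_Cons comp_def del: upt_Suc flip: map_Suc_upt)
    then have "prefix (Suc m) x \<in> ?K" using inK by (simp only: image_eqI)
    then show ?thesis unfolding f.a.val_sum_pr[OF K' x(1)] by (simp only: if_True)
  qed
  finally have one: "rep B (sum pr L) (\<delta> y) y = 1" .
  let ?f = "F * pr ?\<nu> * fstar F"
  have "word_op B w (rep B (pr ?\<nu>) \<xi>) y = 0" if w: "w \<in> Poly_Mapping.keys F" for w \<xi>
  proof (cases "word_map B w y")
    case None
    then show ?thesis by (simp add: word_op_def)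
  next
    case (Some u)
    have u: "u \<in> one_sided B" using letters_map_one_sided[OF Some] y by simp
    have "u \<noteq> z" using contra w Some unfolding y_def z_def by blast
    moreover have "u \<in> U" unfolding U_def using w Some by (intro image_eqI[of _ _ w]) simp_all
    ultimately have "prefix M u \<noteq> ?\<nu>" by (intro M)
    then have "rep B (pr ?\<nu>) \<xi> u = 0" unfolding f.c.rep_pr[OF \<nu>(1) u] \<nu>(2) by (simp only: if_False)
    then show ?thesis by (simp add: word_op_def Some)
  qed
  then have "rep B ?f (\<delta> y) y = 0"
    unfolding rep_mult by (simp add: rep_def[of B F])
  then have "1 = cmod (rep B (sum pr L - ?f) (\<delta> y) y)" by (simp add: rep_diff one)
  also have "\<dots> \<le> cnorm ?B (f.c.ev (sum pr L - ?f))"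
    by (rule f.c.rep_delta_le[OF y]) (intro free_intros f.c.sum_pr_F[OF L(1)] F f.c.pr_F \<nu>(1))
  also have "f.c.ev (sum pr L - ?f) = v \<otimes>\<^bsub>?B\<^esub> q \<otimes>\<^bsub>?B\<^esub> adj ?B v \<ominus>\<^bsub>?B\<^esub> f.c.ev F \<otimes>\<^bsub>?B\<^esub> q \<otimes>\<^bsub>?B\<^esub> adj ?B (f.c.ev F)"
    unfolding f.c.ev_diff L(2)[symmetric] conj by (simp only: f.c.ev_mult f.c.ev_fstar q_def)
  also have "cnorm ?B \<dots> < 1"
  proof (rule f.B.cnorm_conjugate_diff[OF v f.c.ev_closed qc _ _ close[folded v_def]])
    have "\<Phi> (f.a.ev (fgen a * fstar (fgen a) * fgen a)) = v" unfolding f.a.rel1 v_def ..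
    then show "cnorm ?B v \<le> 1"
      by (intro f.B.cnorm_partial_isometry v)
         (simp add: f.a.ev_mult f.a.ev_fstar f.hom_mult f.hom_adj f.A.adj_closed v_def)
    show "cnorm ?B q \<le> 1"
      using f.B.cnorm_projection[OF qc] q unfolding f.c.is_proj_def by fastforce
  qed
  finally show False by simp
qed

text \<open>By equivariance \<open>\<Phi>\<close> maps a generator to an element of degree 1, so the
  approximating words have lag 1 in \<open>letters_map_tail\<close>. As there are finitely many
  edges, the length of these words has a common bound \<open>n\<close>.\<close>

lemma dual_shift: "\<exists>n. \<forall>x\<in>one_sided A. \<forall>t. g.dual x (Suc (t + n)) = g.dual (tl_seq x) (t + n)"
proof -
  let ?B = "cuntz_krieger_algebra B"
  have "\<exists>F\<in>f.c.pres.F. (\<forall>w\<in>Poly_Mapping.keys F. word_degree w = 1) \<and>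
      cnorm ?B (\<Phi> (f.a.ev (fgen a)) \<ominus>\<^bsub>?B\<^esub> f.c.ev F) < 1 / 4" if a: "a \<in> edges A" for a
  proof (rule f.c.homogeneous_approximation)
    show "\<Phi> (f.a.ev (fgen a)) \<in> carrier ?B" by simp
    show "ck_gauge B t (\<Phi> (f.a.ev (fgen a))) = ck_phase t \<odot>\<^bsub>?B\<^esub> \<Phi> (f.a.ev (fgen a))" for t
      using gauge[OF f.a.ev_closed, of t "fgen a"] f.a.gauge_ev[OF free_fgen[OF a], of t]
      by (simp add: fgauge_fgen f.a.ev_fscale f.hom_smult)
  qed simp
  then obtain F where F: "\<And>a. a \<in> edges A \<Longrightarrow> F a \<in> f.c.pres.F"
    "\<And>a w. a \<in> edges A \<Longrightarrow> w \<in> Poly_Mapping.keys (F a) \<Longrightarrow> word_degree w = 1"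
    "\<And>a. a \<in> edges A \<Longrightarrow> cnorm ?B (\<Phi> (f.a.ev (fgen a)) \<ominus>\<^bsub>?B\<^esub> f.c.ev (F a)) < 1 / 4"
    by metis
  define W where "W = (\<Union>a\<in>edges A. Poly_Mapping.keys (F a))"
  define n where "n = Max (insert 0 ((\<lambda>w. length (letters w)) ` W))"
  have n: "length (letters w) \<le> n" if "w \<in> W" for w
    unfolding n_def using that by (intro Max_ge) (auto simp: W_def finite_edges)
  have "g.dual x (Suc (t + n)) = g.dual (tl_seq x) (t + n)" if x: "x \<in> one_sided A" for x t
  proof -
    have a: "x 0 \<in> edges A" using x by (simp add: one_sided_def)
    obtain w where w: "w \<in> Poly_Mapping.keys (F (x 0))" "word_map B w (g.dual x) = Some (g.dual (tl_seq x))"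
      using dual_tail[OF a F(1)[OF a] F(3)[OF a] x refl] by blast
    obtain i j where ij: "j \<le> length (letters w)" "int i - int j = word_degree w"
      "\<And>k. g.dual x (k + i) = g.dual (tl_seq x) (k + j)"
      using letters_map_tail[OF w(2)] unfolding word_degree_def by blast
    have "i = Suc j" using ij(2) F(2)[OF a w(1)] by simp
    moreover have "j \<le> n" using ij(1) n[of w] w(1) a unfolding W_def by fastforce
    ultimately show ?thesis using ij(3)[of "t + n - j"] by simp
  qed
  then show ?thesis by blast
qed

end

section \<open>From eventual conjugacy to conjugacy\<close>

lemma drop_seq_one_sided: "x \<in> one_sided A \<Longrightarrow> (\<lambda>t. x (t + n)) \<in> one_sided A"
  by (simp add: one_sided_def)

locale eventual_conjugacy =
  fixes A B :: "nat mat" and h :: "(nat \<Rightarrow> edge) \<Rightarrow> nat \<Rightarrow> edge" and n :: nat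
  assumes closed: "x \<in> one_sided A \<Longrightarrow> h x \<in> one_sided B"
    and window: "\<exists>M. \<forall>x\<in>one_sided A. \<forall>y\<in>one_sided A. (\<forall>t<M. x t = y t) \<longrightarrow> h x n = h y n"
    and shift: "x \<in> one_sided A \<Longrightarrow> h x (Suc (t + n)) = h (\<lambda>i. x (Suc i)) (t + n)"
begin

lemma shift_iterated: "x \<in> one_sided A \<Longrightarrow> h x (t + n + s) = h (\<lambda>i. x (i + s)) (t + n)"
proof (induction s arbitrary: t)
  case (Suc s)
  have "h x (t + n + Suc s) = h x (Suc t + n + s)" by simp
  also have "\<dots> = h (\<lambda>i. x (i + s)) (Suc t + n)" by (rule Suc.IH[OF Suc.prems])
  also have "\<dots> = h (\<lambda>i. x (Suc i + s)) (t + n)" using shift[OF drop_seq_one_sided[OF Suc.prems, of s], of t] by simp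
  finally show ?case by simp
qed simp

text \<open>The map \<open>\<sigma>^n \<circ> h\<close> commutes with the shift even when
  \<open>h\<close> does not, so its coordinate at 0, read along a two-sided sequence, is a sliding
  block code.\<close>

definition block_map :: "(int \<Rightarrow> edge) \<Rightarrow> int \<Rightarrow> edge" where
  "block_map x = (\<lambda>k. h (\<lambda>i. x (int i + k)) n)"

lemma block_map_tail: assumes x: "x \<in> X A"
  shows "block_map x (int t + k) = h (\<lambda>i. x (int i + k)) (t + n)"
proof -
  have "h (\<lambda>i. x (int i + k)) (0 + n + t) = h (\<lambda>i. x (int (i + t) + k)) (0 + n)"
    by (rule shift_iterated[OF one_sided_of_X[OF x]])
  then show ?thesis by (simp add: block_map_def add.commute add.left_commute)
qed

lemma block_map_X: assumes x: "x \<in> X A" shows "block_map x \<in> X B"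
proof -
  have "block_map x k \<in> edges B \<and> target (block_map x k) = source (block_map x (k + 1))" for k
    using closed[OF one_sided_of_X[OF x, of k]] block_map_tail[OF x, of 0 k] block_map_tail[OF x, of 1 k]
    by (simp add: one_sided_def add.commute)
  then show ?thesis by (simp add: X_iff)
qed

lemma block_map_shift: "block_map (shiftz k x) j = block_map x (j + k)"
  by (simp add: block_map_def algebra_simps)

lemma block_map_window:
  "\<exists>M. \<forall>x\<in>X A. \<forall>y\<in>X A. (\<forall>t<M. x (int t + k) = y (int t + k)) \<longrightarrow> block_map x k = block_map y k"
proof -
  obtain M where M: "\<And>x y. x \<in> one_sided A \<Longrightarrow> y \<in> one_sided A \<Longrightarrow> \<forall>t<M. x t = y t \<Longrightarrow> h x n = h y n"
    using window by blast
  have "block_map x k = block_map y k"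
    if "x \<in> X A" "y \<in> X A" "\<forall>t<M. x (int t + k) = y (int t + k)" for x y
    unfolding block_map_def by (rule M[OF one_sided_of_X[OF that(1)] one_sided_of_X[OF that(2)] that(3)])
  then show ?thesis by blast
qed

end

text \<open>Since \<open>\<sigma>^n \<circ> k\<close> commutes with the shift, \<open>\<sigma>^n k
  \<sigma>^n h = \<sigma>^(2 n) k h = \<sigma>^(2 n)\<close>.\<close>

lemma block_map_inverse:
  assumes x: "x \<in> X A" and "eventual_conjugacy A B h n" "eventual_conjugacy B A k n"
    and inv: "\<And>x. x \<in> one_sided A \<Longrightarrow> k (h x) = x"
  shows "eventual_conjugacy.block_map k n (eventual_conjugacy.block_map h n x) j = x (j + int (2 * n))"
proof -
  interpret h: eventual_conjugacy A B h n by fact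
  interpret k: eventual_conjugacy B A k n by fact
  let ?z = "\<lambda>i. x (int i + j)"
  have z: "?z \<in> one_sided A" by (rule one_sided_of_X[OF x])
  have "k.block_map (h.block_map x) j = k (\<lambda>i. h ?z (i + n)) (0 + n)"
    unfolding k.block_map_def h.block_map_tail[OF x] by (simp only: add_0)
  also have "\<dots> = k (h ?z) (0 + n + n)" by (rule k.shift_iterated[OF h.closed[OF z], symmetric])
  also have "\<dots> = x (int (0 + n + n) + j)" by (simp only: inv[OF z])
  also have "int (0 + n + n) + j = j + int (2 * n)" by simp
  finally show ?thesis .
qed

theorem eventual_conjugacy_imp_conjugate:
  assumes "eventual_conjugacy A B h n" "eventual_conjugacy B A k n"
    and kh: "\<And>x. x \<in> one_sided A \<Longrightarrow> k (h x) = x" and hk: "\<And>y. y \<in> one_sided B \<Longrightarrow> h (k y) = y"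
  shows "topologically_conjugate A B"
proof -
  interpret h: eventual_conjugacy A B h n by fact
  interpret k: eventual_conjugacy B A k n by fact
  define G where "G y = shiftz (- int (2 * n)) (k.block_map y)" for y
  have GX: "G y \<in> X A" if "y \<in> X B" for y
    using k.block_map_X[OF that] unfolding G_def by (simp only: shiftz_X)
  have GH: "G (h.block_map x) = x" if x: "x \<in> X A" for x
    unfolding G_def using block_map_inverse[OF x assms(1,2) kh] by simp
  have HG: "h.block_map (G y) = y" if y: "y \<in> X B" for y
  proof
    fix j
    have "h.block_map (G y) j = h.block_map (k.block_map y) (j - int (2 * n))"
      unfolding G_def by (simp only: h.block_map_shift) simp
    then show "h.block_map (G y) j = y j" using block_map_inverse[OF y assms(2,1) hk, of "j - int (2 * n)"] by simp
  qed
  obtain M where M: "\<And>x y. x \<in> X A \<Longrightarrow> y \<in> X A \<Longrightarrow> (\<forall>t<M. x (int t + 0) = y (int t + 0)) \<Longrightarrow>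
      h.block_map x 0 = h.block_map y 0" using h.block_map_window[of 0] by blast
  obtain N where N: "\<And>x y. x \<in> X B \<Longrightarrow> y \<in> X B \<Longrightarrow>
      (\<forall>t<N. x (int t + - int (2 * n)) = y (int t + - int (2 * n))) \<Longrightarrow>
      k.block_map x (- int (2 * n)) = k.block_map y (- int (2 * n))"
    using k.block_map_window[of "- int (2 * n)"] by blast
  \<comment> \<open>The windows to be covered are \<open>0, ..., M - 1\<close> for the block map of
    \<open>h\<close> and \<open>- 2 n, ..., N - 1 - 2 n\<close> for \<open>G\<close>.\<close>
  define L where "L = M + N + 2 * n"
  have wH: "h.block_map x 0 = h.block_map y 0" if "x \<in> X A" "y \<in> X A" "agree {- int L..int L} x y" for x y
    by (rule M[OF that(1,2)]) (intro allI impI bspec[OF that(3)], simp add: L_def)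
  have wG: "G x 0 = G y 0" if "x \<in> X B" "y \<in> X B" "agree {- int L..int L} x y" for x y
  proof -
    have "k.block_map x (- int (2 * n)) = k.block_map y (- int (2 * n))"
      by (rule N[OF that(1,2)]) (intro allI impI bspec[OF that(3)], simp add: L_def)
    then show ?thesis by (simp add: G_def)
  qed
  have shift: "h.block_map (two_sided_shift x) = two_sided_shift (h.block_map x)" for x
    unfolding two_sided_shift_def by (rule ext) (rule h.block_map_shift)
  have "block_conjugacy A B h.block_map G L"
    unfolding block_conjugacy_def
  proof (intro conjI ballI impI)
    fix x assume x: "x \<in> X A"
    show "h.block_map x \<in> X B" by (rule h.block_map_X[OF x])
    show "G (h.block_map x) = x" by (rule GH[OF x])
    show "h.block_map (two_sided_shift x) = two_sided_shift (h.block_map x)" by (rule shift)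
    fix y assume y: "y \<in> X A" "agree {- int L..int L} x y"
    show "h.block_map x 0 = h.block_map y 0" by (rule wH[OF x y])
  next
    fix x assume x: "x \<in> X B"
    show "G x \<in> X A" by (rule GX[OF x])
    show "h.block_map (G x) = x" by (rule HG[OF x])
    fix y assume y: "y \<in> X B" "agree {- int L..int L} x y"
    show "G x 0 = G y 0" by (rule wG[OF x y])
  qed
  then show ?thesis by (intro iffD2[OF topologically_conjugate_iff] exI)
qed

text \<open>All sufficiently large exponents are provided, so that an isomorphism and its inverse
  can share one.\<close>

lemma eventual_conjugacy_dual:
  assumes "triplet_isomorphism A B \<Phi> \<Psi>"
  shows "\<exists>m. \<forall>n\<ge>m. eventual_conjugacy A B (diagonal_hom.dual B A \<Psi>) n"
proof -
  interpret triplet_isomorphism A B \<Phi> \<Psi> by fact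
  obtain m where m: "\<And>x t. x \<in> one_sided A \<Longrightarrow> g.dual x (Suc (t + m)) = g.dual (tl_seq x) (t + m)"
    using dual_shift by blast
  have "eventual_conjugacy A B g.dual n" if n: "m \<le> n" for n
  proof
    fix x assume x: "x \<in> one_sided A"
    show "g.dual x \<in> one_sided B" by (rule g.dual_one_sided[OF x])
    have "t + n = t + (n - m) + m" for t using n by simp
    then show "g.dual x (Suc (t + n)) = g.dual (tl_seq x) (t + n)" for t using m[OF x, of "t + (n - m)"] by simp
  next
    obtain M where M: "\<And>y z. y \<in> one_sided A \<Longrightarrow> z \<in> one_sided A \<Longrightarrow> prefix M y = prefix M z \<Longrightarrow>
        prefix (Suc n) (g.dual y) = prefix (Suc n) (g.dual z)" using g.dual_window by blast
    have "g.dual x n = g.dual y n" if "x \<in> one_sided A" "y \<in> one_sided A" "\<forall>t<M. x t = y t" for x y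
    proof -
      have "prefix M x = prefix M y" using that(3) by simp
      from arg_cong[OF M[OF that(1,2) this], of last] show ?thesis by simp
    qed
    then show "\<exists>M. \<forall>x\<in>one_sided A. \<forall>y\<in>one_sided A. (\<forall>t<M. x t = y t) \<longrightarrow> g.dual x n = g.dual y n" by blast
  qed
  then show ?thesis by blast
qed

section \<open>Isomorphic triplets, chains and the equivalence\<close>

lemma triplet_isomorphismI:
  assumes \<Phi>: "triplet_iso A B \<Phi>" and \<Psi>: "triplet_iso B A \<Psi>"
    and inv: "\<And>x. x \<in> carrier (cuntz_krieger_algebra A) \<Longrightarrow> \<Psi> (\<Phi> x) = x"
    "\<And>y. y \<in> carrier (cuntz_krieger_algebra B) \<Longrightarrow> \<Phi> (\<Psi> y) = y"
  shows "triplet_isomorphism A B \<Phi> \<Psi>"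
proof (intro triplet_isomorphism.intro triplet_isomorphism_axioms.intro diagonal_hom.intro diagonal_hom_axioms.intro
    triplet_iso_hom[OF \<Phi>] triplet_iso_hom[OF \<Psi>] inv)
  show "\<Phi> x \<in> ck_diagonal B" if "x \<in> ck_diagonal A" for x
    using \<Phi> that unfolding triplet_iso_def by blast
  show "\<Psi> x \<in> ck_diagonal A" if "x \<in> ck_diagonal B" for x
    using \<Psi> that unfolding triplet_iso_def by blast
  show "\<Phi> (ck_gauge A t x) = ck_gauge B t (\<Phi> x)" if "x \<in> carrier (cuntz_krieger_algebra A)" for t x
    using \<Phi> that unfolding triplet_iso_def by blast
qed

lemma triplet_isomorphic_imp_conjugate:
  assumes iso: "triplet_isomorphic (ck_triplet A) (ck_triplet B)"
  shows "topologically_conjugate A B"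
proof -
  obtain \<Phi> where \<Phi>: "triplet_iso A B \<Phi>" using iso unfolding triplet_isomorphic_iff by (rule exE)
  obtain \<Psi> where *: "triplet_iso B A \<Psi> \<and> (\<forall>x\<in>carrier (cuntz_krieger_algebra A). \<Psi> (\<Phi> x) = x) \<and>
    (\<forall>y\<in>carrier (cuntz_krieger_algebra B). \<Phi> (\<Psi> y) = y)"
    using triplet_iso_inverse[OF \<Phi>] by (rule exE)
  note \<Psi> = conjunct1[OF *] and inv = bspec[OF conjunct1[OF conjunct2[OF *]]] bspec[OF conjunct2[OF conjunct2[OF *]]]
  have 1: "triplet_isomorphism A B \<Phi> \<Psi>" by (rule triplet_isomorphismI[OF \<Phi> \<Psi> inv])
  have 2: "triplet_isomorphism B A \<Psi> \<Phi>" by (rule triplet_isomorphismI[OF \<Psi> \<Phi> inv(2,1)])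
  interpret i: triplet_isomorphism A B \<Phi> \<Psi> by (rule 1)
  interpret j: triplet_isomorphism B A \<Psi> \<Phi> by (rule 2)
  obtain m1 where m1: "\<And>n. m1 \<le> n \<Longrightarrow> eventual_conjugacy A B i.g.dual n"
    using eventual_conjugacy_dual[OF 1] by blast
  obtain m2 where m2: "\<And>n. m2 \<le> n \<Longrightarrow> eventual_conjugacy B A i.f.dual n"
    using eventual_conjugacy_dual[OF 2] by blast
  show ?thesis
    by (rule eventual_conjugacy_imp_conjugate[OF m1[of "max m1 m2"] m2[of "max m1 m2"]])
       (simp_all add: i.dual_dual j.dual_dual)
qed

text \<open>Each step of the chain gives a conjugacy of the shifts or of the reversed shifts, and
  reversing time once more turns the latter into the former.\<close>

lemma transpose_free_isomorphic_imp_conjugate: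
  assumes "transpose_free_isomorphic A B"
  shows "topologically_conjugate A B"
proof -
  obtain n :: nat and C where C: "C 0 = A" "C n = B"
    "\<And>i. i < n \<Longrightarrow> tf_isomorphic_1step (ck_triplet_pair (C i)) (ck_triplet_pair (C (Suc i)))"
    using assms unfolding transpose_free_isomorphic_def by blast
  have step: "topologically_conjugate (C i) (C (Suc i))" if i: "i < n" for i
  proof -
    consider "triplet_isomorphic (ck_triplet (C i)) (ck_triplet (C (Suc i)))"
      | "triplet_isomorphic (ck_triplet (transpose_mat (C i))) (ck_triplet (transpose_mat (C (Suc i))))"
      using C(3)[OF i] unfolding ck_triplet_pair_def tf_isomorphic_1step.simps by blast
    then show ?thesis
    proof cases
      case 1
      then show ?thesis by (rule triplet_isomorphic_imp_conjugate)
    next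
      case 2
      from topologically_conjugate_transpose[OF triplet_isomorphic_imp_conjugate[OF 2]] show ?thesis by simp
    qed
  qed
  have "topologically_conjugate A (C i)" if "i \<le> n" for i
    using that
  proof (induction i)
    case (Suc i)
    then show ?case using topologically_conjugate_trans[OF _ step[of i]] by simp
  qed (simp add: C(1) topologically_conjugate_refl)
  then show ?thesis using C(2) by blast
qed

theorem theorem1p4:
  fixes A B :: "nat mat"
  assumes "square_mat A" and "irreducible_matrix A" and "\<not> permutation_matrix A"
    and "square_mat B" and "irreducible_matrix B" and "\<not> permutation_matrix B"
  shows "topologically_conjugate A B \<longleftrightarrow> transpose_free_isomorphic A B"
  using conjugate_imp_transpose_free_isomorphic[OF assms] transpose_free_isomorphic_imp_conjugate by blast

end
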